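(* Let $n\ge 2$ and let $K_0\subset C_0^n=[-1/2,1/2]^n$ be a convex body in $\mathbb{R}^n$ with its centroid at the origin. Suppose that $K_0$ is determined, up to translation and reflection in the origin, among all convex bodies in $\mathbb{R}^n$, by its covariogram. Let $$\frac12+\frac1{4n}<\gamma<1 .$$ If, for each $k\in\mathbb{N}$, $P_k$ is an output of Algorithm NoisyModLSQ (described in the context) for the unknown body $K_0$ with parameter $\gamma$, then, almost surely, $$\min\{\delta(K_0,P_k),\delta(-K_0,P_k)\}\to0\quad\text{as }k\to\infty .$$
   Context: Notation. A convex body in $\mathbb{R}^n$ is a compact convex set with nonempty interior; $V$ denotes volume; $\delta$ is the Hausdorff distance; $o$ is the origin; $o$-symmetric means centrally symmetric about $o$. The Fourier transform is $\widehat f(x)=\int_{\mathbb{R}^n}f(y)e^{-ix\cdot y}\,dy$, and $1_K$ is the characteristic function of $K$. The covariogram of $K$ is $g_K(x)=V(K\cap(K+x))$, $x\in\mathbb{R}^n$. "$K_0$ is determined up to translation and reflection in the origin among all convex bodies by its covariogram" means: if $L$ is a convex body with $g_L=g_{K_0}$, then $L$ is a translate of $K_0$ or of $-K_0$. The surface area measure $S(K,\cdot)$ is the Borel measure on $S^{n-1}$ with $S(K,E)$ equal to the $(n-1)$-dimensional Hausdorff measure of the set of points of $\partial K$ having an outer unit normal in $E$. The Blaschke body $\nabla K$ is the unique $o$-symmetric convex body with $S(\nabla K,\cdot)=\frac12S(K,\cdot)+\frac12S(-K,\cdot)$. The difference body is $DK=K+(-K)$. Let $\mathbb{Z}^n_k=\{z\in\mathbb{Z}^n:|z_j|\le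 k,\ j=1,\dots,n\}$ and let $\mathbb{Z}^n_k(+)\subset\mathbb{Z}^n_k$ satisfy $\mathbb{Z}^n_k(+)\cap(-\mathbb{Z}^n_k(+))=\emptyset$ and $\mathbb{Z}^n_k=\{o\}\cup\mathbb{Z}^n_k(+)\cup(-\mathbb{Z}^n_k(+))$. Let $I_k'=((2k+1)^n-1)/2$. Enumerate $\{o\}\cup(1/k^\gamma)\mathbb{Z}^n_k(+)$ as $z_{ik}$, $i=0,1,\dots,I_k'$, with $z_{0k}=o$, and put $z_{ik}=-z_{(-i)k}$ for $i=-I_k',\dots,-1$. Let $x_{ik}=k^{\gamma-1}z_{ik}$, $i=-I_k',\dots,I_k'$; these are the points of $2C_0^n\cap(1/k)\mathbb{Z}^n$. A family of random variables has uniformly bounded fourth moments if $E(X^4)\le C$ for one constant $C$ and all members $X$. Row-wise independent means independent for each fixed $k$. Algorithm NoisyModLSQ. Input for each $k$: (1) A number $\gamma\in(0,1)$ and noisy measurements $\overline g^{(r)}_{ik}=|\widehat{1_{K_0}}(z_{ik})|+X^{(r)}_{ik}$, $i=0,1,\dots,I_k'$, $r=1,2$, where the $X^{(r)}_{ik}$ are row-wise independent (independent over all $i$ and $r$ for fixed $k$) zero mean random variables with uniformly bounded fourth moments. (2) An $o$-symmetric (random) convex polytope $Q_k$ in $\mathbb{R}^n$, stochastically independent of the measurements $\overline g^{(r)}_{ik}$, such that, almost surely, $\lim_{k\to\infty}\delta(Q_k,\nabla K_0)=0$ or $\lim_{k\to\infty}\delta(Q_k,DK_0)=0$. Action. Let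 $\overline g_{ik}=\overline g^{(1)}_{ik}\overline g^{(2)}_{ik}$ for $i=0,\dots,I_k'$, let $\overline g_{ik}=\overline g_{(-i)k}$ for $i=-I_k',\dots,-1$, and let $$\overline M_k(x_{ik})=\frac1{(2\pi k^\gamma)^n}\sum_{j=-I_k'}^{I_k'}\cos(z_{jk}\cdot x_{ik})\,\overline g_{jk},\qquad i=-I_k',\dots,I_k'.$$ Let $\{\pm u_j:j=1,\dots,s\}$ be the outer unit normals to the facets of $Q_k$. For a vector $a=(a_1^+,a_1^-,\dots,a_s^+,a_s^-)$ with $a_j^\pm\ge0$ and $\sum_{j=1}^s(a_j^+-a_j^-)u_j=o$, let $P(a)$ be the convex polytope with centroid at the origin, facet outer unit normals in $\{\pm u_j\}$, and such that the facet with normal $u_j$ (respectively $-u_j$) has $(n-1)$-dimensional measure $a_j^+$ (respectively $a_j^-$) (a zero value meaning there is no such facet); only those $a$ for which such a polytope exists are considered. Let $\hat a$ be a minimizer of $$\sum_{i=-I_k'}^{I_k'}\bigl(\overline M_k(x_{ik})-g_{P(a)\cap C_0^n}(x_{ik})\bigr)^2$$ over all such $a$. The output $P_k$ is the translate of $P(\hat a)\cap C_0^n$ that has its centroid at the origin. *)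

theory Defs
  imports "HOL-Probability.Probability"
begin

section \<open>Convex bodies\<close>

definition convex_body :: "'a::euclidean_space set \<Rightarrow> bool" where
  "convex_body K \<longleftrightarrow> compact K \<and> convex K \<and> interior K \<noteq> {}"

definition o_symmetric :: "'a::euclidean_space set \<Rightarrow> bool" where
  "o_symmetric K \<longleftrightarrow> uminus ` K = K"

definition centroid :: "'a::euclidean_space set \<Rightarrow> 'a" where
  "centroid K = (1 / measure lebesgue K) *\<^sub>R (LINT x:K|lebesgue. x)"

definition difference_body :: "'a::euclidean_space set \<Rightarrow> 'a set" where
  "difference_body K = {x + y |x y. x \<in> K \<and> y \<in> uminus ` K}"

text \<open>Meaningful for nonempty compact sets, the only ones to which it is applied.\<close>

definition hausdorff_dist :: "'a::euclidean_space set \<Rightarrow> 'a set \<Rightarrow> real" where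
  "hausdorff_dist K L = max (SUP x\<in>K. infdist x L) (SUP y\<in>L. infdist y K)"

definition covariogram :: "'a::euclidean_space set \<Rightarrow> 'a \<Rightarrow> real" where
  "covariogram K x = measure lebesgue (K \<inter> (+) x ` K)"

definition determined_by_covariogram :: "'a::euclidean_space set \<Rightarrow> bool" where
  "determined_by_covariogram K \<longleftrightarrow>
     (\<forall>L. convex_body L \<and> covariogram L = covariogram K \<longrightarrow>
        (\<exists>t. L = (+) t ` K \<or> L = (+) t ` uminus ` K))"

definition fourier_transform :: "('a::euclidean_space \<Rightarrow> complex) \<Rightarrow> 'a \<Rightarrow> complex" where
  "fourier_transform f x = (LINT y|lebesgue. f y * exp (- \<i> * complex_of_real (x \<bullet> y)))"

section \<open>Hausdorff measure, surface area measure and Blaschke body\<close>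

text \<open>
  The factor \<open>unit_ball_vol d / 2 ^ d\<close> normalises the measure so that on
  d-dimensional affine subspaces it agrees with d-dimensional Lebesgue measure. Covering sets
  are required to be bounded because \<open>diameter\<close> is unspecified on unbounded sets.
\<close>

definition hausdorff_content :: "nat \<Rightarrow> real \<Rightarrow> 'a::euclidean_space set \<Rightarrow> ennreal" where
  "hausdorff_content d \<epsilon> A =
     (INF C \<in> {C :: nat \<Rightarrow> 'a set. A \<subseteq> (\<Union>i. C i) \<and> (\<forall>i. bounded (C i) \<and> diameter (C i) \<le> \<epsilon>)}.
        \<Sum>i. if C i = {} then 0
            else ennreal (unit_ball_vol (real d) * (diameter (C i) / 2) ^ d))"

definition hausdorff_measure :: "nat \<Rightarrow> 'a::euclidean_space set \<Rightarrow> ennreal" where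
  "hausdorff_measure d A = (SUP \<epsilon> \<in> {0<..}. hausdorff_content d \<epsilon> A)"

text \<open>The part of \<open>K\<close> at which \<open>u\<close> is an outer normal vector.\<close>

definition support_face :: "'a::euclidean_space set \<Rightarrow> 'a \<Rightarrow> 'a set" where
  "support_face K u = {x \<in> K. \<forall>y\<in>K. u \<bullet> y \<le> u \<bullet> x}"

text \<open>Used for Borel subsets \<open>E\<close> of the unit sphere.\<close>

definition surface_area_measure :: "'a::euclidean_space set \<Rightarrow> 'a set \<Rightarrow> ennreal" where
  "surface_area_measure K E =
     hausdorff_measure (DIM('a) - 1)
       {x \<in> frontier K. \<exists>u\<in>E. norm u = 1 \<and> x \<in> support_face K u}"

text \<open>\<open>N\<close> is the Blaschke body of \<open>K\<close>; by Minkowski's theorem there is exactly one.\<close>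

definition is_blaschke_body :: "'a::euclidean_space set \<Rightarrow> 'a set \<Rightarrow> bool" where
  "is_blaschke_body K N \<longleftrightarrow> convex_body N \<and> o_symmetric N \<and>
     (\<forall>E. E \<in> sets borel \<and> E \<subseteq> sphere 0 1 \<longrightarrow>
        surface_area_measure N E =
          ennreal (1/2) * surface_area_measure K E +
          ennreal (1/2) * surface_area_measure (uminus ` K) E)"

section \<open>Polytopes with prescribed facet normals and facet areas\<close>

text \<open>Facets are those of full-dimensional polytopes; the set is empty in lower dimension.\<close>

definition facet_normals :: "'a::euclidean_space set \<Rightarrow> 'a set" where
  "facet_normals Q =
     {u. norm u = 1 \<and> aff_dim Q = int DIM('a) \<and> support_face Q u facet_of Q}"

text \<open>
  The coordinates of the area vector are indexed by the normals themselves: for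
  \<open>N = {\<plusminus>u\<^sub>j | j = 1,\<dots>,s}\<close> the numbers \<open>a u\<^sub>j\<close> and \<open>a (- u\<^sub>j)\<close> are what is usually
  written \<open>a\<^sub>j\<^sup>+\<close> and \<open>a\<^sub>j\<^sup>-\<close>, and the vector sum below is that of the
  \<open>(a\<^sub>j\<^sup>+ - a\<^sub>j\<^sup>-) u\<^sub>j\<close>.
\<close>

definition admissible_areas :: "'a::euclidean_space set \<Rightarrow> ('a \<Rightarrow> real) \<Rightarrow> bool" where
  "admissible_areas N a \<longleftrightarrow> (\<forall>u\<in>N. a u \<ge> 0) \<and> (\<Sum>u\<in>N. a u *\<^sub>R u) = 0"

text \<open>\<open>P\<close> is the polytope \<open>P(a)\<close>; it is unique if it exists.\<close>

definition is_area_polytope ::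
    "'a::euclidean_space set \<Rightarrow> ('a \<Rightarrow> real) \<Rightarrow> 'a set \<Rightarrow> bool" where
  "is_area_polytope N a P \<longleftrightarrow>
     polytope P \<and> interior P \<noteq> {} \<and> centroid P = 0 \<and> facet_normals P \<subseteq> N \<and>
     (\<forall>u\<in>facet_normals P. hausdorff_measure (DIM('a) - 1) (support_face P u) = ennreal (a u)) \<and>
     (\<forall>u\<in>N - facet_normals P. a u = 0)"

section \<open>Sampling points\<close>

definition unit_cube :: "(real^'n) set" where
  "unit_cube = {x. \<forall>j. -1/2 \<le> x $ j \<and> x $ j \<le> 1/2}"

definition int_grid :: "nat \<Rightarrow> (real^'n) set" where
  "int_grid k = {v. \<forall>j. v $ j \<in> \<int> \<and> \<bar>v $ j\<bar> \<le> real k}"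

definition half_count :: "nat \<Rightarrow> nat \<Rightarrow> int" where
  "half_count n k = ((2 * int k + 1) ^ n - 1) div 2"

text \<open>\<open>H\<close> is a possible choice for the half \<open>\<int>\<^sup>n\<^sub>k(+)\<close> of the integer grid.\<close>

definition frequency_enumeration :: "real \<Rightarrow> nat \<Rightarrow> (int \<Rightarrow> real^'n) \<Rightarrow> bool" where
  "frequency_enumeration \<gamma> k z \<longleftrightarrow>
     (\<exists>H \<subseteq> int_grid k.
        H \<inter> uminus ` H = {} \<and> int_grid k = {0} \<union> H \<union> uminus ` H \<and>
        bij_betw z {0..half_count CARD('n) k}
          ((\<lambda>v. (1 / real k powr \<gamma>) *\<^sub>R v) ` ({0} \<union> H))) \<and>
     z 0 = 0 \<and>
     (\<forall>i\<in>{- half_count CARD('n) k..-1}. z i = - z (- i))"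

definition sample_point :: "real \<Rightarrow> nat \<Rightarrow> (int \<Rightarrow> real^'n) \<Rightarrow> int \<Rightarrow> real^'n" where
  "sample_point \<gamma> k z i = (real k powr (\<gamma> - 1)) *\<^sub>R z i"

section \<open>The algorithm\<close>

definition noisy_measurement ::
    "(real^'n) set \<Rightarrow> (int \<Rightarrow> real^'n) \<Rightarrow> (nat \<Rightarrow> int \<Rightarrow> 'w \<Rightarrow> real) \<Rightarrow> nat \<Rightarrow> int \<Rightarrow> 'w \<Rightarrow> real" where
  "noisy_measurement K z X r i \<omega> = cmod (fourier_transform (indicator K) (z i)) + X r i \<omega>"

text \<open>
  In the following, \<open>g r i\<close> with \<open>r \<in> {1, 2}\<close> and \<open>i \<ge> 0\<close> are the measured values (for one
  outcome); negative indices are treated by symmetry.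
\<close>

definition product_measurement :: "(nat \<Rightarrow> int \<Rightarrow> real) \<Rightarrow> int \<Rightarrow> real" where
  "product_measurement g i = (if i \<ge> 0 then g 1 i * g 2 i else g 1 (- i) * g 2 (- i))"

definition covariogram_estimate ::
    "real \<Rightarrow> nat \<Rightarrow> (int \<Rightarrow> real^'n) \<Rightarrow> (nat \<Rightarrow> int \<Rightarrow> real) \<Rightarrow> real^'n \<Rightarrow> real" where
  "covariogram_estimate \<gamma> k z g x =
     1 / (2 * pi * real k powr \<gamma>) ^ CARD('n) *
     (\<Sum>j\<in>{- half_count CARD('n) k..half_count CARD('n) k}.
        cos (z j \<bullet> x) * product_measurement g j)"

definition lsq_objective ::
    "real \<Rightarrow> nat \<Rightarrow> (int \<Rightarrow> real^'n) \<Rightarrow> (nat \<Rightarrow> int \<Rightarrow> real) \<Rightarrow> (real^'n) set \<Rightarrow> real" where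
  "lsq_objective \<gamma> k z g P =
     (\<Sum>i\<in>{- half_count CARD('n) k..half_count CARD('n) k}.
        (covariogram_estimate \<gamma> k z g (sample_point \<gamma> k z i)
          - covariogram (P \<inter> unit_cube) (sample_point \<gamma> k z i))\<^sup>2)"

text \<open>
  A minimizer need be neither unique nor, for every outcome, existent; hence outputs are described
  by a relation: \<open>R\<close> is an output for the measured values \<open>g\<close> and the input polytope \<open>Q\<close>.
\<close>

definition noisy_mod_lsq_output ::
    "real \<Rightarrow> nat \<Rightarrow> (int \<Rightarrow> real^'n) \<Rightarrow> (nat \<Rightarrow> int \<Rightarrow> real) \<Rightarrow> (real^'n) set \<Rightarrow> (real^'n) set \<Rightarrow> bool" where
  "noisy_mod_lsq_output \<gamma> k z g Q R \<longleftrightarrow>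
     (\<exists>a P. admissible_areas (facet_normals Q) a \<and> is_area_polytope (facet_normals Q) a P \<and>
        (\<forall>b P'. admissible_areas (facet_normals Q) b \<and> is_area_polytope (facet_normals Q) b P' \<longrightarrow>
           lsq_objective \<gamma> k z g P \<le> lsq_objective \<gamma> k z g P') \<and>
        (\<exists>t. R = (+) t ` (P \<inter> unit_cube)) \<and> centroid R = 0)"

section \<open>Random compact sets\<close>

text \<open>The Borel sigma-algebra of the Hausdorff metric on the nonempty compact sets.\<close>

definition hausdorff_borel :: "'a::euclidean_space set measure" where
  "hausdorff_borel = sigma {K. compact K \<and> K \<noteq> {}}
     {U. U \<subseteq> {K. compact K \<and> K \<noteq> {}} \<and>
         (\<forall>K\<in>U. \<exists>e>0. \<forall>L. compact L \<and> L \<noteq> {} \<and> hausdorff_dist K L < e \<longrightarrow> L \<in> U)}"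

text \<open>
  Independence of two random elements with values in different measurable spaces (the library's
  \<open>indep_var\<close> requires a common value type).
\<close>

definition indep_elements ::
    "'w measure \<Rightarrow> 'b measure \<Rightarrow> ('w \<Rightarrow> 'b) \<Rightarrow> 'c measure \<Rightarrow> ('w \<Rightarrow> 'c) \<Rightarrow> bool" where
  "indep_elements M S Y T Z \<longleftrightarrow>
     Y \<in> M \<rightarrow>\<^sub>M S \<and> Z \<in> M \<rightarrow>\<^sub>M T \<and>
     prob_space.indep_set M
       (sets (vimage_algebra (space M) Y S)) (sets (vimage_algebra (space M) Z T))"

end

theory Submission
  imports Defs "HOL-Complex_Analysis.Great_Picard" "HOL-Real_Asymp.Real_Asymp"
begin

text \<open>
  Up to noise, the estimate of the covariogram is a partial sum of the Fourier series, with
  nonnegative coefficients proportional to \<open>|fourier_transform (indicator K)|\<^sup>2\<close>, of the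
  periodised covariogram of \<open>K\<close>; comparing it with the convolution by a nonnegative trigonometric
  kernel shows that it converges uniformly to the covariogram. The noise is a weighted sum of
  independent terms, and a fourth moment bound together with the Borel-Cantelli argument, in which
  \<open>\<gamma> > 1/2 + 1/(4n)\<close> makes the series of moments summable, shows that its mean square over the sample
  points tends to 0 almost surely.

  A unit vector that is the only outer normal of \<open>K\<close> at some boundary point is a limit of facet
  normals of the \<open>Q\<^sub>k\<close>: it has the same property for the difference body, and arbitrarily close to it
  there is such a normal of the Blaschke body, because the surface area measure of \<open>K\<close> charges every
  neighbourhood of it. Hence intersections of supporting half-spaces of \<open>K\<close> whose normals are facet
  normals of \<open>Q\<^sub>k\<close> approximate \<open>K\<close> in volume, and their translates to centroid 0 are admissible in the
  least squares problem. Comparing with these competitors, the covariogram of the minimizer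
  converges to that of \<open>K\<close> in mean square over the sample points. By Blaschke's selection theorem and
  the determination of \<open>K\<close> by its covariogram this forces convergence in the Hausdorff distance.
\<close>

section \<open>Parallel bodies\<close>

text \<open>Both bounds on \<gamma> balance two scales. With \<open>n\<close> the dimension, the
  noise weights are of order \<open>k powr (- n * \<gamma>)\<close> and there are about
  \<open>k ^ n\<close> independent terms, so the fourth moment at a sample point is of order
  \<open>k powr (2 * n - 4 * n * \<gamma>)\<close>, which is summable exactly under the lower bound.
  A kernel of degree \<open>k\<close> with period \<open>2 * pi * k powr \<gamma>\<close> resolves
  the scale \<open>k powr (\<gamma> - 1)\<close>, which tends to 0 because \<gamma> < 1. The
  minimization runs over area vectors, whereas the competitors are built as polytopes whose areas
  are read off afterwards; admissibility is then Minkowski's relation for their facets. Facet areas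
  are Hausdorff measures, and volumes give access to them: a subset of a hyperplane swept along a
  vector has volume proportional to area times height. The same device bounds surface area from
  below. Clipping to the cube supplies the boundedness that the selection argument requires, since
  polytopes with the given normals may be arbitrarily large.\<close>

lemma measure_parallel_body:
  fixes S :: "'a::euclidean_space set"
  assumes S: "compact S" "S \<noteq> {}" and e: "e > 0"
  obtains d where "d > 0" "measure lebesgue {y. infdist y S \<le> d} < measure lebesgue S + e"
proof -
  define A where "A n = {y. infdist y S \<le> 1 / real (Suc n)}" for n
  have cl: "closed {y. infdist y S \<le> d}" for d
    by (intro closed_Collect_le continuous_intros)
  have cA: "compact (A n)" for n
  proof -
    have "bounded (A n)"
    proof -
      obtain r where r: "\<And>x. x \<in> S \<Longrightarrow> norm x \<le> r"
        using compact_imp_bounded[OF S(1)] bounded_iff by metis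
      have "norm y \<le> r + 1" if "y \<in> A n" for y
      proof -
        obtain x where x: "x \<in> S" "infdist y S = dist y x"
          using infdist_attains_inf[of S y] S compact_imp_closed by auto
        have "dist y x \<le> 1"
        proof -
          have "1 / real (Suc n) \<le> 1" by simp
          moreover have "infdist y S \<le> 1 / real (Suc n)" using that unfolding A_def by blast
          ultimately have "infdist y S \<le> 1" by (rule order_trans[rotated])
          then show ?thesis unfolding x(2) .
        qed
        then show ?thesis using r[OF x(1)] norm_triangle_sub[of y x] by (simp add: dist_norm)
      qed
      then show ?thesis unfolding bounded_iff by blast
    qed
    moreover have "closed (A n)" unfolding A_def by (rule cl)
    ultimately show ?thesis using compact_eq_bounded_closed by blast
  qed
  have "(\<lambda>n. measure lebesgue (A n)) \<longlonglongrightarrow> measure lebesgue (\<Inter>n. A n)"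
  proof (rule Lim_measure_decseq)
    show "range A \<subseteq> sets lebesgue"
      using cA lmeasurable_compact by (auto simp: fmeasurable_def)
    show "decseq A"
    proof (rule decseq_SucI, rule subsetI)
      fix n x assume "x \<in> A (Suc n)"
      moreover have "1 / real (Suc (Suc n)) \<le> 1 / real (Suc n)" by (intro frac_le) auto
      ultimately show "x \<in> A n" unfolding A_def mem_Collect_eq by (rule order_trans)
    qed
    show "\<And>i. emeasure lebesgue (A i) \<noteq> \<infinity>"
      using fmeasurableD2[OF lmeasurable_compact[OF cA]] by simp
  qed
  moreover have "(\<Inter>n. A n) = S"
  proof
    show "S \<subseteq> (\<Inter>n. A n)" by (auto simp: A_def)
    show "(\<Inter>n. A n) \<subseteq> S"
    proof
      fix y assume y: "y \<in> (\<Inter>n. A n)"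
      have "infdist y S \<le> 0"
      proof (rule field_le_epsilon)
        fix e :: real assume "e > 0"
        then obtain n where "1 / real (Suc n) < e" using nat_approx_posE by blast
        moreover have "infdist y S \<le> 1 / real (Suc n)" using y by (auto simp: A_def)
        ultimately show "infdist y S \<le> 0 + e" by simp
      qed
      then have "infdist y S = 0" using infdist_nonneg[of y S] by simp
      then show "y \<in> S"
        using in_closed_iff_infdist_zero[of S y] S compact_imp_closed by blast
    qed
  qed
  ultimately have "eventually (\<lambda>n. measure lebesgue (A n) < measure lebesgue S + e) sequentially"
    using e by (intro order_tendstoD(2)) auto
  then obtain n where "measure lebesgue (A n) < measure lebesgue S + e"
    by (auto simp: eventually_sequentially)
  then show ?thesis using that[of "1 / real (Suc n)"] by (auto simp: A_def)
qed

lemma compact_parallel_body: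
  fixes S :: "'a::euclidean_space set"
  assumes S: "compact S" "S \<noteq> {}"
  shows "compact {y. infdist y S \<le> d}"
proof -
  have "closed {y. infdist y S \<le> d}"
    by (intro closed_Collect_le continuous_intros)
  moreover have "bounded {y. infdist y S \<le> d}"
  proof -
    obtain r where r: "\<And>x. x \<in> S \<Longrightarrow> norm x \<le> r"
      using compact_imp_bounded[OF S(1)] bounded_iff by metis
    have "norm y \<le> r + d" if "infdist y S \<le> d" for y
    proof -
      obtain x where x: "x \<in> S" "infdist y S = dist y x"
        using infdist_attains_inf[of S y] S compact_imp_closed by auto
      then show ?thesis using r[OF x(1)] norm_triangle_sub[of y x] that by (simp add: dist_norm)
    qed
    then show ?thesis unfolding bounded_iff by blast
  qed
  ultimately show ?thesis using compact_eq_bounded_closed by blast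
qed

lemma finite_int_vectors:
  fixes r :: real
  shows "finite {v::'a::euclidean_space. (\<forall>b\<in>Basis. v \<bullet> b \<in> \<int>) \<and> norm v \<le> r}"
proof -
  have fin: "finite {t::real. t \<in> \<int> \<and> \<bar>t\<bar> \<le> r}"
  proof (rule finite_subset)
    show "{t::real. t \<in> \<int> \<and> \<bar>t\<bar> \<le> r} \<subseteq> real_of_int ` {-\<lceil>r\<rceil>..\<lceil>r\<rceil>}"
    proof
      fix t :: real assume "t \<in> {t. t \<in> \<int> \<and> \<bar>t\<bar> \<le> r}"
      then obtain i where "t = real_of_int i" "\<bar>real_of_int i\<bar> \<le> r" by (auto elim: Ints_cases)
      then show "t \<in> real_of_int ` {-\<lceil>r\<rceil>..\<lceil>r\<rceil>}"
        by (intro image_eqI[of _ _ i]) (auto, linarith+)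
    qed
  qed simp
  define T where "T = (Basis::'a set) \<rightarrow>\<^sub>E {t::real. t \<in> \<int> \<and> \<bar>t\<bar> \<le> r}"
  have "finite T" unfolding T_def by (intro finite_PiE) (use fin in auto)
  moreover have "{v::'a. (\<forall>b\<in>Basis. v \<bullet> b \<in> \<int>) \<and> norm v \<le> r} \<subseteq> (\<lambda>f. \<Sum>b\<in>Basis. f b *\<^sub>R b) ` T"
  proof
    fix v :: 'a assume v: "v \<in> {v. (\<forall>b\<in>Basis. v \<bullet> b \<in> \<int>) \<and> norm v \<le> r}"
    have "(\<lambda>b\<in>Basis. v \<bullet> b) \<in> T"
      unfolding T_def using v by (auto intro: order_trans[OF Basis_le_norm])
    moreover have "v = (\<Sum>b\<in>Basis. (\<lambda>b\<in>Basis. v \<bullet> b) b *\<^sub>R b)"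
      by (simp add: euclidean_representation)
    ultimately show "v \<in> (\<lambda>f. \<Sum>b\<in>Basis. f b *\<^sub>R b) ` T" by blast
  qed
  ultimately show ?thesis using finite_surj by blast
qed

section \<open>Comparison of set functions with volume\<close>

lemma sum_Basis_inner:
  fixes D :: "'a::euclidean_space set"
  assumes "D \<subseteq> Basis" "b \<in> Basis"
  shows "(\<Sum>i\<in>D. f i *\<^sub>R i) \<bullet> b = (if b \<in> D then f b else 0)"
proof -
  have fin: "finite D" using assms(1) finite_Basis finite_subset by blast
  have "(\<Sum>i\<in>D. f i *\<^sub>R i) \<bullet> b = (\<Sum>i\<in>D. if i = b then f b else 0)"
    unfolding inner_sum_left by (intro sum.cong) (use assms in \<open>auto simp: inner_Basis subset_iff\<close>)
  then show ?thesis using fin by simp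
qed

definition coord_proj :: "'a::euclidean_space set \<Rightarrow> 'a \<Rightarrow> 'a" where
  "coord_proj D x = (\<Sum>b\<in>D. (x \<bullet> b) *\<^sub>R b)"

text \<open>Kept as a subset of the ambient space, so that Hausdorff measure of dimension
  \<open>card D\<close> and the maps of the ambient space apply to its subsets directly.\<close>

definition coord_space :: "'a::euclidean_space set \<Rightarrow> 'a set" where
  "coord_space D = {x. \<forall>b\<in>Basis - D. x \<bullet> b = 0}"

definition unit_cell :: "'a::euclidean_space set \<Rightarrow> 'a set" where
  "unit_cell D = {x \<in> coord_space D. \<forall>b\<in>D. 0 \<le> x \<bullet> b \<and> x \<bullet> b < 1}"

text \<open>For \<open>S\<close> inside \<open>coord_space D\<close> this is the product of
  \<open>S\<close> with a unit cube in the remaining coordinates, so its full-dimensional Lebesgue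
  measure is the \<open>card D\<close>-dimensional volume of \<open>S\<close>.\<close>

definition coord_prism :: "'a::euclidean_space set \<Rightarrow> 'a set \<Rightarrow> 'a set" where
  "coord_prism D S = {x. (\<forall>b\<in>Basis - D. 0 \<le> x \<bullet> b \<and> x \<bullet> b \<le> 1) \<and> coord_proj D x \<in> S}"

lemma coord_proj_inner:
  "D \<subseteq> Basis \<Longrightarrow> b \<in> Basis \<Longrightarrow> coord_proj D x \<bullet> b = (if b \<in> D then x \<bullet> b else 0)"
  unfolding coord_proj_def by (rule sum_Basis_inner)

lemma coord_proj_in_space: "D \<subseteq> Basis \<Longrightarrow> coord_proj D x \<in> coord_space D"
  by (auto simp: coord_space_def coord_proj_inner)

lemma coord_proj_id: "D \<subseteq> Basis \<Longrightarrow> x \<in> coord_space D \<Longrightarrow> coord_proj D x = x"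
  by (rule euclidean_eqI) (auto simp: coord_proj_inner coord_space_def)

lemma linear_coord_proj: "linear (coord_proj D)"
  unfolding coord_proj_def
  by (rule linearI) (simp_all add: inner_add_left scaleR_add_left sum.distrib scaleR_sum_right)

lemma continuous_coord_proj: "continuous_on S (coord_proj D)"
  using linear_coord_proj linear_continuous_on linear_conv_bounded_linear by blast

lemma subspace_coord_space: "subspace (coord_space D)"
  unfolding coord_space_def subspace_def by (auto simp: inner_add_left)

lemma closed_coord_space: "closed (coord_space D)"
  using closed_subspace subspace_coord_space by blast

lemma coord_decomp: "D \<subseteq> Basis \<Longrightarrow> x = coord_proj D x + coord_proj (Basis - D) x"
  by (rule euclidean_eqI) (auto simp: coord_proj_inner inner_add_left)

lemma bounded_coord_prism:
  assumes D: "D \<subseteq> Basis" and "bounded S" shows "bounded (coord_prism D S)"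
proof -
  obtain r where r: "\<And>x. x \<in> S \<Longrightarrow> norm x \<le> r" using assms(2) bounded_iff by metis
  have "norm x \<le> r + real (card (Basis - D))" if "x \<in> coord_prism D S" for x
  proof -
    have "norm (coord_proj (Basis - D) x) \<le> (\<Sum>b\<in>Basis - D. norm ((x \<bullet> b) *\<^sub>R b))"
      unfolding coord_proj_def by (rule norm_sum)
    also have "\<dots> \<le> (\<Sum>b\<in>Basis - D. 1)"
      using that by (intro sum_mono) (auto simp: coord_prism_def)
    finally have 1: "norm (coord_proj (Basis - D) x) \<le> real (card (Basis - D))" by simp
    have 2: "norm (coord_proj D x) \<le> r" using that r by (auto simp: coord_prism_def)
    have "norm x \<le> norm (coord_proj D x) + norm (coord_proj (Basis - D) x)"
      using norm_triangle_ineq coord_decomp[OF D, of x] by metis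
    then show ?thesis using 1 2 by linarith
  qed
  then show ?thesis unfolding bounded_iff by blast
qed

lemma compact_coord_prism:
  assumes D: "D \<subseteq> Basis" and "compact S" shows "compact (coord_prism D S)"
proof -
  have "closed (coord_proj D -` S)"
    using assms(2) by (intro continuous_closed_vimage compact_imp_closed)
      (auto intro: continuous_on_interior[OF continuous_coord_proj[of UNIV]])
  moreover have "closed {x::'a. \<forall>b\<in>Basis - D. 0 \<le> x \<bullet> b \<and> x \<bullet> b \<le> 1}"
    by (simp only: Ball_def) (intro closed_Collect_all closed_Collect_imp closed_Collect_conj closed_Collect_le continuous_intros open_Collect_const)
  ultimately have "closed ({x::'a. \<forall>b\<in>Basis - D. 0 \<le> x \<bullet> b \<and> x \<bullet> b \<le> 1} \<inter> coord_proj D -` S)"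
    by auto
  also have "{x::'a. \<forall>b\<in>Basis - D. 0 \<le> x \<bullet> b \<and> x \<bullet> b \<le> 1} \<inter> coord_proj D -` S = coord_prism D S"
    by (auto simp: coord_prism_def)
  finally have "closed (coord_prism D S)" .
  then show ?thesis
    using bounded_coord_prism[OF D] compact_imp_bounded[OF assms(2)] compact_eq_bounded_closed by blast
qed

lemma convex_coord_prism:
  assumes "convex S" shows "convex (coord_prism D S)"
proof -
  have 1: "convex {x::'a. \<forall>b\<in>Basis - D. 0 \<le> x \<bullet> b \<and> x \<bullet> b \<le> 1}"
    unfolding convex_def
    by (auto simp: inner_add_left intro!: convex_bound_le add_nonneg_nonneg)
  have 2: "convex (coord_proj D -` S)"
    using convex_linear_vimage[OF linear_coord_proj assms] .
  have "{x::'a. \<forall>b\<in>Basis - D. 0 \<le> x \<bullet> b \<and> x \<bullet> b \<le> 1} \<inter> coord_proj D -` S = coord_prism D S"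
    by (auto simp: coord_prism_def)
  then show ?thesis using convex_Int[OF 1 2] by simp
qed

text \<open>Both prisms lie between the open and the closed box with corners \<open>l\<close> and
  \<open>u\<close>, which differ by a null set. Only the coordinates in \<open>D\<close> contribute
  to the product of the edges, the others having length 1.\<close>

lemma measure_coord_prism_cell:
  fixes D :: "'a::euclidean_space set"
  assumes D: "D \<subseteq> Basis" and s: "s > 0"
  shows "coord_prism D {x \<in> coord_space D. \<forall>b\<in>D. a \<bullet> b \<le> x \<bullet> b \<and> x \<bullet> b < a \<bullet> b + s} \<in> lmeasurable" (is "coord_prism D ?S \<in> _")
    and "measure lebesgue (coord_prism D {x \<in> coord_space D. \<forall>b\<in>D. a \<bullet> b \<le> x \<bullet> b \<and> x \<bullet> b < a \<bullet> b + s}) = s ^ card D"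
    and "coord_prism D {x \<in> coord_space D. \<forall>b\<in>D. a \<bullet> b \<le> x \<bullet> b \<and> x \<bullet> b \<le> a \<bullet> b + s} \<in> lmeasurable"
    and "measure lebesgue (coord_prism D {x \<in> coord_space D. \<forall>b\<in>D. a \<bullet> b \<le> x \<bullet> b \<and> x \<bullet> b \<le> a \<bullet> b + s}) = s ^ card D"
proof -
  define l where "l = coord_proj D a"
  define u where "u = (\<Sum>b\<in>Basis. (if b \<in> D then a \<bullet> b + s else 1) *\<^sub>R b)"
  have lb: "l \<bullet> b = (if b \<in> D then a \<bullet> b else 0)" if "b \<in> Basis" for b
    using that D by (simp add: l_def coord_proj_inner)
  have ub: "u \<bullet> b = (if b \<in> D then a \<bullet> b + s else 1)" if "b \<in> Basis" for b
    unfolding u_def by (subst sum_Basis_inner) (use that in auto)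
  have eq: "coord_prism D ?S = {x. \<forall>b\<in>Basis. if b \<in> D then a \<bullet> b \<le> x \<bullet> b \<and> x \<bullet> b < a \<bullet> b + s else 0 \<le> x \<bullet> b \<and> x \<bullet> b \<le> 1}"
    using D coord_proj_in_space[OF D] by (auto simp: coord_prism_def coord_proj_inner subset_iff)
  have 1: "box l u \<subseteq> coord_prism D ?S"
    unfolding eq by (auto simp: box_def lb ub split: if_splits)
  have 2: "coord_prism D ?S \<subseteq> cbox l u"
    unfolding eq by (auto simp: cbox_def lb ub)
  have le: "\<forall>b\<in>Basis. l \<bullet> b \<le> u \<bullet> b" using s by (auto simp: lb ub)
  have "negligible (coord_prism D ?S - box l u)"
  proof (rule negligible_subset)
    show "negligible (cbox l u - box l u)"
      by (intro negligible_iff_null_sets[THEN iffD2] null_sets_completionI null_sets_cbox_Diff_box)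
    show "coord_prism D ?S - box l u \<subseteq> cbox l u - box l u" using 2 by blast
  qed
  then have sd: "negligible ((box l u - coord_prism D ?S) \<union> (coord_prism D ?S - box l u))"
    using 1 by (simp add: Diff_eq_empty_iff[THEN iffD2])
  have m: "measure lebesgue (box l u) = (\<Prod>b\<in>Basis. (u - l) \<bullet> b)"
    using le by (simp add: measure_lborel_box_eq)
  also have "\<dots> = (\<Prod>b\<in>Basis. if b \<in> D then s else 1)"
    by (intro prod.cong) (auto simp: inner_diff_left lb ub)
  also have "\<dots> = s ^ card D"
    using D by (simp add: prod.If_cases Int_absorb1)
  finally have m: "measure lebesgue (box l u) = s ^ card D" .
  show "coord_prism D ?S \<in> lmeasurable"
    using lmeasurable_negligible_symdiff[of "box l u", OF _ sd] by auto
  show "measure lebesgue (coord_prism D ?S) = s ^ card D"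
    using measure_negligible_symdiff[of "box l u", OF _ sd] m by auto
  have eqc: "coord_prism D {x \<in> coord_space D. \<forall>b\<in>D. a \<bullet> b \<le> x \<bullet> b \<and> x \<bullet> b \<le> a \<bullet> b + s} = cbox l u"
    using D coord_proj_in_space[OF D] by (auto simp: coord_prism_def coord_proj_inner subset_iff cbox_def lb ub)
  show "coord_prism D {x \<in> coord_space D. \<forall>b\<in>D. a \<bullet> b \<le> x \<bullet> b \<and> x \<bullet> b \<le> a \<bullet> b + s} \<in> lmeasurable"
    unfolding eqc by simp
  have "measure lebesgue (cbox l u) = measure lebesgue (box l u)"
    using le by (simp add: measure_lborel_box_eq measure_lborel_cbox_eq)
  then show "measure lebesgue (coord_prism D {x \<in> coord_space D. \<forall>b\<in>D. a \<bullet> b \<le> x \<bullet> b \<and> x \<bullet> b \<le> a \<bullet> b + s}) = s ^ card D"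
    unfolding eqc using m by simp
qed

text \<open>Half-open in every direction of \<open>D\<close>, so that the cells with lattice corners
  partition the coordinate subspace and a point finds its cell by rounding down.\<close>

definition cell :: "'a::euclidean_space set \<Rightarrow> 'a \<Rightarrow> real \<Rightarrow> 'a set" where
  "cell D a s = {x \<in> coord_space D. \<forall>b\<in>D. a \<bullet> b \<le> x \<bullet> b \<and> x \<bullet> b < a \<bullet> b + s}"

lemma unit_cell_eq: "unit_cell D = cell D 0 1"
  by (simp add: unit_cell_def cell_def)

lemma cell_subset: "cell D a s \<subseteq> coord_space D"
  by (auto simp: cell_def)

lemma borel_cell:
  assumes "D \<subseteq> Basis" shows "cell D a s \<in> sets borel"
proof -
  have [simp]: "finite D" using assms finite_Basis finite_subset by blast
  have "cell D a s = {x \<in> space borel. (\<forall>b\<in>Basis - D. x \<bullet> b = 0) \<and> (\<forall>b\<in>D. a \<bullet> b \<le> x \<bullet> b \<and> x \<bullet> b < a \<bullet> b + s)}"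
    by (auto simp: cell_def coord_space_def)
  also have "\<dots> \<in> sets borel" by measurable
  finally show ?thesis .
qed

lemma bounded_cell:
  assumes D: "D \<subseteq> Basis" shows "bounded (cell D a s)"
proof -
  have "norm x \<le> (\<Sum>b\<in>Basis. \<bar>a \<bullet> b\<bar> + \<bar>s\<bar>)" if "x \<in> cell D a s" for x
  proof -
    have "norm x \<le> (\<Sum>b\<in>Basis. \<bar>x \<bullet> b\<bar>)" by (rule norm_le_l1)
    also have "\<dots> \<le> (\<Sum>b\<in>Basis. \<bar>a \<bullet> b\<bar> + \<bar>s\<bar>)"
    proof (rule sum_mono)
      fix b :: 'a assume "b \<in> Basis"
      then show "\<bar>x \<bullet> b\<bar> \<le> \<bar>a \<bullet> b\<bar> + \<bar>s\<bar>"
        using that by (cases "b \<in> D") (force simp: cell_def coord_space_def)+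
    qed
    finally show ?thesis .
  qed
  then show ?thesis unfolding bounded_iff by blast
qed

lemma cell_translate:
  assumes "t \<in> coord_space D"
  shows "(+) t ` cell D a s = cell D (t + a) s"
proof
  show "(+) t ` cell D a s \<subseteq> cell D (t + a) s"
    using subspace_add[OF subspace_coord_space assms]
    by (auto simp: cell_def inner_add_left)
  show "cell D (t + a) s \<subseteq> (+) t ` cell D a s"
  proof
    fix x assume "x \<in> cell D (t + a) s"
    then have "x - t \<in> cell D a s"
      using subspace_diff[OF subspace_coord_space _ assms, of x]
      by (auto simp: cell_def inner_diff_left inner_add_left algebra_simps)
    then show "x \<in> (+) t ` cell D a s" by (intro image_eqI[of _ _ "x - t"]) auto
  qed
qed

lemma cell_scale:
  assumes c: "c > 0"
  shows "(*\<^sub>R) c ` cell D a s = cell D (c *\<^sub>R a) (c * s)"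
proof
  show "(*\<^sub>R) c ` cell D a s \<subseteq> cell D (c *\<^sub>R a) (c * s)"
    using subspace_scale[OF subspace_coord_space, of _ D c] c
    by (auto simp: cell_def distrib_left[symmetric])
  show "cell D (c *\<^sub>R a) (c * s) \<subseteq> (*\<^sub>R) c ` cell D a s"
  proof
    fix x assume x: "x \<in> cell D (c *\<^sub>R a) (c * s)"
    have "(1/c) *\<^sub>R x \<in> cell D a s"
      using x subspace_scale[OF subspace_coord_space, of x D "1/c"] c
      by (auto simp: cell_def field_simps)
    then show "x \<in> (*\<^sub>R) c ` cell D a s" using c by (intro image_eqI[of _ _ "(1/c) *\<^sub>R x"]) auto
  qed
qed

text \<open>
  The set functions below agree with Lebesgue measure on the compact convex subsets of a coordinate
  subspace up to a constant factor, by dissection into small cubes. Both Hausdorff measure and the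
  volume of linear images are of this kind.
\<close>

locale prism_volume =
  fixes D :: "'a::euclidean_space set" and m :: "'a set \<Rightarrow> real"
  assumes D: "D \<subseteq> Basis"
    and nonneg: "\<And>A. 0 \<le> m A" and empty: "m {} = 0"
    and mono: "\<And>A B. A \<subseteq> B \<Longrightarrow> B \<subseteq> coord_space D \<Longrightarrow> bounded B \<Longrightarrow> A \<in> sets borel \<Longrightarrow> B \<in> sets borel \<Longrightarrow> m A \<le> m B"
    and subadd: "\<And>A B. A \<subseteq> coord_space D \<Longrightarrow> B \<subseteq> coord_space D \<Longrightarrow> bounded A \<Longrightarrow> bounded B \<Longrightarrow>
      A \<in> sets borel \<Longrightarrow> B \<in> sets borel \<Longrightarrow> m (A \<union> B) \<le> m A + m B"
    and trans: "\<And>A t. A \<subseteq> coord_space D \<Longrightarrow> bounded A \<Longrightarrow> A \<in> sets borel \<Longrightarrow> t \<in> coord_space D \<Longrightarrow> m ((+) t ` A) = m A"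
    and scale: "\<And>A N. A \<subseteq> coord_space D \<Longrightarrow> bounded A \<Longrightarrow> A \<in> sets borel \<Longrightarrow> N > 0 \<Longrightarrow>
      m ((*\<^sub>R) (real N) ` A) = real N ^ card D * m A"
begin

section \<open>Dissection of a coordinate subspace into cubes\<close>

lemma cell_meas:
  assumes "coord_proj D a = a" shows "m (cell D a 1) = m (unit_cell D)"
proof -
  have a: "a \<in> coord_space D" using coord_proj_in_space[OF D, of a] assms by simp
  show ?thesis
    using trans[OF cell_subset bounded_cell[OF D] borel_cell[OF D] a, of 0 1] cell_translate[OF a, of 0 1]
    by (simp add: unit_cell_eq)
qed

lemma big_cell_meas:
  assumes a: "a \<in> coord_space D" and N: "N > 0"
  shows "m (cell D a (real N)) = real N ^ card D * m (unit_cell D)"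
proof -
  have "cell D ((1 / real N) *\<^sub>R a) 1 = (+) ((1 / real N) *\<^sub>R a) ` unit_cell D"
    using cell_translate[OF subspace_scale[OF subspace_coord_space a], of "1 / real N" 0 1] by (simp add: unit_cell_eq)
  moreover have "(*\<^sub>R) (real N) ` cell D ((1 / real N) *\<^sub>R a) 1 = cell D a (real N)"
    using cell_scale[of "real N" D "(1 / real N) *\<^sub>R a" 1] N by simp
  moreover have "m ((*\<^sub>R) (real N) ` cell D ((1 / real N) *\<^sub>R a) 1) = real N ^ card D * m (cell D ((1 / real N) *\<^sub>R a) 1)"
    by (rule scale[OF cell_subset bounded_cell[OF D] borel_cell[OF D] N])
  moreover have "m ((+) ((1 / real N) *\<^sub>R a) ` unit_cell D) = m (unit_cell D)"
    unfolding unit_cell_eq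
    by (rule trans[OF cell_subset bounded_cell[OF D] borel_cell[OF D] subspace_scale[OF subspace_coord_space a]])
  ultimately show ?thesis by simp
qed

text \<open>The scaling law is assumed for integer factors, so a cube of side \<open>1 / N\<close>
  is measured by enlarging it to a unit cube.\<close>

lemma small_cell_meas:
  assumes a: "a \<in> coord_space D" and N: "N > 0"
  shows "real N ^ card D * m (cell D a (1 / real N)) = m (unit_cell D)"
proof -
  have "(*\<^sub>R) (real N) ` cell D a (1 / real N) = cell D (real N *\<^sub>R a) 1"
    using cell_scale[of "real N" D a "1 / real N"] N by simp
  moreover have "m (cell D (real N *\<^sub>R a) 1) = m (unit_cell D)"
    using subspace_scale[OF subspace_coord_space a] by (intro cell_meas coord_proj_id D) auto
  moreover have "m ((*\<^sub>R) (real N) ` cell D a (1 / real N)) = real N ^ card D * m (cell D a (1 / real N))"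
    by (rule scale[OF cell_subset bounded_cell[OF D] borel_cell[OF D] N])
  ultimately show ?thesis by simp
qed

lemma finite_subadd:
  assumes "finite J" and "\<And>j. j \<in> J \<Longrightarrow> C j \<subseteq> coord_space D \<and> bounded (C j) \<and> C j \<in> sets borel"
  shows "m (\<Union>j\<in>J. C j) \<le> (\<Sum>j\<in>J. m (C j))"
  using assms
proof (induction J)
  case (insert j J)
  have "m (C j \<union> (\<Union>j\<in>J. C j)) \<le> m (C j) + m (\<Union>j\<in>J. C j)"
    using insert.prems insert.hyps(1) by (intro subadd) (auto intro!: bounded_Union)
  then show ?case using insert by fastforce
qed (simp add: empty)

text \<open>Count the cubes of side \<open>1 / N\<close> that meet \<open>B\<close>. Subadditivity
  bounds \<open>m B\<close> by their number, while the disjoint prisms over them lie in a thin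
  parallel body of the prism over \<open>closure B\<close>. The closure is there because the volumes
  of parallel bodies shrink to that of the closed set.\<close>

lemma le_closure_volume:
  assumes B: "B \<subseteq> coord_space D" "bounded B" "B \<in> sets borel"
  shows "m B \<le> m (unit_cell D) * measure lebesgue (coord_prism D (closure B))"
proof (cases "B = {}")
  case True then show ?thesis using nonneg by (simp add: empty)
next
  case False
  let ?E = "coord_prism D (closure B)"
  have cE: "compact ?E" using B(2) by (intro compact_coord_prism D) simp
  have nE: "?E \<noteq> {}"
  proof -
    obtain x where x: "x \<in> B" using False by blast
    then have "coord_proj D x = x" using B(1) by (intro coord_proj_id D) auto
    then have "x \<in> ?E" using x B(1) subsetD[OF closure_subset x] by (auto simp: coord_prism_def coord_space_def)
    then show ?thesis by blast
  qed
  have main: "m B \<le> m (unit_cell D) * (measure lebesgue ?E + e)" if e: "e > 0" for e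
  proof -
    obtain d where d: "d > 0" "measure lebesgue {y. infdist y ?E \<le> d} < measure lebesgue ?E + e"
      using measure_parallel_body[OF cE nE e] by blast
    \<comment> \<open>Makes the l1-diameter \<open>card D / N\<close> of a cell at most the width
      \<open>d\<close> of the parallel body.\<close>
    define N where "N = nat \<lceil>real (card D) / d\<rceil> + 1"
    have N: "N > 0" by (simp add: N_def)
    have "real (card D) / d \<le> real N" unfolding N_def using of_nat_ceiling[of "real (card D) / d"] by linarith
    then have Nd: "real (card D) / real N \<le> d" using d(1) N by (simp add: field_simps)
    define C where "C v = cell D ((1 / real N) *\<^sub>R v) (1 / real N)" for v :: 'a
    define J where "J = {v \<in> coord_space D. (\<forall>b\<in>D. v \<bullet> b \<in> \<int>) \<and> C v \<inter> B \<noteq> {}}"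
    have CV: "C v \<subseteq> coord_space D \<and> bounded (C v) \<and> C v \<in> sets borel" for v
      unfolding C_def using cell_subset bounded_cell[OF D] borel_cell[OF D] by blast
    have floorC: "x \<in> C (\<Sum>b\<in>D. of_int \<lfloor>real N * (x \<bullet> b)\<rfloor> *\<^sub>R b)" if "x \<in> coord_space D" for x
    proof -
      have "of_int \<lfloor>real N * (x \<bullet> b)\<rfloor> / real N \<le> x \<bullet> b \<and> x \<bullet> b < of_int \<lfloor>real N * (x \<bullet> b)\<rfloor> / real N + 1 / real N" for b
      proof -
        have "real_of_int \<lfloor>real N * (x \<bullet> b)\<rfloor> \<le> real N * (x \<bullet> b)" "real N * (x \<bullet> b) < real_of_int \<lfloor>real N * (x \<bullet> b)\<rfloor> + 1" by linarith+
        then show ?thesis using N by (simp add: field_simps)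
      qed
      then show ?thesis
        using that D unfolding C_def cell_def by (auto simp: sum_Basis_inner[OF D] subset_iff)
    qed
    \<comment> \<open>A point determines the integer label of its cell by rounding. This yields both
      the finiteness of \<open>J\<close> and the disjointness of the prisms.\<close>
    have uniq: "v \<bullet> b = of_int \<lfloor>real N * (x \<bullet> b)\<rfloor>" if xv: "x \<in> C v" and vi: "v \<bullet> b \<in> \<int>" and bD: "b \<in> D" for v x b
    proof -
      obtain i where i: "v \<bullet> b = of_int i" using vi by (auto elim: Ints_cases)
      have "of_int i / real N \<le> x \<bullet> b" "x \<bullet> b < of_int i / real N + 1 / real N"
        using xv bD i by (auto simp: C_def cell_def)
      then have "of_int i \<le> real N * (x \<bullet> b)" "real N * (x \<bullet> b) < of_int i + 1"
        using N by (auto simp: field_simps)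
      then have "\<lfloor>real N * (x \<bullet> b)\<rfloor> = i" by linarith
      then show ?thesis using i by simp
    qed
    obtain r where r: "\<And>x. x \<in> B \<Longrightarrow> norm x \<le> r" using B(2) bounded_iff by metis
    have finJ: "finite J"
    proof (rule finite_subset[OF _ finite_int_vectors])
      show "J \<subseteq> {v. (\<forall>b\<in>Basis. v \<bullet> b \<in> \<int>) \<and> norm v \<le> real DIM('a) * (real N * r + 1)}"
      proof
        fix v assume v: "v \<in> J"
        then obtain x where x: "x \<in> C v" "x \<in> B" by (auto simp: J_def)
        have vb: "\<bar>v \<bullet> b\<bar> \<le> real N * r + 1" if "b \<in> Basis" for b
        proof (cases "b \<in> D")
          case True
          have "\<bar>x \<bullet> b\<bar> \<le> r" using Basis_le_norm[OF that, of x] r[OF x(2)] by linarith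
          then have "\<bar>real N * (x \<bullet> b)\<bar> \<le> real N * r" by (simp add: abs_mult mult_left_mono)
          moreover have "v \<bullet> b = of_int \<lfloor>real N * (x \<bullet> b)\<rfloor>" using uniq[OF x(1) _ True] v True by (auto simp: J_def)
          ultimately show ?thesis by linarith
        next
          case False
          have "0 \<le> r" using r[OF x(2)] norm_ge_zero order_trans by blast
          then show ?thesis using False that v by (simp add: J_def coord_space_def)
        qed
        have "norm v \<le> (\<Sum>b\<in>Basis. \<bar>v \<bullet> b\<bar>)" by (rule norm_le_l1)
        also have "\<dots> \<le> (\<Sum>b\<in>(Basis::'a set). real N * r + 1)" by (rule sum_mono) (rule vb)
        finally have "norm v \<le> real DIM('a) * (real N * r + 1)" by simp
        moreover have "\<forall>b\<in>Basis. v \<bullet> b \<in> \<int>" using v by (auto simp: J_def coord_space_def)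
        ultimately show "v \<in> {v. (\<forall>b\<in>Basis. v \<bullet> b \<in> \<int>) \<and> norm v \<le> real DIM('a) * (real N * r + 1)}" by blast
      qed
    qed
    have JV: "v \<in> coord_space D" if "v \<in> J" for v using that by (simp add: J_def)
    have cov: "B \<subseteq> (\<Union>v\<in>J. C v)"
    proof
      fix x assume x: "x \<in> B"
      define v where "v = (\<Sum>b\<in>D. of_int \<lfloor>real N * (x \<bullet> b)\<rfloor> *\<^sub>R b)"
      have xv: "x \<in> C v" unfolding v_def using floorC x B(1) by blast
      have "v \<in> coord_space D" using D by (auto simp: v_def coord_space_def sum_Basis_inner)
      moreover have "\<forall>b\<in>D. v \<bullet> b \<in> \<int>" using D by (auto simp: v_def sum_Basis_inner[OF D] subset_iff)
      ultimately show "x \<in> (\<Union>v\<in>J. C v)" using xv x by (auto simp: J_def)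
    qed
    have 1: "real N ^ card D * m B \<le> real (card J) * m (unit_cell D)"
    proof -
      have "m B \<le> m (\<Union>v\<in>J. C v)"
        using cov CV finJ B(3) by (intro mono) (auto intro!: bounded_Union)
      also have "\<dots> \<le> (\<Sum>v\<in>J. m (C v))" using finJ CV by (intro finite_subadd) auto
      finally have "real N ^ card D * m B \<le> (\<Sum>v\<in>J. real N ^ card D * m (C v))"
        unfolding sum_distrib_left[symmetric] using N by (intro mult_left_mono) auto
      also have "\<dots> = (\<Sum>v\<in>J. m (unit_cell D))"
        unfolding C_def
        by (intro sum.cong refl small_cell_meas N subspace_scale[OF subspace_coord_space] JV)
      finally show ?thesis by simp
    qed
    have pc: "coord_prism D (C v) \<in> lmeasurable" "measure lebesgue (coord_prism D (C v)) = (1 / real N) ^ card D" for v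
      using measure_coord_prism_cell[OF D, of "1 / real N" "(1 / real N) *\<^sub>R v"] N
      unfolding C_def cell_def by auto
    have "disjoint_family_on (\<lambda>v. coord_prism D (C v)) J"
    unfolding disjoint_family_on_def
    proof (intro ballI impI)
      fix v w assume vw: "v \<in> J" "w \<in> J" "v \<noteq> w"
      show "coord_prism D (C v) \<inter> coord_prism D (C w) = {}"
      proof (rule ccontr)
        assume "coord_prism D (C v) \<inter> coord_prism D (C w) \<noteq> {}"
        then obtain x where x: "x \<in> C v" "x \<in> C w" by (auto simp: coord_prism_def)
        have "v \<bullet> b = w \<bullet> b" if "b \<in> Basis" for b
          using uniq[OF x(1), of b] uniq[OF x(2), of b] vw that by (cases "b \<in> D") (auto simp: J_def coord_space_def)
        then show False using vw(3) euclidean_eqI by blast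
      qed
    qed
    then have "measure lebesgue (\<Union>v\<in>J. coord_prism D (C v)) = (\<Sum>v\<in>J. measure lebesgue (coord_prism D (C v)))"
      using finJ pc(1)[THEN fmeasurableD] pc(1)[THEN fmeasurableD2] by (intro measure_finite_Union) auto
    then have 2: "measure lebesgue (\<Union>v\<in>J. coord_prism D (C v)) = real (card J) * (1 / real N) ^ card D"
      by (simp add: pc)
    have "(\<Union>v\<in>J. coord_prism D (C v)) \<subseteq> {y. infdist y ?E \<le> d}"
    proof
      fix y assume "y \<in> (\<Union>v\<in>J. coord_prism D (C v))"
      then obtain v where v: "v \<in> J" "y \<in> coord_prism D (C v)" by blast
      then obtain p where p: "p \<in> C v" "p \<in> B" by (auto simp: J_def)
      \<comment> \<open>Only the coordinates in \<open>D\<close> are replaced, by those of a point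
        of \<open>B\<close> in the same cell. Hence \<open>y'\<close> lies in \<open>?E\<close> and
        is no farther from \<open>y\<close> than a cell diameter.\<close>
      define y' where "y' = p + coord_proj (Basis - D) y"
      have pV: "p \<in> coord_space D" using p B by blast
      have yi: "y' \<bullet> b = (if b \<in> D then p \<bullet> b else y \<bullet> b)" if "b \<in> Basis" for b
        using that pV D by (auto simp: y'_def inner_add_left coord_proj_inner coord_space_def)
      have "coord_proj D y' = p"
        using pV D by (intro euclidean_eqI[of "coord_proj D y'"]) (auto simp: coord_proj_inner yi coord_space_def)
      then have "y' \<in> ?E"
        using v(2) subsetD[OF closure_subset p(2)] D by (auto simp: coord_prism_def yi)
      have "dist y y' \<le> (\<Sum>b\<in>Basis. \<bar>(y - y') \<bullet> b\<bar>)" unfolding dist_norm by (rule norm_le_l1)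
      also have "\<dots> \<le> (\<Sum>b\<in>Basis. if b \<in> D then 1 / real N else 0)"
      proof (rule sum_mono)
        fix b :: 'a assume b: "b \<in> Basis"
        show "\<bar>(y - y') \<bullet> b\<bar> \<le> (if b \<in> D then 1 / real N else 0)"
        proof (cases "b \<in> D")
          case True
          have "coord_proj D y \<in> C v" using v(2) by (simp add: coord_prism_def)
          then have "v \<bullet> b / real N \<le> y \<bullet> b \<and> y \<bullet> b < v \<bullet> b / real N + 1 / real N"
            using True b D by (auto simp: C_def cell_def coord_proj_inner)
          moreover have "v \<bullet> b / real N \<le> p \<bullet> b \<and> p \<bullet> b < v \<bullet> b / real N + 1 / real N"
            using p(1) True by (auto simp: C_def cell_def)
          ultimately have "\<bar>y \<bullet> b - p \<bullet> b\<bar> \<le> 1 / real N" by linarith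
          then show ?thesis using True b by (simp add: inner_diff_left yi)
        qed (simp add: inner_diff_left yi b)
      qed
      also have "\<dots> = real (card D) / real N"
        using D by (simp add: sum.If_cases Int_absorb1)
      finally have "infdist y ?E \<le> d"
        using infdist_le[OF \<open>y' \<in> ?E\<close>, of y] Nd by linarith
      then show "y \<in> {y. infdist y ?E \<le> d}" by blast
    qed
    then have "measure lebesgue (\<Union>v\<in>J. coord_prism D (C v)) \<le> measure lebesgue {y. infdist y ?E \<le> d}"
      using pc(1)[THEN fmeasurableD] finJ
      by (intro measure_mono_fmeasurable lmeasurable_compact[OF compact_parallel_body[OF cE nE]]) auto
    with 2 d have 3: "real (card J) * (1 / real N) ^ card D \<le> measure lebesgue ?E + e" by linarith
    have "m B \<le> m (unit_cell D) * (real (card J) * (1 / real N) ^ card D)"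
      using 1 N by (simp add: field_simps power_divide)
    also have "\<dots> \<le> m (unit_cell D) * (measure lebesgue ?E + e)"
      using 3 nonneg by (rule mult_left_mono)
    finally show ?thesis .
  qed
  show ?thesis
  proof (rule field_le_epsilon)
    fix e :: real assume e: "e > 0"
    \<comment> \<open>The summand 1 avoids a division by zero: \<open>m (unit_cell D)\<close> may
      vanish.\<close>
    define e' where "e' = e / (m (unit_cell D) + 1)"
    have p: "m (unit_cell D) + 1 > 0" using nonneg[of "unit_cell D"] by linarith
    then have "e' > 0" using e by (simp add: e'_def)
    have "m (unit_cell D) * e' \<le> (m (unit_cell D) + 1) * e'"
      using \<open>e' > 0\<close> by (intro mult_right_mono) auto
    also have "\<dots> = e" using p by (simp add: e'_def)
    finally show "m B \<le> m (unit_cell D) * measure lebesgue ?E + e"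
      using main[OF \<open>e' > 0\<close>] by (simp add: distrib_left)
  qed
qed

text \<open>The lower bound applies the preceding upper bound to the complement \<open>B\<close> of
  \<open>F\<close> in a big cube, whose measure is known exactly:
  \<open>m ?Q \<le> m F + m B\<close>. Convexity enters because the prism over
  \<open>closure B\<close> misses the interior of the prism over \<open>F\<close>, and a convex set
  has a null boundary.\<close>

theorem convex_eq:
  assumes F: "F \<subseteq> coord_space D" "compact F" "convex F"
  shows "m F = m (unit_cell D) * measure lebesgue (coord_prism D F)"
proof (rule antisym)
  have bF: "bounded F" "F \<in> sets borel"
    using F(2) compact_imp_bounded compact_imp_closed borel_closed by blast+
  show "m F \<le> m (unit_cell D) * measure lebesgue (coord_prism D F)"
    using le_closure_volume[OF F(1) bF] F(2) by (simp add: compact_imp_closed)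
  obtain r where r: "\<And>x. x \<in> F \<Longrightarrow> norm x \<le> r" using bF(1) bounded_iff by metis
  define R where "R = nat \<lceil>\<bar>r\<bar>\<rceil> + 1"
  have R: "r < real R" unfolding R_def by linarith
  define a where "a = (\<Sum>b\<in>D. (- real R) *\<^sub>R b)"
  have aV: "a \<in> coord_space D" using D by (auto simp: a_def coord_space_def sum_Basis_inner simp del: scaleR_minus_left)
  have ab: "a \<bullet> b = - real R" if "b \<in> D" for b using that D by (auto simp: a_def sum_Basis_inner[OF D] subset_iff simp del: scaleR_minus_left)
  \<comment> \<open>The side of the cube from \<open>- R\<close> to \<open>R\<close>; it has to be
    an integer for \<open>big_cell_meas\<close>.\<close>
  define N where "N = 2 * R"
  have N: "N > 0" "real N = 2 * real R" by (simp_all add: N_def R_def)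
  let ?Q = "cell D a (real N)"
  have FQ: "F \<subseteq> ?Q"
  proof
    fix x assume x: "x \<in> F"
    have "- real R \<le> x \<bullet> b \<and> x \<bullet> b < real R" if "b \<in> D" for b
      using Basis_le_norm[of b x] that D r[OF x] R by (force simp: subset_iff)
    then show "x \<in> ?Q" using x F(1) N by (auto simp: cell_def ab)
  qed
  define B where "B = ?Q - F"
  have B: "B \<subseteq> coord_space D" "bounded B" "B \<in> sets borel"
    using cell_subset[of D a "real N"] bounded_cell[OF D, of a "real N"] borel_cell[OF D, of a "real N"] bF(2)
    unfolding B_def by (auto intro: bounded_subset)
  define G where "G = {x \<in> coord_space D. \<forall>b\<in>D. a \<bullet> b \<le> x \<bullet> b \<and> x \<bullet> b \<le> a \<bullet> b + real N}"
  have G: "coord_prism D G \<in> lmeasurable" "measure lebesgue (coord_prism D G) = real N ^ card D"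
    using measure_coord_prism_cell(3,4)[OF D, of "real N" a] N unfolding G_def by auto
  have clG: "closed G"
  proof -
    have "G = coord_space D \<inter> {x. \<forall>b. b \<in> D \<longrightarrow> a \<bullet> b \<le> x \<bullet> b \<and> x \<bullet> b \<le> a \<bullet> b + real N}" by (auto simp: G_def)
    then show ?thesis
      by (auto intro!: closed_Int closed_coord_space closed_Collect_all closed_Collect_imp closed_Collect_conj closed_Collect_le continuous_intros)
  qed
  have clB: "closure B \<subseteq> G"
    by (rule closure_minimal[OF _ clG]) (auto simp: B_def G_def cell_def intro: less_imp_le)
  let ?T = "coord_prism D F"
  have T: "compact ?T" "convex ?T" using compact_coord_prism[OF D F(2)] convex_coord_prism[OF F(3)] by auto
  \<comment> \<open>Near a point of the prism over \<open>closure B\<close> there is one whose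
    projection lies in \<open>B\<close>: shift within the coordinate subspace from the projection of
    \<open>y\<close> to a nearby \<open>q\<close>. Such a point is outside the prism over
    \<open>F\<close>.\<close>
  have sub: "coord_prism D (closure B) \<subseteq> coord_prism D G - interior ?T"
  proof
    fix y assume y: "y \<in> coord_prism D (closure B)"
    have "y \<notin> interior ?T"
    proof
      assume "y \<in> interior ?T"
      then obtain e where e: "e > 0" "ball y e \<subseteq> ?T" using mem_interior by blast
      have cy: "coord_proj D y \<in> closure B" using y by (simp add: coord_prism_def)
      then obtain q where q: "q \<in> B" "dist q (coord_proj D y) < e"
        using e(1) closure_approachable by blast
      define y' where "y' = y + (q - coord_proj D y)"
      have "y' \<in> ball y e" using q(2) by (simp add: y'_def dist_norm norm_minus_commute)
      then have "coord_proj D y' \<in> F" using e(2) by (auto simp: coord_prism_def)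
      moreover have "coord_proj D y' = q"
      proof -
        have "coord_proj D y' = coord_proj D y + (coord_proj D q - coord_proj D (coord_proj D y))"
          unfolding y'_def by (simp add: linear_add[OF linear_coord_proj] linear_diff[OF linear_coord_proj])
        moreover have "coord_proj D q = q" using q(1) B(1) by (intro coord_proj_id D) auto
        moreover have "coord_proj D (coord_proj D y) = coord_proj D y"
          by (intro coord_proj_id D coord_proj_in_space)
        ultimately show ?thesis by simp
      qed
      ultimately show False using q(1) by (simp add: B_def)
    qed
    moreover have "y \<in> coord_prism D G" using y clB by (auto simp: coord_prism_def)
    ultimately show "y \<in> coord_prism D G - interior ?T" by blast
  qed
  have TG: "?T \<subseteq> coord_prism D G"
    using FQ by (auto simp: coord_prism_def G_def cell_def subset_iff intro: less_imp_le)
  have iT: "interior ?T \<in> sets lebesgue" "measure lebesgue (interior ?T) = measure lebesgue ?T"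
    using measure_interior[OF compact_imp_bounded[OF T(1)] negligible_convex_frontier[OF T(2)]] by auto
  have "measure lebesgue (coord_prism D (closure B)) \<le> measure lebesgue (coord_prism D G - interior ?T)"
  proof (rule measure_mono_fmeasurable[OF sub])
    have "compact (coord_prism D (closure B))" using B(2) by (intro compact_coord_prism D) simp
    then show "coord_prism D (closure B) \<in> sets lebesgue" using lmeasurable_compact fmeasurableD by blast
    show "coord_prism D G - interior ?T \<in> lmeasurable" by (rule fmeasurable_Diff[OF G(1) iT(1)])
  qed
  also have "\<dots> = measure lebesgue (coord_prism D G) - measure lebesgue (interior ?T)"
    by (rule measurable_measure_Diff[OF G(1) iT(1)]) (use TG interior_subset in blast)
  finally have 1: "measure lebesgue (coord_prism D (closure B)) \<le> real N ^ card D - measure lebesgue ?T"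
    using G iT by simp
  have "real N ^ card D * m (unit_cell D) = m ?Q" using big_cell_meas[OF aV N(1)] by simp
  also have "?Q = F \<union> B" using FQ by (auto simp: B_def)
  also have "m (F \<union> B) \<le> m F + m B" by (intro subadd F B bF)
  also have "m B \<le> m (unit_cell D) * measure lebesgue (coord_prism D (closure B))" by (rule le_closure_volume[OF B])
  also have "\<dots> \<le> m (unit_cell D) * (real N ^ card D - measure lebesgue ?T)"
    using 1 nonneg by (rule mult_left_mono)
  finally show "m (unit_cell D) * measure lebesgue ?T \<le> m F"
    by (simp add: algebra_simps)
qed

end

section \<open>Hausdorff measure\<close>

lemma hausdorff_content_antimono:
  assumes "\<delta> \<le> \<epsilon>" shows "hausdorff_content d \<epsilon> A \<le> hausdorff_content d \<delta> A"
  unfolding hausdorff_content_def by (rule INF_superset_mono) (use assms order_trans in blast)+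

lemma hausdorff_content_mono:
  assumes "A \<subseteq> B" shows "hausdorff_content d \<epsilon> A \<le> hausdorff_content d \<epsilon> B"
  unfolding hausdorff_content_def by (rule INF_superset_mono) (use assms in blast)+

lemma hausdorff_measure_mono:
  assumes "A \<subseteq> B" shows "hausdorff_measure d A \<le> hausdorff_measure d B"
  unfolding hausdorff_measure_def by (intro SUP_mono') (rule hausdorff_content_mono[OF assms])

text \<open>The content increases as the mesh decreases, so bounds along arbitrarily small \<delta>
  control the supremum.\<close>

lemma hausdorff_measure_leI:
  assumes "\<And>\<epsilon>. \<epsilon> > 0 \<Longrightarrow> \<exists>\<delta>\<le>\<epsilon>. hausdorff_content d \<delta> A \<le> X"
  shows "hausdorff_measure d A \<le> X"
  unfolding hausdorff_measure_def
proof (rule SUP_least)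
  fix \<epsilon> :: real assume "\<epsilon> \<in> {0<..}"
  then obtain \<delta> where "\<delta> \<le> \<epsilon>" "hausdorff_content d \<delta> A \<le> X" using assms by auto
  then show "hausdorff_content d \<epsilon> A \<le> X"
    using hausdorff_content_antimono order_trans by blast
qed

text \<open>An empty covering set has to contribute 0 also for \<open>d = 0\<close>, where the power
  of its diameter is 1.\<close>

definition content_term :: "nat \<Rightarrow> 'a::euclidean_space set \<Rightarrow> ennreal" where
  "content_term d C = (if C = {} then 0 else ennreal (unit_ball_vol (real d) * (diameter C / 2) ^ d))"

lemma hausdorff_content_alt:
  "hausdorff_content d \<epsilon> A =
     (INF C \<in> {C. A \<subseteq> (\<Union>i. C i) \<and> (\<forall>i. bounded (C i) \<and> diameter (C i) \<le> \<epsilon>)}. \<Sum>i::nat. content_term d (C i))"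
  unfolding hausdorff_content_def content_term_def ..

lemma hausdorff_content_le:
  assumes "A \<subseteq> (\<Union>i. C i)" "\<And>i::nat. bounded (C i)" "\<And>i. diameter (C i) \<le> \<epsilon>"
  shows "hausdorff_content d \<epsilon> A \<le> (\<Sum>i. content_term d (C i))"
  unfolding hausdorff_content_alt by (rule INF_lower) (use assms in auto)

lemma hausdorff_content_finite_cover:
  assumes J: "finite J" and A: "A \<subseteq> (\<Union>j\<in>J. C j)"
    and C: "\<And>j. j \<in> J \<Longrightarrow> bounded (C j) \<and> diameter (C j) \<le> \<delta>" and \<delta>: "\<delta> \<ge> 0"
  shows "hausdorff_content d \<delta> A \<le> ennreal (real (card J) * (unit_ball_vol (real d) * (\<delta> / 2) ^ d))"
proof -
  obtain h where h: "bij_betw h {..<card J} J"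
    using ex_bij_betw_nat_finite[OF J] by (auto simp: atLeast0LessThan)
  \<comment> \<open>Covers are sequences; a finite one is padded with empty sets, which contribute
    nothing.\<close>
  define C' where "C' i = (if i < card J then C (h i) else {})" for i
  have hJ: "h i \<in> J" if "i < card J" for i using h that by (auto simp: bij_betw_def)
  have "hausdorff_content d \<delta> A \<le> (\<Sum>i. content_term d (C' i))"
  proof (rule hausdorff_content_le)
    show "A \<subseteq> (\<Union>i. C' i)"
    proof
      fix x assume "x \<in> A"
      then obtain j where j: "j \<in> J" "x \<in> C j" using A by blast
      then obtain i where "i < card J" "h i = j"
        using bij_betw_imp_surj_on[OF h] by (metis imageE lessThan_iff)
      then show "x \<in> (\<Union>i. C' i)" using j by (auto simp: C'_def)
    qed
    show "bounded (C' i)" for i using C hJ by (simp add: C'_def)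
    show "diameter (C' i) \<le> \<delta>" for i using C hJ \<delta> by (simp add: C'_def)
  qed
  also have "(\<Sum>i. content_term d (C' i)) = (\<Sum>i<card J. content_term d (C' i))"
    by (rule suminf_finite) (auto simp: C'_def content_term_def)
  also have "\<dots> \<le> (\<Sum>i<card J. ennreal (unit_ball_vol (real d) * (\<delta> / 2) ^ d))"
  proof (rule sum_mono)
    fix i assume "i \<in> {..<card J}"
    then have b: "bounded (C' i)" "diameter (C' i) \<le> \<delta>" using C hJ by (auto simp: C'_def)
    have "unit_ball_vol (real d) * (diameter (C' i) / 2) ^ d \<le> unit_ball_vol (real d) * (\<delta> / 2) ^ d"
      using b diameter_ge_0[OF b(1)] by (intro mult_left_mono power_mono unit_ball_vol_nonneg) auto
    then show "content_term d (C' i) \<le> ennreal (unit_ball_vol (real d) * (\<delta> / 2) ^ d)"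
      by (auto simp: content_term_def intro: ennreal_leI)
  qed
  also have "\<dots> = ennreal (real (card J) * (unit_ball_vol (real d) * (\<delta> / 2) ^ d))"
    using \<delta> by (simp add: ennreal_mult ennreal_of_nat_eq_real_of_nat)
  finally show ?thesis .
qed

lemma hausdorff_content_empty: "\<epsilon> > 0 \<Longrightarrow> hausdorff_content d \<epsilon> {} = 0"
  using hausdorff_content_finite_cover[of "{}" "{}" "\<lambda>_. {}" \<epsilon> d] by simp

lemma hausdorff_measure_empty: "hausdorff_measure d {} = 0"
  unfolding hausdorff_measure_def by (simp add: hausdorff_content_empty)

text \<open>The \<open>i\<close>-th set gets a cover with excess at most
  \<open>e / 2 ^ (i + 1)\<close>, and the double sequence of covering sets is enumerated through
  \<open>prod_decode\<close>.\<close>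

lemma hausdorff_content_UN:
  fixes A :: "nat \<Rightarrow> 'a::euclidean_space set"
  shows "hausdorff_content d \<epsilon> (\<Union>i. A i) \<le> (\<Sum>i. hausdorff_content d \<epsilon> (A i))"
proof (cases "(\<Sum>i. hausdorff_content d \<epsilon> (A i)) = top")
  case False
  have fin: "hausdorff_content d \<epsilon> (A i) < top" for i
  proof -
    have "hausdorff_content d \<epsilon> (A i) \<le> (\<Sum>i. hausdorff_content d \<epsilon> (A i))"
      using sum_le_suminf[of "\<lambda>i. hausdorff_content d \<epsilon> (A i)" "{i}"] by simp
    then show ?thesis using False by (simp add: less_top order_le_less_trans)
  qed
  show ?thesis
  proof (rule ennreal_le_epsilon)
    fix e :: real assume e: "e > 0"
    have "\<exists>C. A i \<subseteq> (\<Union>j. C j) \<and> (\<forall>j. bounded (C j) \<and> diameter (C j) \<le> \<epsilon>) \<and>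
        (\<Sum>j::nat. content_term d (C j)) \<le> hausdorff_content d \<epsilon> (A i) + ennreal (e * (1/2) ^ Suc i)" for i
    proof -
      have "hausdorff_content d \<epsilon> (A i) < hausdorff_content d \<epsilon> (A i) + ennreal (e * (1/2) ^ Suc i)"
        by (cases "hausdorff_content d \<epsilon> (A i)")
          (use fin[of i] e in \<open>auto simp: ennreal_plus[symmetric] ennreal_less_iff simp del: ennreal_plus\<close>)
      then show ?thesis
      proof -
        assume "hausdorff_content d \<epsilon> (A i) < hausdorff_content d \<epsilon> (A i) + ennreal (e * (1/2) ^ Suc i)"
        then have "(INF C \<in> {C. A i \<subseteq> (\<Union>j. C j) \<and> (\<forall>j. bounded (C j) \<and> diameter (C j) \<le> \<epsilon>)}. \<Sum>j::nat. content_term d (C j))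
            < hausdorff_content d \<epsilon> (A i) + ennreal (e * (1/2) ^ Suc i)"
          by (subst (asm) (1) hausdorff_content_alt)
        then obtain C where "A i \<subseteq> (\<Union>j. C j) \<and> (\<forall>j. bounded (C j) \<and> diameter (C j) \<le> \<epsilon>)"
            "(\<Sum>j::nat. content_term d (C j)) < hausdorff_content d \<epsilon> (A i) + ennreal (e * (1/2) ^ Suc i)"
          unfolding INF_less_iff by blast
        then show ?thesis by (intro exI[of _ C]) (simp add: less_imp_le)
      qed
    qed
    then obtain C where C: "\<And>i. A i \<subseteq> (\<Union>j. C i j)" "\<And>i j. bounded (C i j)" "\<And>i j. diameter (C i j) \<le> \<epsilon>"
      "\<And>i. (\<Sum>j::nat. content_term d (C i j)) \<le> hausdorff_content d \<epsilon> (A i) + ennreal (e * (1/2) ^ Suc i)"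
      by metis
    have "hausdorff_content d \<epsilon> (\<Union>i. A i) \<le> (\<Sum>n. content_term d (case_prod C (prod_decode n)))"
    proof (rule hausdorff_content_le)
      show "(\<Union>i. A i) \<subseteq> (\<Union>n. case_prod C (prod_decode n))"
      proof
        fix x assume "x \<in> (\<Union>i. A i)"
        then obtain i j where "x \<in> C i j" using C(1) by blast
        then have "x \<in> case_prod C (prod_decode (prod_encode (i, j)))" by simp
        then show "x \<in> (\<Union>n. case_prod C (prod_decode n))" by (rule UN_I[OF UNIV_I])
      qed
    qed (use C in \<open>auto split: prod.split\<close>)
    also have "\<dots> = (\<Sum>i. \<Sum>j. content_term d (C i j))"
      using suminf_ennreal_2dimen[of "\<lambda>i. \<Sum>j. content_term d (C i j)" "\<lambda>p. content_term d (case_prod C p)"]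
      by (simp add: comp_def)
    also have "\<dots> \<le> (\<Sum>i. hausdorff_content d \<epsilon> (A i) + ennreal (e * (1/2) ^ Suc i))"
      by (intro suminf_le C(4)) auto
    also have "\<dots> = (\<Sum>i. hausdorff_content d \<epsilon> (A i)) + (\<Sum>i. ennreal (e * (1/2) ^ Suc i))"
      by (intro suminf_add[symmetric]) auto
    also have "(\<Sum>i. ennreal (e * (1/2) ^ Suc i)) = ennreal e"
    proof -
      have "(\<lambda>i. e * (1/2) ^ Suc i) sums (e * 1)"
        by (intro sums_mult power_half_series)
      then show ?thesis using e by (intro suminf_ennreal_eq) auto
    qed
    finally show "hausdorff_content d \<epsilon> (\<Union>i. A i) \<le> (\<Sum>i. hausdorff_content d \<epsilon> (A i)) + ennreal e" .
  qed
qed simp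

lemma hausdorff_measure_UN:
  fixes A :: "nat \<Rightarrow> 'a::euclidean_space set"
  shows "hausdorff_measure d (\<Union>i. A i) \<le> (\<Sum>i. hausdorff_measure d (A i))"
  unfolding hausdorff_measure_def[of d "\<Union>i. A i"]
proof (rule SUP_least)
  fix \<epsilon> :: real assume \<epsilon>: "\<epsilon> \<in> {0<..}"
  have "hausdorff_content d \<epsilon> (\<Union>i. A i) \<le> (\<Sum>i. hausdorff_content d \<epsilon> (A i))"
    by (rule hausdorff_content_UN)
  also have "\<dots> \<le> (\<Sum>i. hausdorff_measure d (A i))"
    unfolding hausdorff_measure_def by (intro suminf_le SUP_upper \<epsilon>) auto
  finally show "hausdorff_content d \<epsilon> (\<Union>i. A i) \<le> (\<Sum>i. hausdorff_measure d (A i))" .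
qed

lemma hausdorff_measure_Un:
  "hausdorff_measure d (A \<union> B) \<le> hausdorff_measure d A + hausdorff_measure d B"
proof -
  let ?C = "\<lambda>i::nat. if i = 0 then A else if i = 1 then B else {}"
  have "A \<union> B = (\<Union>i. ?C i)" by (auto split: if_splits)
  then have "hausdorff_measure d (A \<union> B) \<le> (\<Sum>i. hausdorff_measure d (?C i))"
    using hausdorff_measure_UN[of d ?C] by simp
  also have "\<dots> = (\<Sum>i\<in>{0,1}. hausdorff_measure d (?C i))"
    by (rule suminf_finite) (auto simp: hausdorff_measure_empty)
  finally show ?thesis by simp
qed

text \<open>The images of the covering sets, cut down to the set \<open>S\<close> on which the
  Lipschitz bound holds, cover the image with diameters enlarged by at most \<open>L\<close>. The
  set \<open>S\<close> is general so that the inverse of an isometry, controlled only on its range,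
  is covered as well.\<close>

lemma hausdorff_measure_lipschitz:
  fixes f :: "'a::euclidean_space \<Rightarrow> 'a"
  assumes L: "L > 0" and f: "\<And>x y. x \<in> S \<Longrightarrow> y \<in> S \<Longrightarrow> dist (f x) (f y) \<le> L * dist x y"
    and A: "A \<subseteq> S"
  shows "ennreal (1 / L ^ d) * hausdorff_measure d (f ` A) \<le> hausdorff_measure d A"
proof -
  have *: "ennreal (1 / L ^ d) * hausdorff_content d (L * \<epsilon>) (f ` A) \<le> hausdorff_content d \<epsilon> A" if \<epsilon>: "\<epsilon> > 0" for \<epsilon>
    unfolding hausdorff_content_alt[of d \<epsilon> A]
  proof (rule INF_greatest)
    fix C :: "nat \<Rightarrow> 'a set" assume "C \<in> {C. A \<subseteq> (\<Union>i. C i) \<and> (\<forall>i. bounded (C i) \<and> diameter (C i) \<le> \<epsilon>)}"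
    then have C: "A \<subseteq> (\<Union>i. C i)" "\<And>i. bounded (C i)" "\<And>i. diameter (C i) \<le> \<epsilon>" by auto
    define C' where "C' i = f ` (C i \<inter> S)" for i :: nat
    have di: "dist u v \<le> L * diameter (C i)" if uv: "u \<in> C' i" "v \<in> C' i" for u v i
    proof -
      obtain x y where xy: "x \<in> C i \<inter> S" "y \<in> C i \<inter> S" "u = f x" "v = f y" using uv unfolding C'_def by blast
      have "dist u v \<le> L * dist x y" using f xy by auto
      also have "\<dots> \<le> L * diameter (C i)"
        using diameter_bounded_bound[OF C(2)] xy L by (intro mult_left_mono) auto
      finally show ?thesis .
    qed
    have b: "bounded (C' i)" for i unfolding bounded_two_points using di by blast
    have d: "diameter (C' i) \<le> L * diameter (C i)" for i
      using di diameter_ge_0[OF C(2)] L by (intro diameter_le) (auto simp: dist_norm)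
    have "hausdorff_content d (L * \<epsilon>) (f ` A) \<le> (\<Sum>i. content_term d (C' i))"
    proof (rule hausdorff_content_le)
      show "f ` A \<subseteq> (\<Union>i. C' i)" using C(1) A by (fastforce simp: C'_def)
      show "diameter (C' i) \<le> L * \<epsilon>" for i
        using d[of i] mult_left_mono[OF C(3)[of i], of L] L by linarith
    qed (rule b)
    then have "ennreal (1 / L ^ d) * hausdorff_content d (L * \<epsilon>) (f ` A) \<le> ennreal (1 / L ^ d) * (\<Sum>i. content_term d (C' i))"
      by (rule mult_left_mono) simp
    also have "\<dots> = (\<Sum>i. ennreal (1 / L ^ d) * content_term d (C' i))" by simp
    also have "\<dots> \<le> (\<Sum>i. content_term d (C i))"
    proof (rule suminf_le)
      fix i
      show "ennreal (1 / L ^ d) * content_term d (C' i) \<le> content_term d (C i)"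
      proof (cases "C' i = {}")
        case False
        then have ne: "C i \<noteq> {}" by (auto simp: C'_def)
        have "(1 / L ^ d) * (unit_ball_vol (real d) * (diameter (C' i) / 2) ^ d) \<le> (1 / L ^ d) * (unit_ball_vol (real d) * (L * diameter (C i) / 2) ^ d)"
          using d[of i] L diameter_ge_0[OF b[of i]]
          by (intro mult_left_mono power_mono unit_ball_vol_nonneg) auto
        also have "\<dots> = unit_ball_vol (real d) * (diameter (C i) / 2) ^ d"
          using L by (simp add: power_mult_distrib power_divide)
        finally have "ennreal ((1 / L ^ d) * (unit_ball_vol (real d) * (diameter (C' i) / 2) ^ d)) \<le> ennreal (unit_ball_vol (real d) * (diameter (C i) / 2) ^ d)"
          by (rule ennreal_leI)
        then show ?thesis using False ne L diameter_ge_0[OF b[of i]]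
          by (simp add: content_term_def ennreal_mult'[symmetric])
      qed (simp add: content_term_def)
    qed auto
    finally show "ennreal (1 / L ^ d) * hausdorff_content d (L * \<epsilon>) (f ` A) \<le> (\<Sum>i. content_term d (C i))" .
  qed
  have "ennreal (1 / L ^ d) * hausdorff_measure d (f ` A) = (SUP \<epsilon>\<in>{0<..}. ennreal (1 / L ^ d) * hausdorff_content d \<epsilon> (f ` A))"
    unfolding hausdorff_measure_def by (rule SUP_mult_left_ennreal)
  also have "\<dots> \<le> hausdorff_measure d A"
  proof (rule SUP_least)
    fix \<epsilon> :: real assume "\<epsilon> \<in> {0<..}"
    then have "\<epsilon> / L > 0" using L by simp
    then have "ennreal (1 / L ^ d) * hausdorff_content d (L * (\<epsilon> / L)) (f ` A) \<le> hausdorff_measure d A"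
      using *[of "\<epsilon> / L"] SUP_upper[of "\<epsilon> / L" "{0<..}" "\<lambda>\<epsilon>. hausdorff_content d \<epsilon> A"]
      unfolding hausdorff_measure_def by (meson greaterThan_iff order_trans)
    then show "ennreal (1 / L ^ d) * hausdorff_content d \<epsilon> (f ` A) \<le> hausdorff_measure d A" using L by simp
  qed
  finally show ?thesis .
qed

lemma hausdorff_measure_isometry:
  fixes f :: "'a::euclidean_space \<Rightarrow> 'a"
  assumes f: "\<And>x y. dist (f x) (f y) = dist x y"
  shows "hausdorff_measure d (f ` A) = hausdorff_measure d A"
proof (rule antisym)
  show "hausdorff_measure d (f ` A) \<le> hausdorff_measure d A"
    using hausdorff_measure_lipschitz[of 1 UNIV f A d] f by simp
  have inj: "inj f" by (rule injI) (metis f dist_eq_0_iff)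
  have "hausdorff_measure d (inv f ` (f ` A)) \<le> hausdorff_measure d (f ` A)"
  proof -
    have "dist (inv f x) (inv f y) \<le> 1 * dist x y" if "x \<in> range f" "y \<in> range f" for x y
      using that f inj by auto
    then show ?thesis using hausdorff_measure_lipschitz[of 1 "range f" "inv f" "f ` A" d] by auto
  qed
  then show "hausdorff_measure d A \<le> hausdorff_measure d (f ` A)" using inj by (simp add: image_image)
qed

lemma hausdorff_measure_scale:
  fixes A :: "'a::euclidean_space set"
  assumes L: "L > 0"
  shows "hausdorff_measure d ((*\<^sub>R) L ` A) = ennreal (L ^ d) * hausdorff_measure d A"
proof (rule antisym)
  have e: "ennreal (L ^ d) * ennreal (1 / L ^ d) = 1"
    using L by (simp add: ennreal_mult'[symmetric])
  have "ennreal (1 / L ^ d) * hausdorff_measure d ((*\<^sub>R) L ` A) \<le> hausdorff_measure d A"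
    using L by (intro hausdorff_measure_lipschitz[of L UNIV]) (auto simp: dist_norm scaleR_diff_right[symmetric])
  then have "ennreal (L ^ d) * (ennreal (1 / L ^ d) * hausdorff_measure d ((*\<^sub>R) L ` A)) \<le> ennreal (L ^ d) * hausdorff_measure d A"
    by (rule mult_left_mono) simp
  then show "hausdorff_measure d ((*\<^sub>R) L ` A) \<le> ennreal (L ^ d) * hausdorff_measure d A"
    by (simp add: mult.assoc[symmetric] e)
  have "ennreal (1 / (1/L) ^ d) * hausdorff_measure d ((*\<^sub>R) (1/L) ` ((*\<^sub>R) L ` A)) \<le> hausdorff_measure d ((*\<^sub>R) L ` A)"
    using L by (intro hausdorff_measure_lipschitz[of "1/L" UNIV]) (auto simp: dist_norm scaleR_diff_right[symmetric])
  then show "ennreal (L ^ d) * hausdorff_measure d A \<le> hausdorff_measure d ((*\<^sub>R) L ` A)"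
    using L by (simp add: image_image power_one_over)
qed

section \<open>Facet normals\<close>

definition supp_fun :: "'a::euclidean_space set \<Rightarrow> 'a \<Rightarrow> real" where
  "supp_fun K u = (SUP x\<in>K. u \<bullet> x)"

lemma supp_fun_upper:
  assumes "bounded K" "x \<in> K" shows "u \<bullet> x \<le> supp_fun K u"
proof -
  have "bdd_above ((\<bullet>) u ` K)"
    using bounded_linear_image[OF assms(1) bounded_linear_inner_right[of u]] by (rule bounded_imp_bdd_above)
  then show ?thesis unfolding supp_fun_def using assms(2) by (intro cSUP_upper) auto
qed

lemma supp_fun_least:
  assumes "K \<noteq> {}" "\<And>x. x \<in> K \<Longrightarrow> u \<bullet> x \<le> c" shows "supp_fun K u \<le> c"
  unfolding supp_fun_def using assms by (intro cSUP_least) auto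

lemma supp_fun_attained:
  assumes "compact K" "K \<noteq> {}"
  obtains x where "x \<in> K" "u \<bullet> x = supp_fun K u"
proof -
  obtain x where x: "x \<in> K" "\<And>y. y \<in> K \<Longrightarrow> u \<bullet> y \<le> u \<bullet> x"
    using continuous_attains_sup[OF assms linear_continuous_on[OF bounded_linear_inner_right[of u]]] by blast
  then have "u \<bullet> x = supp_fun K u"
    using supp_fun_upper[OF compact_imp_bounded[OF assms(1)] x(1)] supp_fun_least[OF assms(2) x(2)]
    by (simp add: order_antisym)
  then show ?thesis using that x by blast
qed

lemma support_face_eq:
  assumes "compact K" "K \<noteq> {}"
  shows "support_face K u = {x \<in> K. u \<bullet> x = supp_fun K u}"
proof -
  obtain x where x: "x \<in> K" "u \<bullet> x = supp_fun K u" using supp_fun_attained[OF assms] by blast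
  note up = supp_fun_upper[OF compact_imp_bounded[OF assms(1)]]
  show ?thesis
  proof (intro equalityI subsetI)
    fix y assume "y \<in> support_face K u"
    then have "y \<in> K" "u \<bullet> x \<le> u \<bullet> y" using x(1) by (auto simp: support_face_def)
    then show "y \<in> {x \<in> K. u \<bullet> x = supp_fun K u}" using up[of y u] x(2) by simp
  next
    fix y assume "y \<in> {x \<in> K. u \<bullet> x = supp_fun K u}"
    then show "y \<in> support_face K u" using up by (simp add: support_face_def)
  qed
qed

text \<open>Let \<open>y\<close> be the component of \<open>v\<close> orthogonal to
  \<open>u\<close>. Moving from \<open>a u\<close> by \<open>y\<close> stays in the first
  hyperplane, so \<open>v \<bullet> y = 0\<close>, which forces \<open>y = 0\<close>.\<close>

lemma hyperplane_unit_eq: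
  fixes u v :: "'a::euclidean_space"
  assumes u: "norm u = 1" and v: "norm v = 1" and sub: "{x. u \<bullet> x = a} \<subseteq> {x. v \<bullet> x = b}"
  shows "(v = u \<and> b = a) \<or> (v = - u \<and> b = - a)"
proof -
  have uu: "u \<bullet> u = 1" "v \<bullet> v = 1" using u v by (simp_all add: dot_square_norm)
  define y where "y = v - (u \<bullet> v) *\<^sub>R u"
  have "u \<bullet> y = 0" using uu by (simp add: y_def inner_diff_right)
  then have "u \<bullet> (a *\<^sub>R u) = a" "u \<bullet> (a *\<^sub>R u + y) = a" using uu by (simp_all add: inner_add_right)
  then have b: "v \<bullet> (a *\<^sub>R u) = b" "v \<bullet> (a *\<^sub>R u + y) = b" using sub by blast+
  then have "v \<bullet> y = 0" by (simp add: inner_add_right)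
  then have "y \<bullet> y = 0" using \<open>u \<bullet> y = 0\<close> inner_diff_left[of v "(u \<bullet> v) *\<^sub>R u" y] by (simp flip: y_def)
  then have "y = 0" by simp
  then have v': "v = (u \<bullet> v) *\<^sub>R u" by (simp add: y_def)
  have "norm v = \<bar>u \<bullet> v\<bar> * norm u" using v' norm_scaleR by metis
  then have "\<bar>u \<bullet> v\<bar> = 1" using u v by simp
  then consider "u \<bullet> v = 1" | "u \<bullet> v = - 1" by linarith
  then show ?thesis
  proof cases
    case 1
    then have "v = u" using v' by simp
    then show ?thesis using b uu by simp
  next
    case 2
    then have "v = - u" using v' by simp
    then show ?thesis using b uu by simp
  qed
qed

lemma facet_affine_hull:
  fixes P :: "'a::euclidean_space set"
  assumes full: "aff_dim P = int DIM('a)" and F: "F facet_of P" "F \<subseteq> {x. u \<bullet> x = a}" and u: "norm u = 1"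
  shows "affine hull F = {x. u \<bullet> x = a}"
proof (rule affine_dim_equal)
  show "affine hull F \<noteq> {}" using F(1) by (auto simp: facet_of_def)
  show "affine hull F \<subseteq> {x. u \<bullet> x = a}" by (intro hull_minimal F affine_hyperplane)
  have "u \<noteq> 0" using u by auto
  then have "aff_dim {x. u \<bullet> x = a} = int DIM('a) - 1" using DIM_positive[where 'a='a] by (simp add: of_nat_diff)
  then show "aff_dim (affine hull F) = aff_dim {x. u \<bullet> x = a}"
    using F(1) full by (simp add: facet_of_def aff_dim_affine_hull)
qed (auto simp: affine_hyperplane)

lemma full_dim_iff:
  fixes P :: "'a::euclidean_space set"
  assumes "interior P \<noteq> {}" shows "aff_dim P = int DIM('a)"
  using assms aff_dim_nonempty_interior by blast

text \<open>A facet spans its supporting hyperplane, which leaves only \<open>v = u\<close> or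
  \<open>v = - u\<close>; the second would squeeze \<open>P\<close> into a hyperplane. This makes
  the map from normals to facets injective and later identifies the normals of an intersection of
  half-spaces.\<close>

lemma facet_normal_unique:
  fixes P :: "'a::euclidean_space set"
  assumes P: "compact P" "interior P \<noteq> {}"
    and u: "u \<in> facet_normals P" and v: "norm v = 1" "support_face P u \<subseteq> support_face P v"
  shows "v = u"
proof -
  have ne: "P \<noteq> {}" using P(2) by auto
  have F: "support_face P u facet_of P" "norm u = 1" using u by (auto simp: facet_normals_def)
  have full: "aff_dim P = int DIM('a)" by (rule full_dim_iff[OF P(2)])
  have h1: "affine hull (support_face P u) = {x. u \<bullet> x = supp_fun P u}"
    by (rule facet_affine_hull[OF full F(1) _ F(2)]) (auto simp: support_face_eq[OF P(1) ne])
  have h2: "affine hull (support_face P u) \<subseteq> {x. v \<bullet> x = supp_fun P v}"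
    using v(2) by (intro hull_minimal affine_hyperplane) (auto simp: support_face_eq[OF P(1) ne])
  have "(v = u \<and> supp_fun P v = supp_fun P u) \<or> (v = - u \<and> supp_fun P v = - supp_fun P u)"
    using hyperplane_unit_eq[OF F(2) v(1), of "supp_fun P u" "supp_fun P v"] h1 h2 by simp
  moreover have False if "v = - u \<and> supp_fun P v = - supp_fun P u"
  proof -
    have "P \<subseteq> {x. u \<bullet> x = supp_fun P u}"
    proof
      fix x assume x: "x \<in> P"
      show "x \<in> {x. u \<bullet> x = supp_fun P u}"
      proof -
        have "v \<bullet> x = - (u \<bullet> x)" using that by simp
        then have "- (u \<bullet> x) \<le> - supp_fun P u"
          using supp_fun_upper[OF compact_imp_bounded[OF P(1)] x, of v] that by linarith
        then show ?thesis using supp_fun_upper[OF compact_imp_bounded[OF P(1)] x, of u] by simp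
      qed
    qed
    moreover have "interior {x. u \<bullet> x = supp_fun P u} = {}" using F(2) by (intro interior_hyperplane) auto
    ultimately show False using P(2) interior_mono by blast
  qed
  ultimately show ?thesis by blast
qed

lemma finite_facet_normals:
  fixes P :: "'a::euclidean_space set"
  assumes P: "polytope P" "interior P \<noteq> {}"
  shows "finite (facet_normals P)"
proof (rule inj_on_finite)
  have c: "compact P" using P(1) by (rule polytope_imp_compact)
  show "inj_on (support_face P) (facet_normals P)"
  proof (rule inj_onI)
    fix u v assume uv: "u \<in> facet_normals P" "v \<in> facet_normals P" "support_face P u = support_face P v"
    have "norm v = 1" using uv(2) by (simp add: facet_normals_def)
    then show "u = v" using facet_normal_unique[OF c P(2) uv(1) _ equalityD1[OF uv(3)]] by simp
  qed
  show "support_face P ` facet_normals P \<subseteq> {F. F facet_of P}" by (auto simp: facet_normals_def)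
  show "finite {F. F facet_of P}" using P(1) by (rule finite_polytope_facets)
qed

text \<open>The segment from an interior point to \<open>y\<close> leaves \<open>P\<close> through a
  facet. Its functional is below the maximum at the interior point and reaches it at the exit point,
  so by linearity it exceeds it at \<open>y\<close>.\<close>

lemma facet_normal_separates:
  fixes P :: "'a::euclidean_space set"
  assumes P: "polytope P" "interior P \<noteq> {}" and y: "y \<notin> P"
  obtains u where "u \<in> facet_normals P" "supp_fun P u < u \<bullet> y"
proof -
  have c: "compact P" "convex P" using P(1) polytope_imp_compact polytope_imp_convex by auto
  have ne: "P \<noteq> {}" using P(2) by auto
  obtain a where a: "a \<in> interior P" using P(2) by blast
  have full: "aff_dim P = int DIM('a)" by (rule full_dim_iff[OF P(2)])
  have aP: "a \<in> P" using a interior_subset by blast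
  have "closed_segment a y \<inter> frontier P \<noteq> {}"
  proof (rule connected_Int_frontier)
    show "closed_segment a y \<inter> P \<noteq> {}" using aP ends_in_segment(1)[of a y] by blast
    show "closed_segment a y - P \<noteq> {}" using y ends_in_segment(2)[of a y] by blast
  qed simp
  then obtain p where p: "p \<in> closed_segment a y" "p \<in> frontier P" by blast
  have "rel_frontier P = frontier P"
    using full by (simp add: rel_frontier_def frontier_def rel_interior_interior affine_hull_UNIV aff_dim_eq_full)
  then have "p \<in> \<Union>{F. F facet_of P}"
    using rel_frontier_of_polyhedron[OF polytope_imp_polyhedron[OF P(1)]] p(2) by simp
  then obtain F where F: "F facet_of P" "p \<in> F" by blast
  obtain n b where nb: "n \<noteq> 0" "P \<subseteq> {x. n \<bullet> x \<le> b}" "F = P \<inter> {x. n \<bullet> x = b}"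
    using facet_of_polyhedron[OF polytope_imp_polyhedron[OF P(1)] F(1)] by metis
  define u where "u = (1 / norm n) *\<^sub>R n"
  have un: "norm u = 1" using nb(1) by (simp add: u_def)
  have ux: "u \<bullet> x = (n \<bullet> x) / norm n" for x by (simp add: u_def)
  have h: "supp_fun P u = b / norm n"
  proof (rule antisym)
    show "supp_fun P u \<le> b / norm n"
      using nb ne by (intro supp_fun_least) (auto simp: ux divide_right_mono)
    have "p \<in> P" "n \<bullet> p = b" using F(2) nb(3) by auto
    then show "b / norm n \<le> supp_fun P u"
      using supp_fun_upper[OF compact_imp_bounded[OF c(1)], of p u] by (simp add: ux)
  qed
  have "support_face P u = F"
    unfolding support_face_eq[OF c(1) ne] h using nb by (auto simp: ux)
  then have uN: "u \<in> facet_normals P" using un full F(1) by (simp add: facet_normals_def)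
  have ua: "n \<bullet> a < b"
  proof -
    have "a \<in> interior {x. n \<bullet> x \<le> b}" using a nb(2) interior_mono by blast
    then show ?thesis using nb(1) by (simp add: interior_halfspace_le)
  qed
  have np: "n \<bullet> p = b" "p \<in> P" using F(2) nb(3) by auto
  obtain t where t: "0 \<le> t" "t \<le> 1" "p = (1 - t) *\<^sub>R a + t *\<^sub>R y"
    using p(1) by (auto simp: in_segment)
  have eq: "b = (1 - t) * (n \<bullet> a) + t * (n \<bullet> y)" using np(1) t(3) by (simp add: inner_add_right)
  have "t \<noteq> 1" using t(3) np(2) y by auto
  have "n \<bullet> y > b"
  proof (rule ccontr)
    assume "\<not> n \<bullet> y > b"
    then have "t * (n \<bullet> y) \<le> t * b" using t by (intro mult_left_mono) auto
    moreover have "(1 - t) * (n \<bullet> a) < (1 - t) * b" using t \<open>t \<noteq> 1\<close> ua by (intro mult_strict_left_mono) auto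
    ultimately show False using eq by (simp add: algebra_simps)
  qed
  then have "supp_fun P u < u \<bullet> y" unfolding h ux using nb(1) by (simp add: divide_strict_right_mono)
  then show ?thesis using that uN by blast
qed

lemma facet_normal_face:
  assumes "compact P" "P \<noteq> {}" "u \<in> facet_normals P"
  shows "norm u = 1" "support_face P u \<noteq> {}" "compact (support_face P u)"
    "convex P \<Longrightarrow> convex (support_face P u)" "support_face P u \<subseteq> P" "support_face P u \<subseteq> {x. u \<bullet> x = supp_fun P u}"
proof -
  have eq: "support_face P u = P \<inter> {x. u \<bullet> x = supp_fun P u}" using support_face_eq[OF assms(1,2)] by auto
  show "norm u = 1" "support_face P u \<noteq> {}" using assms(3) by (auto simp: facet_normals_def facet_of_def)
  show "compact (support_face P u)" unfolding eq using assms(1) closed_hyperplane by (rule compact_Int_closed)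
  show "convex (support_face P u)" if "convex P" unfolding eq using that convex_hyperplane by (rule convex_Int)
  show "support_face P u \<subseteq> P" "support_face P u \<subseteq> {x. u \<bullet> x = supp_fun P u}" unfolding eq by auto
qed

section \<open>Volumes of linear images and of swept sets\<close>

text \<open>With \<open>d\<close> for \<open>card D\<close>, the \<open>N ^ d\<close> subcubes have
  diameter at most \<open>d / N\<close>; the powers of \<open>N\<close> cancel, so the same bound
  holds at every mesh. Finiteness is what is wanted here: the value itself later becomes the common
  factor \<kappa>.\<close>

lemma hausdorff_measure_unit_cell:
  fixes D :: "'a::euclidean_space set"
  assumes D: "D \<subseteq> Basis"
  shows "hausdorff_measure (card D) (unit_cell D) < top"
proof -
  let ?d = "card D"
  have fin: "finite D" using D finite_Basis finite_subset by blast
  have "hausdorff_measure ?d (unit_cell D) \<le> ennreal (unit_ball_vol (real ?d) * (real ?d / 2) ^ ?d)"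
  proof (rule hausdorff_measure_leI)
    fix \<epsilon> :: real assume \<epsilon>: "\<epsilon> > 0"
    define N where "N = nat \<lceil>real ?d / \<epsilon>\<rceil> + 1"
    have N: "N > 0" by (simp add: N_def)
    have "real ?d / \<epsilon> \<le> real N" unfolding N_def using of_nat_ceiling[of "real ?d / \<epsilon>"] by linarith
    then have Nd: "real ?d / real N \<le> \<epsilon>" using \<epsilon> N by (simp add: field_simps)
    define J where "J = D \<rightarrow>\<^sub>E {..<N}"
    define C where "C f = cell D (\<Sum>b\<in>D. (real (f b) / real N) *\<^sub>R b) (1 / real N)" for f :: "'a \<Rightarrow> nat"
    have Cb: "(\<Sum>b\<in>D. (real (f b) / real N) *\<^sub>R b) \<bullet> b = real (f b) / real N" if "b \<in> D" for f :: "'a \<Rightarrow> nat" and b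
      using that D by (auto simp: sum_Basis_inner[OF D] subset_iff)
    have "hausdorff_content ?d (real ?d / real N) (unit_cell D)
        \<le> ennreal (real (card J) * (unit_ball_vol (real ?d) * (real ?d / real N / 2) ^ ?d))"
    proof (rule hausdorff_content_finite_cover)
      show "finite J" unfolding J_def using fin by (intro finite_PiE) auto
      show "unit_cell D \<subseteq> (\<Union>f\<in>J. C f)"
      proof
        fix x assume x: "x \<in> unit_cell D"
        define f where "f = (\<lambda>b\<in>D. nat \<lfloor>real N * (x \<bullet> b)\<rfloor>)"
        have f: "real (f b) \<le> real N * (x \<bullet> b) \<and> real N * (x \<bullet> b) < real (f b) + 1 \<and> f b < N" if b: "b \<in> D" for b
        proof -
          have xb: "0 \<le> x \<bullet> b" "x \<bullet> b < 1" using x b by (auto simp: unit_cell_def)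
          have "real N * (x \<bullet> b) < real N * 1" using xb N by (intro mult_strict_left_mono) auto
          then have *: "real N * (x \<bullet> b) < real N" by simp
          have "0 \<le> real N * (x \<bullet> b)" using xb by simp
          then have "real (f b) = of_int \<lfloor>real N * (x \<bullet> b)\<rfloor>" using b by (simp add: f_def)
          then have 1: "real (f b) \<le> real N * (x \<bullet> b)" "real N * (x \<bullet> b) < real (f b) + 1" by linarith+
          then have "real (f b) < real N" using * by linarith
          then show ?thesis using 1 by simp
        qed
        have "f \<in> J" using f unfolding J_def by (auto simp: f_def)
        moreover have "x \<in> C f"
          using x f N by (auto simp: C_def cell_def unit_cell_def Cb field_simps)
        ultimately show "x \<in> (\<Union>f\<in>J. C f)" by blast
      qed
      fix f assume "f \<in> J"
      have "norm (x - y) \<le> real ?d / real N" if xy: "x \<in> C f" "y \<in> C f" for x y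
      proof -
        have "norm (x - y) \<le> (\<Sum>b\<in>Basis. \<bar>(x - y) \<bullet> b\<bar>)" by (rule norm_le_l1)
        also have "\<dots> \<le> (\<Sum>b\<in>Basis. if b \<in> D then 1 / real N else 0)"
        proof (rule sum_mono)
          fix b :: 'a assume b: "b \<in> Basis"
          show "\<bar>(x - y) \<bullet> b\<bar> \<le> (if b \<in> D then 1 / real N else 0)"
          proof (cases "b \<in> D")
            case True
            then have "real (f b) / real N \<le> x \<bullet> b" "x \<bullet> b < real (f b) / real N + 1 / real N"
              "real (f b) / real N \<le> y \<bullet> b" "y \<bullet> b < real (f b) / real N + 1 / real N"
              using xy by (auto simp: C_def cell_def Cb)
            then have "\<bar>x \<bullet> b - y \<bullet> b\<bar> \<le> 1 / real N" by linarith
            then show ?thesis using True by (simp add: inner_diff_left)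
          next
            case False
            then show ?thesis using xy b by (simp add: C_def cell_def coord_space_def inner_diff_left)
          qed
        qed
        also have "\<dots> = real ?d / real N" using D by (simp add: sum.If_cases Int_absorb1)
        finally show ?thesis .
      qed
      then show "bounded (C f) \<and> diameter (C f) \<le> real ?d / real N"
        using bounded_cell[OF D] unfolding C_def by (auto intro!: diameter_le)
    qed simp
    also have "real (card J) = real N ^ ?d" using fin by (simp add: J_def card_PiE)
    also have "real N ^ ?d * (unit_ball_vol (real ?d) * (real ?d / real N / 2) ^ ?d) = unit_ball_vol (real ?d) * (real ?d / 2) ^ ?d"
      using N by (simp add: power_divide)
    finally show "\<exists>\<delta>\<le>\<epsilon>. hausdorff_content ?d \<delta> (unit_cell D) \<le> ennreal (unit_ball_vol (real ?d) * (real ?d / 2) ^ ?d)"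
      using Nd by blast
  qed
  then show ?thesis using ennreal_less_top order_le_less_trans by blast
qed

lemma hausdorff_measure_bounded:
  fixes D :: "'a::euclidean_space set"
  assumes D: "D \<subseteq> Basis" and B: "bounded B" "B \<subseteq> coord_space D"
  shows "hausdorff_measure (card D) B < top"
proof -
  obtain r where r: "\<And>x. x \<in> B \<Longrightarrow> norm x \<le> r" using B(1) bounded_iff by metis
  define R where "R = nat \<lceil>\<bar>r\<bar>\<rceil> + 1"
  have R: "r < real R" "R > 0" unfolding R_def by linarith+
  define a where "a = (\<Sum>b\<in>D. (- real R) *\<^sub>R b)"
  have aV: "a \<in> coord_space D" using D by (auto simp: a_def coord_space_def sum_Basis_inner simp del: scaleR_minus_left)
  have ab: "a \<bullet> b = - real R" if "b \<in> D" for b using that D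
    by (auto simp: a_def sum_Basis_inner[OF D] subset_iff simp del: scaleR_minus_left)
  have "B \<subseteq> cell D a (2 * real R)"
  proof
    fix x assume x: "x \<in> B"
    have "- real R \<le> x \<bullet> b \<and> x \<bullet> b < real R" if "b \<in> D" for b
      using Basis_le_norm[of b x] that D r[OF x] R by (force simp: subset_iff)
    then show "x \<in> cell D a (2 * real R)" using x B(2) by (auto simp: cell_def ab)
  qed
  also have "cell D a (2 * real R) = (+) a ` (*\<^sub>R) (2 * real R) ` unit_cell D"
    using cell_translate[OF aV, of 0 "2 * real R"] cell_scale[of "2 * real R" D 0 1] R by (simp add: unit_cell_eq)
  finally have "hausdorff_measure (card D) B \<le> hausdorff_measure (card D) ((+) a ` (*\<^sub>R) (2 * real R) ` unit_cell D)"
    by (rule hausdorff_measure_mono)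
  also have "\<dots> = hausdorff_measure (card D) ((*\<^sub>R) (2 * real R) ` unit_cell D)"
    by (rule hausdorff_measure_isometry) (simp add: dist_norm)
  also have "\<dots> = ennreal ((2 * real R) ^ card D) * hausdorff_measure (card D) (unit_cell D)"
    using R by (intro hausdorff_measure_scale) auto
  also have "\<dots> < top" using hausdorff_measure_unit_cell[OF D] by (simp add: ennreal_mult_less_top)
  finally show ?thesis .
qed

lemma prism_volume_hausdorff:
  fixes D :: "'a::euclidean_space set"
  assumes D: "D \<subseteq> Basis"
  shows "prism_volume D (\<lambda>A. enn2real (hausdorff_measure (card D) A))"
proof
  note fin = hausdorff_measure_bounded[OF D]
  show "D \<subseteq> Basis" by (rule D)
  show "0 \<le> enn2real (hausdorff_measure (card D) A)" for A :: "'a set" by simp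
  show "enn2real (hausdorff_measure (card D) ({} :: 'a set)) = 0" by (simp add: hausdorff_measure_empty)
  show "enn2real (hausdorff_measure (card D) A) \<le> enn2real (hausdorff_measure (card D) B)"
    if "A \<subseteq> B" "B \<subseteq> coord_space D" "bounded B" for A B
    using that fin[of B] by (intro enn2real_mono hausdorff_measure_mono) auto
  show "enn2real (hausdorff_measure (card D) (A \<union> B)) \<le> enn2real (hausdorff_measure (card D) A) + enn2real (hausdorff_measure (card D) B)"
    if "A \<subseteq> coord_space D" "B \<subseteq> coord_space D" "bounded A" "bounded B" for A B
  proof -
    have "enn2real (hausdorff_measure (card D) (A \<union> B)) \<le> enn2real (hausdorff_measure (card D) A + hausdorff_measure (card D) B)"
      using fin[of A] fin[of B] that by (intro enn2real_mono hausdorff_measure_Un) auto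
    then show ?thesis using fin[of A] fin[of B] that by (simp add: enn2real_plus)
  qed
  show "enn2real (hausdorff_measure (card D) ((+) t ` A)) = enn2real (hausdorff_measure (card D) A)" for A and t :: 'a
    by (subst hausdorff_measure_isometry) (simp_all add: dist_norm)
  show "enn2real (hausdorff_measure (card D) ((*\<^sub>R) (real N) ` A)) = real N ^ card D * enn2real (hausdorff_measure (card D) A)"
    if "N > 0" for A :: "'a set" and N
    using that by (subst hausdorff_measure_scale) (simp_all add: enn2real_mult)
qed

lemma hausdorff_measure_convex:
  fixes D :: "'a::euclidean_space set"
  assumes D: "D \<subseteq> Basis" and F: "F \<subseteq> coord_space D" "compact F" "convex F"
  shows "hausdorff_measure (card D) F
    = ennreal (enn2real (hausdorff_measure (card D) (unit_cell D)) * measure lebesgue (coord_prism D F))"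
proof -
  interpret prism_volume D "\<lambda>A. enn2real (hausdorff_measure (card D) A)"
    by (rule prism_volume_hausdorff[OF D])
  have "hausdorff_measure (card D) F < top"
    using hausdorff_measure_bounded[OF D compact_imp_bounded[OF F(2)] F(1)] .
  then show ?thesis using convex_eq[OF F] by (metis ennreal_enn2real)
qed

lemma borel_linear_image:
  fixes f :: "'a::euclidean_space \<Rightarrow> 'a"
  assumes f: "linear f" "inj f" and A: "A \<in> sets borel"
  shows "f ` A \<in> sets borel"
proof -
  obtain g where g: "linear g" "\<And>x. g (f x) = x" "\<And>x. f (g x) = x"
    using linear_injective_isomorphism[OF f] by blast
  have "f ` A = g -` A"
  proof (intro equalityI subsetI)
    fix x assume "x \<in> g -` A"
    then show "x \<in> f ` A" using g(3) by (intro image_eqI[of _ _ "g x"]) auto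
  qed (auto simp: g(2))
  moreover have "g \<in> borel_measurable borel"
    using g(1) by (intro borel_measurable_continuous_onI linear_continuous_on) (simp add: linear_conv_bounded_linear)
  ultimately show ?thesis using A measurable_sets_borel by metis
qed

text \<open>
  The library computes the volume of linear images only for Cartesian spaces with a well-ordered
  index type.
\<close>

lemma measure_linear_convex:
  fixes f :: "'a::euclidean_space \<Rightarrow> 'a"
  assumes lin: "linear f" and inj: "inj f" and F: "compact F" "convex F"
  shows "measure lebesgue (f ` F) = measure lebesgue (f ` unit_cell Basis) * measure lebesgue F"
proof -
  have meas: "f ` A \<in> lmeasurable" if "bounded A" "A \<in> sets borel" for A
    using bounded_linear_image[OF that(1)] borel_linear_image[OF lin inj that(2)] lin
    by (intro bounded_set_imp_lmeasurable) (auto simp: linear_conv_bounded_linear)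
  interpret prism_volume Basis "\<lambda>A. measure lebesgue (f ` A)"
  proof
    show "measure lebesgue (f ` A) \<le> measure lebesgue (f ` B)"
      if "A \<subseteq> B" "bounded B" "A \<in> sets borel" "B \<in> sets borel" for A B
      using meas[of B] meas[of A] that bounded_subset
      by (intro measure_mono_fmeasurable) (auto dest: fmeasurableD)
    show "measure lebesgue (f ` (A \<union> B)) \<le> measure lebesgue (f ` A) + measure lebesgue (f ` B)"
      if "bounded A" "bounded B" "A \<in> sets borel" "B \<in> sets borel" for A B
      using meas[of B] meas[of A] that unfolding image_Un by (intro measure_Un_le) (auto dest: fmeasurableD)
    show "measure lebesgue (f ` (+) t ` A) = measure lebesgue (f ` A)" for A t
    proof -
      have "f ` (+) t ` A = (+) (f t) ` f ` A" by (auto simp: image_image linear_add[OF lin])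
      then show ?thesis by (simp add: measure_translation)
    qed
    show "measure lebesgue (f ` (*\<^sub>R) (real N) ` A) = real N ^ card (Basis::'a set) * measure lebesgue (f ` A)" for A N
    proof -
      have "f ` (*\<^sub>R) (real N) ` A = (*\<^sub>R) (real N) ` f ` A" by (auto simp: image_image linear_scale[OF lin])
      then show ?thesis using measure_lebesgue_affine[of "real N" 0 "f ` A"] by (simp add: image_image)
    qed
  qed auto
  have "coord_space (Basis::'a set) = UNIV" by (simp add: coord_space_def)
  moreover have "coord_prism (Basis::'a set) F = F"
    by (simp add: coord_prism_def coord_proj_def euclidean_representation)
  ultimately show ?thesis using convex_eq[OF _ F] by simp
qed

text \<open>A linear map multiplies all volumes of compact convex sets by one factor, and an
  orthogonal map fixes the unit ball, so the factor is 1.\<close>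

lemma measure_orthogonal_convex:
  fixes f :: "'a::euclidean_space \<Rightarrow> 'a"
  assumes f: "orthogonal_transformation f" and F: "compact F" "convex F"
  shows "measure lebesgue (f ` F) = measure lebesgue F"
proof -
  have lin: "linear f" using f by (rule orthogonal_transformation_linear)
  note m = measure_linear_convex[OF lin orthogonal_transformation_inj[OF f]]
  have "f ` cball 0 1 = cball 0 1"
    using image_orthogonal_transformation_cball[OF f, of 0 1] linear_0[OF lin] by simp
  then have "measure lebesgue (cball (0::'a) 1) = measure lebesgue (f ` unit_cell Basis) * measure lebesgue (cball (0::'a) 1)"
    using m[of "cball 0 1"] by simp
  then show ?thesis using m[OF F] content_cball_pos[of 1 "0::'a"] by simp
qed

text \<open>
  The shears along \<open>v\<close> and \<open>- v\<close> are mutually inverse and conjugate under the reflection in the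
  hyperplane orthogonal to \<open>e\<close>, so both have volume factor 1.
\<close>

lemma measure_shear_convex:
  fixes e v :: "'a::euclidean_space"
  assumes e: "e \<in> Basis" and v: "v \<bullet> e = 0" and F: "compact F" "convex F"
  shows "measure lebesgue ((\<lambda>x. x + (x \<bullet> e) *\<^sub>R v) ` F) = measure lebesgue F"
proof -
  define s where "s v x = x + (x \<bullet> e) *\<^sub>R v" for v x :: 'a
  define r where "r x = x - (2 * (x \<bullet> e)) *\<^sub>R e" for x :: 'a
  define c where "c f = measure lebesgue (f ` unit_cell Basis)" for f :: "'a \<Rightarrow> 'a"
  have lin: "linear (s v)" "linear r" for v
    by (rule linearI; simp add: s_def r_def inner_add_left algebra_simps)+
  have ss: "s (- v) (s v x) = x" "s v (s (- v) x) = x" for x using v by (simp_all add: s_def inner_add_left inner_diff_left)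
  have rr: "r (r x) = x" for x using e by (simp add: r_def inner_diff_left algebra_simps)
  have rsr: "s (- v) x = r (s v (r x))" for x using e v
    by (simp add: s_def r_def inner_diff_left inner_add_left algebra_simps)
  have inj: "inj (s v)" "inj (s (- v))" "inj r" using ss rr by (metis injI)+
  have m: "measure lebesgue (f ` S) = c f * measure lebesgue S" if "f \<in> {s v, s (- v), r}" "compact S" "convex S" for f S
    unfolding c_def using that lin inj by (intro measure_linear_convex) auto
  have cc: "compact (f ` S) \<and> convex (f ` S)" if "f \<in> {s v, s (- v), r}" "compact S" "convex S" for f S
  proof -
    have "linear f" using that(1) lin by blast
    then show ?thesis using that(2,3)
      by (intro conjI compact_continuous_image linear_continuous_on convex_linear_image) (simp add: linear_conv_bounded_linear)
  qed
  let ?C = "cball (0::'a) 1"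
  have C: "measure lebesgue ?C > 0" using content_cball_pos[of 1 "0::'a"] by simp
  have "r ` r ` ?C = ?C" by (simp add: image_image rr)
  then have "c r * (c r * measure lebesgue ?C) = measure lebesgue ?C" using m[of r ?C] m[of r "r ` ?C"] cc[of r ?C] by simp
  then have r1: "c r * c r = 1" using C by simp
  have "s (- v) ` s v ` ?C = ?C" by (simp add: image_image ss)
  then have "c (s (- v)) * (c (s v) * measure lebesgue ?C) = measure lebesgue ?C"
    using m[of "s v" ?C] m[of "s (- v)" "s v ` ?C"] cc[of "s v" ?C] by simp
  then have s1: "c (s (- v)) * c (s v) = 1" using C by simp
  have "s (- v) ` ?C = r ` s v ` r ` ?C" by (simp add: image_image rsr)
  then have "c (s (- v)) * measure lebesgue ?C = c r * (c (s v) * (c r * measure lebesgue ?C))"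
    using m[of "s (- v)" ?C] m[of r ?C] m[of "s v" "r ` ?C"] m[of r "s v ` r ` ?C"] cc[of r ?C] cc[of "s v" "r ` ?C"] by simp
  then have "c (s (- v)) = (c r * c r) * c (s v)" using C by simp
  then have "c (s v) * c (s v) = 1" using s1 r1 by simp
  moreover have "c (s v) \<ge> 0" by (simp add: c_def)
  ultimately have "c (s v) = 1" by (simp add: square_eq_1_iff)
  then show ?thesis using m[of "s v" F] F by (simp add: s_def[abs_def])
qed

text \<open>The volume factor is read off from the unit cube, which becomes a box with one edge of
  length \<open>h\<close>.\<close>

lemma measure_stretch_convex:
  fixes e :: "'a::euclidean_space"
  assumes e: "e \<in> Basis" and h: "h > 0" and F: "compact F" "convex F"
  shows "measure lebesgue ((\<lambda>x. x + ((h - 1) * (x \<bullet> e)) *\<^sub>R e) ` F) = h * measure lebesgue F"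
proof -
  define f where "f x = x + ((h - 1) * (x \<bullet> e)) *\<^sub>R e" for x :: 'a
  have lin: "linear f" by (rule linearI) (simp_all add: f_def inner_add_left algebra_simps)
  have fb: "f x \<bullet> b = (if b = e then h * (x \<bullet> e) else x \<bullet> b)" if "b \<in> Basis" for x b
    using that e by (simp add: f_def inner_add_left inner_Basis algebra_simps)
  have inj: "inj f"
  proof (rule injI)
    fix x y assume "f x = f y"
    then have "x \<bullet> b = y \<bullet> b" if "b \<in> Basis" for b using fb[OF that] h by (metis mult_left_cancel less_irrefl)
    then show "x = y" by (rule euclidean_eqI)
  qed
  note m = measure_linear_convex[OF lin inj]
  define u where "u = (\<Sum>b\<in>Basis. (if b = e then h else 1) *\<^sub>R b)"
  have u: "u \<bullet> b = (if b = e then h else 1)" if "b \<in> Basis" for b unfolding u_def by (subst sum_Basis_inner; use that in simp)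
  have "f ` cbox 0 One = cbox 0 u"
  proof (intro equalityI subsetI)
    fix x assume x: "x \<in> cbox 0 u"
    define y where "y = x + ((1 / h - 1) * (x \<bullet> e)) *\<^sub>R e"
    have yb: "y \<bullet> b = (if b = e then (x \<bullet> e) / h else x \<bullet> b)" if "b \<in> Basis" for b
      using that e by (simp add: y_def inner_add_left inner_Basis algebra_simps)
    have "f y = x"
    proof (rule euclidean_eqI)
      show "f y \<bullet> b = x \<bullet> b" if "b \<in> Basis" for b using that e h by (simp add: fb yb)
    qed
    moreover have "y \<in> cbox 0 One" using x h unfolding cbox_def by (auto simp: yb u e)
    ultimately show "x \<in> f ` cbox 0 One" by blast
  next
    fix y assume "y \<in> f ` cbox 0 One"
    then obtain x where x: "x \<in> cbox 0 One" "y = f x" by blast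
    then show "y \<in> cbox 0 u" using h e unfolding cbox_def by (auto simp: fb u mult_left_le)
  qed
  moreover have "measure lebesgue (cbox 0 u) = h"
  proof -
    have "measure lebesgue (cbox 0 u) = (\<Prod>b\<in>Basis. u \<bullet> b)" using h by (simp add: measure_lborel_cbox_eq u)
    also have "\<dots> = (\<Prod>b\<in>Basis. if b = e then h else 1)" by (intro prod.cong refl u)
    finally show ?thesis using e by simp
  qed
  moreover have "measure lebesgue (cbox 0 (One::'a)) = 1" by (simp add: measure_lborel_cbox_eq)
  ultimately have "h = measure lebesgue (f ` unit_cell Basis)" using m[of "cbox 0 One"] by simp
  then show ?thesis using m[OF F] by (simp add: f_def[abs_def])
qed

text \<open>The Minkowski sum of \<open>F\<close> with the segment from 0 to \<open>w\<close>. For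
  \<open>F\<close> in a hyperplane with unit normal \<open>u\<close> it is an oblique prism of
  height \<open>u \<bullet> w\<close>, whose volume stands in for the area of
  \<open>F\<close>.\<close>

definition sweep :: "'a::euclidean_space set \<Rightarrow> 'a \<Rightarrow> 'a set" where
  "sweep F w = {x + t *\<^sub>R w |x t. x \<in> F \<and> 0 \<le> t \<and> t \<le> 1}"

lemma sweep_image: "sweep F w = (\<lambda>p. fst p + snd p *\<^sub>R w) ` (F \<times> {0..1})"
  by (force simp: sweep_def)

lemma compact_sweep: "compact F \<Longrightarrow> compact (sweep F w)"
  unfolding sweep_image
  by (intro compact_continuous_image compact_Times continuous_intros compact_Icc)

lemma convex_sweep: "convex F \<Longrightarrow> convex (sweep F w)"
  unfolding sweep_image
  by (intro convex_linear_image convex_Times convex_closed_interval linearI)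
    (auto simp: algebra_simps convex_real_interval)

lemma sweep_translate: "sweep ((+) a ` F) w = (+) a ` sweep F w"
  unfolding sweep_image image_image by (force simp: image_iff algebra_simps)

lemma sweep_linear: "linear f \<Longrightarrow> sweep (f ` F) (f w) = f ` sweep F w"
  unfolding sweep_def by (fastforce simp: linear_add linear_scale image_iff)

lemma coord_space_hyperplane:
  "e \<in> Basis \<Longrightarrow> coord_space (Basis - {e}) = {x. x \<bullet> e = 0}"
  unfolding coord_space_def by auto

text \<open>The oblique prism arises from the upright unit prism by a stretch along \<open>e\<close>
  and a shear taking \<open>(w \<bullet> e) e\<close> to \<open>w\<close>. Both maps fix the
  hyperplane that contains \<open>F\<close>; only the stretch changes volume.\<close>

lemma measure_sweep_coord:
  fixes e :: "'a::euclidean_space"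
  assumes e: "e \<in> Basis" and w: "w \<bullet> e > 0"
    and F: "F \<subseteq> coord_space (Basis - {e})" "compact F" "convex F"
  shows "measure lebesgue (sweep F w) = (w \<bullet> e) * measure lebesgue (coord_prism (Basis - {e}) F)"
proof -
  let ?h = "w \<bullet> e"
  define v where "v = (1 / ?h) *\<^sub>R (w - ?h *\<^sub>R e)"
  define s where "s x = x + (x \<bullet> e) *\<^sub>R v" for x
  define d where "d x = x + ((?h - 1) * (x \<bullet> e)) *\<^sub>R e" for x
  have lin: "linear s" "linear d"
    by (rule linearI; simp add: s_def d_def inner_add_left algebra_simps)+
  have Fe: "x \<bullet> e = 0" if "x \<in> F" for x using that F(1) coord_space_hyperplane[OF e] by blast
  have "s ` F = id ` F" "d ` F = id ` F" by (rule image_cong; simp add: s_def d_def Fe)+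
  moreover have "s (?h *\<^sub>R e) = w" "d e = ?h *\<^sub>R e" using e w by (simp_all add: s_def d_def v_def algebra_simps)
  ultimately have "sweep F w = s ` sweep F (?h *\<^sub>R e)" "sweep F (?h *\<^sub>R e) = d ` sweep F e"
    using sweep_linear[OF lin(1), of F "?h *\<^sub>R e"] sweep_linear[OF lin(2), of F e] by simp_all
  moreover have "measure lebesgue (s ` sweep F (?h *\<^sub>R e)) = measure lebesgue (sweep F (?h *\<^sub>R e))"
    unfolding s_def using e w F by (intro measure_shear_convex compact_sweep convex_sweep) (simp_all add: v_def inner_diff_left)
  moreover have "measure lebesgue (d ` sweep F e) = ?h * measure lebesgue (sweep F e)"
    unfolding d_def using e w F by (intro measure_stretch_convex compact_sweep convex_sweep)
  moreover have "sweep F e = coord_prism (Basis - {e}) F"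
  proof -
    have dec: "x = coord_proj (Basis - {e}) x + (x \<bullet> e) *\<^sub>R e" for x
    proof -
      have "Basis - (Basis - {e}) = {e}" using e by blast
      then show ?thesis using coord_decomp[of "Basis - {e}" x] by (simp add: coord_proj_def)
    qed
    have B: "Basis - (Basis - {e}) = {e}" using e by blast
    show ?thesis
    proof (intro equalityI subsetI)
      fix x assume "x \<in> sweep F e"
      then obtain a t where x: "x = a + t *\<^sub>R e" "a \<in> F" "0 \<le> t" "t \<le> 1" by (auto simp: sweep_def)
      have "x \<bullet> e = t" using e Fe[OF x(2)] by (simp add: x(1) inner_add_left)
      moreover from this have "coord_proj (Basis - {e}) x = a" using dec[of x] x(1) by simp
      ultimately show "x \<in> coord_prism (Basis - {e}) F" using x by (simp add: coord_prism_def B)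
    next
      fix x assume "x \<in> coord_prism (Basis - {e}) F"
      then have "coord_proj (Basis - {e}) x \<in> F" "0 \<le> x \<bullet> e" "x \<bullet> e \<le> 1" by (auto simp: coord_prism_def B)
      then show "x \<in> sweep F e" unfolding sweep_def using dec[of x] by blast
    qed
  qed
  ultimately show ?thesis by simp
qed

section \<open>The Minkowski relation for facet areas\<close>

text \<open>An orthogonal map taking a basis vector to \<open>u\<close>, followed by a translation,
  reduces the claim to a coordinate hyperplane, where both sides are \<kappa> times the volume of a
  unit prism times \<open>u \<bullet> w\<close>. The constant \<kappa> is the Hausdorff measure of a
  unit cell and is the same for all hyperplanes, so the identities for different facets can be
  added.\<close>

lemma hausdorff_measure_sweep:
  obtains \<kappa> :: real where "\<kappa> \<ge> 0"
    "\<And>F u b w. norm u = 1 \<Longrightarrow> u \<bullet> w > 0 \<Longrightarrow> compact F \<Longrightarrow> convex F \<Longrightarrow> F \<subseteq> {x::real^'n. u \<bullet> x = b} \<Longrightarrow>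
       hausdorff_measure (CARD('n) - 1) F < top \<and>
       enn2real (hausdorff_measure (CARD('n) - 1) F) * (u \<bullet> w) = \<kappa> * measure lebesgue (sweep F w)"
proof -
  obtain e :: "real^'n" where e: "e \<in> Basis" using nonempty_Basis by blast
  let ?D = "Basis - {e}"
  have cD: "card ?D = CARD('n) - 1" using e by (simp add: card_Diff_singleton)
  define \<kappa> where "\<kappa> = enn2real (hausdorff_measure (CARD('n) - 1) (unit_cell ?D))"
  show ?thesis
  proof (rule that[of \<kappa>])
    show "\<kappa> \<ge> 0" by (simp add: \<kappa>_def)
    fix F and u w :: "real^'n" and b :: real
    assume u: "norm u = 1" and w: "u \<bullet> w > 0" and F: "compact F" "convex F" "F \<subseteq> {x. u \<bullet> x = b}"
    obtain f where f: "orthogonal_transformation f" "f e = u"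
      using orthogonal_transformation_exists_1[of e u] u e by auto
    have lin: "linear f" using f(1) by (rule orthogonal_transformation_linear)
    define g where "g = inv f"
    have fg: "f (g x) = x" for x
      using orthogonal_transformation_bij[OF f(1)] by (simp add: g_def bij_is_surj surj_f_inv_f)
    have g: "orthogonal_transformation g" unfolding g_def by (rule orthogonal_transformation_inv[OF f(1)])
    have ling: "linear g" using g by (rule orthogonal_transformation_linear)
    have ge: "g x \<bullet> e = u \<bullet> x" for x
    proof -
      have "f (g x) \<bullet> f e = g x \<bullet> e" using f(1) by (simp add: orthogonal_transformation_def)
      then show ?thesis by (simp add: fg f inner_commute)
    qed
    define F' where "F' = (+) (- b *\<^sub>R e) ` g ` F"
    have F'1: "F' \<subseteq> coord_space ?D"
      unfolding coord_space_hyperplane[OF e] F'_def using F(3) e by (auto simp: inner_add_left inner_diff_left ge)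
    have F'2: "compact F'" unfolding F'_def
      using F(1) ling by (intro compact_translation compact_continuous_image linear_continuous_on) (simp add: linear_conv_bounded_linear)
    have F'3: "convex F'" unfolding F'_def using F(2) ling by (intro convex_translation convex_linear_image)
    have FF': "F = (+) (b *\<^sub>R u) ` f ` F'"
    proof -
      have "b *\<^sub>R u + f (- b *\<^sub>R e + g x) = x" for x
        by (simp add: linear_add[OF lin] linear_diff[OF lin] linear_scale[OF lin] f fg)
      then show ?thesis unfolding F'_def image_image by simp
    qed
    have "hausdorff_measure (CARD('n) - 1) F = hausdorff_measure (CARD('n) - 1) (f ` F')"
      unfolding FF' by (rule hausdorff_measure_isometry) (simp add: dist_norm)
    also have "\<dots> = hausdorff_measure (CARD('n) - 1) F'"
      by (rule hausdorff_measure_isometry)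
        (simp add: dist_norm linear_diff[OF lin, symmetric] orthogonal_transformation_norm[OF f(1)])
    also have "\<dots> = ennreal (\<kappa> * measure lebesgue (coord_prism ?D F'))"
      using hausdorff_measure_convex[OF _ F'1 F'2 F'3] unfolding cD \<kappa>_def by simp
    finally have H: "hausdorff_measure (CARD('n) - 1) F = ennreal (\<kappa> * measure lebesgue (coord_prism ?D F'))" .
    have "sweep F w = (+) (b *\<^sub>R u) ` f ` sweep F' (g w)"
      using sweep_linear[OF lin, of F' "g w"] by (subst FF') (simp add: sweep_translate fg)
    then have "measure lebesgue (sweep F w) = measure lebesgue (f ` sweep F' (g w))"
      by (simp add: measure_translation)
    also have "\<dots> = measure lebesgue (sweep F' (g w))"
      using F'2 F'3 by (intro measure_orthogonal_convex f compact_sweep convex_sweep)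
    also have "\<dots> = (u \<bullet> w) * measure lebesgue (coord_prism ?D F')"
      using measure_sweep_coord[OF e _ F'1 F'2 F'3, of "g w"] w by (simp add: ge)
    finally have S: "measure lebesgue (sweep F w) = (u \<bullet> w) * measure lebesgue (coord_prism ?D F')" .
    show "hausdorff_measure (CARD('n) - 1) F < top \<and>
       enn2real (hausdorff_measure (CARD('n) - 1) F) * (u \<bullet> w) = \<kappa> * measure lebesgue (sweep F w)"
      unfolding H S by (simp add: \<kappa>_def)
  qed
qed

lemma polytope_facet_representation:
  assumes P: "polytope P" "interior P \<noteq> {}"
  shows "x \<in> P \<longleftrightarrow> (\<forall>u\<in>facet_normals P. u \<bullet> x \<le> supp_fun P u)"
proof
  assume "x \<in> P"
  then show "\<forall>u\<in>facet_normals P. u \<bullet> x \<le> supp_fun P u"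
    using supp_fun_upper[OF compact_imp_bounded[OF polytope_imp_compact[OF P(1)]]] by blast
next
  assume *: "\<forall>u\<in>facet_normals P. u \<bullet> x \<le> supp_fun P u"
  show "x \<in> P"
  proof (rule ccontr)
    assume "x \<notin> P"
    then obtain u where "u \<in> facet_normals P" "supp_fun P u < u \<bullet> x" by (rule facet_normal_separates[OF P])
    then show False using * by (meson leD)
  qed
qed

text \<open>A point of the swept set outside \<open>P\<close> was last in \<open>P\<close> on a
  facet that faces \<open>w\<close>, so the gain consists of the sets swept by these facets. The
  pieces overlap only within hyperplanes.\<close>

lemma measure_sweep_polytope:
  fixes P :: "'a::euclidean_space set"
  assumes P: "polytope P" "interior P \<noteq> {}"
  shows "measure lebesgue (sweep P w) - measure lebesgue P =
    (\<Sum>u\<in>{u \<in> facet_normals P. u \<bullet> w > 0}. measure lebesgue (sweep (support_face P u) w))"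
proof -
  have c: "compact P" "convex P" "P \<noteq> {}" using polytope_imp_compact[OF P(1)] polytope_imp_convex[OF P(1)] P(2) by auto
  note rep = polytope_facet_representation[OF P]
  note face = facet_normal_face[OF c(1,3)]
  let ?h = "supp_fun P"
  let ?N = "{u \<in> facet_normals P. u \<bullet> w > 0}"
  have fin: "finite (facet_normals P)" by (rule finite_facet_normals[OF P])
  have feq: "support_face P u = {x \<in> P. u \<bullet> x = ?h u}" for u by (rule support_face_eq[OF c(1,3)])
  have norm1: "norm u = 1" if "u \<in> ?N" for u using that face(1) by blast
  \<comment> \<open>Since 0 is not a facet normal, it can serve as the label of the piece
    \<open>P\<close> itself.\<close>
  define S where "S u = (if u = 0 then P else sweep (support_face P u) w)" for u
  have n0: "0 \<notin> ?N" by auto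
  have cov: "sweep P w = (\<Union>u\<in>insert 0 ?N. S u)"
  proof (intro equalityI subsetI)
    fix x assume "x \<in> sweep P w"
    then obtain p t where pt: "x = p + t *\<^sub>R w" "p \<in> P" "0 \<le> t" "t \<le> 1" by (auto simp: sweep_def)
    show "x \<in> (\<Union>u\<in>insert 0 ?N. S u)"
    proof (cases "x \<in> P")
      case True then show ?thesis by (auto simp: S_def)
    next
      case False
      \<comment> \<open>Its maximum \<open>s\<close> is the last moment at which the moving point is
        still in \<open>P\<close>.\<close>
      define I where "I = {0..t} \<inter> (\<lambda>s. p + s *\<^sub>R w) -` P"
      have "closed ((\<lambda>s. p + s *\<^sub>R w) -` P)"
        using c(1) compact_imp_closed by (intro continuous_closed_vimage) (auto intro: continuous_intros)
      then have "compact I" unfolding I_def by (intro compact_Int_closed) auto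
      moreover have "0 \<in> I" using pt by (simp add: I_def)
      ultimately obtain s where s: "s \<in> I" "\<And>s'. s' \<in> I \<Longrightarrow> s' \<le> s"
        using compact_attains_sup[of I] by blast
      have "s < t" using s(1) False pt(1) by (cases "s = t") (auto simp: I_def)
      let ?f = "p + s *\<^sub>R w"
      have fP: "?f \<in> P" using s(1) by (simp add: I_def)
      \<comment> \<open>If no facet facing \<open>w\<close> were active at the last point, each of
        the finitely many inequalities would survive a further short move along \<open>w\<close>,
        and their minimum would contradict the choice of \<open>s\<close>.\<close>
      have "\<exists>u\<in>?N. u \<bullet> ?f = ?h u"
      proof (rule ccontr)
        assume no: "\<not> (\<exists>u\<in>?N. u \<bullet> ?f = ?h u)"
        have "\<exists>\<epsilon>>0. \<forall>r. 0 \<le> r \<and> r \<le> \<epsilon> \<longrightarrow> u \<bullet> (?f + r *\<^sub>R w) \<le> ?h u" if u: "u \<in> facet_normals P" for u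
        proof (cases "u \<bullet> w > 0")
          case True
          then have "u \<bullet> ?f < ?h u" using no u rep fP by (metis (mono_tags, lifting) mem_Collect_eq order_le_less)
          define \<epsilon> where "\<epsilon> = (?h u - u \<bullet> ?f) / (u \<bullet> w)"
          have "\<epsilon> > 0" using \<open>u \<bullet> ?f < ?h u\<close> True by (simp add: \<epsilon>_def)
          moreover have "u \<bullet> (?f + r *\<^sub>R w) \<le> ?h u" if "r \<le> \<epsilon>" for r
          proof -
            have "r * (u \<bullet> w) \<le> ?h u - u \<bullet> ?f" using that True by (simp add: \<epsilon>_def pos_le_divide_eq)
            then show ?thesis by (simp add: inner_add_right)
          qed
          ultimately show ?thesis by blast
        next
          case False
          have "u \<bullet> (?f + r *\<^sub>R w) \<le> ?h u" if "0 \<le> r" for r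
          proof -
            have "r * (u \<bullet> w) \<le> 0" using that False by (simp add: mult_nonneg_nonpos)
            moreover have "u \<bullet> ?f \<le> ?h u" using rep fP u by blast
            ultimately show ?thesis by (simp add: inner_add_right)
          qed
          then show ?thesis by (intro exI[of _ 1]) auto
        qed
        then obtain E where E: "\<And>u. u \<in> facet_normals P \<Longrightarrow> E u > 0 \<and> (\<forall>r. 0 \<le> r \<and> r \<le> E u \<longrightarrow> u \<bullet> (?f + r *\<^sub>R w) \<le> ?h u)"
          by metis
        define r where "r = Min (insert (t - s) (E ` facet_normals P))"
        have r0: "r > 0" unfolding r_def using fin E \<open>s < t\<close> by (subst Min_gr_iff) auto
        have r1: "r \<le> t - s" "\<And>u. u \<in> facet_normals P \<Longrightarrow> r \<le> E u" unfolding r_def using fin by auto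
        have "?f + r *\<^sub>R w \<in> P" unfolding rep using E r0 r1 by (meson less_imp_le)
        then have "s + r \<in> I" using r0 r1 s(1) by (simp add: I_def algebra_simps)
        then show False using s(2) r0 by fastforce
      qed
      then obtain u where u: "u \<in> ?N" "u \<bullet> ?f = ?h u" by blast
      have "x = ?f + (t - s) *\<^sub>R w" by (simp add: pt algebra_simps)
      moreover have "0 \<le> t - s" "t - s \<le> 1" using \<open>s < t\<close> s(1) pt by (auto simp: I_def)
      moreover have "?f \<in> support_face P u" using fP u(2) by (simp add: feq)
      ultimately have "x \<in> sweep (support_face P u) w" unfolding sweep_def by blast
      moreover have "u \<noteq> 0" using u(1) n0 by metis
      ultimately show ?thesis using u(1) by (auto simp: S_def)
    qed
  next
    fix x assume "x \<in> (\<Union>u\<in>insert 0 ?N. S u)"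
    then obtain u where "x \<in> S u" by blast
    then have "x \<in> P \<or> x \<in> sweep (support_face P u) w" by (auto simp: S_def split: if_splits)
    then show "x \<in> sweep P w"
    proof
      assume "x \<in> P" then show ?thesis unfolding sweep_def by (intro CollectI exI[of _ x] exI[of _ 0]) auto
    next
      assume "x \<in> sweep (support_face P u) w"
      then show ?thesis unfolding sweep_def feq by blast
    qed
  qed
  have neg0: "negligible (P \<inter> sweep (support_face P u) w)" if u: "u \<in> ?N" for u
  proof (rule negligible_subset)
    have "u \<noteq> 0" using u by auto
    then show "negligible {x. u \<bullet> x = ?h u}" by (intro negligible_hyperplane) auto
    show "P \<inter> sweep (support_face P u) w \<subseteq> {x. u \<bullet> x = ?h u}"
    proof
      fix x assume x: "x \<in> P \<inter> sweep (support_face P u) w"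
      then obtain f t where ft: "x = f + t *\<^sub>R w" "u \<bullet> f = ?h u" "0 \<le> t" by (auto simp: sweep_def feq)
      have "u \<bullet> x \<le> ?h u" using x rep u by blast
      moreover have "u \<bullet> x \<ge> ?h u" using ft u by (simp add: inner_add_right)
      ultimately show "x \<in> {x. u \<bullet> x = ?h u}" by simp
    qed
  qed
  have neg: "negligible (sweep (support_face P u) w \<inter> sweep (support_face P v) w)" if u: "u \<in> ?N" and v: "v \<in> ?N" and uv: "u \<noteq> v" for u v
  proof (rule negligible_subset)
    \<comment> \<open>The vector \<open>q\<close> is orthogonal to \<open>w\<close>. On the overlap
      the two base points coincide, so \<open>q\<close> has there the constant value given by the
      two support values.\<close>
    define q where "q = (v \<bullet> w) *\<^sub>R u - (u \<bullet> w) *\<^sub>R v"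
    have "q \<noteq> 0"
    proof
      assume "q = 0"
      then have eq: "(v \<bullet> w) *\<^sub>R u = (u \<bullet> w) *\<^sub>R v" by (simp add: q_def)
      then have "norm ((v \<bullet> w) *\<^sub>R u) = norm ((u \<bullet> w) *\<^sub>R v)" by simp
      then have "v \<bullet> w = u \<bullet> w" using u v norm1[OF u] norm1[OF v] by simp
      then show False using eq uv u by simp
    qed
    then show "negligible {x. q \<bullet> x = (v \<bullet> w) * ?h u - (u \<bullet> w) * ?h v}" by (intro negligible_hyperplane) auto
    show "sweep (support_face P u) w \<inter> sweep (support_face P v) w \<subseteq> {x. q \<bullet> x = (v \<bullet> w) * ?h u - (u \<bullet> w) * ?h v}"
    proof
      fix x assume x: "x \<in> sweep (support_face P u) w \<inter> sweep (support_face P v) w"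
      then obtain f t where ft: "x = f + t *\<^sub>R w" "f \<in> P" "u \<bullet> f = ?h u" by (auto simp: sweep_def feq)
      obtain f' t' where ft': "x = f' + t' *\<^sub>R w" "f' \<in> P" "v \<bullet> f' = ?h v" using x by (auto simp: sweep_def feq)
      have 1: "u \<bullet> f' \<le> ?h u" "v \<bullet> f \<le> ?h v" using rep ft ft' u v by blast+
      have f': "f' = f + (t - t') *\<^sub>R w" using ft(1) ft'(1) by (simp add: algebra_simps)
      have "(t - t') * (u \<bullet> w) \<le> 0" using 1(1) ft(3) unfolding f' by (simp add: inner_add_right)
      then have a: "t \<le> t'" using u by (simp add: mult_le_0_iff)
      have "(t - t') * (v \<bullet> w) \<ge> 0" using 1(2) ft'(3) unfolding f' by (simp add: inner_add_right)
      then have b: "t' \<le> t" using v by (simp add: zero_le_mult_iff)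
      have "f' = f" using f' a b by simp
      have qw: "q \<bullet> w = 0" by (simp add: q_def inner_diff_left)
      have "q \<bullet> f = (v \<bullet> w) * ?h u - (u \<bullet> w) * ?h v"
        using ft(3) ft'(3) \<open>f' = f\<close> by (simp add: q_def inner_diff_left)
      then show "x \<in> {x. q \<bullet> x = (v \<bullet> w) * ?h u - (u \<bullet> w) * ?h v}" using ft(1) qw by (simp add: inner_add_right)
    qed
  qed
  have "measure lebesgue (\<Union>u\<in>insert 0 ?N. S u) = (\<Sum>u\<in>insert 0 ?N. measure lebesgue (S u))"
  proof (rule measure_negligible_finite_Union_image)
    show "finite (insert 0 ?N)" using fin by simp
    show "S u \<in> lmeasurable" if "u \<in> insert 0 ?N" for u
      using that c(1) face(3) compact_sweep unfolding S_def by (auto intro!: lmeasurable_compact)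
    show "pairwise (\<lambda>u v. negligible (S u \<inter> S v)) (insert 0 ?N)"
      unfolding pairwise_def
    proof (intro ballI impI)
      fix u v assume uv: "u \<in> insert 0 ?N" "v \<in> insert 0 ?N" "u \<noteq> v"
      consider "u = 0" "v \<in> ?N" | "v = 0" "u \<in> ?N" | "u \<in> ?N" "v \<in> ?N" using uv by blast
      then show "negligible (S u \<inter> S v)"
      proof cases
        case 1 then show ?thesis using neg0[OF 1(2)] uv(3) by (simp add: S_def)
      next
        case 2 then show ?thesis using neg0[OF 2(2)] uv(3) by (simp add: S_def Int_commute)
      next
        case 3
        then have "u \<noteq> 0" "v \<noteq> 0" using n0 by metis+
        then show ?thesis using neg[OF 3 uv(3)] by (simp add: S_def)
      qed
    qed
  qed
  also have "\<dots> = measure lebesgue (S 0) + (\<Sum>u\<in>?N. measure lebesgue (S u))"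
    using fin n0 by (intro sum.insert) auto
  also have "(\<Sum>u\<in>?N. measure lebesgue (S u)) = (\<Sum>u\<in>?N. measure lebesgue (sweep (support_face P u) w))"
    using n0 by (intro sum.cong refl) (auto simp: S_def)
  finally show ?thesis unfolding cov[symmetric] by (simp add: S_def)
qed

text \<open>
  The sets swept by \<open>P\<close> along \<open>w\<close> and along \<open>- w\<close> are translates of each other. Comparing the two volume
  gains gives the inner product of the relation with \<open>w\<close>.
\<close>

theorem minkowski_relation:
  fixes P :: "(real^'n) set"
  assumes P: "polytope P" "interior P \<noteq> {}"
  shows "u \<in> facet_normals P \<Longrightarrow> hausdorff_measure (CARD('n) - 1) (support_face P u) < top"
    and "(\<Sum>u\<in>facet_normals P. enn2real (hausdorff_measure (CARD('n) - 1) (support_face P u)) *\<^sub>R u) = 0"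
proof -
  have c: "compact P" "convex P" "P \<noteq> {}" using polytope_imp_compact[OF P(1)] polytope_imp_convex[OF P(1)] P(2) by auto
  note face = facet_normal_face[OF c(1,3)]
  obtain \<kappa> where \<kappa>: "\<And>F u b w. norm u = 1 \<Longrightarrow> u \<bullet> w > 0 \<Longrightarrow> compact F \<Longrightarrow> convex F \<Longrightarrow> F \<subseteq> {x::real^'n. u \<bullet> x = b} \<Longrightarrow>
       hausdorff_measure (CARD('n) - 1) F < top \<and>
       enn2real (hausdorff_measure (CARD('n) - 1) F) * (u \<bullet> w) = \<kappa> * measure lebesgue (sweep F w)"
    using hausdorff_measure_sweep by metis
  have *: "hausdorff_measure (CARD('n) - 1) (support_face P u) < top \<and>
       enn2real (hausdorff_measure (CARD('n) - 1) (support_face P u)) * (u \<bullet> w) = \<kappa> * measure lebesgue (sweep (support_face P u) w)"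
    if "u \<in> facet_normals P" "u \<bullet> w > 0" for u w
    using \<kappa>[OF face(1)[OF that(1)] that(2) face(3)[OF that(1)] face(4)[OF that(1) c(2)] face(6)[OF that(1)]] .
  show "hausdorff_measure (CARD('n) - 1) (support_face P u) < top" if "u \<in> facet_normals P" for u
    using *[OF that, of u] face(1)[OF that] by (simp add: dot_square_norm)
  define a where "a u = enn2real (hausdorff_measure (CARD('n) - 1) (support_face P u))" for u
  let ?N = "facet_normals P"
  have fin: "finite ?N" by (rule finite_facet_normals[OF P])
  have pos: "(\<Sum>u\<in>{u \<in> ?N. u \<bullet> w > 0}. a u * (u \<bullet> w)) = \<kappa> * (measure lebesgue (sweep P w) - measure lebesgue P)" for w
    unfolding measure_sweep_polytope[OF P] sum_distrib_left using * by (intro sum.cong) (auto simp: a_def)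
  have sym: "measure lebesgue (sweep P (- w)) = measure lebesgue (sweep P w)" for w
  proof -
    have "sweep P (- w) = (+) (- w) ` sweep P w"
    proof (intro equalityI subsetI)
      fix x assume "x \<in> sweep P (- w)"
      then obtain p t where pt: "x = p + t *\<^sub>R (- w)" "p \<in> P" "0 \<le> t" "t \<le> 1" by (auto simp: sweep_def)
      have "x = - w + (p + (1 - t) *\<^sub>R w)" by (simp add: pt algebra_simps)
      moreover have "p + (1 - t) *\<^sub>R w \<in> sweep P w" unfolding sweep_def using pt
        by (intro CollectI exI[of _ p] exI[of _ "1 - t"]) auto
      ultimately show "x \<in> (+) (- w) ` sweep P w" by blast
    next
      fix x assume "x \<in> (+) (- w) ` sweep P w"
      then obtain p t where pt: "x = - w + (p + t *\<^sub>R w)" "p \<in> P" "0 \<le> t" "t \<le> 1" by (auto simp: sweep_def)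
      have "x = p + (1 - t) *\<^sub>R (- w)" by (simp add: pt algebra_simps)
      then show "x \<in> sweep P (- w)" unfolding sweep_def using pt
        by (intro CollectI exI[of _ p] exI[of _ "1 - t"]) auto
    qed
    then show ?thesis by (simp only: measure_translation)
  qed
  have "(\<Sum>u\<in>?N. a u *\<^sub>R u) \<bullet> w = 0" for w
  proof -
    have "(\<Sum>u\<in>?N. a u *\<^sub>R u) \<bullet> w = (\<Sum>u\<in>?N. a u * (u \<bullet> w))" by (simp add: inner_sum_left)
    also have "\<dots> = (\<Sum>u\<in>{u \<in> ?N. u \<bullet> w > 0} \<union> {u \<in> ?N. u \<bullet> (- w) > 0}. a u * (u \<bullet> w))"
      using fin by (intro sum.mono_neutral_right) (auto simp: linorder_neq_iff)
    also have "\<dots> = (\<Sum>u\<in>{u \<in> ?N. u \<bullet> w > 0}. a u * (u \<bullet> w)) + (\<Sum>u\<in>{u \<in> ?N. u \<bullet> (- w) > 0}. a u * (u \<bullet> w))"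
      using fin by (intro sum.union_disjoint) auto
    also have "(\<Sum>u\<in>{u \<in> ?N. u \<bullet> (- w) > 0}. a u * (u \<bullet> w)) = - (\<Sum>u\<in>{u \<in> ?N. u \<bullet> (- w) > 0}. a u * (u \<bullet> (- w)))"
      by (simp add: sum_negf)
    also have "(\<Sum>u\<in>{u \<in> ?N. u \<bullet> w > 0}. a u * (u \<bullet> w)) + - (\<Sum>u\<in>{u \<in> ?N. u \<bullet> (- w) > 0}. a u * (u \<bullet> (- w))) = 0"
      unfolding pos sym by simp
    finally show ?thesis .
  qed
  then show "(\<Sum>u\<in>?N. enn2real (hausdorff_measure (CARD('n) - 1) (support_face P u)) *\<^sub>R u) = 0"
    unfolding a_def[symmetric] by (metis inner_eq_zero_iff)
qed

section \<open>Singular boundary points and positivity of the surface area measure\<close>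

lemma hausdorff_measure_null_UN:
  fixes A :: "'i \<Rightarrow> 'a::euclidean_space set"
  assumes I: "countable I" and A: "\<And>i. i \<in> I \<Longrightarrow> hausdorff_measure d (A i) = 0"
  shows "hausdorff_measure d (\<Union>i\<in>I. A i) = 0"
proof (cases "I = {}")
  case False
  have "(\<Union>i\<in>I. A i) = (\<Union>n. A (from_nat_into I n))"
    using range_from_nat_into[OF False I] by (metis image_image)
  then have "hausdorff_measure d (\<Union>i\<in>I. A i) \<le> (\<Sum>n. hausdorff_measure d (A (from_nat_into I n)))"
    using hausdorff_measure_UN[of d "\<lambda>n. A (from_nat_into I n)"] by simp
  also have "\<dots> = 0" using A from_nat_into[OF False] by simp
  finally show ?thesis by simp
qed (simp add: hausdorff_measure_empty)

text \<open>After a translation the set lies in a compact convex part of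
  \<open>y \<bullet> i = 0\<close> on which also \<open>y \<bullet> j = 0\<close>. The prism over
  that part is contained in a second hyperplane and is therefore null. The norm bound provides
  compactness.\<close>

lemma hausdorff_measure_coord_plane:
  fixes i j :: "'a::euclidean_space"
  assumes ij: "i \<in> Basis" "j \<in> Basis" "i \<noteq> j"
  shows "hausdorff_measure (DIM('a) - 1) {y. y \<bullet> i = p \<and> y \<bullet> j = q \<and> norm y \<le> r} = 0"
proof -
  let ?D = "Basis - {i}"
  define t where "t = - (p *\<^sub>R i + q *\<^sub>R j)"
  define F where "F = {y::'a. y \<bullet> i = 0 \<and> y \<bullet> j = 0} \<inter> cball 0 (r + norm t)"
  have sub: "{y. y \<bullet> i = p \<and> y \<bullet> j = q \<and> norm y \<le> r} \<subseteq> (+) (- t) ` F"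
  proof
    fix y assume y: "y \<in> {y. y \<bullet> i = p \<and> y \<bullet> j = q \<and> norm y \<le> r}"
    have "y + t \<in> F"
      using y ij norm_triangle_ineq[of y t] by (auto simp: F_def t_def inner_diff_left inner_add_left inner_Basis algebra_simps)
    then show "y \<in> (+) (- t) ` F" by (intro image_eqI[of _ _ "y + t"]) auto
  qed
  have hyp: "closed {y::'a. y \<bullet> b = 0}" "convex {y::'a. y \<bullet> b = 0}" for b
    using closed_hyperplane[of b 0] convex_hyperplane[of b 0] by (simp_all add: inner_commute)
  have F: "F \<subseteq> coord_space ?D" "compact F" "convex F"
    unfolding coord_space_hyperplane[OF ij(1)] F_def Collect_conj_eq
    by (auto intro!: closed_Int_compact closed_Int convex_Int hyp)
  have "negligible (coord_prism ?D F)"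
  proof (rule negligible_subset)
    show "negligible {y. j \<bullet> y = 0}" using ij(2) nonzero_Basis by (intro negligible_hyperplane) auto
    show "coord_prism ?D F \<subseteq> {y. j \<bullet> y = 0}"
    proof
      fix y assume "y \<in> coord_prism ?D F"
      then have "coord_proj ?D y \<bullet> j = 0" by (simp add: coord_prism_def F_def)
      then have "y \<bullet> j = 0" using ij by (simp add: coord_proj_inner)
      then show "y \<in> {y. j \<bullet> y = 0}" by (simp only: mem_Collect_eq inner_commute[of j y])
    qed
  qed
  then have m0: "measure lebesgue (coord_prism ?D F) = 0" by (rule negligible_imp_measure0)
  have cD: "card ?D = DIM('a) - 1" using ij by (simp add: card_Diff_singleton)
  have "hausdorff_measure (DIM('a) - 1) {y. y \<bullet> i = p \<and> y \<bullet> j = q \<and> norm y \<le> r} \<le> hausdorff_measure (DIM('a) - 1) ((+) (- t) ` F)"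
    by (rule hausdorff_measure_mono[OF sub])
  also have "\<dots> = hausdorff_measure (DIM('a) - 1) F" by (rule hausdorff_measure_isometry) (simp add: dist_norm)
  also have "\<dots> = 0" using hausdorff_measure_convex[OF _ F] m0 unfolding cD by simp
  finally show ?thesis by simp
qed

text \<open>If all 2 by 2 minors vanished, expanding \<open>v \<bullet> j\<close> against
  \<open>u \<bullet> u = 1\<close> would give \<open>v = (u \<bullet> v) u\<close>, hence
  \<open>v = u\<close> or \<open>v = - u\<close>. The minor serves as determinant when two
  coordinates are prescribed.\<close>

lemma nonzero_minor:
  fixes u v :: "'a::euclidean_space"
  assumes u: "norm u = 1" and v: "norm v = 1" and uv: "u \<noteq> v" "u \<noteq> - v"
  obtains i j where "i \<in> Basis" "j \<in> Basis" "i \<noteq> j" "(u \<bullet> i) * (v \<bullet> j) - (u \<bullet> j) * (v \<bullet> i) \<noteq> 0"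
proof (rule ccontr)
  note obt = that
  assume nt: "\<not> thesis"
  have no: "(u \<bullet> i) * (v \<bullet> j) - (u \<bullet> j) * (v \<bullet> i) = 0" if "i \<in> Basis" "j \<in> Basis" for i j
    using obt[OF that] nt by (cases "i = j") auto
  have uu: "(\<Sum>i\<in>Basis. (u \<bullet> i) * (u \<bullet> i)) = 1"
    using u euclidean_inner[of u u] by (simp add: dot_square_norm)
  have "v \<bullet> j = ((u \<bullet> v) *\<^sub>R u) \<bullet> j" if j: "j \<in> Basis" for j
  proof -
    have "v \<bullet> j = (\<Sum>i\<in>Basis. (u \<bullet> i) * (u \<bullet> i)) * (v \<bullet> j)" using uu by simp
    also have "\<dots> = (\<Sum>i\<in>Basis. (u \<bullet> i) * ((u \<bullet> j) * (v \<bullet> i)))"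
      unfolding sum_distrib_right using no j by (intro sum.cong refl) (simp add: mult.assoc)
    also have "\<dots> = (u \<bullet> j) * (\<Sum>i\<in>Basis. (u \<bullet> i) * (v \<bullet> i))" by (simp add: sum_distrib_left mult_ac)
    also have "(\<Sum>i\<in>Basis. (u \<bullet> i) * (v \<bullet> i)) = u \<bullet> v" using euclidean_inner[of u v] by simp
    finally show ?thesis by simp
  qed
  then have v': "v = (u \<bullet> v) *\<^sub>R u" by (rule euclidean_eqI)
  have "norm v = \<bar>u \<bullet> v\<bar> * norm u" using v' norm_scaleR by metis
  then have "\<bar>u \<bullet> v\<bar> = 1" using u v by simp
  then consider "u \<bullet> v = 1" | "u \<bullet> v = - 1" by linarith
  then show False using v' uv by cases simp_all
qed

lemma closest_point_normal:
  assumes K: "convex K" "closed K" and x: "x \<in> K" and n: "\<And>z. z \<in> K \<Longrightarrow> n \<bullet> z \<le> n \<bullet> x"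
  shows "closest_point K (x + n) = x"
proof -
  have "dist (x + n) x \<le> dist (x + n) z" if "z \<in> K" for z
  proof -
    have "(norm n)\<^sup>2 \<le> (norm (n - (z - x)))\<^sup>2"
      using n[OF that] by (simp add: power2_norm_eq_inner inner_diff_left inner_diff_right inner_commute algebra_simps)
        (smt (verit) inner_ge_zero inner_diff_left inner_diff_right inner_commute)
    then have "norm n \<le> norm (n - (z - x))" by simp
    then show ?thesis by (simp add: dist_norm algebra_simps)
  qed
  then show ?thesis using closest_point_unique[OF K x] by metis
qed

text \<open>
  A point \<open>x\<close> with two independent outer normals \<open>u\<close>, \<open>v\<close> is the nearest point of \<open>K\<close> to every
  \<open>x + a u + b v\<close> with \<open>a, b \<ge> 0\<close>, and some such point lies in one of countably many affine subspaces
  of codimension 2. The nearest point map does not increase Hausdorff measure.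
\<close>

lemma singular_points_null:
  fixes K :: "'a::euclidean_space set"
  assumes K: "convex_body K"
  shows "hausdorff_measure (DIM('a) - 1)
    {x. \<exists>u v. norm u = 1 \<and> norm v = 1 \<and> u \<noteq> v \<and> x \<in> support_face K u \<and> x \<in> support_face K v} = 0"
    (is "hausdorff_measure _ ?A = 0")
proof -
  have c: "compact K" "convex K" "closed K" "interior K \<noteq> {}" "K \<noteq> {}"
    using K interior_subset by (auto simp: convex_body_def compact_imp_closed)
  \<comment> \<open>Two coordinates, two rational values for them, and a radius that keeps each
    piece of plane bounded.\<close>
  define I where "I = {(i::'a, j::'a). i \<in> Basis \<and> j \<in> Basis \<and> i \<noteq> j} \<times> ((\<rat> :: real set) \<times> (\<rat> :: real set)) \<times> (UNIV :: nat set)"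
  define G where "G = (\<lambda>((i::'a, j::'a), (p::real, q::real), r::nat). {y. y \<bullet> i = p \<and> y \<bullet> j = q \<and> norm y \<le> real r})"
  have "countable I"
  proof -
    have "{(i::'a, j::'a). i \<in> Basis \<and> j \<in> Basis \<and> i \<noteq> j} \<subseteq> Basis \<times> Basis" by auto
    then have "countable {(i::'a, j::'a). i \<in> Basis \<and> j \<in> Basis \<and> i \<noteq> j}"
      by (meson countable_finite finite_Basis finite_SigmaI finite_subset)
    then show ?thesis unfolding I_def by (intro countable_SIGMA countable_rat) auto
  qed
  have null: "hausdorff_measure (DIM('a) - 1) (closest_point K ` G k) = 0" if k: "k \<in> I" for k
  proof -
    obtain i j p q r where kk: "k = ((i, j), (p, q), r)" by (metis prod.collapse)
    have "hausdorff_measure (DIM('a) - 1) (closest_point K ` G k) \<le> hausdorff_measure (DIM('a) - 1) (G k)"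
      using hausdorff_measure_lipschitz[of 1 UNIV "closest_point K" "G k" "DIM('a) - 1"] closest_point_lipschitz[OF c(2,3,5)] by simp
    also have "\<dots> = 0" using k hausdorff_measure_coord_plane[of i j p q "real r"] unfolding kk I_def G_def by simp
    finally show ?thesis by simp
  qed
  have "?A \<subseteq> (\<Union>k\<in>I. closest_point K ` G k)"
  proof
    fix x assume "x \<in> ?A"
    then obtain u v where uv: "norm u = 1" "norm v = 1" "u \<noteq> v" "x \<in> support_face K u" "x \<in> support_face K v" by blast
    have "u \<noteq> - v"
    proof
      assume "u = - v"
      then have "K \<subseteq> {y. u \<bullet> y = u \<bullet> x}" using uv(4,5) by (fastforce simp: support_face_def)
      moreover have "interior {y. u \<bullet> y = u \<bullet> x} = {}" using uv(1) by (intro interior_hyperplane) auto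
      ultimately show False using c(4) interior_mono by blast
    qed
    then obtain i j where ij: "i \<in> Basis" "j \<in> Basis" "i \<noteq> j" and dn: "(u \<bullet> i) * (v \<bullet> j) - (u \<bullet> j) * (v \<bullet> i) \<noteq> 0"
      using nonzero_minor uv(1,2,3) by metis
    define d where "d = (u \<bullet> i) * (v \<bullet> j) - (u \<bullet> j) * (v \<bullet> i)"
    have d0: "d \<noteq> 0" using dn by (simp add: d_def)
    define y where "y = x + u + v"
    obtain p where p: "p \<in> \<rat>" "y \<bullet> i < p" "p < y \<bullet> i + \<bar>d\<bar> / 2"
      using Rats_dense_in_real[of "y \<bullet> i" "y \<bullet> i + \<bar>d\<bar> / 2"] d0 by auto
    obtain q where q: "q \<in> \<rat>" "y \<bullet> j < q" "q < y \<bullet> j + \<bar>d\<bar> / 2"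
      using Rats_dense_in_real[of "y \<bullet> j" "y \<bullet> j + \<bar>d\<bar> / 2"] d0 by auto
    define a where "a = p - y \<bullet> i"
    define b where "b = q - y \<bullet> j"
    have ab: "\<bar>a\<bar> < \<bar>d\<bar> / 2" "\<bar>b\<bar> < \<bar>d\<bar> / 2" using p q by (auto simp: a_def b_def)
    \<comment> \<open>Cramer's rule: \<open>s\<close> and \<open>t\<close> give
      \<open>x + s u + t v\<close> the coordinates \<open>p\<close> and \<open>q\<close>, while
      \<open>s = t = 1\<close> gives \<open>y\<close>. The tolerance \<open>|d| / 2\<close> bounds
      both corrections by 1, so \<open>s\<close> and \<open>t\<close> are nonnegative.\<close>
    define s where "s = 1 + (a * (v \<bullet> j) - b * (v \<bullet> i)) / d"
    define t where "t = 1 + (b * (u \<bullet> i) - a * (u \<bullet> j)) / d"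
    have small: "\<bar>(\<alpha> * \<xi> - \<beta> * \<eta>) / d\<bar> \<le> 1" if "\<bar>\<alpha>\<bar> < \<bar>d\<bar> / 2" "\<bar>\<beta>\<bar> < \<bar>d\<bar> / 2" "\<bar>\<xi>\<bar> \<le> 1" "\<bar>\<eta>\<bar> \<le> 1" for \<alpha> \<beta> \<xi> \<eta>
    proof -
      have "\<bar>\<alpha> * \<xi>\<bar> \<le> (\<bar>d\<bar> / 2) * 1" "\<bar>\<beta> * \<eta>\<bar> \<le> (\<bar>d\<bar> / 2) * 1"
        unfolding abs_mult using that by (intro mult_mono; simp)+
      then have "\<bar>\<alpha> * \<xi> - \<beta> * \<eta>\<bar> \<le> \<bar>d\<bar>" by linarith
      then show ?thesis using d0 by (simp add: abs_divide)
    qed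
    have n1: "\<bar>u \<bullet> i\<bar> \<le> 1" "\<bar>u \<bullet> j\<bar> \<le> 1" "\<bar>v \<bullet> i\<bar> \<le> 1" "\<bar>v \<bullet> j\<bar> \<le> 1"
      using Basis_le_norm[OF ij(1), of u] Basis_le_norm[OF ij(2), of u] Basis_le_norm[OF ij(1), of v] Basis_le_norm[OF ij(2), of v] uv(1,2)
      by simp_all
    have st: "s \<ge> 0" "t \<ge> 0"
      using small[OF ab n1(4,3)] small[OF ab(2,1) n1(1,2)] unfolding s_def t_def by linarith+
    define n where "n = s *\<^sub>R u + t *\<^sub>R v"
    have cp: "closest_point K (x + n) = x"
    proof (rule closest_point_normal[OF c(2,3)])
      show "x \<in> K" using uv(4) by (simp add: support_face_def)
      fix z assume z: "z \<in> K"
      have "s * (u \<bullet> z) \<le> s * (u \<bullet> x)" "t * (v \<bullet> z) \<le> t * (v \<bullet> x)"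
        using st z uv(4,5) by (auto simp: support_face_def intro!: mult_left_mono)
      then show "n \<bullet> z \<le> n \<bullet> x" by (simp add: n_def inner_add_left)
    qed
    have xi: "(x + n) \<bullet> i = p"
    proof -
      have "(s - 1) * (u \<bullet> i) + (t - 1) * (v \<bullet> i) = ((a * (v \<bullet> j) - b * (v \<bullet> i)) * (u \<bullet> i) + (b * (u \<bullet> i) - a * (u \<bullet> j)) * (v \<bullet> i)) / d"
        by (simp add: s_def t_def add_divide_distrib)
      also have "(a * (v \<bullet> j) - b * (v \<bullet> i)) * (u \<bullet> i) + (b * (u \<bullet> i) - a * (u \<bullet> j)) * (v \<bullet> i) = a * d" by (simp add: d_def algebra_simps)
      finally have "(s - 1) * (u \<bullet> i) + (t - 1) * (v \<bullet> i) = a" using d0 by simp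
      then show ?thesis by (simp add: n_def y_def a_def inner_add_left algebra_simps)
    qed
    have xj: "(x + n) \<bullet> j = q"
    proof -
      have "(s - 1) * (u \<bullet> j) + (t - 1) * (v \<bullet> j) = ((a * (v \<bullet> j) - b * (v \<bullet> i)) * (u \<bullet> j) + (b * (u \<bullet> i) - a * (u \<bullet> j)) * (v \<bullet> j)) / d"
        by (simp add: s_def t_def add_divide_distrib)
      also have "(a * (v \<bullet> j) - b * (v \<bullet> i)) * (u \<bullet> j) + (b * (u \<bullet> i) - a * (u \<bullet> j)) * (v \<bullet> j) = b * d" by (simp add: d_def algebra_simps)
      finally have "(s - 1) * (u \<bullet> j) + (t - 1) * (v \<bullet> j) = b" using d0 by simp
      then show ?thesis by (simp add: n_def y_def b_def inner_add_left algebra_simps)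
    qed
    obtain r :: nat where "norm (x + n) \<le> real r" using real_arch_simple by blast
    then have "x + n \<in> G ((i, j), (p, q), r)" using xi xj by (simp add: G_def)
    moreover have "((i, j), (p, q), r) \<in> I" using ij p q by (simp add: I_def)
    ultimately show "x \<in> (\<Union>k\<in>I. closest_point K ` G k)" using cp by (metis UN_I image_eqI)
  qed
  then have "hausdorff_measure (DIM('a) - 1) ?A \<le> hausdorff_measure (DIM('a) - 1) (\<Union>k\<in>I. closest_point K ` G k)"
    by (rule hausdorff_measure_mono)
  also have "\<dots> = 0" by (rule hausdorff_measure_null_UN[OF \<open>countable I\<close> null])
  finally show ?thesis by simp
qed

text \<open>A set of diameter \<open>s > 0\<close> swept along \<open>w\<close> is covered by at
  most \<open>2 / s\<close> balls of radius \<open>s (1 + norm w)\<close>. Their total volume is of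
  order \<open>s ^ (n - 1)\<close> in dimension \<open>n\<close>, as is the content of the set. A
  single point has content 0 because \<open>n \<ge> 2\<close>, and its swept segment lies in a
  hyperplane.\<close>

lemma sweep_cover:
  fixes w :: "'a::euclidean_space"
  assumes dim: "DIM('a) \<ge> 2"
  obtains B where "B \<ge> 0" "\<And>C. bounded C \<Longrightarrow> diameter C \<le> 1 \<Longrightarrow>
    \<exists>T. T \<in> sets lebesgue \<and> sweep C w \<subseteq> T \<and> emeasure lebesgue T \<le> ennreal B * content_term (DIM('a) - 1) C"
proof -
  let ?d = "DIM('a) - 1"
  define c where "c = unit_ball_vol (real DIM('a))"
  have c0: "c \<ge> 0" by (simp add: c_def)
  define v where "v = unit_ball_vol (real ?d) / 2 ^ ?d"
  have v0: "v > 0" by (simp add: v_def)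
  \<comment> \<open>The number \<open>2 / s\<close> of balls times the volume
    \<open>c (s (1 + norm w)) ^ n\<close> of one, divided by the content
    \<open>v s ^ (n - 1)\<close> of a set of diameter \<open>s\<close>.\<close>
  define B where "B = 2 * c * (1 + norm w) ^ DIM('a) / v"
  show ?thesis
  proof (rule that[of B])
    show "B \<ge> 0" using c0 v0 by (simp add: B_def)
    fix C :: "'a set" assume C: "bounded C" "diameter C \<le> 1"
    show "\<exists>T. T \<in> sets lebesgue \<and> sweep C w \<subseteq> T \<and> emeasure lebesgue T \<le> ennreal B * content_term ?d C"
    proof (cases "C = {}")
      case True
      then show ?thesis by (intro exI[of _ "{}"]) (auto simp: sweep_def)
    next
      case False
      then obtain x where x: "x \<in> C" by blast
      define s where "s = diameter C"
      have s0: "s \<ge> 0" using diameter_ge_0[OF C(1)] by (simp add: s_def)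
      have ds: "dist x y \<le> s" if "y \<in> C" for y using diameter_bounded_bound[OF C(1) x that] by (simp add: s_def)
      show ?thesis
      proof (cases "s = 0")
        case True
        obtain q where q: "q \<noteq> 0" "orthogonal w q" using orthogonal_to_vector_exists[OF dim] by metis
        have "sweep C w \<subseteq> {y. q \<bullet> y = q \<bullet> x}"
        proof
          fix y assume "y \<in> sweep C w"
          then obtain f t where ft: "y = f + t *\<^sub>R w" "f \<in> C" by (auto simp: sweep_def)
          have "f = x" using ds[OF ft(2)] True by simp
          then show "y \<in> {y. q \<bullet> y = q \<bullet> x}" using q(2) by (simp add: ft(1) inner_add_right orthogonal_def inner_commute)
        qed
        moreover have "{y. q \<bullet> y = q \<bullet> x} \<in> null_sets lebesgue"
          using q(1) by (intro negligible_iff_null_sets[THEN iffD1] negligible_hyperplane) auto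
        ultimately show ?thesis by (intro exI[of _ "{y. q \<bullet> y = q \<bullet> x}"]) (auto simp: null_sets_def)
      next
        case False
        then have s: "s > 0" using s0 by simp
        define N where "N = nat \<lceil>1 / s\<rceil>"
        have N1: "1 / s \<le> real N" unfolding N_def by (rule of_nat_ceiling)
        have s1: "s \<le> 1" using C(2) by (simp add: s_def)
        have "0 \<le> 1 / s" using s by simp
        then have "real N < 1 / s + 1" unfolding N_def by linarith
        moreover have "1 \<le> 1 / s" using s s1 by simp
        moreover have "2 / s = 1 / s + 1 / s" by simp
        ultimately have N2: "real N \<le> 2 / s" by linarith
        have "0 < 1 / s" using s by simp
        then have N0: "N > 0" using N1 by (cases N) auto
        have N3: "1 / real N \<le> s" using N1 N0 s by (simp add: field_simps)
        define T where "T = (\<Union>j<N. cball (x + (real j / real N) *\<^sub>R w) (s * (1 + norm w)))"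
        have "sweep C w \<subseteq> T"
        proof
          fix y assume "y \<in> sweep C w"
          then obtain f t where ft: "y = f + t *\<^sub>R w" "f \<in> C" "0 \<le> t" "t \<le> 1" by (auto simp: sweep_def)
          have "\<exists>j<N. \<bar>t - real j / real N\<bar> \<le> 1 / real N"
          proof (cases "t = 1")
            case True
            have "1 - real (N - 1) / real N = 1 / real N" using N0 by (simp add: field_simps)
            then show ?thesis using N0 True by (intro exI[of _ "N - 1"]) auto
          next
            case False
            define j where "j = nat \<lfloor>t * real N\<rfloor>"
            have "0 \<le> t * real N" using ft by simp
            then have j: "real j \<le> t * real N" "t * real N < real j + 1" unfolding j_def by linarith+
            have "t * real N < 1 * real N" using False ft N0 by (intro mult_strict_right_mono) auto
            then have "j < N" using j by simp
            moreover have "\<bar>t - real j / real N\<bar> \<le> 1 / real N"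
            proof -
              have "t - real j / real N = (t * real N - real j) / real N" using N0 by (simp add: field_simps)
              then show ?thesis using j N0 by (simp add: divide_right_mono)
            qed
            ultimately show ?thesis by blast
          qed
          then obtain j where j: "j < N" "\<bar>t - real j / real N\<bar> \<le> 1 / real N" by blast
          have "dist (x + (real j / real N) *\<^sub>R w) y = norm ((x - f) + (real j / real N - t) *\<^sub>R w)"
            by (simp add: dist_norm ft(1) algebra_simps)
          also have "\<dots> \<le> norm (x - f) + norm ((real j / real N - t) *\<^sub>R w)" by (rule norm_triangle_ineq)
          also have "\<dots> \<le> s + s * norm w"
          proof (rule add_mono)
            show "norm (x - f) \<le> s" using ds[OF ft(2)] by (simp add: dist_norm)
            have "\<bar>real j / real N - t\<bar> \<le> s" using j(2) N3 by linarith
            then show "norm ((real j / real N - t) *\<^sub>R w) \<le> s * norm w" by (simp add: mult_right_mono)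
          qed
          finally have "y \<in> cball (x + (real j / real N) *\<^sub>R w) (s * (1 + norm w))" by (simp add: distrib_left)
          then show "y \<in> T" using j(1) by (auto simp: T_def)
        qed
        moreover have "T \<in> sets lebesgue" unfolding T_def by auto
        moreover have "emeasure lebesgue T \<le> ennreal B * content_term ?d C"
        proof -
          let ?m = "c * (s * (1 + norm w)) ^ DIM('a)"
          have "emeasure lebesgue T \<le> (\<Sum>j<N. emeasure lebesgue (cball (x + (real j / real N) *\<^sub>R w) (s * (1 + norm w))))"
            unfolding T_def by (rule emeasure_subadditive_finite) auto
          also have "\<dots> = (\<Sum>j<N. ennreal ?m)"
            using s by (intro sum.cong refl) (simp add: emeasure_cball c_def)
          also have "\<dots> = ennreal (real N * ?m)" using s c0 by (simp add: ennreal_mult ennreal_of_nat_eq_real_of_nat)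
          also have "real N * ?m \<le> (2 / s) * ?m" using N2 s c0 by (intro mult_right_mono) auto
          also have "(2 / s) * ?m = B * (unit_ball_vol (real ?d) * (s / 2) ^ ?d)"
          proof -
            have "s ^ DIM('a) = s * s ^ ?d" using dim by (metis Suc_1 Suc_diff_1 Suc_le_lessD less_trans lessI power_Suc zero_less_Suc DIM_positive)
            then have "(2 / s) * ?m = 2 * c * (1 + norm w) ^ DIM('a) * s ^ ?d" using s by (simp add: power_mult_distrib)
            also have "\<dots> = B * (v * s ^ ?d)" using v0 by (simp add: B_def)
            also have "v * s ^ ?d = unit_ball_vol (real ?d) * (s / 2) ^ ?d" by (simp add: v_def power_divide)
            finally show ?thesis .
          qed
          also have "ennreal (B * (unit_ball_vol (real ?d) * (s / 2) ^ ?d)) = ennreal B * content_term ?d C"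
          proof -
            have "content_term ?d C = ennreal (unit_ball_vol (real ?d) * (s / 2) ^ ?d)"
              using \<open>C \<noteq> {}\<close> by (simp add: content_term_def s_def)
            moreover have "B \<ge> 0" using c0 v0 by (simp add: B_def)
            ultimately show ?thesis using s by (simp only: ennreal_mult' )
          qed
          finally show ?thesis by (simp add: ennreal_leI)
        qed
        ultimately show ?thesis by blast
      qed
    qed
  qed
qed

text \<open>If \<open>A\<close> were null, it would have covers of arbitrarily small content, and by
  \<open>sweep_cover\<close> the ball would have arbitrarily small volume. Covers of mesh 1 suffice,
  since the content at mesh 1 is bounded by the measure.\<close>

lemma hausdorff_measure_pos_if_sweep:
  fixes A :: "'a::euclidean_space set"
  assumes dim: "DIM('a) \<ge> 2" and r: "r > 0" and sub: "ball y r \<subseteq> sweep A w"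
  shows "hausdorff_measure (DIM('a) - 1) A > 0"
proof (rule ccontr)
  let ?d = "DIM('a) - 1"
  assume "\<not> hausdorff_measure ?d A > 0"
  then have H0: "hausdorff_measure ?d A = 0" by simp
  obtain B where B: "B \<ge> 0" "\<And>C. bounded C \<Longrightarrow> diameter C \<le> 1 \<Longrightarrow>
    \<exists>T. T \<in> sets lebesgue \<and> sweep C w \<subseteq> T \<and> emeasure lebesgue T \<le> ennreal B * content_term ?d C"
    using sweep_cover[OF dim] by metis
  have "hausdorff_content ?d 1 A \<le> hausdorff_measure ?d A"
    unfolding hausdorff_measure_def by (rule SUP_upper) simp
  then have h0: "hausdorff_content ?d 1 A = 0" using H0 by simp
  have main: "emeasure lebesgue (ball y r) \<le> ennreal B * ennreal \<eta>" if \<eta>: "\<eta> > 0" for \<eta>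
  proof -
    have "(INF C \<in> {C. A \<subseteq> (\<Union>i. C i) \<and> (\<forall>i. bounded (C i) \<and> diameter (C i) \<le> 1)}. \<Sum>i::nat. content_term ?d (C i)) < ennreal \<eta>"
      unfolding hausdorff_content_alt[symmetric] h0 using \<eta> by simp
    then obtain C where C: "A \<subseteq> (\<Union>i. C i)" "\<And>i. bounded (C i)" "\<And>i. diameter (C i) \<le> 1" "(\<Sum>i::nat. content_term ?d (C i)) < ennreal \<eta>"
      unfolding INF_less_iff by blast
    obtain T where T: "\<And>i. T i \<in> sets lebesgue" "\<And>i. sweep (C i) w \<subseteq> T i" "\<And>i. emeasure lebesgue (T i) \<le> ennreal B * content_term ?d (C i)"
      using B(2)[OF C(2,3)] by metis
    have "sweep A w \<subseteq> (\<Union>i. T i)"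
    proof
      fix z assume "z \<in> sweep A w"
      then obtain f t where ft: "z = f + t *\<^sub>R w" "f \<in> A" "0 \<le> t" "t \<le> 1" by (auto simp: sweep_def)
      then obtain i where "f \<in> C i" using C(1) by blast
      then have "z \<in> sweep (C i) w" using ft by (auto simp: sweep_def)
      then show "z \<in> (\<Union>i. T i)" using T(2) by blast
    qed
    then have "emeasure lebesgue (ball y r) \<le> emeasure lebesgue (\<Union>i. T i)"
      using sub T(1) by (intro emeasure_mono) auto
    also have "\<dots> \<le> (\<Sum>i. emeasure lebesgue (T i))" using T(1) by (intro emeasure_subadditive_countably) auto
    also have "\<dots> \<le> (\<Sum>i. ennreal B * content_term ?d (C i))" by (intro suminf_le T(3)) auto
    also have "\<dots> = ennreal B * (\<Sum>i. content_term ?d (C i))" by simp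
    also have "\<dots> \<le> ennreal B * ennreal \<eta>" using C(4) by (intro mult_left_mono) auto
    finally show ?thesis .
  qed
  define b where "b = measure lebesgue (ball y r)"
  have b: "b > 0" using content_ball_pos[OF r, of y] by (simp add: b_def)
  have eb: "emeasure lebesgue (ball y r) = ennreal b" unfolding b_def by (simp add: emeasure_eq_measure2 fmeasurableD2)
  \<comment> \<open>Chosen with \<open>B * x < b\<close>; the summand 1 takes care of
    \<open>B = 0\<close>.\<close>
  define x where "x = b / (2 * (B + 1))"
  have x: "x > 0" using b B(1) by (simp add: x_def)
  have "ennreal b \<le> ennreal (B * x)"
    using main[OF x] B(1) x unfolding eb by (simp only: ennreal_mult less_imp_le)
  then have "b \<le> B * x" using B(1) x by (subst (asm) ennreal_le_iff) auto
  also have "B * x = B * (b / (2 * (B + 1)))" by (simp add: x_def)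
  also have "\<dots> = (B / (B + 1)) * (b / 2)" by simp
  also have "\<dots> \<le> 1 * (b / 2)" using B(1) b by (intro mult_right_mono) auto
  finally show False using b by simp
qed

lemma supp_fun_lipschitz:
  assumes K: "bounded K" "K \<noteq> {}" and r: "\<And>x. x \<in> K \<Longrightarrow> norm x \<le> r"
  shows "supp_fun K u \<le> supp_fun K v + r * norm (u - v)"
proof (rule supp_fun_least[OF K(2)])
  fix x assume x: "x \<in> K"
  have "u \<bullet> x = v \<bullet> x + (u - v) \<bullet> x" by (simp add: inner_diff_left)
  also have "(u - v) \<bullet> x \<le> norm (u - v) * norm x" by (rule norm_cauchy_schwarz)
  also have "\<dots> \<le> norm (u - v) * r" using r[OF x] by (intro mult_left_mono) auto
  finally show "u \<bullet> x \<le> supp_fun K v + r * norm (u - v)"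
    using supp_fun_upper[OF K(1) x, of v] by (simp add: mult.commute)
qed

lemma continuous_supp_fun:
  fixes K :: "'a::euclidean_space set"
  assumes K: "bounded K" "K \<noteq> {}"
  shows "continuous_on S (supp_fun K)"
proof -
  obtain r where r: "r > 0" "\<And>x. x \<in> K \<Longrightarrow> norm x \<le> r" using K(1) bounded_pos by metis
  have "dist (supp_fun K u) (supp_fun K v) \<le> r * dist u v" for u v
    using supp_fun_lipschitz[OF K r(2), of u v] supp_fun_lipschitz[OF K r(2), of v u]
    by (simp add: dist_norm norm_minus_commute)
  then have "r-lipschitz_on S (supp_fun K)" using r(1) by (intro lipschitz_onI) auto
  then show ?thesis by (rule lipschitz_on_continuous_on)
qed

text \<open>The slack \<open>supp_fun K v - v \<bullet> x\<close> is continuous and positive on the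
  compact set of unit vectors outside \<open>E\<close>, so it has a positive minimum.\<close>

lemma unique_normal_gap:
  fixes K :: "'a::euclidean_space set"
  assumes K: "compact K" and x: "x \<in> K" and uniq: "\<And>v. norm v = 1 \<Longrightarrow> x \<in> support_face K v \<Longrightarrow> v \<in> E"
    and E: "open E"
  obtains \<delta> where "\<delta> > 0" "\<And>v. norm v = 1 \<Longrightarrow> v \<notin> E \<Longrightarrow> v \<bullet> x + \<delta> \<le> supp_fun K v"
proof -
  define C where "C = sphere 0 1 - E"
  have ne: "K \<noteq> {}" using x by auto
  note up = supp_fun_upper[OF compact_imp_bounded[OF K]]
  have pos: "supp_fun K v - v \<bullet> x > 0" if "v \<in> C" for v
  proof (rule ccontr)
    assume "\<not> supp_fun K v - v \<bullet> x > 0"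
    then have "v \<bullet> x = supp_fun K v" using up[OF x, of v] by simp
    then have "x \<in> support_face K v" using x by (simp add: support_face_eq[OF K ne])
    moreover have "norm v = 1" "v \<notin> E" using that by (auto simp: C_def)
    ultimately show False using uniq by blast
  qed
  show ?thesis
  proof (cases "C = {}")
    case True
    show ?thesis by (rule that[of 1]) (use True in \<open>auto simp: C_def\<close>)
  next
    case False
    have "compact C" unfolding C_def by (intro compact_diff E compact_sphere)
    moreover have "continuous_on C (\<lambda>v. supp_fun K v - v \<bullet> x)"
      by (intro continuous_intros continuous_supp_fun compact_imp_bounded K ne)
    ultimately obtain v0 where v0: "v0 \<in> C" "\<And>v. v \<in> C \<Longrightarrow> supp_fun K v0 - v0 \<bullet> x \<le> supp_fun K v - v \<bullet> x"
      using continuous_attains_inf[OF _ False] by blast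
    show ?thesis
    proof (rule that[of "supp_fun K v0 - v0 \<bullet> x"])
      show "supp_fun K v0 - v0 \<bullet> x > 0" using pos v0(1) by blast
      fix v :: 'a assume "norm v = 1" "v \<notin> E"
      then have "v \<in> C" by (simp add: C_def)
      then show "v \<bullet> x + (supp_fun K v0 - v0 \<bullet> x) \<le> supp_fun K v" using v0(2) by fastforce
    qed
  qed
qed

lemma interior_lt_supp_fun:
  assumes K: "bounded K" and x: "ball x r \<subseteq> K" "r > 0" and v: "norm v = 1"
  shows "v \<bullet> x + r / 2 \<le> supp_fun K v"
proof -
  have "x + (r/2) *\<^sub>R v \<in> ball x r" using x(2) v by (simp add: dist_norm)
  then have "v \<bullet> (x + (r/2) *\<^sub>R v) \<le> supp_fun K v" using x by (intro supp_fun_upper K) auto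
  then show ?thesis using v by (simp add: inner_add_right dot_square_norm)
qed

lemma supporting_normal:
  fixes K :: "'a::euclidean_space set"
  assumes K: "convex K" "closed K" "interior K \<noteq> {}" and x: "x \<in> frontier K"
  obtains v where "norm v = 1" "x \<in> support_face K v"
proof -
  have xK: "x \<in> K" using x K(2) by (simp add: frontier_def)
  have "x \<notin> interior K" using x by (simp add: frontier_def)
  then have "x \<notin> rel_interior K" using rel_interior_nonempty_interior[OF K(3)] by simp
  then obtain a where a: "a \<noteq> 0" "\<And>y. y \<in> K \<Longrightarrow> a \<bullet> x \<le> a \<bullet> y"
    using supporting_hyperplane_rel_boundary[OF K(1) xK] by metis
  show ?thesis
  proof (rule that[of "- (1 / norm a) *\<^sub>R a"])
    show "norm (- (1 / norm a) *\<^sub>R a) = 1" using a(1) by simp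
    show "x \<in> support_face K (- (1 / norm a) *\<^sub>R a)"
      using xK a unfolding support_face_def by (auto simp: divide_right_mono)
  qed
qed

text \<open>Lifting \<open>x0\<close> by \<open>\<delta> / 2\<close> along \<open>u\<close> gives a
  point \<open>y\<close> that violates only supporting half-spaces with normal in \<open>E\<close>,
  and so do the points near it. A segment from the interior of \<open>K\<close> to such a point
  therefore leaves \<open>K\<close> where all outer normals are in \<open>E\<close>. Hence these
  boundary points sweep out a ball around \<open>y\<close>.\<close>

theorem surface_area_pos:
  fixes K :: "'a::euclidean_space set"
  assumes dim: "DIM('a) \<ge> 2" and K: "convex_body K"
    and x0: "x0 \<in> support_face K u" "norm u = 1" and uniq: "\<And>v. norm v = 1 \<Longrightarrow> x0 \<in> support_face K v \<Longrightarrow> v = u"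
    and E: "open E" "u \<in> E"
  shows "surface_area_measure K (E \<inter> sphere 0 1) > 0"
proof -
  have c: "compact K" "convex K" "closed K" "interior K \<noteq> {}" "K \<noteq> {}"
    using K interior_subset by (auto simp: convex_body_def compact_imp_closed)
  note up = supp_fun_upper[OF compact_imp_bounded[OF c(1)]]
  have x0K: "x0 \<in> K" using x0(1) by (simp add: support_face_def)
  obtain \<delta> where \<delta>: "\<delta> > 0" "\<And>v. norm v = 1 \<Longrightarrow> v \<notin> E \<Longrightarrow> v \<bullet> x0 + \<delta> \<le> supp_fun K v"
    using unique_normal_gap[OF c(1) x0K _ E(1)] uniq E(2) by metis
  define y where "y = x0 + (\<delta> / 2) *\<^sub>R u"
  obtain a \<rho> where a: "\<rho> > 0" "ball a \<rho> \<subseteq> K" using c(4) mem_interior by blast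
  define r where "r = min \<rho> (\<delta> / 2)"
  have r: "r > 0" "r \<le> \<rho>" "r \<le> \<delta> / 2" using a \<delta> by (auto simp: r_def)
  define w where "w = y - a"
  let ?A = "{x \<in> frontier K. \<exists>v\<in>E \<inter> sphere 0 1. norm v = 1 \<and> x \<in> support_face K v}"
  have hu: "supp_fun K u = u \<bullet> x0" using x0(1) by (simp add: support_face_eq[OF c(1,5)])
  have "ball y r \<subseteq> sweep ?A w"
  proof
    fix z assume "z \<in> ball y r"
    then have zy: "norm (z - y) < r" by (simp add: dist_norm norm_minus_commute)
    have ip: "v \<bullet> (z - y) < r" if "norm v = 1" for v
      using norm_cauchy_schwarz[of v "z - y"] that zy by simp
    \<comment> \<open>The inner end point moves along with \<open>z\<close>, so that all segments
      have the same direction \<open>w\<close>.\<close>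
    define a' where "a' = a + (z - y)"
    have a'i: "a' \<in> interior K"
    proof -
      have "a' \<in> ball a \<rho>" using zy r(2) by (simp add: a'_def dist_norm norm_minus_commute)
      then show ?thesis using a(2) by (meson interior_maximal open_ball subsetD)
    qed
    have zK: "z \<notin> K"
    proof
      assume "z \<in> K"
      then have "u \<bullet> z \<le> u \<bullet> x0" using up[of z u] unfolding hu by blast
      moreover have "u \<bullet> z = u \<bullet> x0 + \<delta> / 2 + u \<bullet> (z - y)"
        using x0(2) by (simp add: y_def inner_add_right inner_diff_right dot_square_norm)
      moreover have "u \<bullet> (y - z) < r" using norm_cauchy_schwarz[of u "y - z"] x0(2) zy by (simp add: norm_minus_commute)
      moreover have "u \<bullet> (y - z) = - (u \<bullet> (z - y))" by (simp add: inner_diff_right)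
      ultimately show False using r(3) by linarith
    qed
    have "closed_segment a' z \<inter> frontier K \<noteq> {}"
    proof (rule connected_Int_frontier)
      show "closed_segment a' z \<inter> K \<noteq> {}" using a'i interior_subset ends_in_segment(1)[of a' z] by blast
      show "closed_segment a' z - K \<noteq> {}" using zK ends_in_segment(2)[of a' z] by blast
    qed simp
    then obtain p where p: "p \<in> closed_segment a' z" "p \<in> frontier K" by blast
    obtain t where t: "0 \<le> t" "t \<le> 1" "p = (1 - t) *\<^sub>R a' + t *\<^sub>R z" using p(1) by (auto simp: in_segment)
    obtain v where v: "norm v = 1" "p \<in> support_face K v" using supporting_normal[OF c(2,3,4) p(2)] by blast
    have hv: "v \<bullet> p = supp_fun K v" using v(2) by (simp add: support_face_eq[OF c(1,5)])
    have "v \<in> E"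
    proof (rule ccontr)
      assume vE: "v \<notin> E"
      obtain s where s: "s > 0" "ball a' s \<subseteq> K" using a'i mem_interior by blast
      have 1: "v \<bullet> a' < supp_fun K v" using interior_lt_supp_fun[OF compact_imp_bounded[OF c(1)] s(2,1) v(1)] s(1) by simp
      have "v \<bullet> u \<le> 1" using norm_cauchy_schwarz[of v u] v(1) x0(2) by simp
      then have "(\<delta> / 2) * (v \<bullet> u) \<le> \<delta> / 2" using \<delta>(1) by simp
      moreover have "v \<bullet> z = v \<bullet> x0 + (\<delta> / 2) * (v \<bullet> u) + v \<bullet> (z - y)" by (simp add: y_def inner_add_right inner_diff_right)
      ultimately have 2: "v \<bullet> z < supp_fun K v" using ip[OF v(1)] \<delta>(2)[OF v(1) vE] r(3) by linarith
      have eq: "supp_fun K v = (1 - t) * (v \<bullet> a') + t * (v \<bullet> z)" using hv t(3) by (simp add: inner_add_right)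
      show False
      proof (cases "t = 1")
        case True then show ?thesis using eq 2 by simp
      next
        case False
        then have "(1 - t) * (v \<bullet> a') < (1 - t) * supp_fun K v" using t 1 by (intro mult_strict_left_mono) auto
        moreover have "t * (v \<bullet> z) \<le> t * supp_fun K v" using t 2 by (intro mult_left_mono) auto
        ultimately show ?thesis using eq by (simp add: algebra_simps)
      qed
    qed
    then have pA: "p \<in> ?A" using p(2) v by auto
    have "z = p + (1 - t) *\<^sub>R w" by (simp add: t(3) a'_def w_def algebra_simps)
    then show "z \<in> sweep ?A w" unfolding sweep_def using pA t(1,2) by (intro CollectI exI[of _ p] exI[of _ "1 - t"]) auto
  qed
  then show ?thesis unfolding surface_area_measure_def by (rule hausdorff_measure_pos_if_sweep[OF dim r(1)])
qed

section \<open>Approximation of smooth normals by facet normals\<close>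

lemma infdist_bdd_above:
  fixes K L :: "'a::euclidean_space set"
  assumes "bounded K" "L \<noteq> {}"
  shows "bdd_above ((\<lambda>x. infdist x L) ` K)"
proof -
  obtain l where l: "l \<in> L" using assms(2) by blast
  obtain r where r: "\<And>x. x \<in> K \<Longrightarrow> norm x \<le> r" using assms(1) bounded_iff by metis
  have "infdist x L \<le> r + norm l" if "x \<in> K" for x
    using infdist_le[OF l, of x] norm_triangle_ineq4[of x l] r[OF that] by (simp add: dist_norm)
  then show ?thesis by (intro bdd_aboveI2)
qed

lemma hausdorff_dist_lessD:
  fixes K L :: "'a::euclidean_space set"
  assumes K: "compact K" "K \<noteq> {}" and L: "compact L" "L \<noteq> {}" and e: "hausdorff_dist K L < e"
  shows "x \<in> K \<Longrightarrow> \<exists>y\<in>L. dist x y < e" and "y \<in> L \<Longrightarrow> \<exists>x\<in>K. dist x y < e"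
proof -
  assume x: "x \<in> K"
  have "infdist x L \<le> (SUP x\<in>K. infdist x L)"
    using x infdist_bdd_above[OF compact_imp_bounded[OF K(1)] L(2)] by (intro cSUP_upper)
  also have "\<dots> < e" using e by (simp add: hausdorff_dist_def)
  finally have "infdist x L < e" .
  moreover obtain y where "y \<in> L" "infdist x L = dist x y"
    using infdist_attains_inf[of L x] L compact_imp_closed by blast
  ultimately show "\<exists>y\<in>L. dist x y < e" by metis
next
  assume y: "y \<in> L"
  have "infdist y K \<le> (SUP x\<in>L. infdist x K)"
    using y infdist_bdd_above[OF compact_imp_bounded[OF L(1)] K(2)] by (intro cSUP_upper)
  also have "\<dots> < e" using e by (simp add: hausdorff_dist_def)
  finally have "infdist y K < e" .
  moreover obtain x where "x \<in> K" "infdist y K = dist y x"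
    using infdist_attains_inf[of K y] K compact_imp_closed by blast
  ultimately show "\<exists>x\<in>K. dist x y < e" by (metis dist_commute)
qed

lemma hausdorff_dist_leI:
  fixes K L :: "'a::euclidean_space set"
  assumes "K \<noteq> {}" "L \<noteq> {}" "\<And>x. x \<in> K \<Longrightarrow> \<exists>y\<in>L. dist x y \<le> e" "\<And>y. y \<in> L \<Longrightarrow> \<exists>x\<in>K. dist x y \<le> e"
  shows "hausdorff_dist K L \<le> e"
  unfolding hausdorff_dist_def
proof (rule max.boundedI)
  show "(SUP x\<in>K. infdist x L) \<le> e"
    using assms(1,3) by (intro cSUP_least) (auto intro: infdist_le2)
  show "(SUP x\<in>L. infdist x K) \<le> e"
  proof (rule cSUP_least[OF assms(2)])
    fix y assume "y \<in> L"
    then obtain x where "x \<in> K" "dist x y \<le> e" using assms(4) by blast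
    then show "infdist y K \<le> e" by (intro infdist_le2[of x]) (auto simp: dist_commute)
  qed
qed

lemma hausdorff_dist_nonneg:
  fixes K L :: "'a::euclidean_space set"
  assumes "K \<noteq> {}" "compact K" "L \<noteq> {}"
  shows "hausdorff_dist K L \<ge> 0"
proof -
  obtain x where x: "x \<in> K" using assms(1) by blast
  have "0 \<le> infdist x L" by (rule infdist_nonneg)
  also have "\<dots> \<le> (SUP x\<in>K. infdist x L)"
    using x infdist_bdd_above[OF compact_imp_bounded[OF assms(2)] assms(3)] by (intro cSUP_upper)
  finally show ?thesis by (simp add: hausdorff_dist_def)
qed

text \<open>If \<open>x\<close> were outside the convex set \<open>Q\<close>, moving from
  \<open>x\<close> away from its nearest point by a length between \<open>e\<close> and
  \<open>r\<close> would stay in the ball but end farther than \<open>e\<close> from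
  \<open>Q\<close>.\<close>

lemma inner_ball_point:
  fixes Q L :: "'a::euclidean_space set"
  assumes Q: "convex Q" "closed Q" "Q \<noteq> {}" and L: "ball x r \<subseteq> L" and er: "e < r" "0 < r"
    and near: "\<And>y. y \<in> L \<Longrightarrow> \<exists>q\<in>Q. dist y q \<le> e"
  shows "x \<in> Q"
proof (rule ccontr)
  assume x: "x \<notin> Q"
  define c where "c = closest_point Q x"
  have cQ: "c \<in> Q" unfolding c_def by (rule closest_point_in_set[OF Q(2,3)])
  then have xc: "x \<noteq> c" using x by auto
  define n where "n = (1 / norm (x - c)) *\<^sub>R (x - c)"
  have n1: "norm n = 1" using xc by (simp add: n_def)
  \<comment> \<open>The maximum is taken because \<open>e\<close> may be negative, while
    \<open>s\<close> has to be positive.\<close>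
  define s where "s = (max e 0 + r) / 2"
  have s: "0 < s" "s < r" "e < s" using er by (auto simp: s_def max_def)
  have "x + s *\<^sub>R n \<in> ball x r" using s n1 by (simp add: dist_norm)
  then obtain q where q: "q \<in> Q" "dist (x + s *\<^sub>R n) q \<le> e" using near L by blast
  have "(x - c) \<bullet> (q - c) \<le> 0" using closest_point_dot[OF Q(1,2) q(1), of x] by (simp add: c_def)
  then have 1: "n \<bullet> (q - c) \<le> 0" by (simp add: n_def divide_nonpos_nonneg)
  have 2: "n \<bullet> (x - c) > 0" using xc by (simp add: n_def)
  have "n \<bullet> (x + s *\<^sub>R n - q) \<le> norm n * norm (x + s *\<^sub>R n - q)" by (rule norm_cauchy_schwarz)
  also have "\<dots> \<le> e" using q(2) n1 by (simp add: dist_norm)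
  finally have "n \<bullet> (x - q) + s \<le> e" using n1 by (simp add: inner_add_right inner_diff_right dot_square_norm)
  moreover have "n \<bullet> (x - q) = n \<bullet> (x - c) - n \<bullet> (q - c)" by (simp add: inner_diff_right)
  ultimately show False using 1 2 s by linarith
qed

text \<open>Normals at regular boundary points. They are rigid enough to be approximated by facet
  normals of every approximating polytope, and numerous enough for their supporting half-spaces to
  cut out a convex body.\<close>

definition smooth_normal :: "'a::euclidean_space set \<Rightarrow> 'a \<Rightarrow> bool" where
  "smooth_normal K u \<longleftrightarrow> norm u = 1 \<and>
     (\<exists>x\<in>support_face K u. \<forall>v. norm v = 1 \<and> x \<in> support_face K v \<longrightarrow> v = u)"

text \<open>The smooth point \<open>p\<close> lifted by \<open>\<delta> / 2\<close> along
  \<open>u\<close> is outside \<open>Q k\<close> for large \<open>k\<close>, so a facet half-space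
  excludes it. A normal farther than \<epsilon> from \<open>u\<close> cannot do this, because its
  supporting half-space of \<open>L\<close> contains the lifted point with margin
  \<open>\<delta> / 2\<close>.\<close>

lemma facet_normals_approximate:
  fixes L :: "'a::euclidean_space set" and Q :: "nat \<Rightarrow> 'a set"
  assumes L: "convex_body L" and u: "smooth_normal L u"
    and Q: "\<forall>\<^sub>F k in sequentially. polytope (Q k) \<and> Q k \<noteq> {}"
    and lim: "(\<lambda>k. hausdorff_dist (Q k) L) \<longlonglongrightarrow> 0" and \<epsilon>: "\<epsilon> > 0"
  shows "\<forall>\<^sub>F k in sequentially. interior (Q k) \<noteq> {} \<and> (\<exists>v\<in>facet_normals (Q k). norm (v - u) < \<epsilon>)"
proof -
  have c: "compact L" "convex L" "interior L \<noteq> {}" "L \<noteq> {}"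
    using L interior_subset by (auto simp: convex_body_def)
  have u1: "norm u = 1" using u by (simp add: smooth_normal_def)
  obtain p where p: "p \<in> support_face L u" "\<And>v. norm v = 1 \<Longrightarrow> p \<in> support_face L v \<Longrightarrow> v = u"
    using u unfolding smooth_normal_def by blast
  have pL: "p \<in> L" using p(1) by (simp add: support_face_def)
  have hp: "u \<bullet> p = supp_fun L u" using p(1) by (simp add: support_face_eq[OF c(1,4)])
  have uE: "u \<in> ball u \<epsilon>" using \<epsilon> by simp
  obtain \<delta> where \<delta>: "\<delta> > 0" "\<And>v. norm v = 1 \<Longrightarrow> v \<notin> ball u \<epsilon> \<Longrightarrow> v \<bullet> p + \<delta> \<le> supp_fun L v"
    using unique_normal_gap[OF c(1) pL _ open_ball, of u \<epsilon>] p(2) uE by metis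
  obtain x r where x: "r > 0" "ball x r \<subseteq> L" using c(3) mem_interior by blast
  \<comment> \<open>The part \<open>\<delta> / 4\<close> is below both margins
    \<open>\<delta> / 2\<close>: of the lifted point above \<open>L\<close>, and of the half-spaces
    with far normals. The part \<open>r / 2\<close> leaves a ball inside \<open>Q k\<close>.\<close>
  define e where "e = min (\<delta> / 4) (r / 2)"
  have e: "e > 0" "e \<le> \<delta> / 4" "e \<le> r / 2" using \<delta>(1) x(1) by (auto simp: e_def)
  have "\<forall>\<^sub>F k in sequentially. hausdorff_dist (Q k) L < e" using order_tendstoD(2)[OF lim e(1)] .
  with Q show ?thesis
  proof eventually_elim
    case (elim k)
    then have Qk: "polytope (Q k)" "Q k \<noteq> {}" "hausdorff_dist (Q k) L < e" by auto
    have cQ: "compact (Q k)" "convex (Q k)" using Qk polytope_imp_compact polytope_imp_convex by auto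
    note near = hausdorff_dist_lessD[OF cQ(1) Qk(2) c(1,4) Qk(3)]
    have near': "\<exists>q\<in>Q k. dist y q \<le> e" if "y \<in> L" for y
      using near(2)[OF that] by (metis dist_commute less_imp_le)
    have "ball x (r / 4) \<subseteq> Q k"
    proof
      fix y assume y: "y \<in> ball x (r / 4)"
      have "ball y (3 * r / 4) \<subseteq> L"
      proof
        fix z assume "z \<in> ball y (3 * r / 4)"
        then have "dist x z < r" using y dist_triangle[of x z y] by simp
        then show "z \<in> L" using x(2) by auto
      qed
      then show "y \<in> Q k"
        by (rule inner_ball_point[OF cQ(2) compact_imp_closed[OF cQ(1)] Qk(2) _ _ _ near']) (use e x in auto)
    qed
    then have int: "interior (Q k) \<noteq> {}"
      using x(1) interior_maximal[OF _ open_ball, of x "r/4" "Q k"] by (metis centre_in_ball divide_pos_pos empty_iff subsetD zero_less_numeral)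
    define y where "y = p + (\<delta> / 2) *\<^sub>R u"
    have "y \<notin> Q k"
    proof
      assume "y \<in> Q k"
      then obtain l where l: "l \<in> L" "dist y l < e" using near(1) by blast
      have "u \<bullet> (y - l) \<le> norm u * norm (y - l)" by (rule norm_cauchy_schwarz)
      also have "\<dots> < e" using l(2) u1 by (simp add: dist_norm)
      finally have "u \<bullet> y < u \<bullet> l + e" by (simp add: inner_diff_right)
      moreover have "u \<bullet> l \<le> u \<bullet> p" using supp_fun_upper[OF compact_imp_bounded[OF c(1)] l(1), of u] hp by simp
      moreover have "u \<bullet> y = u \<bullet> p + \<delta> / 2" using u1 by (simp add: y_def inner_add_right dot_square_norm)
      ultimately show False using e \<delta>(1) by linarith
    qed
    then obtain v where v: "v \<in> facet_normals (Q k)" "supp_fun (Q k) v < v \<bullet> y"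
      using facet_normal_separates[OF Qk(1) int] by metis
    have v1: "norm v = 1" using v(1) by (simp add: facet_normals_def)
    have "v \<in> ball u \<epsilon>"
    proof (rule ccontr)
      assume "v \<notin> ball u \<epsilon>"
      then have 1: "v \<bullet> p + \<delta> \<le> supp_fun L v" using \<delta>(2) v1 by blast
      obtain l where l: "l \<in> L" "v \<bullet> l = supp_fun L v" using supp_fun_attained[OF c(1,4)] by blast
      obtain q where q: "q \<in> Q k" "dist l q \<le> e" using near'[OF l(1)] by blast
      have "v \<bullet> (l - q) \<le> norm v * norm (l - q)" by (rule norm_cauchy_schwarz)
      also have "\<dots> \<le> e" using q(2) v1 by (simp add: dist_norm)
      finally have 2: "v \<bullet> l \<le> v \<bullet> q + e" by (simp add: inner_diff_right)
      have 3: "v \<bullet> q \<le> supp_fun (Q k) v" using supp_fun_upper[OF compact_imp_bounded[OF cQ(1)] q(1)] .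
      have "v \<bullet> u \<le> 1" using norm_cauchy_schwarz[of v u] v1 u1 by simp
      then have "(\<delta> / 2) * (v \<bullet> u) \<le> \<delta> / 2" using \<delta>(1) by simp
      then have "v \<bullet> y \<le> v \<bullet> p + \<delta> / 2" by (simp add: y_def inner_add_right)
      then show False using 1 2 3 l(2) v(2) e \<delta>(1) by linarith
    qed
    then have "norm (v - u) < \<epsilon>" by (simp add: dist_norm norm_minus_commute)
    then show ?case using int v(1) by blast
  qed
qed

lemma convex_body_difference_body:
  assumes K: "convex_body K" shows "convex_body (difference_body K)"
proof -
  have c: "compact K" "convex K" "interior K \<noteq> {}" "K \<noteq> {}"
    using K interior_subset by (auto simp: convex_body_def)
  have eq: "difference_body K = {x - y |x y. x \<in> K \<and> y \<in> K}" by (force simp: difference_body_def)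
  have 1: "compact (difference_body K)" unfolding eq using c(1) c(1) by (rule compact_differences)
  have 2: "convex (difference_body K)"
  proof -
    have "difference_body K = (\<Union>x\<in>K. \<Union>y\<in>K. {x - y})" unfolding eq by auto
    then show ?thesis using convex_differences[OF c(2,2)] by simp
  qed
  obtain y where y: "y \<in> K" using c(4) by blast
  have "(+) (- y) ` interior K \<subseteq> difference_body K" unfolding eq using y interior_subset by fastforce
  then have "(+) (- y) ` interior K \<subseteq> interior (difference_body K)"
    by (intro interior_maximal open_translation) auto
  then have "interior (difference_body K) \<noteq> {}" using c(3) by blast
  then show ?thesis using 1 2 by (simp add: convex_body_def)
qed

text \<open>Take a smooth point \<open>x\<close> of \<open>K\<close> and a point \<open>y\<close> of
  \<open>K\<close> minimizing \<open>u\<close>. Since the difference body contains the translate of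
  \<open>K\<close> by \<open>- y\<close>, every normal of it at \<open>x - y\<close> is a normal of
  \<open>K\<close> at \<open>x\<close>.\<close>

lemma smooth_normal_difference_body:
  assumes K: "convex_body K" and u: "smooth_normal K u"
  shows "smooth_normal (difference_body K) u"
proof -
  have c: "compact K" "K \<noteq> {}" using K interior_subset by (auto simp: convex_body_def)
  have eq: "difference_body K = {x - y |x y. x \<in> K \<and> y \<in> K}" by (force simp: difference_body_def)
  obtain x where x: "x \<in> support_face K u" "\<And>v. norm v = 1 \<Longrightarrow> x \<in> support_face K v \<Longrightarrow> v = u"
    using u unfolding smooth_normal_def by blast
  obtain y where y: "y \<in> K" "(- u) \<bullet> y = supp_fun K (- u)" using supp_fun_attained[OF c] by blast
  have ymin: "u \<bullet> y \<le> u \<bullet> z" if "z \<in> K" for z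
    using supp_fun_upper[OF compact_imp_bounded[OF c(1)] that, of "- u"] y(2) by simp
  have 1: "x - y \<in> support_face (difference_body K) u"
    unfolding support_face_def eq
  proof (intro CollectI conjI ballI)
    show "\<exists>x' y'. x - y = x' - y' \<and> x' \<in> K \<and> y' \<in> K" using x(1) y(1) unfolding support_face_def by blast
    fix z assume "z \<in> {x - y |x y. x \<in> K \<and> y \<in> K}"
    then obtain x' y' where z: "z = x' - y'" "x' \<in> K" "y' \<in> K" by blast
    have "u \<bullet> x' \<le> u \<bullet> x" using x(1) z(2) by (simp add: support_face_def)
    then show "u \<bullet> z \<le> u \<bullet> (x - y)" using ymin[OF z(3)] by (simp add: z(1) inner_diff_right)
  qed
  have 2: "v = u" if v: "norm v = 1" "x - y \<in> support_face (difference_body K) v" for v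
  proof (rule x(2)[OF v(1)])
    have xK: "x \<in> K" using x(1) by (simp add: support_face_def)
    have "v \<bullet> z \<le> v \<bullet> x" if "z \<in> K" for z
    proof -
      have "z - y \<in> difference_body K" unfolding eq using that y(1) by blast
      then have "v \<bullet> (z - y) \<le> v \<bullet> (x - y)" using v(2) by (simp add: support_face_def)
      then show ?thesis by (simp add: inner_diff_right)
    qed
    then show "x \<in> support_face K v" using xK by (simp add: support_face_def)
  qed
  show ?thesis unfolding smooth_normal_def using u 1 2 by (auto simp: smooth_normal_def)
qed

text \<open>Otherwise all boundary points of \<open>N\<close> with a normal near \<open>u\<close>
  would have a second normal and form a null set. But the surface area of \<open>N\<close> near
  \<open>u\<close> is at least half that of \<open>K\<close>, which is positive.\<close>

lemma smooth_normal_blaschke_body: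
  fixes K N :: "'a::euclidean_space set"
  assumes dim: "DIM('a) \<ge> 2" and K: "convex_body K" and N: "is_blaschke_body K N"
    and u: "smooth_normal K u" and \<epsilon>: "\<epsilon> > 0"
  obtains v where "smooth_normal N v" "norm (v - u) < \<epsilon>"
proof (rule ccontr)
  assume no: "\<not> thesis"
  obtain x where x: "x \<in> support_face K u" "\<And>v. norm v = 1 \<Longrightarrow> x \<in> support_face K v \<Longrightarrow> v = u"
    using u unfolding smooth_normal_def by blast
  let ?E = "ball u \<epsilon> \<inter> sphere 0 1"
  have Nb: "convex_body N" using N by (simp add: is_blaschke_body_def)
  have "surface_area_measure K ?E > 0"
    using surface_area_pos[OF dim K x(1) _ x(2) open_ball[of u \<epsilon>]] u \<epsilon> by (simp add: smooth_normal_def)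
  moreover have "surface_area_measure N ?E = ennreal (1/2) * surface_area_measure K ?E + ennreal (1/2) * surface_area_measure (uminus ` K) ?E"
    using N unfolding is_blaschke_body_def by (auto simp: borel_open borel_closed)
  ultimately have pos: "surface_area_measure N ?E > 0"
    by (metis add_pos_nonneg ennreal_less_zero_iff ennreal_zero_less_mult_iff half_gt_zero zero_le zero_less_one)
  have "{x \<in> frontier N. \<exists>v\<in>?E. norm v = 1 \<and> x \<in> support_face N v} \<subseteq>
      {x. \<exists>u v. norm u = 1 \<and> norm v = 1 \<and> u \<noteq> v \<and> x \<in> support_face N u \<and> x \<in> support_face N v}"
  proof
    fix x assume "x \<in> {x \<in> frontier N. \<exists>v\<in>?E. norm v = 1 \<and> x \<in> support_face N v}"
    then obtain v where v: "v \<in> ?E" "norm v = 1" "x \<in> support_face N v" by blast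
    have "norm (v - u) < \<epsilon>" using v(1) by (simp add: dist_norm norm_minus_commute)
    then have "\<not> smooth_normal N v" using no that by blast
    then obtain v' where "norm v' = 1" "x \<in> support_face N v'" "v' \<noteq> v"
      using v(2,3) unfolding smooth_normal_def by blast
    then show "x \<in> {x. \<exists>u v. norm u = 1 \<and> norm v = 1 \<and> u \<noteq> v \<and> x \<in> support_face N u \<and> x \<in> support_face N v}"
      using v(2,3) by blast
  qed
  then have "surface_area_measure N ?E \<le> hausdorff_measure (DIM('a) - 1)
      {x. \<exists>u v. norm u = 1 \<and> norm v = 1 \<and> u \<noteq> v \<and> x \<in> support_face N u \<and> x \<in> support_face N v}"
    unfolding surface_area_measure_def by (rule hausdorff_measure_mono)
  then show False using singular_points_null[OF Nb] pos by simp
qed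

lemma smooth_normals_approximated:
  fixes K :: "'a::euclidean_space set" and Q :: "nat \<Rightarrow> 'a set"
  assumes dim: "DIM('a) \<ge> 2" and K: "convex_body K"
    and Q: "\<forall>\<^sub>F k in sequentially. polytope (Q k) \<and> Q k \<noteq> {}"
    and lim: "(\<exists>N. is_blaschke_body K N \<and> (\<lambda>k. hausdorff_dist (Q k) N) \<longlonglongrightarrow> 0) \<or>
          (\<lambda>k. hausdorff_dist (Q k) (difference_body K)) \<longlonglongrightarrow> 0"
    and u: "smooth_normal K u" and \<epsilon>: "\<epsilon> > 0"
  shows "\<forall>\<^sub>F k in sequentially. interior (Q k) \<noteq> {} \<and> (\<exists>v\<in>facet_normals (Q k). norm (v - u) < \<epsilon>)"
  using lim
proof
  assume "\<exists>N. is_blaschke_body K N \<and> (\<lambda>k. hausdorff_dist (Q k) N) \<longlonglongrightarrow> 0"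
  then obtain N where N: "is_blaschke_body K N" "(\<lambda>k. hausdorff_dist (Q k) N) \<longlonglongrightarrow> 0" by blast
  have Nb: "convex_body N" using N(1) by (simp add: is_blaschke_body_def)
  obtain v where v: "smooth_normal N v" "norm (v - u) < \<epsilon> / 2"
    using smooth_normal_blaschke_body[OF dim K N(1) u, of "\<epsilon> / 2"] \<epsilon> by auto
  have "\<forall>\<^sub>F k in sequentially. interior (Q k) \<noteq> {} \<and> (\<exists>v'\<in>facet_normals (Q k). norm (v' - v) < \<epsilon> / 2)"
    using \<epsilon> by (intro facet_normals_approximate[OF Nb v(1) Q N(2)]) auto
  then show ?thesis
  proof eventually_elim
    case (elim k)
    then obtain v' where v': "v' \<in> facet_normals (Q k)" "norm (v' - v) < \<epsilon> / 2" by blast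
    have "norm (v' - u) \<le> norm (v' - v) + norm (v - u)" using norm_triangle_ineq[of "v' - v" "v - u"] by simp
    then have "norm (v' - u) < \<epsilon>" using v' v by simp
    then show ?case using elim v' by blast
  qed
next
  assume "(\<lambda>k. hausdorff_dist (Q k) (difference_body K)) \<longlonglongrightarrow> 0"
  then show ?thesis
    using facet_normals_approximate[OF convex_body_difference_body[OF K] smooth_normal_difference_body[OF K u] Q _ \<epsilon>] by blast
qed

section \<open>Circumscribed polytopes\<close>

text \<open>Regular points are found as contact points of inscribed balls: a ball inside
  \<open>K\<close> that touches the boundary at \<open>x\<close> determines the normal there. The
  centre is taken close to the point \<open>p\<close> at which the segment from an interior point
  \<open>a\<close> to \<open>y\<close> leaves \<open>K\<close>. The ball is then so small that its
  tangent hyperplane at the contact point separates \<open>y\<close>.\<close>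

lemma smooth_normal_separates:
  fixes K :: "'a::euclidean_space set"
  assumes K: "convex_body K" and y: "y \<notin> K"
  obtains u where "smooth_normal K u" "supp_fun K u < u \<bullet> y"
proof -
  have c: "compact K" "convex K" "closed K" "interior K \<noteq> {}" "K \<noteq> {}"
    using K interior_subset by (auto simp: convex_body_def compact_imp_closed)
  note bK = compact_imp_bounded[OF c(1)]
  obtain a where ai: "a \<in> interior K" using c(4) by blast
  then obtain \<rho> where \<rho>: "\<rho> > 0" "ball a \<rho> \<subseteq> K" using mem_interior by blast
  have aK: "a \<in> K" using ai interior_subset by blast
  have "closed_segment a y \<inter> frontier K \<noteq> {}"
  proof (rule connected_Int_frontier)
    show "closed_segment a y \<inter> K \<noteq> {}" using aK ends_in_segment(1)[of a y] by blast
    show "closed_segment a y - K \<noteq> {}" using y ends_in_segment(2)[of a y] by blast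
  qed simp
  then obtain p where p: "p \<in> closed_segment a y" "p \<in> frontier K" by blast
  have pK: "p \<in> K" using p(2) c(3) by (simp add: frontier_def)
  have pa: "p \<noteq> a" using p(2) ai by (auto simp: frontier_def)
  obtain \<tau> where \<tau>: "0 \<le> \<tau>" "\<tau> \<le> 1" "p = (1 - \<tau>) *\<^sub>R a + \<tau> *\<^sub>R y" using p(1) by (auto simp: in_segment)
  have "\<tau> \<noteq> 1" using \<tau>(3) pK y by auto
  have "\<tau> \<noteq> 0" using \<tau>(3) pa by auto
  then have \<tau>01: "0 < \<tau>" "\<tau> < 1" using \<tau> \<open>\<tau> \<noteq> 1\<close> by auto
  \<comment> \<open>The relative overshoot of \<open>y\<close> beyond the exit point:
    \<open>y - a\<close> is \<open>1 + \<kappa>\<close> times \<open>p - a\<close>.\<close>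
  define \<kappa> where "\<kappa> = 1 / \<tau> - 1"
  have \<kappa>: "\<kappa> > 0" using \<tau>01 by (simp add: \<kappa>_def)
  define D where "D = norm (p - a)"
  have D: "D > 0" using pa by (simp add: D_def)
  \<comment> \<open>Forces \<open>r * (1 + \<kappa>) < \<rho> * \<kappa> / 2\<close> for the radius
    \<open>r \<le> t * D\<close>. That is the inequality which finally puts \<open>y\<close> beyond
    the tangent hyperplane.\<close>
  define t where "t = min (1 / 2) (\<rho> * \<kappa> / (4 * D * (1 + \<kappa>)))"
  have t: "0 < t" "t \<le> 1 / 2" "t \<le> \<rho> * \<kappa> / (4 * D * (1 + \<kappa>))" using \<rho>(1) \<kappa> D by (auto simp: t_def)
  define c0 where "c0 = p + t *\<^sub>R (a - p)"
  have c0i: "c0 \<in> interior K"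
  proof -
    have "p - t *\<^sub>R (p - a) \<in> interior K"
      using mem_interior_convex_shrink[OF c(2) ai pK t(1)] t(2) by simp
    then show ?thesis by (simp add: c0_def algebra_simps)
  qed
  have fne: "frontier K \<noteq> {}" "closed (frontier K)" using p(2) by auto
  obtain x where x: "x \<in> frontier K" "infdist c0 (frontier K) = dist c0 x"
    using infdist_attains_inf[OF fne(2,1), of c0] by blast
  define r where "r = dist c0 x"
  have r_le: "r \<le> t * D"
  proof -
    have "r \<le> dist c0 p" using infdist_le[OF p(2), of c0] x(2) by (simp add: r_def)
    also have "\<dots> = t * D" using t(1) by (simp add: c0_def dist_norm D_def norm_minus_commute)
    finally show ?thesis .
  qed
  have r0: "r > 0"
  proof -
    have "c0 \<noteq> x" using c0i x(1) by (auto simp: frontier_def)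
    then show ?thesis by (simp add: r_def)
  qed
  have bK': "ball c0 r \<subseteq> K"
  proof (rule ccontr)
    assume "\<not> ball c0 r \<subseteq> K"
    then have "ball c0 r - K \<noteq> {}" by blast
    moreover have "ball c0 r \<inter> K \<noteq> {}" using r0 c0i interior_subset by (metis IntI centre_in_ball empty_iff subsetD)
    ultimately have "ball c0 r \<inter> frontier K \<noteq> {}" by (intro connected_Int_frontier) auto
    then obtain z where z: "z \<in> frontier K" "dist c0 z < r" by auto
    then show False using infdist_le[OF z(1), of c0] x(2) by (simp add: r_def)
  qed
  have bc: "cball c0 r \<subseteq> K" using closure_minimal[OF bK' c(3)] r0 by simp
  have xK: "x \<in> K" using x(1) c(3) by (simp add: frontier_def)
  \<comment> \<open>The farthest point of the ball in direction \<open>v\<close> belongs to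
    \<open>K\<close>, so \<open>v \<bullet> (x - c0)\<close> is at least \<open>r\<close>, the norm
    of \<open>x - c0\<close>: the equality case of the Cauchy-Schwarz inequality.\<close>
  have normal: "v = (1 / r) *\<^sub>R (x - c0)" if v: "norm v = 1" "x \<in> support_face K v" for v
  proof -
    have "c0 + r *\<^sub>R v \<in> K" using bc r0 v(1) by (intro subsetD[OF bc]) (simp add: dist_norm)
    then have "v \<bullet> (c0 + r *\<^sub>R v) \<le> v \<bullet> x" using v(2) by (simp add: support_face_def)
    then have 1: "r \<le> v \<bullet> (x - c0)" using v(1) by (simp add: inner_add_right inner_diff_right dot_square_norm)
    have xr: "norm (x - c0) = r" by (simp add: r_def dist_norm norm_minus_commute)
    have gen: "(norm (v - q))\<^sup>2 = (norm v)\<^sup>2 - 2 * (v \<bullet> q) + (norm q)\<^sup>2" for q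
      by (simp add: power2_norm_eq_inner inner_diff_left inner_diff_right inner_commute)
    have "(norm (v - (1 / r) *\<^sub>R (x - c0)))\<^sup>2 = (norm v)\<^sup>2 - 2 * (v \<bullet> ((1 / r) *\<^sub>R (x - c0))) + (norm ((1 / r) *\<^sub>R (x - c0)))\<^sup>2"
      by (rule gen)
    also have "\<dots> = 2 - 2 * (v \<bullet> (x - c0)) / r" using v(1) xr r0 by simp
    also have "\<dots> \<le> 0"
    proof -
      have "1 \<le> (v \<bullet> (x - c0)) / r" using 1 r0 by (simp add: le_divide_eq)
      then show ?thesis by simp
    qed
    finally show ?thesis by simp
  qed
  obtain u where u: "norm u = 1" "x \<in> support_face K u" using supporting_normal[OF c(2,3,4) x(1)] by blast
  have sm: "smooth_normal K u" unfolding smooth_normal_def using u normal by blast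
  have hu: "supp_fun K u = u \<bullet> x" using u(2) by (simp add: support_face_eq[OF c(1,5)])
  have ux: "u \<bullet> x = u \<bullet> c0 + r"
  proof -
    have "u \<bullet> (x - c0) = r"
      using normal[OF u] r0 u(1) by (metis (no_types, lifting) divide_inverse_commute dot_square_norm inner_scaleR_right
          mult.right_neutral nonzero_eq_divide_eq order_less_irrefl power2_eq_square scaleR_right_imp_eq inner_commute mult_cancel_right1 inverse_eq_divide)
    then show ?thesis by (simp add: inner_diff_right)
  qed
  have ha: "u \<bullet> a + \<rho> / 2 \<le> supp_fun K u" by (rule interior_lt_supp_fun[OF bK \<rho>(2,1) u(1)])
  define \<sigma> where "\<sigma> = (1 - t) * \<tau>"
  have \<sigma>: "0 < \<sigma>" "\<sigma> < \<tau>" using t \<tau>01 by (auto simp: \<sigma>_def)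
  have c0a: "c0 - a = \<sigma> *\<^sub>R (y - a)"
    by (simp add: c0_def \<tau>(3) \<sigma>_def algebra_simps)
  have d: "u \<bullet> (c0 - a) \<ge> \<rho> / 2 - r" using ha hu ux by (simp add: inner_diff_right)
  have rr: "r * (1 + \<kappa>) < \<rho> * \<kappa> / 2"
  proof -
    have "r * (1 + \<kappa>) \<le> t * D * (1 + \<kappa>)" using r_le \<kappa> by (intro mult_right_mono) auto
    also have "\<dots> = t * (D * (1 + \<kappa>))" by simp
    also have "\<dots> \<le> (\<rho> * \<kappa> / (4 * D * (1 + \<kappa>))) * (D * (1 + \<kappa>))" using t(3) D \<kappa> by (intro mult_right_mono) auto
    also have "\<dots> = \<rho> * \<kappa> / 4"
    proof -
      have "A / (4 * G) * G = A / 4" if "G > 0" for A G :: real using that by simp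
      from this[of "D * (1 + \<kappa>)" "\<rho> * \<kappa>"] show ?thesis using D \<kappa> by (simp only: mult.assoc) simp
    qed
    also have "\<dots> < \<rho> * \<kappa> / 2" using \<rho>(1) \<kappa> by simp
    finally show ?thesis .
  qed
  have dpos: "u \<bullet> (c0 - a) > 0"
  proof -
    have "r \<le> r * (1 + \<kappa>) / 1" using r0 \<kappa> by simp
    have "r * \<kappa> < \<rho> / 2 * \<kappa>" using rr r0 by (simp add: algebra_simps)
    then have "r < \<rho> / 2" using \<kappa> by simp
    then show ?thesis using d by simp
  qed
  have "u \<bullet> (y - a) = u \<bullet> (c0 - a) / \<sigma>" using c0a \<sigma>(1) by simp
  also have "\<dots> > u \<bullet> (c0 - a) / \<tau>" using dpos \<sigma> by (intro divide_strict_left_mono) auto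
  finally have "u \<bullet> (y - a) > u \<bullet> (c0 - a) * (1 + \<kappa>)" by (simp add: \<kappa>_def)
  moreover have "u \<bullet> (c0 - a) * \<kappa> \<ge> (\<rho> / 2 - r) * \<kappa>" using d \<kappa> by (intro mult_right_mono) auto
  moreover have "(\<rho> / 2 - r) * \<kappa> > r" using rr by (simp add: algebra_simps)
  ultimately have "u \<bullet> (y - a) > u \<bullet> (c0 - a) + r" by (simp add: algebra_simps)
  then have "u \<bullet> y > u \<bullet> x" using ux by (simp add: inner_diff_right)
  then show ?thesis using that sm hu by simp
qed

definition circumscribed :: "'a::euclidean_space set \<Rightarrow> 'a set \<Rightarrow> 'a set" where
  "circumscribed N K = {x. \<forall>v\<in>N. v \<bullet> x \<le> supp_fun K v}"

lemma subset_circumscribed: "bounded K \<Longrightarrow> K \<subseteq> circumscribed N K"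
  unfolding circumscribed_def using supp_fun_upper by blast

lemma polyhedron_halfspaces:
  fixes N :: "'a::euclidean_space set"
  assumes "finite N" shows "polyhedron {x. \<forall>v\<in>N. v \<bullet> x \<le> b v}"
proof -
  have "{x. \<forall>v\<in>N. v \<bullet> x \<le> b v} = \<Inter>((\<lambda>v. {x. v \<bullet> x \<le> b v}) ` N)" by auto
  then show ?thesis using assms by (auto intro: polyhedron_Inter polyhedron_halfspace_le)
qed

text \<open>A smooth normal \<open>u\<close> separates \<open>y\<close> from \<open>K\<close> by a
  gap \<open>g\<close>. Support function and inner product depend continuously on the normal, so a
  sufficiently close \<open>v\<close> still excludes a whole ball around \<open>y\<close>. A ball
  rather than the point is needed for the covering argument on a sphere.\<close>

lemma circumscribed_excludes:
  fixes K :: "'a::euclidean_space set" and N :: "nat \<Rightarrow> 'a set"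
  assumes K: "convex_body K"
    and N: "\<And>u \<epsilon>. smooth_normal K u \<Longrightarrow> \<epsilon> > 0 \<Longrightarrow> \<forall>\<^sub>F k in sequentially. \<exists>v\<in>N k. norm (v - u) < \<epsilon>"
    and y: "y \<notin> K"
  obtains d where "d > 0" "\<forall>\<^sub>F k in sequentially. ball y d \<inter> circumscribed (N k) K = {}"
proof -
  have bK: "bounded K" "K \<noteq> {}" using K interior_subset by (auto simp: convex_body_def compact_imp_bounded)
  obtain u where u: "smooth_normal K u" "supp_fun K u < u \<bullet> y" by (rule smooth_normal_separates[OF K y])
  obtain R where R: "R > 0" "\<And>x. x \<in> K \<Longrightarrow> norm x \<le> R" using bK(1) bounded_pos by metis
  have u1: "norm u = 1" using u(1) by (simp add: smooth_normal_def)
  define g where "g = u \<bullet> y - supp_fun K u"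
  have g: "g > 0" using u(2) by (simp add: g_def)
  define d where "d = min 1 (g / 4)"
  have d: "d > 0" "d \<le> 1" "d \<le> g / 4" using g by (auto simp: d_def)
  \<comment> \<open>Replacing \<open>u\<close> by \<open>v\<close> changes the support value by at
    most \<open>R * norm (v - u)\<close> and the inner product with \<open>z\<close> by at most
    \<open>(norm y + 1) * norm (v - u)\<close>; together this stays below
    \<open>g / 4\<close>.\<close>
  define \<epsilon> where "\<epsilon> = g / (4 * (R + norm y + 1))"
  have nn: "R + norm y + 1 > 0" using R(1) by (simp add: add_pos_nonneg)
  then have \<epsilon>: "\<epsilon> > 0" using g by (simp add: \<epsilon>_def)
  show ?thesis
  proof (rule that[OF d(1)])
    show "\<forall>\<^sub>F k in sequentially. ball y d \<inter> circumscribed (N k) K = {}"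
      using N[OF u(1) \<epsilon>]
    proof eventually_elim
      case (elim k)
      then obtain v where v: "v \<in> N k" "norm (v - u) < \<epsilon>" by blast
      have False if z: "z \<in> ball y d" "z \<in> circumscribed (N k) K" for z
      proof -
        have vz: "v \<bullet> z \<le> supp_fun K v" using z(2) v(1) by (simp add: circumscribed_def)
        have hv: "supp_fun K v \<le> supp_fun K u + R * norm (v - u)" by (rule supp_fun_lipschitz[OF bK R(2)])
        have yz: "norm (y - z) < d" using z(1) by (simp add: dist_norm)
        have "u \<bullet> (y - z) \<le> norm u * norm (y - z)" by (rule norm_cauchy_schwarz)
        then have 1: "u \<bullet> y \<le> u \<bullet> z + d" using yz u1 by (simp add: inner_diff_right)
        have "norm z \<le> norm y + 1" using norm_triangle_ineq4[of y "y - z"] yz d(2) by simp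
        then have zz: "norm (v - u) * norm z \<le> norm (v - u) * (norm y + 1)" by (intro mult_left_mono) auto
        have "(u - v) \<bullet> z \<le> norm (u - v) * norm z" by (rule norm_cauchy_schwarz)
        then have "u \<bullet> z \<le> v \<bullet> z + norm (v - u) * (norm y + 1)" using zz by (simp add: inner_diff_left norm_minus_commute)
        then have "u \<bullet> y \<le> supp_fun K u + norm (v - u) * (R + norm y + 1) + d"
          using 1 vz hv by (simp add: algebra_simps)
        also have "norm (v - u) * (R + norm y + 1) \<le> \<epsilon> * (R + norm y + 1)" using v(2) nn by (intro mult_right_mono) auto
        also have "\<epsilon> * (R + norm y + 1) = g / 4"
        proof -
          have "g / (4 * G) * G = g / 4" if "G > 0" for G :: real using that by simp
          then show ?thesis unfolding \<epsilon>_def using nn by blast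
        qed
        finally show False using d g g_def by linarith
      qed
      then show ?case by blast
    qed
  qed
qed

text \<open>Finitely many excluded balls cover the sphere of radius \<open>R\<close>. A convex set
  that contains \<open>K\<close> and misses the sphere has no point beyond it.\<close>

lemma circumscribed_bounded:
  fixes K :: "'a::euclidean_space set" and N :: "nat \<Rightarrow> 'a set"
  assumes K: "convex_body K"
    and N: "\<And>u \<epsilon>. smooth_normal K u \<Longrightarrow> \<epsilon> > 0 \<Longrightarrow> \<forall>\<^sub>F k in sequentially. \<exists>v\<in>N k. norm (v - u) < \<epsilon>"
    and R: "K \<subseteq> ball 0 R"
  shows "\<forall>\<^sub>F k in sequentially. circumscribed (N k) K \<subseteq> ball 0 R"
proof -
  have bK: "bounded K" "K \<noteq> {}" using K interior_subset by (auto simp: convex_body_def compact_imp_bounded)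
  have "\<exists>d>0. \<forall>\<^sub>F k in sequentially. ball y d \<inter> circumscribed (N k) K = {}" if "y \<in> sphere 0 R" for y
  proof -
    have "y \<notin> K" using that R by auto
    then show ?thesis using circumscribed_excludes[OF K N] by metis
  qed
  then obtain d where d: "\<And>y. y \<in> sphere 0 R \<Longrightarrow> d y > 0 \<and> (\<forall>\<^sub>F k in sequentially. ball y (d y) \<inter> circumscribed (N k) K = {})"
    by metis
  have "sphere 0 R \<subseteq> (\<Union>y\<in>sphere 0 R. ball y (d y))" using d by force
  then obtain C where C: "C \<subseteq> sphere 0 R" "finite C" "sphere 0 R \<subseteq> (\<Union>y\<in>C. ball y (d y))"
    using compactE_image[OF compact_sphere[of 0 R], of "sphere 0 R" "\<lambda>y. ball y (d y)"] by (metis open_ball)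
  have "\<forall>\<^sub>F k in sequentially. \<forall>y\<in>C. ball y (d y) \<inter> circumscribed (N k) K = {}"
    using C(1,2) d by (intro eventually_ball_finite) auto
  then show ?thesis
  proof eventually_elim
    case (elim k)
    then have dis: "sphere 0 R \<inter> circumscribed (N k) K = {}" using C(3) by blast
    obtain a where a: "a \<in> K" using bK(2) by blast
    show ?case
    proof
      fix z assume z: "z \<in> circumscribed (N k) K"
      show "z \<in> ball 0 R"
      proof (rule ccontr)
        assume "z \<notin> ball 0 R"
        have conv: "convex (circumscribed (N k) K)"
        proof -
          have "circumscribed (N k) K = (\<Inter>v\<in>N k. {x. v \<bullet> x \<le> supp_fun K v})" by (auto simp: circumscribed_def)
          then show ?thesis by (simp add: convex_INT convex_halfspace_le)
        qed
        have "closed_segment a z \<inter> frontier (ball 0 R) \<noteq> {}"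
        proof (rule connected_Int_frontier)
          show "closed_segment a z \<inter> ball 0 R \<noteq> {}" using a R ends_in_segment(1)[of a z] by blast
          show "closed_segment a z - ball 0 R \<noteq> {}" using \<open>z \<notin> ball 0 R\<close> ends_in_segment(2)[of a z] by blast
        qed simp
        moreover have "frontier (ball (0::'a) R) \<subseteq> sphere 0 R"
          using closure_minimal[OF ball_subset_cball closed_cball, of "0::'a" R] by (auto simp: frontier_def)
        moreover have "closed_segment a z \<subseteq> circumscribed (N k) K"
          using a subset_circumscribed[OF bK(1)] z by (intro closed_segment_subset[OF _ _ conv]) auto
        ultimately show False using dis by blast
      qed
    qed
  qed
qed

text \<open>Every point outside \<open>K\<close> is eventually excluded, so the indicator functions
  tend to 0 pointwise; eventual containment in one ball makes dominated convergence
  applicable.\<close>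

lemma circumscribed_measure:
  fixes K :: "'a::euclidean_space set" and N :: "nat \<Rightarrow> 'a set"
  assumes K: "convex_body K"
    and N: "\<And>u \<epsilon>. smooth_normal K u \<Longrightarrow> \<epsilon> > 0 \<Longrightarrow> \<forall>\<^sub>F k in sequentially. \<exists>v\<in>N k. norm (v - u) < \<epsilon>"
    and \<epsilon>: "\<epsilon> > 0"
  shows "\<forall>\<^sub>F k in sequentially. measure lebesgue (circumscribed (N k) K - K) < \<epsilon>"
proof -
  have cK: "compact K" "bounded K" using K by (auto simp: convex_body_def compact_imp_bounded)
  obtain R where R: "K \<subseteq> ball 0 R" using cK(2) bounded_subset_ballD by blast
  define T where "T k = (circumscribed (N k) K \<inter> cball 0 R) - K" for k
  have clos: "closed (circumscribed (N k) K)" for k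
  proof -
    have "circumscribed (N k) K = (\<Inter>v\<in>N k. {x. v \<bullet> x \<le> supp_fun K v})" by (auto simp: circumscribed_def)
    then show ?thesis by (auto intro: closed_halfspace_le)
  qed
  have Tm: "T k \<in> sets lborel" for k
    using clos[of k] compact_imp_closed[OF cK(1)] unfolding T_def sets_lborel by (intro sets.Diff sets.Int borel_closed) auto
  have "(\<lambda>k. integral\<^sup>L lborel (indicator (T k) :: 'a \<Rightarrow> real)) \<longlonglongrightarrow> integral\<^sup>L lborel (\<lambda>x::'a. 0::real)"
  proof (rule integral_dominated_convergence[where w = "indicator (cball 0 R) :: 'a \<Rightarrow> real"])
    show "integrable lborel (indicator (cball 0 R) :: 'a \<Rightarrow> real)"
      using emeasure_compact_finite[OF compact_cball[of "0::'a" R]] by (simp add: integrable_indicator_iff)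
    show "(\<lambda>x. 0::real) \<in> borel_measurable lborel" by simp
    show "(indicator (T k) :: 'a \<Rightarrow> real) \<in> borel_measurable lborel" for k using Tm by simp
    show "AE x in lborel. (\<lambda>k. indicator (T k) x :: real) \<longlonglongrightarrow> 0"
    proof (rule AE_I2)
      fix x :: 'a
      show "(\<lambda>k. indicator (T k) x :: real) \<longlonglongrightarrow> 0"
      proof (cases "x \<in> K")
        case True then show ?thesis by (simp add: T_def)
      next
        case False
        then obtain d where "d > 0" and "\<forall>\<^sub>F k in sequentially. ball x d \<inter> circumscribed (N k) K = {}"
          using circumscribed_excludes[OF K N] by metis
        then have "\<forall>\<^sub>F k in sequentially. indicator (T k) x = (0::real)"
        proof (elim eventually_mono)
          fix k assume "ball x d \<inter> circumscribed (N k) K = {}"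
          then have "x \<notin> circumscribed (N k) K" using \<open>d > 0\<close> centre_in_ball[of x d] by blast
          then show "indicator (T k) x = (0::real)" by (simp add: T_def)
        qed
        then show ?thesis by (rule tendsto_eventually)
      qed
    qed
    show "AE x in lborel. norm (indicator (T k) x :: real) \<le> indicator (cball 0 R) x" for k
      by (rule AE_I2) (auto simp: T_def indicator_def)
  qed
  then have "(\<lambda>k. measure lborel (T k)) \<longlonglongrightarrow> 0" using Tm by simp
  then have "\<forall>\<^sub>F k in sequentially. measure lborel (T k) < \<epsilon>" using \<epsilon> by (rule order_tendstoD(2))
  moreover have "\<forall>\<^sub>F k in sequentially. circumscribed (N k) K \<subseteq> ball 0 R"
    by (rule circumscribed_bounded[OF K _ R]) (rule N)
  ultimately show ?thesis
  proof eventually_elim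
    case (elim k)
    have "circumscribed (N k) K - K = T k" using elim(2) by (auto simp: T_def)
    then show ?case using elim(1) Tm by simp
  qed
qed

text \<open>At a relative interior point of a facet some constraint \<open>v\<close> is active, as
  the point would otherwise be interior to \<open>P\<close>. Extending segments beyond that point
  shows that \<open>v\<close> is active on the whole facet, and the uniqueness of facet normals
  gives \<open>v = u\<close>.\<close>

lemma facet_normals_halfspaces:
  fixes N :: "'a::euclidean_space set"
  assumes N: "finite N" "\<And>v. v \<in> N \<Longrightarrow> norm v = 1"
    and P: "P = {x. \<forall>v\<in>N. v \<bullet> x \<le> b v}" "compact P" "interior P \<noteq> {}"
  shows "facet_normals P \<subseteq> N"
proof
  fix u assume u: "u \<in> facet_normals P"
  let ?F = "support_face P u"
  have Pne: "P \<noteq> {}" using P(3) by auto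
  have u1: "norm u = 1" "?F facet_of P" using u by (auto simp: facet_normals_def)
  have Fc: "convex ?F" "?F \<noteq> {}" using u1(2) facet_of_imp_face_of face_of_imp_convex
    by (auto simp: facet_of_def dest: face_of_imp_convex)
  have "rel_interior ?F \<noteq> {}" using Fc rel_interior_eq_empty by blast
  then obtain x where x: "x \<in> rel_interior ?F" by blast
  then have xF: "x \<in> ?F" using rel_interior_subset by blast
  have xP: "x \<in> P" using xF by (simp add: support_face_def)
  have "\<exists>v\<in>N. v \<bullet> x = b v"
  proof (rule ccontr)
    assume "\<not> (\<exists>v\<in>N. v \<bullet> x = b v)"
    then have "\<And>v. v \<in> N \<Longrightarrow> v \<bullet> x < b v" using xP P(1) by force
    then have xU: "x \<in> (\<Inter>v\<in>N. {x. v \<bullet> x < b v})" by blast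
    have "open (\<Inter>v\<in>N. {x. v \<bullet> x < b v})" using N(1) by (intro open_INT) (auto simp: open_halfspace_lt)
    moreover have "(\<Inter>v\<in>N. {x. v \<bullet> x < b v}) \<subseteq> P" unfolding P(1) by (auto intro: less_imp_le)
    ultimately obtain e where e: "e > 0" "ball x e \<subseteq> P" using xU by (meson open_contains_ball order_trans)
    have "u \<bullet> x + e / 2 \<le> supp_fun P u" by (rule interior_lt_supp_fun[OF compact_imp_bounded[OF P(2)] e(2,1) u1(1)])
    moreover have "u \<bullet> x = supp_fun P u" using xF by (simp add: support_face_eq[OF P(2) Pne])
    ultimately show False using e(1) by simp
  qed
  then obtain v where v: "v \<in> N" "v \<bullet> x = b v" by blast
  have "?F \<subseteq> support_face P v"
  proof
    fix y assume y: "y \<in> ?F"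
    have yP: "y \<in> P" using y by (simp add: support_face_def)
    have "v \<bullet> y = b v"
    proof (rule ccontr)
      assume "v \<bullet> y \<noteq> b v"
      then have lt: "v \<bullet> y < b v" using yP P(1) v(1) by force
      obtain e where e: "e > 1" "(1 - e) *\<^sub>R y + e *\<^sub>R x \<in> ?F"
        using convex_rel_interior_iff[OF Fc] x y by blast
      have "v \<bullet> ((1 - e) *\<^sub>R y + e *\<^sub>R x) \<le> b v" using e(2) P(1) v(1) by (auto simp: support_face_def)
      then have "(1 - e) * (v \<bullet> y) + e * b v \<le> b v" by (simp add: inner_add_right v(2))
      then have "(e - 1) * (b v - v \<bullet> y) \<le> 0" by (simp add: algebra_simps)
      then show False using e(1) lt by (simp add: mult_le_0_iff)
    qed
    then show "y \<in> support_face P v" unfolding support_face_def using yP P(1) v(1) by auto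
  qed
  then have "v = u" using facet_normal_unique[OF P(2,3) u N(2)[OF v(1)]] by blast
  then show "u \<in> N" using v(1) by simp
qed

section \<open>Centroids, and volumes under small translations\<close>

lemma set_integral_translate:
  fixes A :: "'a::euclidean_space set"
  assumes A: "compact A"
  shows "(LINT x:(+) t ` A|lebesgue. x) = measure lebesgue A *\<^sub>R t + (LINT x:A|lebesgue. x)"
proof -
  have Ab: "A \<in> sets borel" using compact_imp_closed[OF A] by (rule borel_closed)
  have tAb: "(+) t ` A \<in> sets borel" using compact_imp_closed[OF compact_translation[OF A, of t]] by (rule borel_closed)
  have intA: "set_integrable lborel A (\<lambda>x. x)"
    unfolding set_integrable_def by (intro borel_integrable_compact A continuous_on_id)
  have intc: "set_integrable lborel A (\<lambda>x. t)"
    unfolding set_integrable_def by (intro borel_integrable_compact A continuous_on_const)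
  have leb: "(LINT x:B|lebesgue. x) = (LINT x:B|lborel. x)" if "B \<in> sets borel" for B :: "'a set"
    unfolding set_lebesgue_integral_def using that by (intro integral_completion) auto
  have "(LINT x:(+) t ` A|lborel. x) = (\<integral>x. indicator ((+) t ` A) x *\<^sub>R x \<partial>distr lborel borel ((+) t))"
    unfolding set_lebesgue_integral_def lborel_distr_plus by simp
  also have "\<dots> = (\<integral>x. indicator ((+) t ` A) (t + x) *\<^sub>R (t + x) \<partial>lborel)"
    using tAb by (intro integral_distr) auto
  also have "\<dots> = (LINT x:A|lborel. t + x)"
    unfolding set_lebesgue_integral_def by (intro Bochner_Integration.integral_cong) (auto simp: indicator_def)
  also have "\<dots> = (LINT x:A|lborel. t) + (LINT x:A|lborel. x)"
    by (rule set_integral_add(2)[OF intc intA])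
  also have "(LINT x:A|lborel. t) = measure lborel A *\<^sub>R t"
    unfolding set_lebesgue_integral_def using Ab emeasure_compact_finite[OF A] by (subst integral_scaleR_left) (auto simp: integrable_indicator_iff)
  finally show ?thesis using leb[OF Ab] leb[OF tAb] Ab by simp
qed

lemma centroid_translate:
  fixes A :: "'a::euclidean_space set"
  assumes A: "compact A" "measure lebesgue A > 0"
  shows "centroid ((+) t ` A) = t + centroid A"
  unfolding centroid_def set_integral_translate[OF A(1)] measure_translation
  using A(2) by (simp add: scaleR_add_right)

lemma convex_body_measure_pos:
  assumes "convex_body K" shows "measure lebesgue K > 0"
proof -
  obtain x e where x: "e > 0" "ball x e \<subseteq> K" using assms mem_interior unfolding convex_body_def by blast
  have "0 < measure lebesgue (ball x e)" using content_ball_pos[OF x(1), of x] by simp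
  also have "\<dots> \<le> measure lebesgue K"
    using assms lmeasurable_compact by (intro measure_mono_fmeasurable x(2)) (auto simp: convex_body_def)
  finally show ?thesis .
qed

text \<open>As \<open>B\<close> has centroid 0, the first moment of \<open>A\<close> comes from
  \<open>A - B\<close> alone, where the integrand has norm at most \<open>R\<close>.\<close>

lemma centroid_close:
  fixes A B :: "'a::euclidean_space set"
  assumes AB: "compact A" "compact B" "B \<subseteq> A" and pos: "measure lebesgue B > 0"
    and R: "A \<subseteq> cball 0 R" and B0: "centroid B = 0"
  shows "norm (centroid A) \<le> R * measure lebesgue (A - B) / measure lebesgue B"
proof -
  have m: "A \<in> lmeasurable" "B \<in> lmeasurable" using AB lmeasurable_compact by auto
  have D: "A - B \<in> lmeasurable" using m by (simp add: fmeasurable_Diff fmeasurableD)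
  have intg: "set_integrable lebesgue S (\<lambda>x. x)" if "S \<in> sets borel" "S \<subseteq> A" for S
  proof -
    have "set_integrable lborel A (\<lambda>x. x)"
      unfolding set_integrable_def by (intro borel_integrable_compact AB continuous_on_id)
    then have "set_integrable lborel S (\<lambda>x. x)" by (rule set_integrable_subset) (use that in auto)
    then show ?thesis unfolding set_integrable_def using that by (subst integrable_completion) auto
  qed
  have bA: "A \<in> sets borel" "B \<in> sets borel" using AB(1,2)[THEN compact_imp_closed] by (simp_all add: borel_closed)
  have "(LINT x:A|lebesgue. x) = (LINT x:B \<union> (A - B)|lebesgue. x)"
    using AB(3) by (simp add: Un_absorb1)
  also have "\<dots> = (LINT x:B|lebesgue. x) + (LINT x:A - B|lebesgue. x)"
    using AB(3) bA by (intro set_integral_Un intg) auto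
  also have "(LINT x:B|lebesgue. x) = 0" using B0 pos by (simp add: centroid_def)
  finally have eq: "(LINT x:A|lebesgue. x) = (LINT x:A - B|lebesgue. x)" by simp
  have "norm (LINT x:A - B|lebesgue. x) \<le> (\<integral>x. R * indicator (A - B) x \<partial>lebesgue)"
  proof -
    have 1: "integrable lebesgue (\<lambda>x. indicator (A - B) x *\<^sub>R x)"
      using intg[of "A - B"] bA by (auto simp: set_integrable_def)
    have 2: "integrable lebesgue (\<lambda>x. R * indicator (A - B) x)"
      using D by (auto simp: fmeasurable_def)
    have 3: "norm (indicator (A - B) x *\<^sub>R x) \<le> R * indicator (A - B) x" for x
      using R by (auto simp: indicator_def)
    show ?thesis
      unfolding set_lebesgue_integral_def
      by (rule order_trans[OF integral_norm_bound integral_mono[OF integrable_norm[OF 1] 2 3]])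
  qed
  also have "\<dots> = R * measure lebesgue (A - B)" using D fmeasurableD by simp
  finally have 1: "norm (LINT x:A|lebesgue. x) \<le> R * measure lebesgue (A - B)" using eq by simp
  have BA: "measure lebesgue B \<le> measure lebesgue A" using AB(3) m by (intro measure_mono_fmeasurable) (auto dest: fmeasurableD)
  have "norm (centroid A) = norm (LINT x:A|lebesgue. x) / measure lebesgue A"
    by (simp add: centroid_def)
  also have "\<dots> \<le> (R * measure lebesgue (A - B)) / measure lebesgue B"
    using 1 BA pos order_trans[OF norm_ge_zero 1] by (intro frac_le) auto
  finally show ?thesis .
qed

text \<open>A small translate of \<open>K\<close> lies in a thin parallel body. The opposite
  difference is a translate of the difference for \<open>- t\<close>, so one bound serves
  both.\<close>

lemma measure_translate_diff:
  fixes K :: "'a::euclidean_space set"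
  assumes K: "compact K" "K \<noteq> {}" and e: "e > 0"
  obtains d where "d > 0" "\<And>t. norm t \<le> d \<Longrightarrow> measure lebesgue ((+) t ` K - K) < e \<and> measure lebesgue (K - (+) t ` K) < e"
proof -
  obtain d where d: "d > 0" "measure lebesgue {y. infdist y K \<le> d} < measure lebesgue K + e"
    using measure_parallel_body[OF K e] by blast
  have mP: "{y. infdist y K \<le> d} \<in> lmeasurable" by (rule lmeasurable_compact[OF compact_parallel_body[OF K]])
  have mK: "(+) t ` K \<in> lmeasurable" for t by (intro measurable_translation lmeasurable_compact K)
  have mK0: "K \<in> lmeasurable" by (intro lmeasurable_compact K)
  have *: "measure lebesgue ((+) t ` K - K) < e" if t: "norm t \<le> d" for t
  proof -
    have "(+) t ` K - K \<subseteq> {y. infdist y K \<le> d} - K"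
    proof
      fix y assume y: "y \<in> (+) t ` K - K"
      then obtain x where x: "x \<in> K" "y = t + x" by blast
      then have "infdist y K \<le> d" using infdist_le[OF x(1), of y] t by (simp add: dist_norm)
      then show "y \<in> {y. infdist y K \<le> d} - K" using y by blast
    qed
    then have "measure lebesgue ((+) t ` K - K) \<le> measure lebesgue ({y. infdist y K \<le> d} - K)"
      using mP mK mK0 by (intro measure_mono_fmeasurable) (auto intro: fmeasurable_Diff fmeasurableD)
    also have "\<dots> = measure lebesgue {y. infdist y K \<le> d} - measure lebesgue K"
      using mP mK0 d(1) by (intro measurable_measure_Diff) (auto dest: fmeasurableD)
    finally show ?thesis using d(2) by simp
  qed
  have "measure lebesgue (K - (+) t ` K) < e" if t: "norm t \<le> d" for t
  proof -
    have "K - (+) t ` K = (+) t ` ((+) (- t) ` K - K)"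
    proof -
      have "(+) t ` ((+) (- t) ` K - K) = (+) t ` (+) (- t) ` K - (+) t ` K" by (intro image_set_diff) simp
      then show ?thesis by (simp add: image_image)
    qed
    then have "measure lebesgue (K - (+) t ` K) = measure lebesgue ((+) (- t) ` K - K)" by (simp only: measure_translation)
    then show ?thesis using *[of "- t"] t by simp
  qed
  then show ?thesis using that d(1) * by blast
qed

text \<open>The competitor is the circumscribed polytope with normals from \<open>Q k\<close>, moved
  to centroid 0. Its own facet areas form the vector \<open>a\<close>, admissible by
  \<open>minkowski_relation\<close>. The move is short because \<open>K\<close> already has centroid
  0 and the volumes are close.\<close>

theorem area_polytopes_approximate:
  fixes K :: "(real^'n) set" and Q :: "nat \<Rightarrow> (real^'n) set"
  assumes dim: "CARD('n) \<ge> 2" and K: "convex_body K" "centroid K = 0"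
    and Q: "\<forall>\<^sub>F k in sequentially. polytope (Q k) \<and> Q k \<noteq> {}"
    and lim: "(\<exists>N. is_blaschke_body K N \<and> (\<lambda>k. hausdorff_dist (Q k) N) \<longlonglongrightarrow> 0) \<or>
          (\<lambda>k. hausdorff_dist (Q k) (difference_body K)) \<longlonglongrightarrow> 0"
    and \<epsilon>: "\<epsilon> > 0"
  shows "\<forall>\<^sub>F k in sequentially. \<exists>a P. admissible_areas (facet_normals (Q k)) a \<and>
    is_area_polytope (facet_normals (Q k)) a P \<and> measure lebesgue (P - K) < \<epsilon> \<and> measure lebesgue (K - P) < \<epsilon>"
proof -
  have cK: "compact K" "convex K" "bounded K" "interior K \<noteq> {}" "K \<noteq> {}"
    using K(1) interior_subset by (auto simp: convex_body_def compact_imp_bounded)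
  have Kpos: "measure lebesgue K > 0" by (rule convex_body_measure_pos[OF K(1)])
  have mK: "K \<in> lmeasurable" using cK(1) by (rule lmeasurable_compact)
  have dim': "DIM(real^'n) \<ge> 2" using dim by simp
  note app = smooth_normals_approximated[OF dim' K(1) Q lim]
  have N: "\<forall>\<^sub>F k in sequentially. \<exists>v\<in>facet_normals (Q k). norm (v - u) < \<epsilon>" if "smooth_normal K u" "\<epsilon> > 0" for u \<epsilon>
    using app[OF that] by (rule eventually_mono) blast
  obtain R where R: "R > 0" "K \<subseteq> ball 0 R" using cK(3) bounded_subset_ballD by blast
  obtain d where d: "d > 0" "\<And>t. norm t \<le> d \<Longrightarrow> measure lebesgue ((+) t ` K - K) < \<epsilon> / 2 \<and> measure lebesgue (K - (+) t ` K) < \<epsilon> / 2"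
    using measure_translate_diff[OF cK(1,5), of "\<epsilon> / 2"] \<epsilon> by auto
  \<comment> \<open>The second bound is what turns \<open>centroid_close\<close> into a translation
    of length at most \<open>d\<close>.\<close>
  define \<eta> where "\<eta> = min (\<epsilon> / 2) (d * measure lebesgue K / R)"
  have \<eta>: "\<eta> > 0" using \<epsilon> d(1) Kpos R(1) by (simp add: \<eta>_def)
  \<comment> \<open>Any point outside \<open>K\<close> produces a smooth normal, and from one smooth
    normal \<open>app\<close> yields that the \<open>Q k\<close> eventually have interior points,
    hence finitely many facet normals.\<close>
  obtain y where "y \<notin> K" using cK(3) not_bounded_UNIV by (metis UNIV_eq_I)
  then obtain u0 where u0: "smooth_normal K u0" using smooth_normal_separates[OF K(1)] by metis
  have ints: "\<forall>\<^sub>F k in sequentially. interior (Q k) \<noteq> {}"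
    using app[OF u0 zero_less_one] by (rule eventually_mono) blast
  have ev1: "\<forall>\<^sub>F k in sequentially. measure lebesgue (circumscribed (facet_normals (Q k)) K - K) < \<eta>"
    by (rule circumscribed_measure[OF K(1) _ \<eta>]) (rule N)
  have ev2: "\<forall>\<^sub>F k in sequentially. circumscribed (facet_normals (Q k)) K \<subseteq> ball 0 R"
    by (rule circumscribed_bounded[OF K(1) _ R(2)]) (rule N)
  show ?thesis
    using ev1 ev2 ints Q
  proof eventually_elim
    case (elim k)
    define NN where "NN = facet_normals (Q k)"
    define T where "T = circumscribed NN K"
    have finN: "finite NN" unfolding NN_def using elim by (intro finite_facet_normals) auto
    have N1: "norm v = 1" if "v \<in> NN" for v using that by (simp add: NN_def facet_normals_def)
    have mT: "measure lebesgue (T - K) < \<eta>" and bT: "T \<subseteq> ball 0 R" using elim by (simp_all add: T_def NN_def)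
    have KT: "K \<subseteq> T" unfolding T_def by (rule subset_circumscribed[OF cK(3)])
    have polyT: "polytope T"
      unfolding polytope_eq_bounded_polyhedron
    proof
      show "polyhedron T" unfolding T_def circumscribed_def by (rule polyhedron_halfspaces[OF finN])
      show "bounded T" using bT bounded_ball bounded_subset by blast
    qed
    have cT: "compact T" using polyT by (rule polytope_imp_compact)
    have mTm: "T \<in> lmeasurable" using cT by (rule lmeasurable_compact)
    have Tpos: "measure lebesgue T > 0"
      using Kpos measure_mono_fmeasurable[OF KT fmeasurableD[OF mK] mTm] by linarith
    define c where "c = - centroid T"
    have nc: "norm c \<le> d"
    proof -
      have "T \<subseteq> cball 0 R" using bT ball_subset_cball by blast
      then have "norm (centroid T) \<le> R * measure lebesgue (T - K) / measure lebesgue K"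
        by (rule centroid_close[OF cT cK(1) KT Kpos _ K(2)])
      also have "\<dots> \<le> R * (d * measure lebesgue K / R) / measure lebesgue K"
        using mT R(1) Kpos by (intro divide_right_mono mult_left_mono) (auto simp: \<eta>_def)
      also have "\<dots> = d" using R(1) Kpos by simp
      finally show ?thesis by (simp add: c_def)
    qed
    define P where "P = (+) c ` T"
    have cP: "compact P" unfolding P_def using cT by (rule compact_translation)
    have polyP: "polytope P" unfolding P_def using polyT by (simp add: polytope_translation_eq)
    have intP: "interior P \<noteq> {}"
    proof -
      have "interior T \<noteq> {}" using cK(4) interior_mono[OF KT] by blast
      then show ?thesis by (simp add: P_def interior_translation)
    qed
    have cenP: "centroid P = 0" unfolding P_def centroid_translate[OF cT Tpos] c_def by simp
    have Peq: "P = {x. \<forall>v\<in>NN. v \<bullet> x \<le> supp_fun K v + v \<bullet> c}"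
    proof (intro equalityI subsetI)
      fix x assume "x \<in> P"
      then show "x \<in> {x. \<forall>v\<in>NN. v \<bullet> x \<le> supp_fun K v + v \<bullet> c}"
        by (auto simp: P_def T_def circumscribed_def inner_add_right)
    next
      fix x assume x: "x \<in> {x. \<forall>v\<in>NN. v \<bullet> x \<le> supp_fun K v + v \<bullet> c}"
      then have "x - c \<in> T" by (auto simp: T_def circumscribed_def inner_diff_right)
      then show "x \<in> P" unfolding P_def by (intro image_eqI[of _ _ "x - c"]) auto
    qed
    have fN: "facet_normals P \<subseteq> NN" by (rule facet_normals_halfspaces[OF finN N1 Peq cP intP])
    define a where "a v = (if v \<in> facet_normals P then enn2real (hausdorff_measure (CARD('n) - 1) (support_face P v)) else 0)" for v
    have "(\<Sum>v\<in>NN. a v *\<^sub>R v) = (\<Sum>v\<in>facet_normals P. a v *\<^sub>R v)"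
      using finN fN by (intro sum.mono_neutral_right) (auto simp: a_def)
    also have "\<dots> = 0" using minkowski_relation(2)[OF polyP intP] by (simp add: a_def)
    finally have adm: "admissible_areas NN a" by (auto simp: admissible_areas_def a_def)
    have areaP: "is_area_polytope NN a P"
      unfolding is_area_polytope_def
      using polyP intP cenP fN minkowski_relation(1)[OF polyP intP] by (auto simp: a_def)
    have mcK: "(+) c ` K \<in> lmeasurable" using mK by (rule measurable_translation)
    have mP: "P \<in> lmeasurable" using cP by (rule lmeasurable_compact)
    have PK: "measure lebesgue (P - (+) c ` K) = measure lebesgue (T - K)"
    proof -
      have "P - (+) c ` K = (+) c ` (T - K)" unfolding P_def by (intro image_set_diff[symmetric]) simp
      then show ?thesis by (simp only: measure_translation)
    qed
    have "measure lebesgue (P - K) \<le> measure lebesgue ((P - (+) c ` K) \<union> ((+) c ` K - K))"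
      using mP mcK mK by (intro measure_mono_fmeasurable) (auto intro!: fmeasurable_Diff fmeasurable.Un sets.Diff dest: fmeasurableD)
    also have "\<dots> \<le> measure lebesgue (P - (+) c ` K) + measure lebesgue ((+) c ` K - K)"
      using mP mcK mK by (intro measure_Un_le sets.Diff) (auto dest: fmeasurableD)
    also have "\<dots> < \<epsilon>" using PK mT d(2)[OF nc] by (simp add: \<eta>_def)
    finally have 1: "measure lebesgue (P - K) < \<epsilon>" .
    have "(+) c ` K \<subseteq> P" unfolding P_def using KT by blast
    then have "measure lebesgue (K - P) \<le> measure lebesgue (K - (+) c ` K)"
      using mP mcK mK by (intro measure_mono_fmeasurable fmeasurable_Diff) (auto intro!: sets.Diff dest: fmeasurableD)
    then have 2: "measure lebesgue (K - P) < \<epsilon>" using d(2)[OF nc] \<epsilon> by linarith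
    show ?case using adm areaP 1 2 unfolding NN_def by blast
  qed
qed

section \<open>Covariograms\<close>

text \<open>A point of the intersection for \<open>A\<close> that is lost for \<open>B\<close> lies
  in \<open>A - B\<close> or in its translate by \<open>x\<close>. The bound is uniform in
  \<open>x\<close>.\<close>

lemma covariogram_diff_le:
  fixes A B :: "'a::euclidean_space set"
  assumes A: "A \<in> lmeasurable" and B: "B \<in> lmeasurable"
  shows "\<bar>covariogram A x - covariogram B x\<bar> \<le> 2 * (measure lebesgue (A - B) + measure lebesgue (B - A))"
proof -
  have *: "covariogram A x \<le> covariogram B x + 2 * measure lebesgue (A - B)"
    if A: "A \<in> lmeasurable" and B: "B \<in> lmeasurable" for A B :: "'a set"
  proof -
    let ?T = "(+) x"
    have TA: "?T ` A \<in> lmeasurable" "?T ` B \<in> lmeasurable" using A B by (auto intro: measurable_translation)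
    have D: "A - B \<in> lmeasurable" "?T ` (A - B) \<in> lmeasurable"
      using A B by (auto intro!: measurable_translation fmeasurable_Diff fmeasurableD)
    have I: "B \<inter> ?T ` B \<in> lmeasurable" using B TA by (intro fmeasurable_Int_fmeasurable fmeasurableD) auto
    have "covariogram A x \<le> measure lebesgue ((B \<inter> ?T ` B) \<union> ((A - B) \<union> ?T ` (A - B)))"
      unfolding covariogram_def
    proof (rule measure_mono_fmeasurable)
      show "A \<inter> ?T ` A \<in> sets lebesgue" using A TA by (auto dest: fmeasurableD)
    qed (use I D in auto)
    also have "\<dots> \<le> measure lebesgue (B \<inter> ?T ` B) + (measure lebesgue (A - B) + measure lebesgue (?T ` (A - B)))"
      using I D by (intro order_trans[OF measure_Un_le] add_mono order_refl) (auto dest: fmeasurableD)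
    finally show ?thesis by (simp add: covariogram_def measure_translation)
  qed
  define p q where "p = measure lebesgue (A - B)" and "q = measure lebesgue (B - A)"
  have "0 \<le> p" "0 \<le> q" by (simp_all add: p_def q_def)
  have 1: "covariogram A x \<le> covariogram B x + 2 * p" using *[OF A B] by (simp add: p_def)
  have 2: "covariogram B x \<le> covariogram A x + 2 * q" using *[OF B A] by (simp add: q_def)
  have "covariogram A x - covariogram B x \<le> 2 * (p + q)" using 1 \<open>0 \<le> q\<close> by simp
  moreover have "- (covariogram A x - covariogram B x) \<le> 2 * (p + q)" using 2 \<open>0 \<le> p\<close> by simp
  ultimately show ?thesis unfolding p_def[symmetric] q_def[symmetric] by (rule abs_leI)
qed

text \<open>The change from \<open>y\<close> to \<open>x\<close> is controlled by the part of the
  translate by \<open>x\<close> outside the translate by \<open>y\<close>; its volume depends only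
  on \<open>x - y\<close>, which makes continuity uniform.\<close>

lemma covariogram_modulus:
  fixes K :: "'a::euclidean_space set"
  assumes K: "compact K" "K \<noteq> {}" and e: "e > 0"
  obtains d where "d > 0" "\<And>x y :: 'a. norm (x - y) \<le> d \<Longrightarrow> \<bar>covariogram K x - covariogram K y\<bar> < e"
proof -
  obtain d where d: "d > 0" "\<And>t. norm t \<le> d \<Longrightarrow> measure lebesgue ((+) t ` K - K) < e \<and> measure lebesgue (K - (+) t ` K) < e"
    using measure_translate_diff[OF K e] by blast
  have mK: "K \<in> lmeasurable" using K(1) by (rule lmeasurable_compact)
  have *: "covariogram K x < covariogram K y + e" if xy: "norm (x - y) \<le> d" for x y :: 'a
  proof -
    have m: "(+) x ` K \<in> lmeasurable" "(+) y ` K \<in> lmeasurable" using mK by (auto intro: measurable_translation)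
    have I: "K \<inter> (+) y ` K \<in> lmeasurable" "(+) x ` K - (+) y ` K \<in> lmeasurable"
      using mK m by (auto intro!: fmeasurable_Int_fmeasurable fmeasurable_Diff dest: fmeasurableD)
    have "covariogram K x \<le> measure lebesgue ((K \<inter> (+) y ` K) \<union> ((+) x ` K - (+) y ` K))"
      unfolding covariogram_def
    proof (rule measure_mono_fmeasurable)
      show "K \<inter> (+) x ` K \<in> sets lebesgue" using mK m by (auto dest: fmeasurableD)
    qed (use I in auto)
    also have "\<dots> \<le> covariogram K y + measure lebesgue ((+) x ` K - (+) y ` K)"
      unfolding covariogram_def using I by (intro measure_Un_le) (auto dest: fmeasurableD)
    also have "(+) x ` K - (+) y ` K = (+) y ` ((+) (x - y) ` K - K)"
    proof -
      have "(+) y ` ((+) (x - y) ` K - K) = (+) y ` (+) (x - y) ` K - (+) y ` K" by (intro image_set_diff) simp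
      then show ?thesis by (simp add: image_image)
    qed
    also have "measure lebesgue \<dots> = measure lebesgue ((+) (x - y) ` K - K)" by (rule measure_translation)
    also have "\<dots> < e" using d(2)[OF xy] by simp
    finally show ?thesis by simp
  qed
  show ?thesis
  proof (rule that[OF d(1)])
    fix x y :: 'a assume xy: "norm (x - y) \<le> d"
    then show "\<bar>covariogram K x - covariogram K y\<bar> < e"
      using *[OF xy] *[of y x] by (simp add: norm_minus_commute abs_less_iff)
  qed
qed

lemma covariogram_empty: "covariogram {} x = 0"
  by (simp add: covariogram_def)

lemma covariogram_zero: "covariogram K 0 = measure lebesgue K"
  by (simp add: covariogram_def)

lemma continuous_covariogram:
  fixes K :: "'a::euclidean_space set"
  assumes K: "compact K" shows "continuous_on S (covariogram K)"
proof (cases "K = {}")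
  case True
  then have "covariogram K = (\<lambda>_. 0)" by (simp add: covariogram_empty fun_eq_iff)
  then show ?thesis by simp
next
  case False
  show ?thesis
    unfolding continuous_on_iff
  proof (intro ballI allI impI)
    fix x :: 'a and e :: real assume "0 < e"
    then obtain d where "d > 0" "\<And>x y. norm (x - y) \<le> d \<Longrightarrow> \<bar>covariogram K x - covariogram K y\<bar> < e"
      using covariogram_modulus[OF K False] by metis
    then show "\<exists>d>0. \<forall>x'\<in>S. dist x' x < d \<longrightarrow> dist (covariogram K x') (covariogram K x) < e"
      by (intro exI[of _ d]) (auto simp: dist_norm)
  qed
qed

lemma covariogram_nonneg: "covariogram K x \<ge> 0"
  by (simp add: covariogram_def)

lemma covariogram_le:
  assumes "K \<in> lmeasurable" shows "covariogram K x \<le> measure lebesgue K"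
  unfolding covariogram_def using assms
  by (intro measure_mono_fmeasurable) (auto intro!: sets.Int dest: fmeasurableD measurable_translation)

lemma covariogram_outside:
  fixes K :: "(real^'n) set"
  assumes K: "K \<subseteq> unit_cube" and x: "\<not> (\<forall>i. \<bar>x $ i\<bar> \<le> 1)"
  shows "covariogram K x = 0"
proof -
  obtain i where i: "\<bar>x $ i\<bar> > 1" using x by (auto simp: not_le)
  have "K \<inter> (+) x ` K = {}"
  proof (rule ccontr)
    assume "K \<inter> (+) x ` K \<noteq> {}"
    then obtain y where y: "y \<in> K" "x + y \<in> K" by blast
    have "- 1/2 \<le> y $ i \<and> y $ i \<le> 1/2" "- 1/2 \<le> x $ i + y $ i \<and> x $ i + y $ i \<le> 1/2"
      using subsetD[OF K y(1)] subsetD[OF K y(2)] by (auto simp: unit_cube_def)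
    then show False using i by linarith
  qed
  then show ?thesis by (simp add: covariogram_def)
qed

section \<open>Compactness of families of convex sets, and volume under Hausdorff
  convergence\<close>

lemma unit_cube_cbox: "(unit_cube :: (real^'n) set) = cbox (\<chi> i. - 1/2) (\<chi> i. 1/2)"
  by (auto simp: unit_cube_def mem_box_cart)

text \<open>The distance functions of the sets are 1-Lipschitz and uniformly bounded, so a
  subsequence converges uniformly by the Arzela-Ascoli theorem. The limit \<open>h\<close> is the
  distance function of its zero set \<open>B\<close>. The argument runs on the convex hull of
  \<open>C\<close>, in which convex combinations of points of \<open>B\<close> stay.\<close>

theorem blaschke_selection:
  fixes A :: "nat \<Rightarrow> 'a::euclidean_space set"
  assumes C: "compact C" and A: "\<And>j. compact (A j)" "\<And>j. convex (A j)" "\<And>j. A j \<noteq> {}" "\<And>j. A j \<subseteq> C"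
  obtains s B where "strict_mono s" "compact B" "convex B" "B \<noteq> {}" "B \<subseteq> C"
    "\<And>e. e > 0 \<Longrightarrow> \<forall>\<^sub>F j in sequentially. (\<forall>x\<in>A (s j). \<exists>y\<in>B. dist x y < e) \<and> (\<forall>y\<in>B. \<exists>x\<in>A (s j). dist x y < e)"
proof -
  define C' where "C' = convex hull C"
  have C': "compact C'" "convex C'" "C \<subseteq> C'"
    unfolding C'_def using C by (auto intro: compact_convex_hull hull_inc)
  define f where "f j x = infdist x (A j)" for j x
  have att: "\<exists>p\<in>A j. f j x = dist x p" for j x
  proof -
    obtain p where "p \<in> A j" "infdist x (A j) = dist x p"
      using infdist_attains_inf[OF compact_imp_closed[OF A(1)] A(3)] by metis
    then show ?thesis by (auto simp: f_def)
  qed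
  have lip: "\<bar>f j x - f j y\<bar> \<le> dist x y" for j x y
    using infdist_triangle[of x "A j" y] infdist_triangle[of y "A j" x] unfolding f_def by (simp add: dist_commute)
  obtain M where M: "\<And>x. x \<in> C' \<Longrightarrow> norm x \<le> M" using compact_imp_bounded[OF C'(1)] bounded_iff by metis
  have bd: "norm (f j x) \<le> 2 * M" if "x \<in> C'" for j x
  proof -
    obtain a where a: "a \<in> A j" using A(3) by blast
    have "f j x \<le> dist x a" unfolding f_def by (rule infdist_le[OF a])
    also have "\<dots> \<le> norm x + norm a" by (simp add: dist_norm norm_triangle_ineq4)
    also have "\<dots> \<le> M + M" using M that a A(4) C'(3) by (intro add_mono) blast+
    finally show ?thesis using infdist_nonneg[of x "A j"] by (simp add: f_def)
  qed
  obtain h s where h: "continuous_on C' h" "strict_mono (s :: nat \<Rightarrow> nat)"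
    "\<And>e. 0 < e \<Longrightarrow> \<exists>N. \<forall>n x. n \<ge> N \<and> x \<in> C' \<longrightarrow> norm (f (s n) x - h x) < e"
  proof (rule Arzela_Ascoli[OF C'(1), of f "2 * M"])
    show "norm (f n x) \<le> 2 * M" if "x \<in> C'" for n x by (rule bd[OF that])
    show "\<exists>d>0. \<forall>n y. y \<in> C' \<and> norm (x - y) < d \<longrightarrow> norm (f n x - f n y) < e" if "x \<in> C'" "0 < e" for x e
      using lip that(2) by (intro exI[of _ e]) (auto simp: dist_norm intro: order_le_less_trans)
  qed blast
  have lim: "(\<lambda>n. f (s n) x) \<longlonglongrightarrow> h x" if "x \<in> C'" for x
    unfolding LIMSEQ_iff using h(3) that by blast
  have h0: "h x \<ge> 0" if "x \<in> C'" for x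
    by (rule LIMSEQ_le_const[OF lim[OF that]]) (auto simp: f_def infdist_nonneg)
  have hlip: "\<bar>h x - h y\<bar> \<le> dist x y" if "x \<in> C'" "y \<in> C'" for x y
  proof (rule LIMSEQ_le_const2)
    show "(\<lambda>n. \<bar>f (s n) x - f (s n) y\<bar>) \<longlonglongrightarrow> \<bar>h x - h y\<bar>" using lim that by (intro tendsto_intros) auto
  qed (use lip in blast)
  define B where "B = {x \<in> C'. h x = 0}"
  \<comment> \<open>Points of \<open>A (s n)\<close> nearest to \<open>x\<close> accumulate at some
    \<open>l\<close> with \<open>dist x l = h x\<close>, and \<open>h l = 0\<close> because these
    points approach \<open>l\<close>.\<close>
  have attained: "\<exists>p\<in>B. dist x p = h x" if x: "x \<in> C'" for x
  proof -
    have "\<forall>n. \<exists>p. p \<in> A (s n) \<and> f (s n) x = dist x p" using att by blast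
    from choice[OF this] obtain p where "\<forall>n. p n \<in> A (s n) \<and> f (s n) x = dist x (p n)" by blast
    then have p: "\<And>n. p n \<in> A (s n)" "\<And>n. f (s n) x = dist x (p n)" by blast+
    have pC: "p n \<in> C'" for n using p(1) A(4) C'(3) by blast
    obtain l t where l: "l \<in> C'" "strict_mono (t :: nat \<Rightarrow> nat)" "(p \<circ> t) \<longlonglongrightarrow> l"
      using C'(1) pC unfolding compact_def by metis
    have "(\<lambda>n. dist x (p (t n))) \<longlonglongrightarrow> dist x l" using l(3) by (intro tendsto_intros) (simp add: comp_def)
    moreover have "(\<lambda>n. f (s (t n)) x) \<longlonglongrightarrow> h x" using LIMSEQ_subseq_LIMSEQ[OF lim[OF x] l(2)] by (simp add: comp_def)
    ultimately have 1: "dist x l = h x" using p(2) by (simp add: LIMSEQ_unique)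
    have "(\<lambda>n. f (s (t n)) l) \<longlonglongrightarrow> h l" using LIMSEQ_subseq_LIMSEQ[OF lim[OF l(1)] l(2)] by (simp add: comp_def)
    moreover have "(\<lambda>n. f (s (t n)) l) \<longlonglongrightarrow> 0"
    proof (rule tendsto_sandwich[of "\<lambda>_. 0" _ _ "\<lambda>n. dist l (p (t n))"])
      show "\<forall>\<^sub>F n in sequentially. f (s (t n)) l \<le> dist l (p (t n))"
        unfolding f_def using p(1) by (intro always_eventually allI infdist_le)
      show "(\<lambda>n. dist l (p (t n))) \<longlonglongrightarrow> 0"
        using tendsto_dist[OF tendsto_const[of l] l(3)] by (simp add: comp_def)
    qed (auto simp: f_def infdist_nonneg)
    ultimately have "h l = 0" by (rule LIMSEQ_unique)
    then show ?thesis using l(1) 1 by (auto simp: B_def)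
  qed
  have Bne: "B \<noteq> {}"
  proof -
    obtain a where "a \<in> A 0" using A(3) by blast
    then have "a \<in> C'" using A(4) C'(3) by blast
    then show ?thesis using attained by blast
  qed
  have hB: "infdist x B = h x" if x: "x \<in> C'" for x
  proof (rule antisym)
    obtain p where "p \<in> B" "dist x p = h x" using attained[OF x] by blast
    then show "infdist x B \<le> h x" using infdist_le by metis
    show "h x \<le> infdist x B"
      unfolding infdist_notempty[OF Bne]
    proof (rule cINF_greatest[OF Bne])
      fix b assume "b \<in> B"
      then show "h x \<le> dist x b" using hlip[OF x, of b] by (simp add: B_def)
    qed
  qed
  have clB: "compact B"
  proof -
    have "closed {x \<in> C'. h x = 0}"
      using continuous_closed_preimage_constant[OF h(1) compact_imp_closed[OF C'(1)]] .
    then have "compact (C' \<inter> {x \<in> C'. h x = 0})" using C'(1) by (intro compact_Int_closed)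
    moreover have "C' \<inter> {x \<in> C'. h x = 0} = B" by (auto simp: B_def)
    ultimately show ?thesis by simp
  qed
  have fconv: "f j (a *\<^sub>R x + b *\<^sub>R y) \<le> a * f j x + b * f j y" if ab: "0 \<le> a" "0 \<le> b" "a + b = 1" for j a b x y
  proof -
    obtain p where p: "p \<in> A j" "f j x = dist x p" using att by blast
    obtain q where q: "q \<in> A j" "f j y = dist y q" using att by blast
    have "a *\<^sub>R p + b *\<^sub>R q \<in> A j" using A(2) p q ab by (auto simp: convex_def)
    then have "f j (a *\<^sub>R x + b *\<^sub>R y) \<le> dist (a *\<^sub>R x + b *\<^sub>R y) (a *\<^sub>R p + b *\<^sub>R q)" unfolding f_def by (rule infdist_le)
    also have "\<dots> = norm (a *\<^sub>R (x - p) + b *\<^sub>R (y - q))" by (simp add: dist_norm algebra_simps)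
    also have "\<dots> \<le> a * norm (x - p) + b * norm (y - q)"
      using norm_triangle_ineq[of "a *\<^sub>R (x - p)" "b *\<^sub>R (y - q)"] ab by simp
    finally show ?thesis by (simp add: p q dist_norm)
  qed
  have cvB: "convex B"
  proof (rule convexI)
    fix x y and a b :: real assume xy: "x \<in> B" "y \<in> B" and ab: "0 \<le> a" "0 \<le> b" "a + b = 1"
    have C: "x \<in> C'" "y \<in> C'" "h x = 0" "h y = 0" using xy by (auto simp: B_def)
    have zC: "a *\<^sub>R x + b *\<^sub>R y \<in> C'" using C C'(2) ab by (auto simp: convex_def)
    have "h (a *\<^sub>R x + b *\<^sub>R y) \<le> a * h x + b * h y"
    proof (rule LIMSEQ_le[OF lim[OF zC]])
      show "(\<lambda>n. a * f (s n) x + b * f (s n) y) \<longlonglongrightarrow> a * h x + b * h y"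
        by (intro tendsto_add tendsto_mult tendsto_const lim C(1,2))
    qed (use fconv ab in blast)
    then show "a *\<^sub>R x + b *\<^sub>R y \<in> B" using h0[OF zC] zC C by (simp add: B_def)
  qed
  have ev: "\<forall>\<^sub>F j in sequentially. (\<forall>x\<in>A (s j). \<exists>y\<in>B. dist x y < e) \<and> (\<forall>y\<in>B. \<exists>x\<in>A (s j). dist x y < e)" if e: "e > 0" for e
  proof -
    obtain N where N: "\<And>n x. n \<ge> N \<Longrightarrow> x \<in> C' \<Longrightarrow> norm (f (s n) x - h x) < e" using h(3)[OF e] by blast
    have "(\<forall>x\<in>A (s j). \<exists>y\<in>B. dist x y < e) \<and> (\<forall>y\<in>B. \<exists>x\<in>A (s j). dist x y < e)" if j: "j \<ge> N" for j
    proof (intro conjI ballI)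
      fix x assume x: "x \<in> A (s j)"
      then have xC: "x \<in> C'" using A(4) C'(3) by blast
      have "f (s j) x = 0" using x by (simp add: f_def)
      then have "h x < e" using N[OF j xC] by simp
      then show "\<exists>y\<in>B. dist x y < e" using attained[OF xC] by metis
    next
      fix y assume "y \<in> B"
      then have y: "y \<in> C'" "h y = 0" by (auto simp: B_def)
      have "f (s j) y < e" using N[OF j y(1)] y(2) by simp
      moreover obtain p where "p \<in> A (s j)" "f (s j) y = dist y p" using att by blast
      ultimately show "\<exists>x\<in>A (s j). dist x y < e" by (metis dist_commute)
    qed
    then show ?thesis by (auto simp: eventually_sequentially)
  qed
  have BC: "B \<subseteq> C"
  proof
    fix y assume y: "y \<in> B"
    have "y \<in> closure C"
      unfolding closure_approachable
    proof (intro allI impI)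
      fix e :: real assume "0 < e"
      then obtain j where "\<forall>y\<in>B. \<exists>x\<in>A (s j). dist x y < e"
        using ev[of e] unfolding eventually_sequentially by blast
      then show "\<exists>x\<in>C. dist x y < e" using y A(4) by blast
    qed
    then show "y \<in> C" using compact_imp_closed[OF C] by simp
  qed
  show ?thesis by (rule that[OF h(2) clB cvB Bne BC ev])
qed

text \<open>As \<open>r\<close> tends to 0, the points of \<open>A\<close> at distance at least
  \<open>r\<close> from the complement exhaust the interior, which has full measure in a convex
  set.\<close>

lemma convex_inner_parallel_measure:
  fixes A :: "'a::euclidean_space set"
  assumes A: "compact A" "convex A" and e: "e > 0"
  obtains r where "r > 0" "\<And>A'. A' \<in> sets lebesgue \<Longrightarrow> (\<And>x. ball x r \<subseteq> A \<Longrightarrow> x \<in> A') \<Longrightarrow> measure lebesgue (A - A') < e"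
proof -
  have mA: "A \<in> lmeasurable" using A(1) by (rule lmeasurable_compact)
  define I where "I m = A \<inter> {x. infdist x (- A) \<ge> 1 / real (Suc m)}" for m
  have cA: "- A \<noteq> {}"
  proof
    assume "- A = {}"
    then have "A = UNIV" by blast
    then show False using compact_imp_bounded[OF A(1)] not_bounded_UNIV by simp
  qed
  have mI: "I m \<in> lmeasurable" for m
    unfolding I_def by (intro lmeasurable_compact compact_Int_closed A closed_Collect_le continuous_intros)
  have "(\<lambda>m. measure lebesgue (I m)) \<longlonglongrightarrow> measure lebesgue (\<Union>m. I m)"
  proof (rule Lim_measure_incseq)
    show "range I \<subseteq> sets lebesgue" using fmeasurableD[OF mI] by blast
    show "incseq I"
    proof (rule incseq_SucI, rule subsetI)
      fix m x assume "x \<in> I m"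
      moreover have "1 / real (Suc (Suc m)) \<le> 1 / real (Suc m)" by (intro frac_le) auto
      ultimately show "x \<in> I (Suc m)" unfolding I_def by (auto simp del: of_nat_Suc)
    qed
    have "(\<Union>m. I m) \<subseteq> A" by (auto simp: I_def)
    then have "emeasure lebesgue (\<Union>m. I m) \<le> emeasure lebesgue A" using fmeasurableD[OF mA] by (intro emeasure_mono)
    then show "emeasure lebesgue (\<Union>m. I m) \<noteq> \<infinity>" using fmeasurableD2[OF mA] by (auto simp: top_unique)
  qed
  moreover have "measure lebesgue (\<Union>m. I m) = measure lebesgue A"
  proof -
    have "(\<Union>m. I m) = interior A"
    proof (intro equalityI subsetI)
      fix x assume "x \<in> (\<Union>m. I m)"
      then obtain m where m: "infdist x (- A) \<ge> 1 / real (Suc m)" by (auto simp: I_def)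
      have "ball x (1 / real (Suc m)) \<subseteq> A"
      proof
        fix y assume y: "y \<in> ball x (1 / real (Suc m))"
        show "y \<in> A"
        proof (rule ccontr)
          assume "y \<notin> A"
          then have "infdist x (- A) \<le> dist x y" by (intro infdist_le) auto
          moreover have "dist x y < 1 / real (Suc m)" using y by simp
          ultimately show False using m by linarith
        qed
      qed
      then show "x \<in> interior A" unfolding mem_interior by (intro exI[of _ "1 / real (Suc m)"]) auto
    next
      fix x assume x: "x \<in> interior A"
      then have "x \<notin> closure (- A)" by (simp add: closure_complement)
      then have "infdist x (- A) \<noteq> 0" using in_closure_iff_infdist_zero[OF cA] by blast
      then have "infdist x (- A) > 0" using infdist_nonneg[of x "- A"] by linarith
      then obtain m where "1 / real (Suc m) < infdist x (- A)" using nat_approx_posE by blast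
      then have "x \<in> I m" using subsetD[OF interior_subset x] unfolding I_def by (intro IntI CollectI less_imp_le)
      then show "x \<in> (\<Union>m. I m)" by blast
    qed
    then show ?thesis
      using measure_interior[OF compact_imp_bounded[OF A(1)] negligible_convex_frontier[OF A(2)]] by simp
  qed
  ultimately have "\<forall>\<^sub>F m in sequentially. measure lebesgue (I m) > measure lebesgue A - e"
    using e by (intro order_tendstoD(1)) auto
  then obtain m where m: "measure lebesgue (I m) > measure lebesgue A - e" by (auto simp: eventually_sequentially)
  show ?thesis
  proof (rule that[of "1 / real (Suc m)"])
    fix A' assume A': "A' \<in> sets lebesgue" and sub: "\<And>x. ball x (1 / real (Suc m)) \<subseteq> A \<Longrightarrow> x \<in> A'"
    have "I m \<subseteq> A'"
    proof
      fix x assume x: "x \<in> I m"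
      show "x \<in> A'"
      proof (rule sub, rule subsetI)
        fix y assume y: "y \<in> ball x (1 / real (Suc m))"
        show "y \<in> A"
        proof (rule ccontr)
          assume "y \<notin> A"
          then have "infdist x (- A) \<le> dist x y" by (intro infdist_le) auto
          moreover have "dist x y < 1 / real (Suc m)" using y by simp
          moreover have "infdist x (- A) \<ge> 1 / real (Suc m)" using x by (simp add: I_def)
          ultimately show False by linarith
        qed
      qed
    qed
    then have "measure lebesgue (A - A') \<le> measure lebesgue (A - I m)"
      using mA mI A' by (intro measure_mono_fmeasurable) (auto intro!: fmeasurable_Diff dest: fmeasurableD)
    also have "\<dots> = measure lebesgue A - measure lebesgue (I m)"
      using mA mI by (intro measurable_measure_Diff) (auto simp: I_def dest: fmeasurableD)
    finally show "measure lebesgue (A - A') < e" using m by linarith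
  qed simp
qed

text \<open>The excess \<open>A' - A\<close> lies in a thin parallel body of \<open>A\<close>. For
  the defect, \<open>inner_ball_point\<close> places in \<open>A'\<close> every point whose
  \<open>r\<close>-ball is contained in \<open>A\<close>; this is where convexity of
  \<open>A'\<close> is used.\<close>

lemma hausdorff_close_measure:
  fixes A :: "'a::euclidean_space set"
  assumes A: "compact A" "convex A" "A \<noteq> {}" and e: "e > 0"
  obtains d where "d > 0" "\<And>A'. compact A' \<Longrightarrow> convex A' \<Longrightarrow> A' \<noteq> {} \<Longrightarrow> (\<forall>x\<in>A'. \<exists>y\<in>A. dist x y < d) \<Longrightarrow>
    (\<forall>y\<in>A. \<exists>x\<in>A'. dist x y < d) \<Longrightarrow> measure lebesgue (A' - A) < e \<and> measure lebesgue (A - A') < e"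
proof -
  obtain d1 where d1: "d1 > 0" "measure lebesgue {y. infdist y A \<le> d1} < measure lebesgue A + e"
    using measure_parallel_body[OF A(1,3) e] by blast
  obtain r where r: "r > 0" "\<And>A'. A' \<in> sets lebesgue \<Longrightarrow> (\<And>x. ball x r \<subseteq> A \<Longrightarrow> x \<in> A') \<Longrightarrow> measure lebesgue (A - A') < e"
    using convex_inner_parallel_measure[OF A(1,2) e] by blast
  define d where "d = min d1 (r / 2)"
  have d: "d > 0" "d \<le> d1" "d \<le> r / 2" using d1 r by (auto simp: d_def)
  have mA: "A \<in> lmeasurable" using A(1) by (rule lmeasurable_compact)
  have mP: "{y. infdist y A \<le> d1} \<in> lmeasurable" by (rule lmeasurable_compact[OF compact_parallel_body[OF A(1,3)]])
  show ?thesis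
  proof (rule that[OF d(1)], intro conjI)
    fix A' :: "'a set" assume A': "compact A'" "convex A'" "A' \<noteq> {}" and n1: "\<forall>x\<in>A'. \<exists>y\<in>A. dist x y < d" and n2: "\<forall>y\<in>A. \<exists>x\<in>A'. dist x y < d"
    have mA': "A' \<in> lmeasurable" using A'(1) by (rule lmeasurable_compact)
    have "A' - A \<subseteq> {y. infdist y A \<le> d1} - A"
    proof
      fix x assume x: "x \<in> A' - A"
      then obtain y where "y \<in> A" "dist x y < d" using n1 by blast
      then have "infdist x A \<le> d1" using infdist_le[of y A x] d by linarith
      then show "x \<in> {y. infdist y A \<le> d1} - A" using x by blast
    qed
    then have "measure lebesgue (A' - A) \<le> measure lebesgue ({y. infdist y A \<le> d1} - A)"
      using mP mA mA' by (intro measure_mono_fmeasurable) (auto intro!: fmeasurable_Diff sets.Diff dest: fmeasurableD)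
    also have "\<dots> = measure lebesgue {y. infdist y A \<le> d1} - measure lebesgue A"
      using mP mA d1(1) by (intro measurable_measure_Diff) (auto dest: fmeasurableD)
    finally show "measure lebesgue (A' - A) < e" using d1(2) by linarith
    show "measure lebesgue (A - A') < e"
    proof (rule r(2)[OF fmeasurableD[OF mA']])
      fix x assume "ball x r \<subseteq> A"
      then show "x \<in> A'"
      proof (rule inner_ball_point[OF A'(2) compact_imp_closed[OF A'(1)] A'(3), of x r A d])
        show "d < r" "0 < r" using d r(1) by auto
        show "\<exists>q\<in>A'. dist y q \<le> d" if "y \<in> A" for y using n2 that by (metis dist_commute less_imp_le)
      qed
    qed
  qed
qed

section \<open>Stability of the determination by the covariogram\<close>

text \<open>The average over all sample points: the sample points are \<open>int_grid k\<close>
  scaled by \<open>1 / k\<close>, and the denominator is their number. The least squares objective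
  is a multiple of such a mean.\<close>

definition grid_mean :: "nat \<Rightarrow> (real^'n \<Rightarrow> real) \<Rightarrow> real" where
  "grid_mean k f = (\<Sum>v\<in>int_grid k. f ((1 / real k) *\<^sub>R v)) / (2 * real k + 1) ^ CARD('n)"

lemma finite_int_grid: "finite (int_grid k :: (real^'n) set)"
proof (rule finite_subset[OF _ finite_int_vectors])
  show "(int_grid k :: (real^'n) set) \<subseteq> {v. (\<forall>b\<in>Basis. v \<bullet> b \<in> \<int>) \<and> norm v \<le> real CARD('n) * real k}"
  proof
    fix v :: "real^'n" assume v: "v \<in> int_grid k"
    have "norm v \<le> (\<Sum>i\<in>UNIV. \<bar>v $ i\<bar>)" by (rule norm_le_l1_cart)
    also have "\<dots> \<le> (\<Sum>i\<in>(UNIV::'n set). real k)" using v by (intro sum_mono) (auto simp: int_grid_def)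
    finally have "norm v \<le> real CARD('n) * real k" by simp
    then show "v \<in> {v. (\<forall>b\<in>Basis. v \<bullet> b \<in> \<int>) \<and> norm v \<le> real CARD('n) * real k}"
      using v by (auto simp: int_grid_def Basis_vec_def inner_axis)
  qed
qed

text \<open>In each coordinate an interval of length \<open>2 k \<delta>\<close> contains at least
  \<open>k \<delta>\<close> integers; the factor 2 absorbs the rounding because
  \<open>k \<delta> \<ge> 1\<close>.\<close>

lemma grid_count:
  fixes x0 :: "real^'n"
  assumes \<delta>: "\<delta> > 0" "real k * \<delta> \<ge> 1" and k: "k > 0" and x0: "\<And>i. \<bar>x0 $ i\<bar> + \<delta> \<le> 1"
  shows "(real k * \<delta>) ^ CARD('n) \<le> real (card {v \<in> int_grid k. \<forall>i. \<bar>((1 / real k) *\<^sub>R v - x0) $ i\<bar> \<le> \<delta>})"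
proof -
  define m where "m = nat \<lfloor>real k * \<delta>\<rfloor> + 1"
  have m: "real k * \<delta> \<le> real m" "real m \<le> real k * \<delta> + 1"
    using \<delta> unfolding m_def by (simp_all, linarith+)
  define V where "V o' = (\<chi> i. real_of_int \<lceil>real k * (x0 $ i - \<delta>)\<rceil> + real (o' i))" for o' :: "'n \<Rightarrow> nat"
  define O' where "O' = ((UNIV :: 'n set) \<rightarrow>\<^sub>E {..<m})"
  have inj: "inj_on V O'"
  proof (rule inj_onI)
    fix p q assume "V p = V q"
    then have "V p $ i = V q $ i" for i by simp
    then show "p = q" by (auto simp: V_def fun_eq_iff)
  qed
  have sub: "V ` O' \<subseteq> {v \<in> int_grid k. \<forall>i. \<bar>((1 / real k) *\<^sub>R v - x0) $ i\<bar> \<le> \<delta>}"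
  proof
    fix v assume "v \<in> V ` O'"
    then obtain p where p: "p \<in> O'" "v = V p" by blast
    have b: "real k * (x0 $ i - \<delta>) \<le> v $ i \<and> v $ i \<le> real k * (x0 $ i + \<delta>)" for i
    proof -
      have "p i < m" using p(1) by (auto simp: O'_def)
      then have "real (p i) \<le> real m - 1" by linarith
      moreover have "real k * (x0 $ i - \<delta>) \<le> of_int \<lceil>real k * (x0 $ i - \<delta>)\<rceil>" by linarith
      moreover have "of_int \<lceil>real k * (x0 $ i - \<delta>)\<rceil> \<le> real k * (x0 $ i - \<delta>) + 1" by linarith
      moreover have "real k * (x0 $ i + \<delta>) = real k * (x0 $ i - \<delta>) + 2 * (real k * \<delta>)" by (simp add: algebra_simps)
      moreover have "v $ i = of_int \<lceil>real k * (x0 $ i - \<delta>)\<rceil> + real (p i)" by (simp add: p(2) V_def)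
      ultimately show ?thesis using m(2) \<delta>(2) by linarith
    qed
    have b2: "x0 $ i - \<delta> \<le> v $ i / real k \<and> v $ i / real k \<le> x0 $ i + \<delta>" for i
      using b[of i] k by (simp add: field_simps)
    have "\<bar>v $ i\<bar> \<le> real k" for i
    proof -
      have "- 1 \<le> v $ i / real k" "v $ i / real k \<le> 1" using b2[of i] x0[of i] by linarith+
      then show ?thesis using k by (simp add: field_simps abs_le_iff)
    qed
    moreover have "v $ i \<in> \<int>" for i by (simp add: p(2) V_def)
    moreover have "\<bar>((1 / real k) *\<^sub>R v - x0) $ i\<bar> \<le> \<delta>" for i using b2[of i] by (simp add: abs_le_iff)
    ultimately show "v \<in> {v \<in> int_grid k. \<forall>i. \<bar>((1 / real k) *\<^sub>R v - x0) $ i\<bar> \<le> \<delta>}" by (simp add: int_grid_def)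
  qed
  have "(real k * \<delta>) ^ CARD('n) \<le> real m ^ CARD('n)" using m(1) \<delta> by (intro power_mono) auto
  also have "\<dots> = real (card O')" by (simp add: O'_def card_PiE)
  also have "card O' = card (V ` O')" using card_image[OF inj] by simp
  also have "card (V ` O') \<le> card {v \<in> int_grid k. \<forall>i. \<bar>((1 / real k) *\<^sub>R v - x0) $ i\<bar> \<le> \<delta>}"
    by (intro card_mono sub) (rule finite_subset[OF _ finite_int_grid[of k]], blast)
  finally show ?thesis by simp
qed

text \<open>If the continuous limit were nonzero at \<open>x0\<close>, it would be bounded away from
  0 on a small cube around \<open>x0\<close>. This cube contains a fixed proportion of the sample
  points, so the mean squares could not tend to 0.\<close>

lemma grid_mean_limit_zero:
  fixes \<phi> :: "real^'n \<Rightarrow> real" and \<psi> :: "nat \<Rightarrow> real^'n \<Rightarrow> real"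
  assumes r: "strict_mono (r :: nat \<Rightarrow> nat)" and cont: "continuous_on UNIV \<phi>"
    and unif: "\<And>e. e > 0 \<Longrightarrow> \<forall>\<^sub>F j in sequentially. \<forall>x. \<bar>\<psi> j x - \<phi> x\<bar> < e"
    and lim: "(\<lambda>j. grid_mean (r j) (\<lambda>x. (\<psi> j x)\<^sup>2)) \<longlonglongrightarrow> 0"
    and x0: "\<And>i. \<bar>x0 $ i\<bar> < 1"
  shows "\<phi> x0 = 0"
proof (rule ccontr)
  assume ne: "\<phi> x0 \<noteq> 0"
  define \<eta> where "\<eta> = \<bar>\<phi> x0\<bar>"
  have \<eta>: "\<eta> > 0" using ne by (simp add: \<eta>_def)
  obtain d where d: "d > 0" "\<And>x. dist x x0 < d \<Longrightarrow> dist (\<phi> x) (\<phi> x0) < \<eta> / 2"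
    using cont \<eta> unfolding continuous_on_iff by (metis UNIV_I half_gt_zero)
  define \<delta> where "\<delta> = min (d / (real CARD('n) + 1)) (Min (range (\<lambda>i. 1 - \<bar>x0 $ i\<bar>)))"
  have \<delta>: "\<delta> > 0" unfolding \<delta>_def using d(1) x0 by (auto simp: Min_gr_iff)
  have \<delta>1: "\<bar>x0 $ i\<bar> + \<delta> \<le> 1" for i
  proof -
    have "\<delta> \<le> Min (range (\<lambda>i. 1 - \<bar>x0 $ i\<bar>))" by (simp add: \<delta>_def)
    also have "\<dots> \<le> 1 - \<bar>x0 $ i\<bar>" by (rule Min_le) auto
    finally show ?thesis by simp
  qed
  have \<delta>d: "real CARD('n) * \<delta> < d"
  proof -
    have "real CARD('n) * \<delta> \<le> real CARD('n) * (d / (real CARD('n) + 1))" by (intro mult_left_mono) (auto simp: \<delta>_def)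
    also have "\<dots> < d" using d(1) by (simp add: field_simps)
    finally show ?thesis .
  qed
  have big: "\<bar>\<phi> x\<bar> \<ge> \<eta> / 2" if "\<And>i. \<bar>(x - x0) $ i\<bar> \<le> \<delta>" for x
  proof -
    have "dist x x0 \<le> (\<Sum>i\<in>UNIV. \<bar>(x - x0) $ i\<bar>)" unfolding dist_norm by (rule norm_le_l1_cart)
    also have "\<dots> \<le> (\<Sum>i\<in>(UNIV::'n set). \<delta>)" by (intro sum_mono that)
    finally have "dist x x0 < d" using \<delta>d by simp
    then have "\<bar>\<phi> x - \<phi> x0\<bar> < \<eta> / 2" using d(2) by (simp add: dist_real_def)
    then show ?thesis unfolding \<eta>_def by linarith
  qed
  \<comment> \<open>On the cube at least \<open>\<eta> / 4\<close> remains after the uniform error.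
    The proportion of grid points comes from \<open>(k \<delta>) ^ n\<close> points of the cube
    among at most \<open>(3 k) ^ n\<close>.\<close>
  define c where "c = (\<eta> / 4)\<^sup>2 * (\<delta> / 3) ^ CARD('n)"
  have c: "c > 0" using \<eta> \<delta> by (simp add: c_def)
  obtain N1 where N1: "\<And>j x. j \<ge> N1 \<Longrightarrow> \<bar>\<psi> j x - \<phi> x\<bar> < \<eta> / 4"
    using unif[of "\<eta> / 4"] \<eta> by (auto simp: eventually_sequentially)
  obtain N2 where N2: "\<And>j. j \<ge> N2 \<Longrightarrow> grid_mean (r j) (\<lambda>x. (\<psi> j x)\<^sup>2) < c"
    using order_tendstoD(2)[OF lim c] by (auto simp: eventually_sequentially)
  define j where "j = max (max N1 N2) (nat \<lceil>1 / \<delta>\<rceil> + 1)"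
  let ?k = "r j"
  have "j \<le> ?k" using r by (rule seq_suble)
  then have k: "?k > 0" "1 / \<delta> \<le> real ?k" unfolding j_def by linarith+
  then have k\<delta>: "real ?k * \<delta> \<ge> 1" using \<delta> by (simp add: field_simps)
  define S where "S = {v \<in> int_grid ?k. \<forall>i. \<bar>((1 / real ?k) *\<^sub>R v - x0) $ i\<bar> \<le> \<delta>}"
  have S: "(real ?k * \<delta>) ^ CARD('n) \<le> real (card S)" unfolding S_def by (rule grid_count[OF \<delta> k\<delta> k(1) \<delta>1])
  have "(real ?k * \<delta>) ^ CARD('n) * (\<eta> / 4)\<^sup>2 \<le> real (card S) * (\<eta> / 4)\<^sup>2" using S by (intro mult_right_mono) auto
  also have "\<dots> = (\<Sum>v\<in>S. (\<eta> / 4)\<^sup>2)" by simp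
  also have "\<dots> \<le> (\<Sum>v\<in>S. (\<psi> j ((1 / real ?k) *\<^sub>R v))\<^sup>2)"
  proof (rule sum_mono)
    fix v assume "v \<in> S"
    then have "\<bar>\<phi> ((1 / real ?k) *\<^sub>R v)\<bar> \<ge> \<eta> / 2" by (intro big) (auto simp: S_def)
    moreover have "\<bar>\<psi> j ((1 / real ?k) *\<^sub>R v) - \<phi> ((1 / real ?k) *\<^sub>R v)\<bar> < \<eta> / 4" by (rule N1) (simp add: j_def)
    ultimately have "\<eta> / 4 \<le> \<bar>\<psi> j ((1 / real ?k) *\<^sub>R v)\<bar>" by linarith
    then have "(\<eta> / 4)\<^sup>2 \<le> \<bar>\<psi> j ((1 / real ?k) *\<^sub>R v)\<bar>\<^sup>2" using \<eta> by (intro power_mono) auto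
    then show "(\<eta> / 4)\<^sup>2 \<le> (\<psi> j ((1 / real ?k) *\<^sub>R v))\<^sup>2" by simp
  qed
  also have "\<dots> \<le> (\<Sum>v\<in>int_grid ?k. (\<psi> j ((1 / real ?k) *\<^sub>R v))\<^sup>2)"
    by (intro sum_mono2 finite_int_grid) (auto simp: S_def)
  also have "\<dots> = grid_mean ?k (\<lambda>x. (\<psi> j x)\<^sup>2) * (2 * real ?k + 1) ^ CARD('n)"
    by (simp add: grid_mean_def)
  also have "\<dots> \<le> grid_mean ?k (\<lambda>x. (\<psi> j x)\<^sup>2) * (3 * real ?k) ^ CARD('n)"
    using k(1) by (intro mult_left_mono power_mono) (auto simp: grid_mean_def intro!: sum_nonneg divide_nonneg_nonneg)
  finally have "(real ?k * \<delta>) ^ CARD('n) * (\<eta> / 4)\<^sup>2 / (3 * real ?k) ^ CARD('n) \<le> grid_mean ?k (\<lambda>x. (\<psi> j x)\<^sup>2)"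
    using k(1) by (simp add: pos_divide_le_eq)
  also have "(real ?k * \<delta>) ^ CARD('n) * (\<eta> / 4)\<^sup>2 / (3 * real ?k) ^ CARD('n) = c"
    using k(1) by (simp add: c_def power_mult_distrib power_divide)
  finally have "c \<le> grid_mean ?k (\<lambda>x. (\<psi> j x)\<^sup>2)" .
  moreover have "N2 \<le> j" unfolding j_def by linarith
  ultimately show False using N2[of j] by simp
qed

text \<open>Beyond the closed cube both covariograms vanish, and its faces are reached from inside
  along rays through the origin by continuity.\<close>

lemma covariogram_eq_if_interior:
  fixes A K :: "(real^'n) set"
  assumes A: "compact A" "A \<subseteq> unit_cube" and K: "compact K" "K \<subseteq> unit_cube"
    and eq: "\<And>x. (\<And>i. \<bar>x $ i\<bar> < 1) \<Longrightarrow> covariogram A x = covariogram K x"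
  shows "covariogram A = covariogram K"
proof
  fix x :: "real^'n"
  show "covariogram A x = covariogram K x"
  proof (cases "\<forall>i. \<bar>x $ i\<bar> \<le> 1")
    case False
    then show ?thesis using covariogram_outside[OF A(2) False] covariogram_outside[OF K(2) False] by simp
  next
    case True
    define t where "t m = 1 - 1 / real (Suc m)" for m
    have t: "0 \<le> t m" "t m < 1" for m by (auto simp: t_def)
    have "(\<lambda>m. t m *\<^sub>R x) \<longlonglongrightarrow> (1 - 0) *\<^sub>R x"
      unfolding t_def by (intro tendsto_intros LIMSEQ_inverse_real_of_nat[unfolded inverse_eq_divide])
    then have l: "(\<lambda>m. t m *\<^sub>R x) \<longlonglongrightarrow> x" by simp
    have "isCont (covariogram A) x" "isCont (covariogram K) x"
      using continuous_covariogram[OF A(1), of UNIV] continuous_covariogram[OF K(1), of UNIV]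
      by (auto simp: continuous_on_eq_continuous_at)
    then have 1: "(\<lambda>m. covariogram A (t m *\<^sub>R x)) \<longlonglongrightarrow> covariogram A x" "(\<lambda>m. covariogram K (t m *\<^sub>R x)) \<longlonglongrightarrow> covariogram K x"
      using l isCont_tendsto_compose by blast+
    have "covariogram A (t m *\<^sub>R x) = covariogram K (t m *\<^sub>R x)" for m
    proof (rule eq)
      fix i
      have "\<bar>(t m *\<^sub>R x) $ i\<bar> = t m * \<bar>x $ i\<bar>" using t by (simp add: abs_mult)
      also have "\<dots> \<le> t m * 1" using True t by (intro mult_left_mono) auto
      finally show "\<bar>(t m *\<^sub>R x) $ i\<bar> < 1" using t(2)[of m] by linarith
    qed
    then show ?thesis using 1 LIMSEQ_unique by auto
  qed
qed

lemma centroid_uminus: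
  fixes K :: "'a::euclidean_space set"
  assumes K: "compact K" shows "centroid (uminus ` K) = - centroid K"
proof -
  have refl: "distr lborel borel uminus = (lborel :: 'a measure)"
  proof -
    have "lborel = density (distr lborel borel (\<lambda>x::'a. 0 + (-1) *\<^sub>R x)) (\<lambda>_. ennreal (\<bar>-1\<bar> ^ DIM('a)))"
      by (rule lborel_affine) simp
    then show ?thesis by (simp add: density_1)
  qed
  have b: "K \<in> sets borel" "uminus ` K \<in> sets borel"
    using K compact_negations compact_imp_closed borel_closed by blast+
  have "measure lborel (uminus ` K) = measure (distr lborel borel uminus) (uminus ` K)" by (simp add: refl)
  also have "\<dots> = measure lborel (uminus -` (uminus ` K) \<inter> space lborel)" using b by (intro measure_distr) auto
  also have "uminus -` (uminus ` K) \<inter> space lborel = K" by auto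
  finally have 1: "measure lebesgue (uminus ` K) = measure lebesgue K" using b by simp
  have leb: "(LINT x:B|lebesgue. x) = (LINT x:B|lborel. x)" if "B \<in> sets borel" for B :: "'a set"
    unfolding set_lebesgue_integral_def using that by (intro integral_completion) auto
  have "(LINT x:uminus ` K|lborel. x) = (\<integral>x. indicator (uminus ` K) x *\<^sub>R x \<partial>distr lborel borel uminus)"
    unfolding set_lebesgue_integral_def refl by simp
  also have "\<dots> = (\<integral>x. indicator (uminus ` K) (- x) *\<^sub>R (- x) \<partial>lborel)"
    using b by (intro integral_distr) auto
  also have "\<dots> = (\<integral>x. - (indicator K x *\<^sub>R x) \<partial>lborel)"
    by (intro Bochner_Integration.integral_cong) (auto simp: indicator_def)
  also have "\<dots> = - (LINT x:K|lborel. x)" by (simp add: set_lebesgue_integral_def)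
  finally show ?thesis using 1 leb[OF b(1)] leb[OF b(2)] by (simp add: centroid_def)
qed

text \<open>Volumes and first moments differ by integrals over the symmetric difference, on which
  the integrands are bounded.\<close>

lemma centroid_tendsto:
  fixes A :: "nat \<Rightarrow> 'a::euclidean_space set"
  assumes A: "\<And>j. compact (A j)" and B: "compact B" "measure lebesgue B > 0"
    and R: "\<And>j. A j \<subseteq> cball 0 R" "B \<subseteq> cball 0 R"
    and lim: "(\<lambda>j. measure lebesgue (A j - B) + measure lebesgue (B - A j)) \<longlonglongrightarrow> 0"
  shows "(\<lambda>j. centroid (A j)) \<longlonglongrightarrow> centroid B" and "(\<lambda>j. measure lebesgue (A j)) \<longlonglongrightarrow> measure lebesgue B"
proof -
  have R0: "R \<ge> 0"
  proof -
    have "B \<noteq> {}" using B(2) by auto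
    then obtain b where "b \<in> B" by blast
    then have "norm b \<le> R" using R(2) by auto
    then show ?thesis using norm_ge_zero[of b] by linarith
  qed
  have mA: "A j \<in> lmeasurable" and mB: "B \<in> lmeasurable" for j using A B lmeasurable_compact by auto
  have D: "A j - B \<in> lmeasurable" "B - A j \<in> lmeasurable" for j
    using mA mB by (auto intro!: fmeasurable_Diff dest: fmeasurableD)
  have intR: "integrable lebesgue (\<lambda>x. R * indicator S x)" if S: "S \<in> lmeasurable" for S :: "'a set"
    using fmeasurableD[OF S] fmeasurableD2[OF S]
    by (intro Bochner_Integration.integrable_mult_right integrable_real_indicator) (auto simp: less_top)
  have intg: "integrable lebesgue (\<lambda>x. indicator S x *\<^sub>R x)" if S: "S \<in> lmeasurable" "S \<subseteq> cball 0 R" for S :: "'a set"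
  proof (rule Bochner_Integration.integrable_bound[where f = "\<lambda>x. R * indicator S x"])
    show "integrable lebesgue (\<lambda>x. R * indicator S x)" by (rule intR[OF S(1)])
    show "(\<lambda>x. indicator S x *\<^sub>R x) \<in> borel_measurable lebesgue"
      using fmeasurableD[OF S(1)] by (intro borel_measurable_scaleR borel_measurable_indicator) (auto intro: measurable_completion)
    show "AE x in lebesgue. norm (indicator S x *\<^sub>R x) \<le> norm (R * indicator S x)"
      using S(2) R0 by (intro AE_I2) (auto simp: indicator_def)
  qed
  have nb: "norm (LINT x|lebesgue. indicator S x *\<^sub>R x) \<le> R * measure lebesgue S" if S: "S \<in> lmeasurable" "S \<subseteq> cball 0 R" for S :: "'a set"
  proof -
    have "norm (LINT x|lebesgue. indicator S x *\<^sub>R x) \<le> (LINT x|lebesgue. norm (indicator S x *\<^sub>R x))" by (rule integral_norm_bound)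
    also have "\<dots> \<le> (LINT x|lebesgue. R * indicator S x)"
      using S by (intro integral_mono integrable_norm intg intR) (auto simp: indicator_def)
    also have "\<dots> = R * measure lebesgue S" using fmeasurableD[OF S(1)] by simp
    finally show ?thesis .
  qed
  let ?J = "\<lambda>S. (LINT x:S|lebesgue. x)"
  have dJ: "norm (?J (A j) - ?J B) \<le> R * (measure lebesgue (A j - B) + measure lebesgue (B - A j))" for j
  proof -
    have "?J (A j) - ?J B = (LINT x|lebesgue. indicator (A j) x *\<^sub>R x - indicator B x *\<^sub>R x)"
      unfolding set_lebesgue_integral_def using mA mB R by (intro Bochner_Integration.integral_diff[symmetric] intg) auto
    also have "\<dots> = (LINT x|lebesgue. indicator (A j - B) x *\<^sub>R x - indicator (B - A j) x *\<^sub>R x)"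
      by (intro Bochner_Integration.integral_cong) (auto simp: indicator_def)
    also have "\<dots> = (LINT x|lebesgue. indicator (A j - B) x *\<^sub>R x) - (LINT x|lebesgue. indicator (B - A j) x *\<^sub>R x)"
      using D R by (intro Bochner_Integration.integral_diff intg) auto
    finally have "norm (?J (A j) - ?J B) \<le> norm (LINT x|lebesgue. indicator (A j - B) x *\<^sub>R x) + norm (LINT x|lebesgue. indicator (B - A j) x *\<^sub>R x)"
      by (simp add: norm_triangle_ineq4)
    also have "\<dots> \<le> R * measure lebesgue (A j - B) + R * measure lebesgue (B - A j)"
      using D R by (intro add_mono nb) auto
    finally show ?thesis by (simp add: distrib_left)
  qed
  have "(\<lambda>j. R * (measure lebesgue (A j - B) + measure lebesgue (B - A j))) \<longlonglongrightarrow> R * 0"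
    by (intro tendsto_intros lim)
  then have "(\<lambda>j. ?J (A j) - ?J B) \<longlonglongrightarrow> 0"
    using Lim_null_comparison[OF always_eventually[OF allI[OF dJ]]] by simp
  then have lJ: "(\<lambda>j. ?J (A j)) \<longlonglongrightarrow> ?J B" by (simp add: LIM_zero_cancel)
  have hb: "\<bar>measure lebesgue (A j) - measure lebesgue B\<bar> \<le> measure lebesgue (A j - B) + measure lebesgue (B - A j)" for j
  proof -
    have *: "measure lebesgue X \<le> measure lebesgue Y + measure lebesgue (X - Y)" if "X \<in> lmeasurable" "Y \<in> lmeasurable" for X Y :: "'a set"
    proof -
      have "measure lebesgue X \<le> measure lebesgue (Y \<union> (X - Y))"
        using that by (intro measure_mono_fmeasurable) (auto intro!: fmeasurable.Un fmeasurable_Diff dest: fmeasurableD)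
      also have "\<dots> \<le> measure lebesgue Y + measure lebesgue (X - Y)"
        using that by (intro measure_Un_le) (auto dest: fmeasurableD)
      finally show ?thesis .
    qed
    have h: "measure lebesgue (A j) - measure lebesgue B \<le> measure lebesgue (A j - B)" "measure lebesgue B - measure lebesgue (A j) \<le> measure lebesgue (B - A j)"
      using *[OF mA mB] *[OF mB mA] by (simp_all add: algebra_simps)
    show ?thesis
    proof (rule abs_leI)
      show "measure lebesgue (A j) - measure lebesgue B \<le> measure lebesgue (A j - B) + measure lebesgue (B - A j)"
        by (rule add_increasing2[OF measure_nonneg h(1)])
      show "- (measure lebesgue (A j) - measure lebesgue B) \<le> measure lebesgue (A j - B) + measure lebesgue (B - A j)"
        unfolding minus_diff_eq by (rule add_increasing[OF measure_nonneg h(2)])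
    qed
  qed
  have "(\<lambda>j. measure lebesgue (A j) - measure lebesgue B) \<longlonglongrightarrow> 0"
    by (rule Lim_null_comparison[OF always_eventually[OF allI[OF hb[folded real_norm_def]]] lim])
  then show lm: "(\<lambda>j. measure lebesgue (A j)) \<longlonglongrightarrow> measure lebesgue B" by (simp add: LIM_zero_cancel)
  show "(\<lambda>j. centroid (A j)) \<longlonglongrightarrow> centroid B"
    unfolding centroid_def using B(2) by (intro tendsto_intros lm lJ) auto
qed

lemma not_tendsto_zero_subseq:
  fixes X :: "nat \<Rightarrow> real"
  assumes "\<not> X \<longlonglongrightarrow> 0"
  shows "\<exists>\<epsilon>>0. \<exists>r. strict_mono (r :: nat \<Rightarrow> nat) \<and> (\<forall>j. \<bar>X (r j)\<bar> \<ge> \<epsilon>)"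
proof -
  obtain \<epsilon> where \<epsilon>: "\<epsilon> > 0" "\<And>N. \<exists>n\<ge>N. \<bar>X n\<bar> \<ge> \<epsilon>"
    using assms unfolding LIMSEQ_iff by (auto simp: not_less)
  then have "infinite {n. \<bar>X n\<bar> \<ge> \<epsilon>}" unfolding infinite_nat_iff_unbounded_le by blast
  then obtain r :: "nat \<Rightarrow> nat" where "strict_mono r" "\<forall>n. r n \<in> {n. \<bar>X n\<bar> \<ge> \<epsilon>}"
    using infinite_enumerate by metis
  then show ?thesis using \<epsilon>(1) by blast
qed

text \<open>Argue along a subsequence that stays away from 0. Before the uniqueness hypothesis
  applies to a limit set \<open>B\<close>, it has to be a convex body: its volume is its covariogram
  at 0 and hence positive. The translation left open by uniqueness is then fixed by the centroids,
  which converge together with the volumes of the symmetric differences.\<close>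

theorem covariogram_stability:
  fixes K :: "(real^'n) set" and A P :: "nat \<Rightarrow> (real^'n) set"
  assumes K: "convex_body K" "K \<subseteq> unit_cube" "centroid K = 0" and det: "determined_by_covariogram K"
    and A: "\<And>k. k \<ge> 1 \<Longrightarrow> compact (A k) \<and> convex (A k) \<and> A k \<subseteq> unit_cube"
    and P: "\<And>k. k \<ge> 1 \<Longrightarrow> (\<exists>t. P k = (+) t ` A k) \<and> centroid (P k) = 0"
    and lim: "(\<lambda>k. grid_mean k (\<lambda>x. (covariogram (A k) x - covariogram K x)\<^sup>2)) \<longlonglongrightarrow> 0"
  shows "(\<lambda>k. min (hausdorff_dist K (P k)) (hausdorff_dist (uminus ` K) (P k))) \<longlonglongrightarrow> 0"
proof (rule ccontr)
  let ?X = "\<lambda>k. min (hausdorff_dist K (P k)) (hausdorff_dist (uminus ` K) (P k))"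
  define X where "X = ?X"
  assume "\<not> ?X \<longlonglongrightarrow> 0"
  then have "\<not> X \<longlonglongrightarrow> 0" by (simp add: X_def)
  then obtain \<epsilon> r0 where \<epsilon>: "\<epsilon> > 0" and r0': "strict_mono (r0 :: nat \<Rightarrow> nat)" "\<And>j. \<bar>X (r0 j)\<bar> \<ge> \<epsilon>"
    using not_tendsto_zero_subseq[of X] by blast
  have r0: "strict_mono r0" "\<And>j. \<bar>?X (r0 j)\<bar> \<ge> \<epsilon>" using r0' by (simp_all add: X_def)
  \<comment> \<open>The shift keeps all indices at least 1, where the hypotheses on \<open>A\<close>
    and \<open>P\<close> hold.\<close>
  define r1 where "r1 j = r0 (Suc j)" for j
  have r1: "strict_mono r1" "\<And>j. \<bar>?X (r1 j)\<bar> \<ge> \<epsilon>" using r0 by (auto simp: r1_def strict_mono_def)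
  have r1_ge: "r1 j \<ge> 1" for j
    using seq_suble[OF r0(1), of "Suc j"] by (simp add: r1_def)
  have cK: "compact K" "K \<noteq> {}" "convex K" using K(1) interior_subset by (auto simp: convex_body_def)
  have Kpos: "measure lebesgue K > 0" by (rule convex_body_measure_pos[OF K(1)])
  have lim_sub: "(\<lambda>j. grid_mean (r j) (\<lambda>x. (covariogram (A (r j)) x - covariogram K x)\<^sup>2)) \<longlonglongrightarrow> 0"
    if "strict_mono (r :: nat \<Rightarrow> nat)" for r
    using LIMSEQ_subseq_LIMSEQ[OF lim that] by (simp add: comp_def)
  \<comment> \<open>The selection theorem needs nonempty sets. Infinitely many empty ones would make
    the covariogram of \<open>K\<close> vanish at 0, where it equals the volume.\<close>
  have "finite {j. A (r1 j) = {}}"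
  proof (rule ccontr)
    assume "infinite {j. A (r1 j) = {}}"
    then obtain q :: "nat \<Rightarrow> nat" where q: "strict_mono q" "\<forall>n. q n \<in> {j. A (r1 j) = {}}"
      using infinite_enumerate by metis
    have r: "strict_mono (r1 \<circ> q)" using r1(1) q(1) by (rule strict_mono_o)
    have "(\<lambda>x. 0 - covariogram K x) 0 = 0"
    proof (rule grid_mean_limit_zero[OF r])
      show "continuous_on UNIV (\<lambda>x. 0 - covariogram K x)" by (intro continuous_intros continuous_covariogram cK)
      show "\<forall>\<^sub>F j in sequentially. \<forall>x. \<bar>(\<lambda>x. covariogram (A ((r1 \<circ> q) j)) x - covariogram K x) x - (0 - covariogram K x)\<bar> < e" if "e > 0" for e
        using q(2) that by (intro always_eventually) (auto simp: covariogram_empty)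
      show "(\<lambda>j. grid_mean ((r1 \<circ> q) j) (\<lambda>x. (covariogram (A ((r1 \<circ> q) j)) x - covariogram K x)\<^sup>2)) \<longlonglongrightarrow> 0"
        by (rule lim_sub[OF r])
    qed simp
    then show False using Kpos by (simp add: covariogram_zero)
  qed
  then obtain J0 where J0: "\<forall>j\<in>{j. A (r1 j) = {}}. j \<le> J0"
    unfolding finite_nat_set_iff_bounded_le by blast
  define J where "J = Suc J0"
  have J: "A (r1 j) \<noteq> {}" if "j \<ge> J" for j using J0 that by (auto simp: J_def)
  define r2 where "r2 j = r1 (j + J)" for j
  have r2: "strict_mono r2" "\<And>j. \<bar>?X (r2 j)\<bar> \<ge> \<epsilon>" "\<And>j. A (r2 j) \<noteq> {}" "\<And>j. r2 j \<ge> 1"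
    using r1 J r1_ge by (auto simp: r2_def strict_mono_def)
  have cube: "compact (unit_cube :: (real^'n) set)" by (simp add: unit_cube_cbox)
  obtain s B where s: "strict_mono (s :: nat \<Rightarrow> nat)" and B: "compact B" "convex B" "B \<noteq> {}" "B \<subseteq> unit_cube"
    and close: "\<And>e. e > 0 \<Longrightarrow> \<forall>\<^sub>F j in sequentially. (\<forall>x\<in>A (r2 (s j)). \<exists>y\<in>B. dist x y < e) \<and> (\<forall>y\<in>B. \<exists>x\<in>A (r2 (s j)). dist x y < e)"
  proof (rule blaschke_selection[OF cube, of "\<lambda>j. A (r2 j)"])
    show "compact (A (r2 j))" "convex (A (r2 j))" "A (r2 j) \<subseteq> unit_cube" for j using A[OF r2(4)] by blast+
    show "A (r2 j) \<noteq> {}" for j by (rule r2(3))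
  qed (rule that)
  define r where "r j = r2 (s j)" for j
  have "r = r2 \<circ> s" by (simp add: r_def fun_eq_iff)
  then have r: "strict_mono r" using strict_mono_o[OF r2(1) s] by simp
  have rX: "\<bar>?X (r j)\<bar> \<ge> \<epsilon>" "A (r j) \<noteq> {}" "r j \<ge> 1" for j using r2 by (simp_all add: r_def)
  have cA: "compact (A (r j))" "convex (A (r j))" "A (r j) \<subseteq> unit_cube" for j using A rX(3) by blast+
  have ms: "(\<lambda>j. measure lebesgue (A (r j) - B) + measure lebesgue (B - A (r j))) \<longlonglongrightarrow> 0"
    unfolding LIMSEQ_iff
  proof (intro allI impI)
    fix e :: real assume e: "0 < e"
    obtain d where d: "d > 0" "\<And>A'. compact A' \<Longrightarrow> convex A' \<Longrightarrow> A' \<noteq> {} \<Longrightarrow> (\<forall>x\<in>A'. \<exists>y\<in>B. dist x y < d) \<Longrightarrow>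
      (\<forall>y\<in>B. \<exists>x\<in>A'. dist x y < d) \<Longrightarrow> measure lebesgue (A' - B) < e / 2 \<and> measure lebesgue (B - A') < e / 2"
      using hausdorff_close_measure[OF B(1,2,3), of "e / 2"] e by auto
    obtain N where "\<forall>j\<ge>N. (\<forall>x\<in>A (r2 (s j)). \<exists>y\<in>B. dist x y < d) \<and> (\<forall>y\<in>B. \<exists>x\<in>A (r2 (s j)). dist x y < d)"
      using close[OF d(1)] unfolding eventually_sequentially by blast
    then have "measure lebesgue (A (r j) - B) < e / 2 \<and> measure lebesgue (B - A (r j)) < e / 2" if "j \<ge> N" for j
      using d(2)[OF cA(1,2) rX(2), of j] that unfolding r_def by blast
    then show "\<exists>N. \<forall>j\<ge>N. norm (measure lebesgue (A (r j) - B) + measure lebesgue (B - A (r j)) - 0) < e"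
      by (intro exI[of _ N]) (fastforce simp: measure_nonneg)
  qed
  have mA: "A (r j) \<in> lmeasurable" "B \<in> lmeasurable" for j using cA(1) B(1) by (auto intro: lmeasurable_compact)
  have "covariogram B = covariogram K"
  proof (rule covariogram_eq_if_interior[OF B(1,4) cK(1) K(2)])
    fix x :: "real^'n" assume x: "\<And>i. \<bar>x $ i\<bar> < 1"
    have "(\<lambda>x. covariogram B x - covariogram K x) x = 0"
    proof (rule grid_mean_limit_zero[OF r _ _ lim_sub[OF r] x])
      show "continuous_on UNIV (\<lambda>x. covariogram B x - covariogram K x)" by (intro continuous_intros continuous_covariogram cK B)
      show "\<forall>\<^sub>F j in sequentially. \<forall>x. \<bar>covariogram (A (r j)) x - covariogram K x - (covariogram B x - covariogram K x)\<bar> < e" if e: "e > 0" for e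
      proof -
        have "\<forall>\<^sub>F j in sequentially. measure lebesgue (A (r j) - B) + measure lebesgue (B - A (r j)) < e / 2"
          using order_tendstoD(2)[OF ms, of "e / 2"] e by simp
        then show ?thesis
        proof (elim eventually_mono, intro allI)
          fix j x assume "measure lebesgue (A (r j) - B) + measure lebesgue (B - A (r j)) < e / 2"
          moreover have "\<bar>covariogram (A (r j)) x - covariogram B x\<bar> \<le> 2 * (measure lebesgue (A (r j) - B) + measure lebesgue (B - A (r j)))"
            by (rule covariogram_diff_le[OF mA])
          ultimately show "\<bar>covariogram (A (r j)) x - covariogram K x - (covariogram B x - covariogram K x)\<bar> < e" by simp
        qed
      qed
    qed
    then show "covariogram B x = covariogram K x" by simp
  qed
  note eqcov = this
  have Bpos: "measure lebesgue B > 0" using eqcov Kpos covariogram_zero by metis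
  have "interior B \<noteq> {}"
  proof
    assume "interior B = {}"
    then have "negligible B" using negligible_convex_interior[OF B(2)] by simp
    then show False using Bpos negligible_imp_measure0[of B] by simp
  qed
  then have "convex_body B" using B by (simp add: convex_body_def)
  then obtain t K' where t: "B = (+) t ` K'" "K' = K \<or> K' = uminus ` K"
    using det eqcov unfolding determined_by_covariogram_def by metis
  have K': "compact K'" "K' \<noteq> {}" "centroid K' = 0"
    using t(2) cK K(3) centroid_uminus[OF cK(1)] compact_negations[OF cK(1)] by auto
  have "measure lebesgue K' > 0" using Bpos unfolding t(1) measure_translation .
  then have cB: "centroid B = t" unfolding t(1) using centroid_translate[OF K'(1)] K'(3) by simp
  obtain R where R: "(unit_cube :: (real^'n) set) \<subseteq> cball 0 R"
    using bounded_subset_ballD[OF compact_imp_bounded[OF cube], of 0] ball_subset_cball by (metis order_trans)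
  have AR: "A (r j) \<subseteq> cball 0 R" "B \<subseteq> cball 0 R" for j using cA(3) B(4) R by blast+
  note ct = centroid_tendsto[OF cA(1) B(1) Bpos AR ms]
  have "\<forall>\<^sub>F j in sequentially. measure lebesgue (A (r j)) > 0" using order_tendstoD(1)[OF ct(2) Bpos] .
  moreover have "\<forall>\<^sub>F j in sequentially. dist (centroid (A (r j))) t < \<epsilon> / 4"
    using tendstoD[OF ct(1), of "\<epsilon> / 4"] \<epsilon> cB by simp
  moreover have "\<forall>\<^sub>F j in sequentially. (\<forall>x\<in>A (r j). \<exists>y\<in>B. dist x y < \<epsilon> / 4) \<and> (\<forall>y\<in>B. \<exists>x\<in>A (r j). dist x y < \<epsilon> / 4)"
    using close[of "\<epsilon> / 4"] \<epsilon> by (simp add: r_def)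
  ultimately have "\<forall>\<^sub>F j in sequentially. \<bar>?X (r j)\<bar> < \<epsilon>"
  proof eventually_elim
    case (elim j)
    obtain u where u: "P (r j) = (+) u ` A (r j)" "centroid (P (r j)) = 0" using P[OF rX(3)] by blast
    have "u + centroid (A (r j)) = 0" using centroid_translate[OF cA(1) elim(1), of u] u by simp
    then have u': "norm (u + t) < \<epsilon> / 4"
    proof -
      assume "u + centroid (A (r j)) = 0"
      then have "u + t = t - centroid (A (r j))" by (simp add: add_eq_0_iff2)
      then show ?thesis using elim(2) by (simp add: dist_norm norm_minus_commute)
    qed
    \<comment> \<open>Here \<open>t\<close> is the centroid of \<open>B\<close> and
      \<open>- u\<close> that of \<open>A (r j)\<close>, so \<open>u + t\<close> is small and the
      translation by \<open>u\<close> nearly undoes the one by \<open>t\<close>.\<close>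
    have move: "dist (u + a) \<kappa> < \<epsilon> / 2" if "dist a (t + \<kappa>) < \<epsilon> / 4" for a \<kappa>
    proof -
      have "u + a - \<kappa> = (u + t) + (a - (t + \<kappa>))" by simp
      then have "norm (u + a - \<kappa>) \<le> norm (u + t) + norm (a - (t + \<kappa>))" using norm_triangle_ineq by metis
      then show ?thesis using u' that by (simp add: dist_norm)
    qed
    have "hausdorff_dist K' (P (r j)) \<le> \<epsilon> / 2"
    proof (rule hausdorff_dist_leI[OF K'(2)])
      show "P (r j) \<noteq> {}" using u(1) rX(2) by simp
      fix \<kappa> assume "\<kappa> \<in> K'"
      then obtain a where "a \<in> A (r j)" "dist a (t + \<kappa>) < \<epsilon> / 4" using elim(3) t(1) by blast
      then show "\<exists>y\<in>P (r j). dist \<kappa> y \<le> \<epsilon> / 2" using move[of a \<kappa>] unfolding u(1)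
        by (intro bexI[of _ "u + a"]) (auto simp: dist_commute)
    next
      fix y assume "y \<in> P (r j)"
      then obtain a where a: "a \<in> A (r j)" "y = u + a" unfolding u(1) by blast
      then obtain b where "b \<in> B" "dist a b < \<epsilon> / 4" using elim(3) by blast
      then obtain \<kappa> where "\<kappa> \<in> K'" "dist a (t + \<kappa>) < \<epsilon> / 4" unfolding t(1) by blast
      then show "\<exists>x\<in>K'. dist x y \<le> \<epsilon> / 2" using move[of a \<kappa>] a(2) by (intro bexI[of _ \<kappa>]) (auto simp: dist_commute)
    qed
    moreover have "?X (r j) \<le> hausdorff_dist K' (P (r j))" using t(2) by auto
    moreover have "?X (r j) \<ge> 0"
    proof -
      have "P (r j) \<noteq> {}" using u(1) rX(2) by simp
      then have "hausdorff_dist K (P (r j)) \<ge> 0" "hausdorff_dist (uminus ` K) (P (r j)) \<ge> 0"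
        using cK compact_negations[OF cK(1)] by (auto intro!: hausdorff_dist_nonneg)
      then show ?thesis by simp
    qed
    ultimately show ?case using \<epsilon> by simp
  qed
  then show False using rX(1) by (auto simp: eventually_sequentially not_less[symmetric])
qed

section \<open>Fourth moments of the noise\<close>

lemma abs_power_le_one_plus: "p \<le> 4 \<Longrightarrow> \<bar>x::real\<bar> ^ p \<le> 1 + x ^ 4"
proof (cases "\<bar>x\<bar> \<le> 1")
  case True
  then have "\<bar>x\<bar> ^ p \<le> 1" by (simp add: power_le_one)
  moreover have "0 \<le> x ^ 4" by simp
  ultimately show ?thesis by linarith
next
  case False
  assume "p \<le> 4"
  then have "\<bar>x\<bar> ^ p \<le> \<bar>x\<bar> ^ 4" using False by (intro power_increasing) auto
  then show ?thesis by (simp add: power_even_abs)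
qed

context prob_space
begin

lemma integrable_lower_power:
  fixes Y :: "'a \<Rightarrow> real"
  assumes "Y \<in> borel_measurable M" "integrable M (\<lambda>\<omega>. Y \<omega> ^ 4)" "p \<le> 4"
  shows "integrable M (\<lambda>\<omega>. Y \<omega> ^ p)"
proof (rule Bochner_Integration.integrable_bound)
  show "integrable M (\<lambda>\<omega>. 1 + Y \<omega> ^ 4)" using assms by simp
  show "(\<lambda>\<omega>. Y \<omega> ^ p) \<in> borel_measurable M" using assms by simp
  show "AE \<omega> in M. norm (Y \<omega> ^ p) \<le> norm (1 + Y \<omega> ^ 4)"
  proof (rule AE_I2)
    fix \<omega>
    show "norm (Y \<omega> ^ p) \<le> norm (1 + Y \<omega> ^ 4)"
      using abs_power_le_one_plus[OF assms(3), of "Y \<omega>"] by (simp add: power_abs)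
  qed
qed

text \<open>When one variable is added, the terms with a first power vanish by independence and zero
  means. What remains is \<open>3 B\<^sup>2 m\<^sup>2 + 6 B\<^sup>2 m + B\<^sup>2\<close>, below
  \<open>3 B\<^sup>2 (m + 1)\<^sup>2\<close>. The growth is thus quadratic in the number of terms;
  \<open>B \<ge> 1\<close> allows one constant for both moments.\<close>

lemma fourth_moment_sum:
  fixes Z :: "'i \<Rightarrow> 'a \<Rightarrow> real"
  assumes J: "finite J" and indep: "indep_vars (\<lambda>_. borel) Z J" and B: "B \<ge> 1"
    and Z: "\<And>j. j \<in> J \<Longrightarrow> integrable M (\<lambda>\<omega>. Z j \<omega> ^ 4) \<and> expectation (Z j) = 0
      \<and> expectation (\<lambda>\<omega>. Z j \<omega> ^ 2) \<le> B \<and> expectation (\<lambda>\<omega>. Z j \<omega> ^ 4) \<le> B"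
  shows "integrable M (\<lambda>\<omega>. (\<Sum>j\<in>J. Z j \<omega>) ^ 4) \<and> expectation (\<lambda>\<omega>. \<Sum>j\<in>J. Z j \<omega>) = 0 \<and>
    expectation (\<lambda>\<omega>. (\<Sum>j\<in>J. Z j \<omega>) ^ 2) \<le> B * real (card J) \<and>
    expectation (\<lambda>\<omega>. (\<Sum>j\<in>J. Z j \<omega>) ^ 4) \<le> 3 * B\<^sup>2 * (real (card J))\<^sup>2"
  using J indep Z
proof (induction J)
  case empty
  then show ?case by simp
next
  case (insert i J)
  define S where "S \<omega> = (\<Sum>j\<in>J. Z j \<omega>)" for \<omega>
  define m where "m = real (card J)"
  have meas: "Z j \<in> borel_measurable M" if "j \<in> insert i J" for j
    using insert.prems(1) that by (auto simp: indep_vars_def)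
  have Sm: "S \<in> borel_measurable M" unfolding S_def using meas by (intro borel_measurable_sum) auto
  have IH: "integrable M (\<lambda>\<omega>. S \<omega> ^ 4)" "expectation S = 0" "expectation (\<lambda>\<omega>. S \<omega> ^ 2) \<le> B * m"
    "expectation (\<lambda>\<omega>. S \<omega> ^ 4) \<le> 3 * B\<^sup>2 * m\<^sup>2"
    using insert.IH[OF indep_vars_subset[OF insert.prems(1)]] insert.prems(2) unfolding S_def m_def by auto
  have Zi: "integrable M (\<lambda>\<omega>. Z i \<omega> ^ 4)" "expectation (Z i) = 0" "expectation (\<lambda>\<omega>. Z i \<omega> ^ 2) \<le> B"
    "expectation (\<lambda>\<omega>. Z i \<omega> ^ 4) \<le> B" using insert.prems(2) by auto
  have Zp: "integrable M (\<lambda>\<omega>. Z i \<omega> ^ p)" if "p \<le> 4" for p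
    using integrable_lower_power[OF meas Zi(1) that] by simp
  have Sp: "integrable M (\<lambda>\<omega>. S \<omega> ^ p)" if "p \<le> 4" for p
    using integrable_lower_power[OF Sm IH(1) that] by simp
  have ind: "indep_var borel (Z i) borel S"
    unfolding S_def by (rule indep_vars_sum[OF insert.hyps insert.prems(1)])
  have indp: "indep_var borel (\<lambda>\<omega>. Z i \<omega> ^ p) borel (\<lambda>\<omega>. S \<omega> ^ q)" for p q
    using indep_var_compose[OF ind, of "\<lambda>x. x ^ p" borel "\<lambda>x. x ^ q" borel] by (simp add: comp_def)
  have prodE: "expectation (\<lambda>\<omega>. Z i \<omega> ^ p * S \<omega> ^ q) = expectation (\<lambda>\<omega>. Z i \<omega> ^ p) * expectation (\<lambda>\<omega>. S \<omega> ^ q)"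
    and prodI: "integrable M (\<lambda>\<omega>. Z i \<omega> ^ p * S \<omega> ^ q)" if "p \<le> 4" "q \<le> 4" for p q
    using indep_var_lebesgue_integral[OF indp Zp Sp] indep_var_integrable[OF indp Zp Sp] that by auto
  have sum_eq: "(\<Sum>j\<in>insert i J. Z j \<omega>) = Z i \<omega> + S \<omega>" for \<omega>
    using insert.hyps by (simp add: S_def)
  have e4: "(Z i \<omega> + S \<omega>) ^ 4 = S \<omega> ^ 4 + (4 * (Z i \<omega> ^ 1 * S \<omega> ^ 3) + (6 * (Z i \<omega> ^ 2 * S \<omega> ^ 2) + (4 * (Z i \<omega> ^ 3 * S \<omega> ^ 1) + Z i \<omega> ^ 4)))" for \<omega>
    by (simp add: power4_eq_xxxx power3_eq_cube power2_eq_square algebra_simps)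
  have e2: "(Z i \<omega> + S \<omega>) ^ 2 = S \<omega> ^ 2 + (2 * (Z i \<omega> ^ 1 * S \<omega> ^ 1) + Z i \<omega> ^ 2)" for \<omega>
    by (simp add: power2_eq_square algebra_simps)
  have ints: "integrable M (\<lambda>\<omega>. S \<omega> ^ 4)" "integrable M (\<lambda>\<omega>. 4 * (Z i \<omega> ^ 1 * S \<omega> ^ 3))"
    "integrable M (\<lambda>\<omega>. 6 * (Z i \<omega> ^ 2 * S \<omega> ^ 2))" "integrable M (\<lambda>\<omega>. 4 * (Z i \<omega> ^ 3 * S \<omega> ^ 1))"
    "integrable M (\<lambda>\<omega>. Z i \<omega> ^ 4)" "integrable M (\<lambda>\<omega>. S \<omega> ^ 2)" "integrable M (\<lambda>\<omega>. 2 * (Z i \<omega> ^ 1 * S \<omega> ^ 1))"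
    "integrable M (\<lambda>\<omega>. Z i \<omega> ^ 2)"
    by (intro Bochner_Integration.integrable_mult_right prodI Sp Zp; simp)+
  have I4: "integrable M (\<lambda>\<omega>. (Z i \<omega> + S \<omega>) ^ 4)"
    unfolding e4 by (intro Bochner_Integration.integrable_add ints)
  have E4: "expectation (\<lambda>\<omega>. (Z i \<omega> + S \<omega>) ^ 4) = expectation (\<lambda>\<omega>. S \<omega> ^ 4) + (4 * expectation (\<lambda>\<omega>. Z i \<omega> ^ 1 * S \<omega> ^ 3)
      + (6 * expectation (\<lambda>\<omega>. Z i \<omega> ^ 2 * S \<omega> ^ 2) + (4 * expectation (\<lambda>\<omega>. Z i \<omega> ^ 3 * S \<omega> ^ 1) + expectation (\<lambda>\<omega>. Z i \<omega> ^ 4))))"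
    unfolding e4
    by (simp only: Bochner_Integration.integral_add Bochner_Integration.integrable_add ints Bochner_Integration.integral_mult_right_zero)
  have E2: "expectation (\<lambda>\<omega>. (Z i \<omega> + S \<omega>) ^ 2) = expectation (\<lambda>\<omega>. S \<omega> ^ 2) + (2 * expectation (\<lambda>\<omega>. Z i \<omega> ^ 1 * S \<omega> ^ 1) + expectation (\<lambda>\<omega>. Z i \<omega> ^ 2))"
    unfolding e2
    by (simp only: Bochner_Integration.integral_add Bochner_Integration.integrable_add ints Bochner_Integration.integral_mult_right_zero)
  have z: "expectation (\<lambda>\<omega>. Z i \<omega> ^ 1 * S \<omega> ^ 3) = 0" "expectation (\<lambda>\<omega>. Z i \<omega> ^ 3 * S \<omega> ^ 1) = 0" "expectation (\<lambda>\<omega>. Z i \<omega> ^ 1 * S \<omega> ^ 1) = 0"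
    using prodE[of 1 3] prodE[of 3 1] prodE[of 1 1] Zi(2) IH(2) by simp_all
  have c: "real (card (insert i J)) = m + 1" using insert.hyps by (simp add: m_def)
  have m0: "m \<ge> 0" by (simp add: m_def)
  have n2: "expectation (\<lambda>\<omega>. S \<omega> ^ 2) \<ge> 0" "expectation (\<lambda>\<omega>. Z i \<omega> ^ 2) \<ge> 0" by (auto intro: Bochner_Integration.integral_nonneg)
  have "expectation (\<lambda>\<omega>. Z i \<omega> ^ 2 * S \<omega> ^ 2) = expectation (\<lambda>\<omega>. Z i \<omega> ^ 2) * expectation (\<lambda>\<omega>. S \<omega> ^ 2)"
    by (rule prodE) simp_all
  also have "\<dots> \<le> B * (B * m)" using Zi(3) IH(3) n2 B by (intro mult_mono) auto
  finally have c22: "expectation (\<lambda>\<omega>. Z i \<omega> ^ 2 * S \<omega> ^ 2) \<le> B\<^sup>2 * m" by (simp add: power2_eq_square)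
  have BB: "B \<le> B\<^sup>2" using B by (simp add: power2_eq_square)
  have "expectation (\<lambda>\<omega>. (Z i \<omega> + S \<omega>) ^ 4) \<le> 3 * B\<^sup>2 * m\<^sup>2 + (6 * (B\<^sup>2 * m) + B\<^sup>2)"
    unfolding E4 z using IH(4) c22 Zi(4) BB by simp
  also have "\<dots> \<le> 3 * B\<^sup>2 * (m + 1)\<^sup>2" by (simp add: power2_eq_square algebra_simps)
  finally have 4: "expectation (\<lambda>\<omega>. (Z i \<omega> + S \<omega>) ^ 4) \<le> 3 * B\<^sup>2 * (m + 1)\<^sup>2" .
  have 2: "expectation (\<lambda>\<omega>. (Z i \<omega> + S \<omega>) ^ 2) \<le> B * (m + 1)"
    unfolding E2 z using IH(3) Zi(3) by (simp add: algebra_simps)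
  have "expectation (\<lambda>\<omega>. Z i \<omega> + S \<omega>) = expectation (Z i) + expectation S"
    using Zp[of 1] Sp[of 1] by (intro Bochner_Integration.integral_add) simp_all
  then have 1: "expectation (\<lambda>\<omega>. Z i \<omega> + S \<omega>) = 0" using Zi(2) IH(2) by simp
  show ?case unfolding sum_eq c using I4 1 2 4 by blast
qed

text \<open>By monotone convergence the series of the \<open>f k\<close> has finite expectation, so
  it converges almost surely and its terms tend to 0.\<close>

lemma AE_tendsto_zero_if_summable_expectation:
  fixes f :: "nat \<Rightarrow> 'a \<Rightarrow> real"
  assumes f: "\<And>k. integrable M (f k)" "\<And>k \<omega>. f k \<omega> \<ge> 0" and s: "summable (\<lambda>k. expectation (f k))"
  shows "AE \<omega> in M. (\<lambda>k. f k \<omega>) \<longlonglongrightarrow> 0"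
proof -
  have "(\<integral>\<^sup>+\<omega>. (\<Sum>k. ennreal (f k \<omega>)) \<partial>M) = (\<Sum>k. \<integral>\<^sup>+\<omega>. ennreal (f k \<omega>) \<partial>M)"
    using f by (intro nn_integral_suminf) auto
  also have "\<dots> = (\<Sum>k. ennreal (expectation (f k)))"
    using f by (intro suminf_cong nn_integral_eq_integral) auto
  also have "\<dots> = ennreal (\<Sum>k. expectation (f k))"
    using f s by (intro suminf_ennreal2 Bochner_Integration.integral_nonneg) auto
  finally have "(\<integral>\<^sup>+\<omega>. (\<Sum>k. ennreal (f k \<omega>)) \<partial>M) \<noteq> \<infinity>" by simp
  moreover have "(\<lambda>\<omega>. \<Sum>k. ennreal (f k \<omega>)) \<in> borel_measurable M"
  proof (rule borel_measurable_suminf_order)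
    show "(\<lambda>\<omega>. ennreal (f k \<omega>)) \<in> borel_measurable M" for k
      by (rule measurable_compose[OF borel_measurable_integrable[OF f(1)] measurable_ennreal])
  qed
  ultimately have "AE \<omega> in M. (\<Sum>k. ennreal (f k \<omega>)) \<noteq> \<infinity>" by (intro nn_integral_PInf_AE)
  then show ?thesis
  proof (rule AE_mp, intro AE_I2 impI)
    fix \<omega> assume "(\<Sum>k. ennreal (f k \<omega>)) \<noteq> \<infinity>"
    then have "summable (\<lambda>k. f k \<omega>)" using f(2) by (intro summable_suminf_not_top) auto
    then show "(\<lambda>k. f k \<omega>) \<longlonglongrightarrow> 0" by (rule summable_LIMSEQ_zero)
  qed
qed

end

text \<open>The error \<open>(F + X 1) (F + X 2) - F\<^sup>2\<close> of a product of two
  measurements of \<open>F\<close>. Independence of the two measurements gives it mean zero, whereas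
  the square of one measurement would carry the variance of its noise as a bias.\<close>

definition noise_term :: "(int \<Rightarrow> real) \<Rightarrow> (nat \<Rightarrow> int \<Rightarrow> 'w \<Rightarrow> real) \<Rightarrow> int \<Rightarrow> 'w \<Rightarrow> real" where
  "noise_term F X j \<omega> = F j * (X 1 j \<omega> + X 2 j \<omega>) + X 1 j \<omega> * X 2 j \<omega>"

text \<open>Convexity of the fourth power, obtained by applying the quadratic inequality twice;
  \<open>27 = 3 ^ 3\<close>.\<close>

lemma power4_sum3_le: "(a + b + c) ^ 4 \<le> 27 * (a ^ 4 + b ^ 4 + c ^ 4)" for a b c :: real
proof -
  have sq: "(x + y + z)\<^sup>2 \<le> 3 * (x\<^sup>2 + y\<^sup>2 + z\<^sup>2)" for x y z :: real
  proof -
    have "3 * (x\<^sup>2 + y\<^sup>2 + z\<^sup>2) - (x + y + z)\<^sup>2 = (x - y)\<^sup>2 + (y - z)\<^sup>2 + (x - z)\<^sup>2"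
      by (simp add: power2_eq_square algebra_simps)
    moreover have "0 \<le> (x - y)\<^sup>2 + (y - z)\<^sup>2 + (x - z)\<^sup>2" by simp
    ultimately show ?thesis by linarith
  qed
  have p4: "x ^ 4 = (x\<^sup>2)\<^sup>2" for x :: real by (simp add: power4_eq_xxxx power2_eq_square)
  have "((a + b + c)\<^sup>2)\<^sup>2 \<le> (3 * (a\<^sup>2 + b\<^sup>2 + c\<^sup>2))\<^sup>2" using sq by (intro power_mono) auto
  also have "\<dots> = 9 * (a\<^sup>2 + b\<^sup>2 + c\<^sup>2)\<^sup>2" by (subst power_mult_distrib) simp
  also have "\<dots> \<le> 9 * (3 * ((a\<^sup>2)\<^sup>2 + (b\<^sup>2)\<^sup>2 + (c\<^sup>2)\<^sup>2))" by (rule mult_left_mono[OF sq]) simp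
  finally show ?thesis unfolding p4 by simp
qed

context prob_space
begin

text \<open>The \<open>j\<close>-th term is a function of the block of variables with indices in
  \<open>{1, 2} \<times> {j}\<close>, and these blocks are disjoint.\<close>

lemma noise_term_indep:
  fixes X :: "nat \<Rightarrow> int \<Rightarrow> 'a \<Rightarrow> real"
  assumes indep: "indep_vars (\<lambda>_. borel) (\<lambda>(r, i). X r i) ({1, 2} \<times> {0..h})"
  shows "indep_vars (\<lambda>_. borel) (noise_term F X) {0..h}"
proof -
  have "indep_vars (\<lambda>j. PiM ({1, 2} \<times> {j}) (\<lambda>_. borel)) (\<lambda>j \<omega>. restrict (\<lambda>p. (case p of (r, i) \<Rightarrow> X r i) \<omega>) ({1, 2} \<times> {j})) {0..h}"
    by (rule indep_vars_restrict[OF indep]) (auto simp: disjoint_family_on_def)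
  then have "indep_vars (\<lambda>_. borel)
      (\<lambda>j \<omega>. (\<lambda>g. F j * (g (1, j) + g (2, j)) + g (1, j) * g (2, j)) (restrict (\<lambda>p. (case p of (r, i) \<Rightarrow> X r i) \<omega>) ({1, 2} \<times> {j}))) {0..h}"
    by (rule indep_vars_compose2) (auto intro!: borel_measurable_add borel_measurable_times measurable_component_singleton)
  moreover have "(\<lambda>j \<omega>. (\<lambda>g. F j * (g (1, j) + g (2, j)) + g (1, j) * g (2, j)) (restrict (\<lambda>p. (case p of (r, i) \<Rightarrow> X r i) \<omega>) ({1, 2} \<times> {j})))
      = noise_term F X"
    by (simp add: fun_eq_iff noise_term_def)
  ultimately show ?thesis by simp
qed

text \<open>The fourth power is split into three summands; by independence the product of the two
  errors contributes at most \<open>C\<^sup>2\<close>, and \<open>|F j| \<le> 1\<close> removes the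
  signal from the other two.\<close>

lemma noise_term_moments:
  fixes X :: "nat \<Rightarrow> int \<Rightarrow> 'a \<Rightarrow> real"
  assumes indep: "indep_vars (\<lambda>_. borel) (\<lambda>(r, i). X r i) ({1, 2} \<times> {0..h})"
    and j: "j \<in> {0..h}" and F: "\<bar>F j\<bar> \<le> 1"
    and X: "\<And>r. r \<in> {1, 2} \<Longrightarrow> integrable M (X r j) \<and> expectation (X r j) = 0 \<and>
      integrable M (\<lambda>\<omega>. X r j \<omega> ^ 4) \<and> expectation (\<lambda>\<omega>. X r j \<omega> ^ 4) \<le> C"
  shows "integrable M (\<lambda>\<omega>. noise_term F X j \<omega> ^ 4)" "expectation (noise_term F X j) = 0"
    "expectation (\<lambda>\<omega>. noise_term F X j \<omega> ^ 4) \<le> 27 * (2 * C + C\<^sup>2)"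
proof -
  have ip: "integrable M (\<lambda>\<omega>. X 1 j \<omega> ^ p * X 2 j \<omega> ^ p) \<and>
      expectation (\<lambda>\<omega>. X 1 j \<omega> ^ p * X 2 j \<omega> ^ p) = expectation (\<lambda>\<omega>. X 1 j \<omega> ^ p) * expectation (\<lambda>\<omega>. X 2 j \<omega> ^ p)"
    if "p = 1 \<or> p = 4" for p
  proof -
    have sub: "indep_vars (\<lambda>_. borel) (\<lambda>(r, i). X r i) {(1, j), (2, j)}"
      using j by (intro indep_vars_subset[OF indep]) auto
    have "indep_vars (\<lambda>_. borel) (\<lambda>q \<omega>. (\<lambda>x. x ^ p) ((case q of (r, i) \<Rightarrow> X r i) \<omega>)) {(1, j), (2, j)}"
      by (rule indep_vars_compose2[OF sub]) auto
    moreover have "integrable M (\<lambda>\<omega>. (\<lambda>x. x ^ p) ((case q of (r, i) \<Rightarrow> X r i) \<omega>))" if "q \<in> {(1, j), (2, j)}" for q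
      using that X[of 1] X[of 2] \<open>p = 1 \<or> p = 4\<close> by auto
    ultimately show ?thesis
      using indep_vars_lebesgue_integral[of "{(1, j), (2, j)}" "\<lambda>q \<omega>. (\<lambda>x. x ^ p) ((case q of (r, i) \<Rightarrow> X r i) \<omega>)"]
        indep_vars_integrable[of "{(1, j), (2, j)}" "\<lambda>q \<omega>. (\<lambda>x. x ^ p) ((case q of (r, i) \<Rightarrow> X r i) \<omega>)"]
      by simp
  qed
  have X1: "integrable M (X 1 j)" "expectation (X 1 j) = 0" "integrable M (\<lambda>\<omega>. X 1 j \<omega> ^ 4)" "expectation (\<lambda>\<omega>. X 1 j \<omega> ^ 4) \<le> C"
    and X2: "integrable M (X 2 j)" "expectation (X 2 j) = 0" "integrable M (\<lambda>\<omega>. X 2 j \<omega> ^ 4)" "expectation (\<lambda>\<omega>. X 2 j \<omega> ^ 4) \<le> C"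
    using X[of 1] X[of 2] by auto
  have p1: "integrable M (\<lambda>\<omega>. X 1 j \<omega> * X 2 j \<omega>)" "expectation (\<lambda>\<omega>. X 1 j \<omega> * X 2 j \<omega>) = 0"
    using ip[of 1] X1(2) by simp_all
  have p4: "integrable M (\<lambda>\<omega>. X 1 j \<omega> ^ 4 * X 2 j \<omega> ^ 4)"
    "expectation (\<lambda>\<omega>. X 1 j \<omega> ^ 4 * X 2 j \<omega> ^ 4) = expectation (\<lambda>\<omega>. X 1 j \<omega> ^ 4) * expectation (\<lambda>\<omega>. X 2 j \<omega> ^ 4)"
    using ip[of 4] by simp_all
  have n4: "expectation (\<lambda>\<omega>. X 1 j \<omega> ^ 4) \<ge> 0" "expectation (\<lambda>\<omega>. X 2 j \<omega> ^ 4) \<ge> 0"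
    by (auto intro: Bochner_Integration.integral_nonneg)
  have C0: "C \<ge> 0" using n4(1) X1(4) by linarith
  show "expectation (noise_term F X j) = 0"
  proof -
    have "expectation (noise_term F X j) = F j * (expectation (X 1 j) + expectation (X 2 j)) + expectation (\<lambda>\<omega>. X 1 j \<omega> * X 2 j \<omega>)"
      unfolding noise_term_def using X1(1) X2(1) p1(1) by simp
    then show ?thesis using X1(2) X2(2) p1(2) by simp
  qed
  have m: "X 1 j \<in> borel_measurable M" "X 2 j \<in> borel_measurable M" using X1(1) X2(1) by auto
  have F4: "F j ^ 4 \<le> 1" using F by (metis abs_ge_zero power_even_abs_numeral even_numeral power_le_one)
  have bound: "noise_term F X j \<omega> ^ 4 \<le> 27 * (X 1 j \<omega> ^ 4 + X 2 j \<omega> ^ 4 + X 1 j \<omega> ^ 4 * X 2 j \<omega> ^ 4)" for \<omega>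
  proof -
    have "noise_term F X j \<omega> ^ 4 = (F j * X 1 j \<omega> + F j * X 2 j \<omega> + X 1 j \<omega> * X 2 j \<omega>) ^ 4" by (simp add: noise_term_def algebra_simps)
    also have "\<dots> \<le> 27 * ((F j * X 1 j \<omega>) ^ 4 + (F j * X 2 j \<omega>) ^ 4 + (X 1 j \<omega> * X 2 j \<omega>) ^ 4)" by (rule power4_sum3_le)
    also have "\<dots> \<le> 27 * (X 1 j \<omega> ^ 4 + X 2 j \<omega> ^ 4 + X 1 j \<omega> ^ 4 * X 2 j \<omega> ^ 4)"
      using mult_right_mono[OF F4, of "X 1 j \<omega> ^ 4"] mult_right_mono[OF F4, of "X 2 j \<omega> ^ 4"]
      by (simp add: power_mult_distrib)
    finally show ?thesis .
  qed
  have ib: "integrable M (\<lambda>\<omega>. 27 * (X 1 j \<omega> ^ 4 + X 2 j \<omega> ^ 4 + X 1 j \<omega> ^ 4 * X 2 j \<omega> ^ 4))"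
    using X1(3) X2(3) p4(1) by simp
  show i4: "integrable M (\<lambda>\<omega>. noise_term F X j \<omega> ^ 4)"
  proof (rule Bochner_Integration.integrable_bound[OF ib])
    show "(\<lambda>\<omega>. noise_term F X j \<omega> ^ 4) \<in> borel_measurable M" unfolding noise_term_def using m by simp
    show "AE \<omega> in M. norm (noise_term F X j \<omega> ^ 4) \<le> norm (27 * (X 1 j \<omega> ^ 4 + X 2 j \<omega> ^ 4 + X 1 j \<omega> ^ 4 * X 2 j \<omega> ^ 4))"
      using bound by (intro AE_I2) (simp add: abs_of_nonneg)
  qed
  have "expectation (\<lambda>\<omega>. noise_term F X j \<omega> ^ 4) \<le> expectation (\<lambda>\<omega>. 27 * (X 1 j \<omega> ^ 4 + X 2 j \<omega> ^ 4 + X 1 j \<omega> ^ 4 * X 2 j \<omega> ^ 4))"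
    by (rule integral_mono[OF i4 ib bound])
  also have "\<dots> = 27 * (expectation (\<lambda>\<omega>. X 1 j \<omega> ^ 4) + expectation (\<lambda>\<omega>. X 2 j \<omega> ^ 4) + expectation (\<lambda>\<omega>. X 1 j \<omega> ^ 4) * expectation (\<lambda>\<omega>. X 2 j \<omega> ^ 4))"
    using X1(3) X2(3) p4 by simp
  also have "\<dots> \<le> 27 * (C + C + C * C)"
    using X1(4) X2(4) n4 C0 by (intro mult_left_mono add_mono mult_mono) auto
  finally show "expectation (\<lambda>\<omega>. noise_term F X j \<omega> ^ 4) \<le> 27 * (2 * C + C\<^sup>2)" by (simp add: power2_eq_square)
qed

text \<open>The squared mean of squares is at most the mean of fourth powers, whose expectation is
  bounded uniformly over the points of \<open>G k\<close> by a multiple of the summable sequence.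
  Hence the number of points in \<open>G k\<close> does not enter the bound, although the noise at
  different points is built from the same variables.\<close>

theorem noise_mean_square_tendsto_zero:
  fixes X :: "nat \<Rightarrow> nat \<Rightarrow> int \<Rightarrow> 'a \<Rightarrow> real" and h :: "nat \<Rightarrow> int" and G :: "nat \<Rightarrow> 'b set"
  assumes indep: "\<And>k. k \<ge> 1 \<Longrightarrow> indep_vars (\<lambda>_. borel) (\<lambda>(r, i). X k r i) ({1, 2} \<times> {0..h k})"
    and X: "\<And>k r j. k \<ge> 1 \<Longrightarrow> r \<in> {1, 2} \<Longrightarrow> j \<in> {0..h k} \<Longrightarrow>
      integrable M (X k r j) \<and> expectation (X k r j) = 0 \<and>
      integrable M (\<lambda>\<omega>. X k r j \<omega> ^ 4) \<and> expectation (\<lambda>\<omega>. X k r j \<omega> ^ 4) \<le> C"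
    and F: "\<And>k j. \<bar>F k j\<bar> \<le> 1"
    and G: "\<And>k. k \<ge> 1 \<Longrightarrow> finite (G k) \<and> G k \<noteq> {}"
    and b: "\<And>k x j. k \<ge> 1 \<Longrightarrow> \<bar>b k x j\<bar> \<le> \<beta> k" and \<beta>: "\<And>k. k \<ge> 1 \<Longrightarrow> \<beta> k > 0"
    and s: "summable (\<lambda>k. \<beta> k ^ 4 * (real (card {0..h k}))\<^sup>2)"
  shows "AE \<omega> in M. (\<lambda>k. (\<Sum>x\<in>G k. (\<Sum>j\<in>{0..h k}. b k x j * noise_term (F k) (X k) j \<omega>)\<^sup>2) / real (card (G k))) \<longlonglongrightarrow> 0"
proof -
  \<comment> \<open>The absolute value makes \<open>D\<close> nonnegative without information on the
    sign of \<open>C\<close>.\<close>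
  define D where "D = 27 * (2 * \<bar>C\<bar> + C\<^sup>2)"
  define B where "B = 1 + D"
  have B: "B \<ge> 1" by (simp add: B_def D_def)
  define N where "N k x \<omega> = (\<Sum>j\<in>{0..h k}. b k x j * noise_term (F k) (X k) j \<omega>)" for k x \<omega>
  define A where "A k \<omega> = (\<Sum>x\<in>G k. (N k x \<omega>)\<^sup>2) / real (card (G k))" for k \<omega>
  have N4: "integrable M (\<lambda>\<omega>. N k x \<omega> ^ 4) \<and> expectation (\<lambda>\<omega>. N k x \<omega> ^ 4) \<le> 3 * B\<^sup>2 * (\<beta> k ^ 4 * (real (card {0..h k}))\<^sup>2)"
    and Nm: "(\<lambda>\<omega>. N k x \<omega>) \<in> borel_measurable M" if k: "k \<ge> 1" for k x
  proof -
    \<comment> \<open>Division by \<open>\<beta> k\<close> normalizes the weights to modulus at most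
      1, so one constant \<open>B\<close> serves every \<open>k\<close> and
      \<open>x\<close>.\<close>
    define Z where "Z j \<omega> = (b k x j / \<beta> k) * noise_term (F k) (X k) j \<omega>" for j \<omega>
    have iZ: "indep_vars (\<lambda>_. borel) Z {0..h k}"
    proof -
      have "indep_vars (\<lambda>_. borel) (\<lambda>j \<omega>. (\<lambda>y. (b k x j / \<beta> k) * y) (noise_term (F k) (X k) j \<omega>)) {0..h k}"
        by (rule indep_vars_compose2[OF noise_term_indep[OF indep[OF k]]]) auto
      then show ?thesis by (simp add: Z_def[abs_def])
    qed
    have Zm: "integrable M (\<lambda>\<omega>. Z j \<omega> ^ 4) \<and> expectation (Z j) = 0
      \<and> expectation (\<lambda>\<omega>. Z j \<omega> ^ 2) \<le> B \<and> expectation (\<lambda>\<omega>. Z j \<omega> ^ 4) \<le> B" if j: "j \<in> {0..h k}" for j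
    proof -
      have Xj: "integrable M (X k r j) \<and> expectation (X k r j) = 0 \<and>
          integrable M (\<lambda>\<omega>. X k r j \<omega> ^ 4) \<and> expectation (\<lambda>\<omega>. X k r j \<omega> ^ 4) \<le> C" if "r \<in> {1, 2}" for r
        by (rule X[OF k that j])
      have nt: "integrable M (\<lambda>\<omega>. noise_term (F k) (X k) j \<omega> ^ 4)" "expectation (noise_term (F k) (X k) j) = 0"
        "expectation (\<lambda>\<omega>. noise_term (F k) (X k) j \<omega> ^ 4) \<le> 27 * (2 * C + C\<^sup>2)"
        by (rule noise_term_moments[OF indep[OF k] j F]; rule Xj; assumption)+
      have q: "\<bar>b k x j / \<beta> k\<bar> \<le> 1" using b[OF k, of x j] \<beta>[OF k] by (simp add: abs_divide)
      then have q4: "(b k x j / \<beta> k) ^ 4 \<le> 1" by (metis abs_ge_zero power_even_abs_numeral even_numeral power_le_one)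
      have Z4: "Z j \<omega> ^ 4 = (b k x j / \<beta> k) ^ 4 * noise_term (F k) (X k) j \<omega> ^ 4" for \<omega> by (simp only: Z_def power_mult_distrib)
      have I4: "integrable M (\<lambda>\<omega>. Z j \<omega> ^ 4)" unfolding Z4 using nt(1) by simp
      have "expectation (\<lambda>\<omega>. Z j \<omega> ^ 4) = (b k x j / \<beta> k) ^ 4 * expectation (\<lambda>\<omega>. noise_term (F k) (X k) j \<omega> ^ 4)" unfolding Z4 by simp
      also have "\<dots> \<le> 1 * expectation (\<lambda>\<omega>. noise_term (F k) (X k) j \<omega> ^ 4)"
        using q4 by (intro mult_right_mono Bochner_Integration.integral_nonneg) auto
      also have "\<dots> = expectation (\<lambda>\<omega>. noise_term (F k) (X k) j \<omega> ^ 4)" by simp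
      also note nt(3)
      also have "27 * (2 * C + C\<^sup>2) \<le> D" unfolding D_def by (intro mult_left_mono add_right_mono) simp_all
      finally have E4: "expectation (\<lambda>\<omega>. Z j \<omega> ^ 4) \<le> D" .
      have mZ: "Z j \<in> borel_measurable M" using iZ j by (auto simp: indep_vars_def)
      have "expectation (\<lambda>\<omega>. Z j \<omega> ^ 2) \<le> expectation (\<lambda>\<omega>. 1 + Z j \<omega> ^ 4)"
      proof (rule integral_mono)
        show "integrable M (\<lambda>\<omega>. Z j \<omega> ^ 2)" by (rule integrable_lower_power[OF mZ I4]) simp
        show "integrable M (\<lambda>\<omega>. 1 + Z j \<omega> ^ 4)" using I4 by simp
        show "Z j \<omega> ^ 2 \<le> 1 + Z j \<omega> ^ 4" for \<omega> using abs_power_le_one_plus[of 2 "Z j \<omega>"] by simp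
      qed
      also have "\<dots> = 1 + expectation (\<lambda>\<omega>. Z j \<omega> ^ 4)" using I4 by (simp add: prob_space)
      finally have E2: "expectation (\<lambda>\<omega>. Z j \<omega> ^ 2) \<le> B" using E4 by (simp add: B_def)
      have E1: "expectation (Z j) = 0" unfolding Z_def using nt(2) by simp
      show ?thesis using I4 E1 E2 E4 by (simp add: B_def)
    qed
    have NZ: "N k x \<omega> = \<beta> k * (\<Sum>j\<in>{0..h k}. Z j \<omega>)" for \<omega>
      unfolding N_def Z_def sum_distrib_left using \<beta>[OF k] by (intro sum.cong) auto
    note fm = fourth_moment_sum[OF finite_atLeastAtMost_int iZ B Zm]
    have N4: "N k x \<omega> ^ 4 = \<beta> k ^ 4 * (\<Sum>j\<in>{0..h k}. Z j \<omega>) ^ 4" for \<omega> unfolding NZ by (simp only: power_mult_distrib)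
    have "expectation (\<lambda>\<omega>. N k x \<omega> ^ 4) = \<beta> k ^ 4 * expectation (\<lambda>\<omega>. (\<Sum>j\<in>{0..h k}. Z j \<omega>) ^ 4)" unfolding N4 by simp
    also have "\<dots> \<le> \<beta> k ^ 4 * (3 * B\<^sup>2 * (real (card {0..h k}))\<^sup>2)" using fm \<beta>[OF k] by (intro mult_left_mono) auto
    finally show "integrable M (\<lambda>\<omega>. N k x \<omega> ^ 4) \<and> expectation (\<lambda>\<omega>. N k x \<omega> ^ 4) \<le> 3 * B\<^sup>2 * (\<beta> k ^ 4 * (real (card {0..h k}))\<^sup>2)"
      using fm unfolding N4 by (simp add: mult_ac)
    have "(\<lambda>\<omega>. \<Sum>j\<in>{0..h k}. Z j \<omega>) \<in> borel_measurable M"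
      using iZ by (intro borel_measurable_sum) (auto simp: indep_vars_def)
    then show "(\<lambda>\<omega>. N k x \<omega>) \<in> borel_measurable M" unfolding NZ by simp
  qed
  define f where "f k \<omega> = (if k \<ge> 1 then (A k \<omega>)\<^sup>2 else 0)" for k \<omega>
  have A2: "(A k \<omega>)\<^sup>2 \<le> (\<Sum>x\<in>G k. N k x \<omega> ^ 4) / real (card (G k))" if k: "k \<ge> 1" for k \<omega>
  proof -
    have c: "real (card (G k)) > 0" using G[OF k] by (simp add: card_gt_0_iff)
    have "(\<Sum>x\<in>G k. (N k x \<omega>)\<^sup>2)\<^sup>2 \<le> (\<Sum>x\<in>G k. ((N k x \<omega>)\<^sup>2)\<^sup>2) * real (card (G k))"
      by (rule sum_squared_le_sum_of_squares)
    then have "(\<Sum>x\<in>G k. (N k x \<omega>)\<^sup>2)\<^sup>2 / (real (card (G k)))\<^sup>2 \<le> ((\<Sum>x\<in>G k. ((N k x \<omega>)\<^sup>2)\<^sup>2) * real (card (G k))) / (real (card (G k)))\<^sup>2"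
      by (rule divide_right_mono) simp
    also have "\<dots> = (\<Sum>x\<in>G k. ((N k x \<omega>)\<^sup>2)\<^sup>2) / real (card (G k))" using c by (simp add: power2_eq_square)
    finally show ?thesis by (simp add: A_def power_divide)
  qed
  have intB: "integrable M (\<lambda>\<omega>. (\<Sum>x\<in>G k. N k x \<omega> ^ 4) / real (card (G k)))" if "k \<ge> 1" for k
    using N4[OF that] by simp
  have fint: "integrable M (f k)" for k
  proof (cases "k \<ge> 1")
    case True
    have "integrable M (\<lambda>\<omega>. (A k \<omega>)\<^sup>2)"
    proof (rule Bochner_Integration.integrable_bound[OF intB[OF True]])
      show "(\<lambda>\<omega>. (A k \<omega>)\<^sup>2) \<in> borel_measurable M" unfolding A_def using Nm[OF True] by simp
      show "AE \<omega> in M. norm ((A k \<omega>)\<^sup>2) \<le> norm ((\<Sum>x\<in>G k. N k x \<omega> ^ 4) / real (card (G k)))"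
      proof (rule AE_I2)
        fix \<omega>
        have "0 \<le> (\<Sum>x\<in>G k. N k x \<omega> ^ 4) / real (card (G k))" by (simp add: sum_nonneg)
        then show "norm ((A k \<omega>)\<^sup>2) \<le> norm ((\<Sum>x\<in>G k. N k x \<omega> ^ 4) / real (card (G k)))"
          using A2[OF True, of \<omega>] by (simp only: real_norm_def abs_power2 abs_of_nonneg)
      qed
    qed
    then show ?thesis using True by (simp add: f_def[abs_def])
  qed (simp add: f_def[abs_def])
  have Ef: "expectation (f k) \<le> 3 * B\<^sup>2 * (\<beta> k ^ 4 * (real (card {0..h k}))\<^sup>2)" if k: "k \<ge> 1" for k
  proof -
    have c: "real (card (G k)) > 0" using G[OF k] by (simp add: card_gt_0_iff)
    have "expectation (f k) \<le> expectation (\<lambda>\<omega>. (\<Sum>x\<in>G k. N k x \<omega> ^ 4) / real (card (G k)))"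
      using A2[OF k] k by (intro integral_mono fint intB) (auto simp: f_def)
    also have "\<dots> = (\<Sum>x\<in>G k. expectation (\<lambda>\<omega>. N k x \<omega> ^ 4)) / real (card (G k))"
      using N4[OF k] by simp
    also have "\<dots> \<le> (\<Sum>x\<in>G k. 3 * B\<^sup>2 * (\<beta> k ^ 4 * (real (card {0..h k}))\<^sup>2)) / real (card (G k))"
      using N4[OF k] c by (intro divide_right_mono sum_mono) auto
    also have "\<dots> = 3 * B\<^sup>2 * (\<beta> k ^ 4 * (real (card {0..h k}))\<^sup>2)" using c by simp
    finally show ?thesis .
  qed
  have "summable (\<lambda>k. expectation (f k))"
  proof (rule summable_comparison_test_ev)
    show "\<forall>\<^sub>F k in sequentially. norm (expectation (f k)) \<le> 3 * B\<^sup>2 * (\<beta> k ^ 4 * (real (card {0..h k}))\<^sup>2)"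
      using eventually_ge_at_top[of 1]
    proof eventually_elim
      case (elim k)
      have "expectation (f k) \<ge> 0" by (intro Bochner_Integration.integral_nonneg) (simp add: f_def)
      then show ?case using Ef[OF elim] by simp
    qed
    show "summable (\<lambda>k. 3 * B\<^sup>2 * (\<beta> k ^ 4 * (real (card {0..h k}))\<^sup>2))" using s by (rule summable_mult)
  qed
  then have "AE \<omega> in M. (\<lambda>k. f k \<omega>) \<longlonglongrightarrow> 0"
  proof (rule AE_tendsto_zero_if_summable_expectation[OF fint, rotated])
    show "0 \<le> f k \<omega>" for k \<omega> by (simp add: f_def)
  qed
  then show ?thesis
  proof (rule AE_mp, intro AE_I2 impI)
    fix \<omega> assume "(\<lambda>k. f k \<omega>) \<longlonglongrightarrow> 0"
    then have "(\<lambda>k. sqrt (f k \<omega>)) \<longlonglongrightarrow> sqrt 0" by (rule tendsto_real_sqrt)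
    moreover have "\<forall>\<^sub>F k in sequentially. sqrt (f k \<omega>) = A k \<omega>"
      using eventually_ge_at_top[of 1]
      by eventually_elim (simp add: f_def A_def sum_nonneg)
    ultimately have "(\<lambda>k. A k \<omega>) \<longlonglongrightarrow> 0" using tendsto_cong by force
    then show "(\<lambda>k. (\<Sum>x\<in>G k. (\<Sum>j\<in>{0..h k}. b k x j * noise_term (F k) (X k) j \<omega>)\<^sup>2) / real (card (G k))) \<longlonglongrightarrow> 0"
      by (simp add: A_def N_def)
  qed
qed

end

section \<open>Trigonometric kernels\<close>

text \<open>Fubini's theorem for product functions. Lebesgue measure is an image of a product
  measure indexed by basis vectors, and \<open>ix\<close> takes a basis vector back to its
  coordinate index.\<close>

lemma lborel_integral_prod_cart:
  fixes f :: "'n::finite \<Rightarrow> real \<Rightarrow> real"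
  assumes f: "\<And>i. integrable lborel (f i)"
  shows "integrable lborel (\<lambda>x::real^'n. \<Prod>i\<in>UNIV. f i (x $ i))"
    and "(\<integral>x. (\<Prod>i\<in>UNIV. f i (x $ i)) \<partial>(lborel :: (real^'n) measure)) = (\<Prod>i\<in>UNIV. \<integral>s. f i s \<partial>lborel)"
proof -
  interpret P: product_sigma_finite "\<lambda>_::real^'n. lborel :: real measure" by standard
  define ix where "ix = inv (\<lambda>i::'n. axis i (1::real))"
  have inj: "inj (\<lambda>i::'n. axis i (1::real))" by (auto simp: inj_on_def axis_eq_axis)
  have ix: "ix (axis i 1) = i" for i unfolding ix_def by (rule inv_f_f[OF inj])
  have B: "(Basis :: (real^'n) set) = range (\<lambda>i. axis i 1)" by (auto simp: Basis_vec_def)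
  have co: "(\<Sum>b\<in>Basis. \<omega> b *\<^sub>R b) $ i = \<omega> (axis i 1)" for \<omega> :: "real^'n \<Rightarrow> real" and i :: 'n
  proof -
    have "(\<Sum>b\<in>Basis. \<omega> b *\<^sub>R b) $ i = (\<Sum>b\<in>Basis. \<omega> b *\<^sub>R b) \<bullet> axis i 1" by (simp add: inner_axis)
    also have "\<dots> = \<omega> (axis i 1)"
      by (subst inner_sum_left) (simp add: inner_Basis B if_distrib cong: if_cong sum.cong)
    finally show ?thesis .
  qed
  have pr: "(\<Prod>i\<in>UNIV. f i ((\<Sum>b\<in>Basis. \<omega> b *\<^sub>R b) $ i)) = (\<Prod>b\<in>Basis. f (ix b) (\<omega> b))" for \<omega> :: "real^'n \<Rightarrow> real"
    unfolding B co[unfolded B] by (subst prod.reindex[OF inj]) (simp add: ix)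
  have meas: "(\<lambda>x::real^'n. \<Prod>i\<in>UNIV. f i (x $ i)) \<in> borel_measurable borel"
  proof (intro borel_measurable_prod)
    fix i
    have "f i \<in> borel_measurable borel" using f[of i] by (auto dest: borel_measurable_integrable)
    moreover have "(\<lambda>x::real^'n. x $ i) \<in> borel_measurable borel" by (intro borel_measurable_continuous_onI continuous_intros)
    ultimately show "(\<lambda>x::real^'n. f i (x $ i)) \<in> borel_measurable borel" by (rule measurable_compose[rotated])
  qed
  have T: "(\<lambda>\<omega>. \<Sum>b\<in>Basis. \<omega> b *\<^sub>R b) \<in> measurable (\<Pi>\<^sub>M b\<in>(Basis::(real^'n) set). lborel) borel" by measurable
  have "integrable (\<Pi>\<^sub>M b\<in>(Basis::(real^'n) set). lborel) (\<lambda>\<omega>. \<Prod>b\<in>Basis. f (ix b) (\<omega> b))"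
    by (intro P.product_integrable_prod f) simp
  then have "integrable (\<Pi>\<^sub>M b\<in>(Basis::(real^'n) set). lborel) (\<lambda>\<omega>. \<Prod>i\<in>UNIV. f i ((\<Sum>b\<in>Basis. \<omega> b *\<^sub>R b) $ i))"
    unfolding pr .
  then have "integrable (distr (\<Pi>\<^sub>M b\<in>(Basis::(real^'n) set). lborel) borel (\<lambda>f. \<Sum>b\<in>Basis. f b *\<^sub>R b)) (\<lambda>x. \<Prod>i\<in>UNIV. f i (x $ i))"
    by (rule integrable_distr_eq[OF T meas, THEN iffD2])
  then show "integrable lborel (\<lambda>x::real^'n. \<Prod>i\<in>UNIV. f i (x $ i))"
    by (simp only: lborel_eq[where 'a="real^'n", symmetric])
  have "(\<integral>x. (\<Prod>i\<in>UNIV. f i (x $ i)) \<partial>(distr (\<Pi>\<^sub>M b\<in>(Basis::(real^'n) set). lborel) borel (\<lambda>f. \<Sum>b\<in>Basis. f b *\<^sub>R b))) =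
      (\<integral>\<omega>. (\<Prod>b\<in>Basis. f (ix b) (\<omega> b)) \<partial>(\<Pi>\<^sub>M b\<in>(Basis::(real^'n) set). lborel))"
    unfolding integral_distr[OF T meas] pr ..
  then have "(\<integral>x. (\<Prod>i\<in>UNIV. f i (x $ i)) \<partial>(lborel :: (real^'n) measure)) =
      (\<integral>\<omega>. (\<Prod>b\<in>Basis. f (ix b) (\<omega> b)) \<partial>(\<Pi>\<^sub>M b\<in>(Basis::(real^'n) set). lborel))"
    by (simp only: lborel_eq[where 'a="real^'n", symmetric])
  also have "\<dots> = (\<Prod>b\<in>(Basis::(real^'n) set). \<integral>s. f (ix b) s \<partial>lborel)"
    by (intro P.product_integral_prod f) simp
  also have "\<dots> = (\<Prod>i\<in>UNIV. \<integral>s. f i s \<partial>lborel)" unfolding B by (subst prod.reindex[OF inj]) (simp add: ix)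
  finally show "(\<integral>x. (\<Prod>i\<in>UNIV. f i (x $ i)) \<partial>(lborel :: (real^'n) measure)) = (\<Prod>i\<in>UNIV. \<integral>s. f i s \<partial>lborel)" .
qed

lemma integral_cis_period:
  assumes R: "R > 0"
  shows "integrable lborel (\<lambda>s. indicator {- pi * R..pi * R} s *\<^sub>R cis (of_int m * s / R))"
    and "(\<integral>s. indicator {- pi * R..pi * R} s *\<^sub>R cis (of_int m * s / R) \<partial>lborel) = (if m = 0 then complex_of_real (2 * pi * R) else 0)"
proof -
  show "integrable lborel (\<lambda>s. indicator {- pi * R..pi * R} s *\<^sub>R cis (of_int m * s / R))"
    using R by (intro borel_integrable_compact continuous_intros) auto
  show "(\<integral>s. indicator {- pi * R..pi * R} s *\<^sub>R cis (of_int m * s / R) \<partial>lborel) = (if m = 0 then complex_of_real (2 * pi * R) else 0)"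
  proof (cases "m = 0")
    case True
    then show ?thesis using R by (simp add: scaleR_conv_of_real)
  next
    case False
    define G where "G s = Complex ((R / of_int m) * sin (of_int m * s / R)) (- ((R / of_int m) * cos (of_int m * s / R)))" for s
    have d: "(G has_vector_derivative cis (of_int m * s / R)) (at s within S)" for s S
      unfolding has_vector_derivative_complex_iff G_def using False R
      by (auto intro!: derivative_eq_intros simp: field_simps)
    have "(\<integral>s. indicator {- pi * R..pi * R} s *\<^sub>R cis (of_int m * s / R) \<partial>lborel) = G (pi * R) - G (- pi * R)"
      using R by (intro integral_FTC_Icc d continuous_intros) auto
    also have "\<dots> = 0"
    proof -
      have "sin (of_int m * (pi * R) / R) = 0" "sin (of_int m * (- pi * R) / R) = 0"
        using R sin_npi_int[of m] by (simp_all add: mult.commute)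
      moreover have "cos (of_int m * (pi * R) / R) = cos (of_int m * (- pi * R) / R)" using R by simp
      ultimately show ?thesis by (simp only: G_def) (simp add: complex_eq_iff)
    qed
    finally show ?thesis using False by simp
  qed
qed

text \<open>The squared modulus of a trigonometric polynomial with nonnegative coefficients is a
  nonnegative kernel with nonnegative Fourier coefficients. The weights \<beta> remain a parameter
  because two choices are needed: constant ones, giving the Fejer kernel, and sines, giving strong
  concentration.\<close>

locale trig_kernel =
  fixes R :: real and k :: nat and \<beta> :: "nat \<Rightarrow> real"
  assumes R: "R > 0" and \<beta>: "\<And>p. \<beta> p \<ge> 0" and \<beta>0: "\<exists>p\<le>k. \<beta> p > 0"
begin

definition "nrm = (\<Sum>p\<le>k. (\<beta> p)\<^sup>2)"

text \<open>The normalized autocorrelation of the weights, which gives the Fourier coefficients of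
  the kernel \<open>kap\<close>.\<close>

definition w :: "int \<Rightarrow> real" where
  "w m = (\<Sum>p\<le>k. \<Sum>q\<le>k. if int p - int q = m then \<beta> p * \<beta> q else 0) / nrm"

definition kap :: "real \<Rightarrow> real" where
  "kap s = (cmod (\<Sum>p\<le>k. \<beta> p *\<^sub>R cis (real p * s / R)))\<^sup>2 / (2 * pi * R * nrm)"

definition win :: "real set" where "win = {- pi * R..pi * R}"

lemma nrm_pos: "nrm > 0"
proof -
  obtain p where "p \<le> k" "\<beta> p > 0" using \<beta>0 by blast
  then show ?thesis unfolding nrm_def by (intro sum_pos2[of _ p]) auto
qed

lemma kap_nonneg: "kap s \<ge> 0"
  using R nrm_pos by (simp add: kap_def)

lemma w_nonneg: "w m \<ge> 0"
  using nrm_pos \<beta> unfolding w_def by (intro divide_nonneg_pos sum_nonneg) auto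

text \<open>Bound \<open>\<beta> p * \<beta> q\<close> by half the sum of squares; for a fixed
  difference \<open>m\<close> every index occurs at most once as \<open>p\<close> and once as
  \<open>q\<close>.\<close>

lemma w_le_1: "w m \<le> 1"
proof -
  have "(\<Sum>p\<le>k. \<Sum>q\<le>k. if int p - int q = m then \<beta> p * \<beta> q else 0)
      \<le> (\<Sum>p\<le>k. \<Sum>q\<le>k. if int p - int q = m then ((\<beta> p)\<^sup>2 + (\<beta> q)\<^sup>2) / 2 else 0)"
  proof (intro sum_mono)
    fix p q
    have "0 \<le> (\<beta> p - \<beta> q)\<^sup>2" by simp
    then show "(if int p - int q = m then \<beta> p * \<beta> q else 0) \<le> (if int p - int q = m then ((\<beta> p)\<^sup>2 + (\<beta> q)\<^sup>2) / 2 else 0)"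
      by (simp add: power2_eq_square algebra_simps)
  qed
  also have "\<dots> = (\<Sum>p\<le>k. \<Sum>q\<le>k. if int p - int q = m then (\<beta> p)\<^sup>2 / 2 else 0) + (\<Sum>p\<le>k. \<Sum>q\<le>k. if int p - int q = m then (\<beta> q)\<^sup>2 / 2 else 0)"
    unfolding sum.distrib[symmetric] by (intro sum.cong refl) (simp add: add_divide_distrib)
  also have "\<dots> \<le> (\<Sum>p\<le>k. (\<beta> p)\<^sup>2 / 2) + (\<Sum>q\<le>k. (\<beta> q)\<^sup>2 / 2)"
  proof (rule add_mono)
    show "(\<Sum>p\<le>k. \<Sum>q\<le>k. if int p - int q = m then (\<beta> p)\<^sup>2 / 2 else 0) \<le> (\<Sum>p\<le>k. (\<beta> p)\<^sup>2 / 2)"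
    proof (rule sum_mono)
      fix p
      have "(\<Sum>q\<le>k. if int p - int q = m then (\<beta> p)\<^sup>2 / 2 else 0) = (\<Sum>q\<le>k. if q = nat (int p - m) \<and> int p \<ge> m then (\<beta> p)\<^sup>2 / 2 else 0)"
        by (intro sum.cong refl if_cong) auto
      also have "\<dots> \<le> (\<Sum>q\<le>k. if q = nat (int p - m) then (\<beta> p)\<^sup>2 / 2 else 0)" by (intro sum_mono) auto
      also have "\<dots> \<le> (\<beta> p)\<^sup>2 / 2" by (simp add: sum.delta)
      finally show "(\<Sum>q\<le>k. if int p - int q = m then (\<beta> p)\<^sup>2 / 2 else 0) \<le> (\<beta> p)\<^sup>2 / 2" .
    qed
    show "(\<Sum>p\<le>k. \<Sum>q\<le>k. if int p - int q = m then (\<beta> q)\<^sup>2 / 2 else 0) \<le> (\<Sum>q\<le>k. (\<beta> q)\<^sup>2 / 2)"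
    proof (subst sum.swap, rule sum_mono)
      fix q
      have "(\<Sum>p\<le>k. if int p - int q = m then (\<beta> q)\<^sup>2 / 2 else 0) = (\<Sum>p\<le>k. if p = nat (int q + m) \<and> int q + m \<ge> 0 then (\<beta> q)\<^sup>2 / 2 else 0)"
        by (intro sum.cong refl if_cong) auto
      also have "\<dots> \<le> (\<Sum>p\<le>k. if p = nat (int q + m) then (\<beta> q)\<^sup>2 / 2 else 0)" by (intro sum_mono) auto
      also have "\<dots> \<le> (\<beta> q)\<^sup>2 / 2" by (simp add: sum.delta)
      finally show "(\<Sum>p\<le>k. if int p - int q = m then (\<beta> q)\<^sup>2 / 2 else 0) \<le> (\<beta> q)\<^sup>2 / 2" .
    qed
  qed
  also have "\<dots> = nrm" by (simp add: nrm_def sum_divide_distrib[symmetric])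
  finally show ?thesis using nrm_pos by (simp add: w_def)
qed

lemma w_0: "w 0 = 1"
proof -
  have "(\<Sum>p\<le>k. \<Sum>q\<le>k. if int p - int q = 0 then \<beta> p * \<beta> q else 0) = (\<Sum>p\<le>k. \<Sum>q\<le>k. if q = p then \<beta> p * \<beta> p else 0)"
    by (intro sum.cong refl) auto
  also have "\<dots> = nrm" by (simp add: nrm_def power2_eq_square)
  finally show ?thesis using nrm_pos by (simp add: w_def)
qed

lemma kap_expand: "complex_of_real (kap s) = (\<Sum>m\<in>{- int k..int k}. (w m / (2 * pi * R)) *\<^sub>R cis (of_int m * s / R))"
proof -
  let ?z = "\<Sum>p\<le>k. \<beta> p *\<^sub>R cis (real p * s / R)"
  have "complex_of_real ((cmod ?z)\<^sup>2) = ?z * cnj ?z" by (rule complex_norm_square)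
  also have "cnj ?z = (\<Sum>q\<le>k. \<beta> q *\<^sub>R cis (- (real q * s / R)))" by (simp add: cis_cnj)
  also have "?z * \<dots> = (\<Sum>p\<le>k. \<Sum>q\<le>k. (\<beta> p * \<beta> q) *\<^sub>R cis (of_int (int p - int q) * s / R))"
    unfolding sum_product by (intro sum.cong refl) (simp add: cis_mult left_diff_distrib diff_divide_distrib)
  also have "\<dots> = (\<Sum>p\<le>k. \<Sum>q\<le>k. \<Sum>m\<in>{- int k..int k}. if int p - int q = m then (\<beta> p * \<beta> q) *\<^sub>R cis (of_int m * s / R) else 0)"
    by (intro sum.cong refl) (auto simp: sum.delta)
  also have "\<dots> = (\<Sum>m\<in>{- int k..int k}. \<Sum>p\<le>k. \<Sum>q\<le>k. if int p - int q = m then (\<beta> p * \<beta> q) *\<^sub>R cis (of_int m * s / R) else 0)"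
  proof -
    let ?f = "\<lambda>p q m. if int p - int q = m then (\<beta> p * \<beta> q) *\<^sub>R cis (of_int m * s / R) else 0"
    have "(\<Sum>p\<le>k. \<Sum>q\<le>k. \<Sum>m\<in>{- int k..int k}. ?f p q m) = (\<Sum>p\<le>k. \<Sum>m\<in>{- int k..int k}. \<Sum>q\<le>k. ?f p q m)"
      by (intro sum.cong refl sum.swap)
    also have "\<dots> = (\<Sum>m\<in>{- int k..int k}. \<Sum>p\<le>k. \<Sum>q\<le>k. ?f p q m)" by (rule sum.swap)
    finally show ?thesis .
  qed
  also have "\<dots> = (\<Sum>m\<in>{- int k..int k}. (w m * nrm) *\<^sub>R cis (of_int m * s / R))"
  proof (intro sum.cong refl)
    fix m
    have "w m * nrm = (\<Sum>p\<le>k. \<Sum>q\<le>k. if int p - int q = m then \<beta> p * \<beta> q else 0)"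
      using nrm_pos by (simp add: w_def)
    then show "(\<Sum>p\<le>k. \<Sum>q\<le>k. if int p - int q = m then (\<beta> p * \<beta> q) *\<^sub>R cis (of_int m * s / R) else 0) = (w m * nrm) *\<^sub>R cis (of_int m * s / R)"
      by (simp add: scaleR_sum_left if_distrib[of "\<lambda>x. x *\<^sub>R _"] cong: if_cong)
  qed
  finally have "complex_of_real ((cmod ?z)\<^sup>2) = (\<Sum>m\<in>{- int k..int k}. (w m * nrm) *\<^sub>R cis (of_int m * s / R))" .
  then have "complex_of_real (kap s) = (1 / (2 * pi * R * nrm)) *\<^sub>R (\<Sum>m\<in>{- int k..int k}. (w m * nrm) *\<^sub>R cis (of_int m * s / R))"
    by (simp add: kap_def scaleR_conv_of_real)
  also have "\<dots> = (\<Sum>m\<in>{- int k..int k}. (w m / (2 * pi * R)) *\<^sub>R cis (of_int m * s / R))"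
    unfolding scaleR_sum_right using nrm_pos by (intro sum.cong refl) simp
  finally show ?thesis .
qed

lemma continuous_kap: "continuous_on S kap"
  unfolding kap_def using R nrm_pos by (intro continuous_intros) auto

lemma integrable_kap: "continuous_on win h \<Longrightarrow> integrable lborel (\<lambda>s. indicator win s *\<^sub>R (kap s * h s :: real))"
  unfolding win_def by (intro borel_integrable_compact continuous_intros continuous_kap) auto

lemma integral_kap_cis:
  assumes a: "\<bar>a\<bar> \<le> int k"
  shows "(\<integral>s. indicator win s *\<^sub>R (complex_of_real (kap s) * cis (of_int a * s / R)) \<partial>lborel) = complex_of_real (w (- a))"
proof -
  note ic = integral_cis_period[OF R]
  have "(\<integral>s. indicator win s *\<^sub>R (complex_of_real (kap s) * cis (of_int a * s / R)) \<partial>lborel) =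
      (\<integral>s. (\<Sum>m\<in>{- int k..int k}. (w m / (2 * pi * R)) *\<^sub>R (indicator win s *\<^sub>R cis (of_int (m + a) * s / R))) \<partial>lborel)"
    unfolding kap_expand
  proof (intro Bochner_Integration.integral_cong refl)
    fix s
    have "(\<Sum>m\<in>{- int k..int k}. (w m / (2 * pi * R)) *\<^sub>R cis (of_int m * s / R)) * cis (of_int a * s / R)
        = (\<Sum>m\<in>{- int k..int k}. (w m / (2 * pi * R)) *\<^sub>R cis (of_int (m + a) * s / R))"
      unfolding sum_distrib_right
      by (intro sum.cong refl) (simp add: cis_mult distrib_right add_divide_distrib)
    then show "indicator win s *\<^sub>R ((\<Sum>m\<in>{- int k..int k}. (w m / (2 * pi * R)) *\<^sub>R cis (of_int m * s / R)) * cis (of_int a * s / R))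
        = (\<Sum>m\<in>{- int k..int k}. (w m / (2 * pi * R)) *\<^sub>R (indicator win s *\<^sub>R cis (of_int (m + a) * s / R)))"
      by (simp only: scaleR_sum_right scaleR_left_commute)
  qed
  also have "\<dots> = (\<Sum>m\<in>{- int k..int k}. (\<integral>s. (w m / (2 * pi * R)) *\<^sub>R (indicator win s *\<^sub>R cis (of_int (m + a) * s / R)) \<partial>lborel))"
    unfolding win_def by (intro Bochner_Integration.integral_sum integrable_scaleR_right ic(1))
  also have "\<dots> = (\<Sum>m\<in>{- int k..int k}. (w m / (2 * pi * R)) *\<^sub>R (\<integral>s. (indicator win s *\<^sub>R cis (of_int (m + a) * s / R)) \<partial>lborel))"
    unfolding win_def by (intro sum.cong refl integral_scaleR_right ic(1))
  also have "\<dots> = (\<Sum>m\<in>{- int k..int k}. (w m / (2 * pi * R)) *\<^sub>R (if m + a = 0 then complex_of_real (2 * pi * R) else 0))"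
    unfolding win_def by (simp only: ic(2))
  also have "\<dots> = (\<Sum>m\<in>{- int k..int k}. if m = - a then complex_of_real (w m) else 0)"
    using R by (intro sum.cong refl) (auto simp: scaleR_conv_of_real)
  also have "\<dots> = complex_of_real (w (- a))" using a by (auto simp: sum.delta)
  finally show ?thesis .
qed

lemma integral_kap: "(\<integral>s. indicator win s *\<^sub>R kap s \<partial>lborel) = 1"
proof -
  have "complex_of_real (\<integral>s. indicator win s *\<^sub>R kap s \<partial>lborel) = (\<integral>s. complex_of_real (indicator win s *\<^sub>R kap s) \<partial>lborel)"
    by (rule integral_complex_of_real[symmetric])
  also have "\<dots> = (\<integral>s. indicator win s *\<^sub>R (complex_of_real (kap s) * cis (of_int 0 * s / R)) \<partial>lborel)"
    by (intro Bochner_Integration.integral_cong refl) (simp add: scaleR_conv_of_real)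
  also have "\<dots> = 1" using integral_kap_cis[of 0] by (simp add: w_0)
  finally show ?thesis by (simp only: of_real_eq_1_iff)
qed

text \<open>The function \<open>1 - cos (s / R)\<close> plays the role of a second moment on the
  period, so the concentration of the kernel is governed by its first Fourier coefficient.\<close>

lemma integral_kap_cos:
  assumes k: "k \<ge> 1"
  shows "(\<integral>s. indicator win s *\<^sub>R (kap s * (1 - cos (s / R))) \<partial>lborel) = 1 - w (- 1)"
proof -
  have int: "integrable lborel (\<lambda>s. indicator win s *\<^sub>R (complex_of_real (kap s) * cis (of_int 1 * s / R)))"
    unfolding win_def using R by (intro borel_integrable_compact continuous_intros continuous_kap) auto
  have "(\<integral>s. indicator win s *\<^sub>R (kap s * cos (s / R)) \<partial>lborel) =
      (\<integral>s. Re (indicator win s *\<^sub>R (complex_of_real (kap s) * cis (of_int 1 * s / R))) \<partial>lborel)"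
    by (intro Bochner_Integration.integral_cong refl) simp
  also have "\<dots> = Re (\<integral>s. indicator win s *\<^sub>R (complex_of_real (kap s) * cis (of_int 1 * s / R)) \<partial>lborel)"
    by (rule integral_Re[OF int])
  also have "\<dots> = w (- 1)" using integral_kap_cis[of 1] k by simp
  finally have c: "(\<integral>s. indicator win s *\<^sub>R (kap s * cos (s / R)) \<partial>lborel) = w (- 1)" .
  have i1: "integrable lborel (\<lambda>s. indicator win s *\<^sub>R (kap s * 1))" by (intro integrable_kap continuous_intros)
  have i2: "integrable lborel (\<lambda>s. indicator win s *\<^sub>R (kap s * cos (s / R)))" using R by (intro integrable_kap continuous_intros) auto
  have "(\<integral>s. indicator win s *\<^sub>R (kap s * (1 - cos (s / R))) \<partial>lborel) = (\<integral>s. indicator win s *\<^sub>R (kap s * 1) - indicator win s *\<^sub>R (kap s * cos (s / R)) \<partial>lborel)"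
    by (intro Bochner_Integration.integral_cong refl) (simp add: algebra_simps)
  also have "\<dots> = (\<integral>s. indicator win s *\<^sub>R (kap s * 1) \<partial>lborel) - w (- 1)"
    using Bochner_Integration.integral_diff[OF i1 i2] c by simp
  finally show ?thesis using integral_kap by simp
qed

end

section \<open>The Fourier series of the covariogram\<close>

lemma lborel_distr_uminus_euclidean: "distr lborel borel uminus = (lborel :: 'a::euclidean_space measure)"
proof -
  have "lborel = density (distr lborel borel (\<lambda>x::'a. 0 + (-1) *\<^sub>R x)) (\<lambda>_. ennreal (\<bar>-1\<bar> ^ DIM('a)))"
    by (rule lborel_affine) simp
  then show ?thesis by (simp add: density_1)
qed

lemma lborel_integral_reflect:
  fixes f :: "'a::euclidean_space \<Rightarrow> 'b::{banach, second_countable_topology}"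
  assumes f: "f \<in> borel_measurable borel"
  shows "(\<integral>t. f (b - t) \<partial>lborel) = (\<integral>t. f t \<partial>lborel)"
proof -
  have m: "(\<lambda>x. f (b + x)) \<in> borel_measurable borel" using f by measurable
  have "(\<integral>t. f t \<partial>lborel) = (\<integral>t. f t \<partial>distr lborel borel ((+) b))" by (simp add: lborel_distr_plus)
  also have "\<dots> = (\<integral>t. f (b + t) \<partial>lborel)" using f by (intro integral_distr) auto
  also have "\<dots> = (\<integral>t. f (b + t) \<partial>distr lborel borel uminus)" by (simp add: lborel_distr_uminus_euclidean)
  also have "\<dots> = (\<integral>t. f (b + (- t)) \<partial>lborel)" using m by (intro integral_distr) auto
  finally show ?thesis by simp
qed

lemma covariogram_integral:
  fixes K :: "'a::euclidean_space set"
  assumes K: "compact K"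
  shows "covariogram K t = (\<integral>b. indicator K b * indicator K (b - t) \<partial>lborel)"
proof -
  have b: "K \<inter> (+) t ` K \<in> sets borel"
    using K compact_translation[OF K, of t] by (intro sets.Int borel_closed compact_imp_closed)
  have "covariogram K t = measure lborel (K \<inter> (+) t ` K)" using b by (simp add: covariogram_def)
  also have "\<dots> = (\<integral>b. indicator (K \<inter> (+) t ` K) b \<partial>lborel)" using b by simp
  also have "\<dots> = (\<integral>b. indicator K b * indicator K (b - t) \<partial>lborel)"
  proof (intro Bochner_Integration.integral_cong refl)
    fix b
    have "b \<in> (+) t ` K \<longleftrightarrow> b - t \<in> K" by (force simp: image_iff)
    then show "indicator (K \<inter> (+) t ` K) b = (indicator K b * indicator K (b - t) :: real)" by (simp add: indicator_def)
  qed
  finally show ?thesis .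
qed

lemma integrable_covariogram_times:
  fixes K :: "'a::euclidean_space set" and f :: "'a \<Rightarrow> 'b::{banach, second_countable_topology}"
  assumes K: "compact K" and f: "continuous_on UNIV f"
  shows "integrable lborel (\<lambda>t. covariogram K t *\<^sub>R f t)"
proof -
  define C where "C = {x - y |x y. x \<in> K \<and> y \<in> K}"
  have C: "compact C" unfolding C_def using K K by (rule compact_differences)
  have z: "covariogram K t = 0" if "t \<notin> C" for t
  proof -
    have "K \<inter> (+) t ` K = {}"
    proof (rule ccontr)
      assume "K \<inter> (+) t ` K \<noteq> {}"
      then obtain y where "t + y \<in> K" "y \<in> K" by blast
      then have "t \<in> C" unfolding C_def by force
      then show False using that by blast
    qed
    then show ?thesis by (simp add: covariogram_def)
  qed
  have "integrable lborel (\<lambda>t. indicator C t *\<^sub>R (covariogram K t *\<^sub>R f t))"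
    by (intro borel_integrable_compact C continuous_intros continuous_covariogram K continuous_on_subset[OF f]) auto
  moreover have "(\<lambda>t. indicator C t *\<^sub>R (covariogram K t *\<^sub>R f t)) = (\<lambda>t. covariogram K t *\<^sub>R f t)"
    using z by (auto simp: fun_eq_iff indicator_def)
  ultimately show ?thesis by simp
qed

text \<open>The covariogram is the autocorrelation of the indicator function, so by Fubini's theorem
  its transform is \<open>F * cnj F\<close>. This is how measured moduli carry information on the
  covariogram.\<close>

lemma covariogram_fourier:
  fixes K :: "'a::euclidean_space set"
  assumes K: "compact K"
  shows "(\<integral>t. covariogram K t *\<^sub>R cis (z \<bullet> t) \<partial>lborel) = complex_of_real ((cmod (fourier_transform (indicator K) z))\<^sup>2)"
proof -
  have Kb [measurable]: "K \<in> sets borel" using K by (intro borel_closed compact_imp_closed)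
  have cism' [measurable]: "(\<lambda>a. cis (- (z \<bullet> a))) \<in> borel_measurable borel"
    by (intro borel_measurable_continuous_onI continuous_intros)
  define F where "F = (\<integral>a. indicator K a *\<^sub>R cis (- (z \<bullet> a)) \<partial>lborel)"
  have Ffou: "fourier_transform (indicator K) z = F"
  proof -
    have m: "(\<lambda>a. indicator K a *\<^sub>R cis (- (z \<bullet> a))) \<in> borel_measurable lborel" by measurable
    have "fourier_transform (indicator K) z = (\<integral>a. indicator K a *\<^sub>R cis (- (z \<bullet> a)) \<partial>lebesgue)"
      unfolding fourier_transform_def
      by (intro Bochner_Integration.integral_cong refl) (simp add: indicator_def cis_conv_exp)
    also have "\<dots> = F" unfolding F_def using m by (rule integral_completion)
    finally show ?thesis .
  qed
  define C where "C = {x - y |x y. x \<in> K \<and> y \<in> K}"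
  have C: "compact C" unfolding C_def using K K by (rule compact_differences)
  have Cb [measurable]: "C \<in> sets borel" using C by (intro borel_closed compact_imp_closed)
  define f where "f t b = (indicator K b * indicator K (b - t) :: real) *\<^sub>R cis (z \<bullet> t)" for t b
  have cism [measurable]: "(\<lambda>t. cis (z \<bullet> t)) \<in> borel_measurable borel"
    by (intro borel_measurable_continuous_onI continuous_intros)
  \<comment> \<open>If \<open>b\<close> and \<open>b - t\<close> are in \<open>K\<close>, then
    \<open>t\<close> is in the difference set \<open>C\<close>, so \<open>f\<close> is supported in
    \<open>C \<times> K\<close> and bounded by 1.\<close>
  have fint: "integrable (lborel \<Otimes>\<^sub>M lborel) (\<lambda>(t, b). f t b)"
  proof (rule Bochner_Integration.integrable_bound[where f = "indicator (C \<times> K) :: 'a \<times> 'a \<Rightarrow> real"])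
    have "emeasure (lborel \<Otimes>\<^sub>M lborel) (C \<times> K) = emeasure lborel C * emeasure lborel K"
      by (intro lborel.emeasure_pair_measure_Times) auto
    also have "\<dots> < \<infinity>" using emeasure_compact_finite[OF C] emeasure_compact_finite[OF K] by (simp add: ennreal_mult_less_top)
    finally show "integrable (lborel \<Otimes>\<^sub>M lborel) (indicator (C \<times> K) :: 'a \<times> 'a \<Rightarrow> real)"
      by (intro integrable_real_indicator) auto
    show "(\<lambda>(t, b). f t b) \<in> borel_measurable (lborel \<Otimes>\<^sub>M lborel)"
      unfolding f_def by measurable
    show "AE x in lborel \<Otimes>\<^sub>M lborel. norm (case x of (t, b) \<Rightarrow> f t b) \<le> norm (indicator (C \<times> K) x :: real)"
    proof (rule AE_I2)
      fix x :: "'a \<times> 'a"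
      obtain t b where x: "x = (t, b)" by (cases x)
      have "t \<in> C" if "b \<in> K" "b - t \<in> K" using that unfolding C_def by force
      then show "norm (case x of (t, b) \<Rightarrow> f t b) \<le> norm (indicator (C \<times> K) x :: real)"
        by (auto simp: x f_def indicator_def)
    qed
  qed
  have "(\<integral>t. covariogram K t *\<^sub>R cis (z \<bullet> t) \<partial>lborel) = (\<integral>t. (\<integral>b. f t b \<partial>lborel) \<partial>lborel)"
  proof (intro Bochner_Integration.integral_cong refl)
    fix t
    have i: "integrable lborel (\<lambda>b. indicator K b * indicator K (b - t) :: real)"
    proof (rule Bochner_Integration.integrable_bound[where f = "indicator K :: 'a \<Rightarrow> real"])
      show "integrable lborel (indicator K :: 'a \<Rightarrow> real)"
        using emeasure_compact_finite[OF K] by (intro integrable_real_indicator) auto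
      show "(\<lambda>b. indicator K b * indicator K (b - t) :: real) \<in> borel_measurable lborel" by measurable
    qed (auto simp: indicator_def)
    show "covariogram K t *\<^sub>R cis (z \<bullet> t) = (\<integral>b. f t b \<partial>lborel)"
      unfolding f_def covariogram_integral[OF K] by (rule integral_scaleR_left[symmetric]) (rule i)
  qed
  also have "\<dots> = (\<integral>b. (\<integral>t. f t b \<partial>lborel) \<partial>lborel)"
    using lborel_pair.Fubini_integral[OF fint] by simp
  also have "\<dots> = (\<integral>b. F * (indicator K b *\<^sub>R cis (z \<bullet> b)) \<partial>lborel)"
  proof (intro Bochner_Integration.integral_cong refl)
    fix b
    have "(\<integral>t. f t b \<partial>lborel) = (\<integral>t. (indicator K b *\<^sub>R cis (z \<bullet> b)) * (\<lambda>a. indicator K a *\<^sub>R cis (- (z \<bullet> a))) (b - t) \<partial>lborel)"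
      unfolding f_def
      by (intro Bochner_Integration.integral_cong refl) (auto simp: cis_mult inner_diff_right indicator_def)
    also have "\<dots> = (indicator K b *\<^sub>R cis (z \<bullet> b)) * (\<integral>t. (\<lambda>a. indicator K a *\<^sub>R cis (- (z \<bullet> a))) (b - t) \<partial>lborel)"
      by (rule integral_mult_right_zero)
    also have "(\<integral>t. (\<lambda>a. indicator K a *\<^sub>R cis (- (z \<bullet> a))) (b - t) \<partial>lborel) = F"
      unfolding F_def by (rule lborel_integral_reflect) measurable
    finally show "(\<integral>t. f t b \<partial>lborel) = F * (indicator K b *\<^sub>R cis (z \<bullet> b))" by (simp add: mult.commute)
  qed
  also have "\<dots> = F * (\<integral>b. indicator K b *\<^sub>R cis (z \<bullet> b) \<partial>lborel)" by (rule integral_mult_right_zero)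
  also have "(\<integral>b. indicator K b *\<^sub>R cis (z \<bullet> b) \<partial>lborel) = cnj F"
    unfolding F_def by (subst Bochner_Integration.integral_cnj[symmetric]) (simp add: cis_cnj)
  also note complex_norm_square[symmetric]
  finally show ?thesis unfolding Ffou by (simp only: of_real_power)
qed

lemma covariogram_fourier_real:
  fixes K :: "'a::euclidean_space set"
  assumes K: "compact K"
  shows "(\<integral>t. covariogram K t * cos (z \<bullet> t) \<partial>lborel) = (cmod (fourier_transform (indicator K) z))\<^sup>2"
    and "(\<integral>t. covariogram K t * sin (z \<bullet> t) \<partial>lborel) = 0"
proof -
  have i: "integrable lborel (\<lambda>t. covariogram K t *\<^sub>R cis (z \<bullet> t))"
    by (intro integrable_covariogram_times K continuous_intros)
  have "(\<integral>t. covariogram K t * cos (z \<bullet> t) \<partial>lborel) = (\<integral>t. Re (covariogram K t *\<^sub>R cis (z \<bullet> t)) \<partial>lborel)" by simp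
  also have "\<dots> = Re (\<integral>t. covariogram K t *\<^sub>R cis (z \<bullet> t) \<partial>lborel)" by (rule integral_Re[OF i])
  finally show "(\<integral>t. covariogram K t * cos (z \<bullet> t) \<partial>lborel) = (cmod (fourier_transform (indicator K) z))\<^sup>2"
    unfolding covariogram_fourier[OF K] by simp
  have "(\<integral>t. covariogram K t * sin (z \<bullet> t) \<partial>lborel) = (\<integral>t. Im (covariogram K t *\<^sub>R cis (z \<bullet> t)) \<partial>lborel)" by simp
  also have "\<dots> = Im (\<integral>t. covariogram K t *\<^sub>R cis (z \<bullet> t) \<partial>lborel)" by (rule integral_Im[OF i])
  finally show "(\<integral>t. covariogram K t * sin (z \<bullet> t) \<partial>lborel) = 0"
    unfolding covariogram_fourier[OF K] by simp
qed

text \<open>Frequencies as functions rather than vectors, in the form in which a product of sums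
  over the coordinates is expanded.\<close>

definition freq_grid :: "nat \<Rightarrow> ('n::finite \<Rightarrow> int) set" where
  "freq_grid k = (UNIV \<rightarrow>\<^sub>E {- int k..int k})"

definition freq_vec :: "('n::finite \<Rightarrow> int) \<Rightarrow> real^'n" where
  "freq_vec g = (\<chi> i. of_int (g i))"

lemma finite_freq_grid: "finite (freq_grid k :: ('n::finite \<Rightarrow> int) set)"
  unfolding freq_grid_def by (intro finite_PiE) auto

lemma bij_freq_vec: "bij_betw freq_vec (freq_grid k) (int_grid k :: (real^'n) set)"
  unfolding bij_betw_def
proof
  show "inj_on freq_vec (freq_grid k)"
    by (rule inj_onI) (auto simp: freq_vec_def vec_eq_iff fun_eq_iff)
  show "freq_vec ` freq_grid k = (int_grid k :: (real^'n) set)"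
  proof (intro equalityI subsetI)
    fix v :: "real^'n" assume "v \<in> freq_vec ` freq_grid k"
    then obtain g where g: "g \<in> freq_grid k" "v = freq_vec g" by blast
    have "\<bar>real_of_int (g i)\<bar> \<le> real k" for i
    proof -
      have "g i \<in> {- int k..int k}" using g(1) by (auto simp: freq_grid_def)
      then have "\<bar>g i\<bar> \<le> int k" by auto
      then show ?thesis by linarith
    qed
    then show "v \<in> int_grid k" by (simp add: g(2) int_grid_def freq_vec_def)
  next
    fix v :: "real^'n" assume v: "v \<in> int_grid k"
    define g where "g i = \<lfloor>v $ i\<rfloor>" for i
    have vi: "v $ i = of_int (g i)" for i using v by (simp add: g_def int_grid_def)
    have "\<bar>g i\<bar> \<le> int k" for i
    proof -
      have "\<bar>v $ i\<bar> \<le> real k" using v by (simp add: int_grid_def)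
      then show ?thesis unfolding vi by linarith
    qed
    then have "g \<in> freq_grid k" by (auto simp: freq_grid_def abs_le_iff minus_le_iff)
    moreover have "v = freq_vec g" by (simp add: vec_eq_iff freq_vec_def vi)
    ultimately show "v \<in> freq_vec ` freq_grid k" by blast
  qed
qed

text \<open>By \<open>covariogram_fourier\<close> these are the Fourier coefficients of the
  covariogram made periodic with period \<open>2 pi R\<close> in every coordinate.\<close>

definition fourier_coeff :: "(real^'n) set \<Rightarrow> real \<Rightarrow> ('n \<Rightarrow> int) \<Rightarrow> real" where
  "fourier_coeff K R g = (cmod (fourier_transform (indicator K) ((1 / R) *\<^sub>R freq_vec g)))\<^sup>2 / (2 * pi * R) ^ CARD('n)"

definition fourier_sum :: "(real^'n) set \<Rightarrow> real \<Rightarrow> nat \<Rightarrow> real^'n \<Rightarrow> real" where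
  "fourier_sum K R k x = (\<Sum>g\<in>freq_grid k. fourier_coeff K R g * cos (((1 / R) *\<^sub>R freq_vec g) \<bullet> x))"

context trig_kernel
begin

definition W :: "('n::finite \<Rightarrow> int) \<Rightarrow> real" where
  "W g = (\<Prod>i\<in>UNIV. w (g i))"

lemma W_nonneg: "W g \<ge> 0" unfolding W_def using w_nonneg by (intro prod_nonneg) auto

lemma W_le_1: "W g \<le> 1" unfolding W_def using w_nonneg w_le_1 by (intro prod_le_1) auto

text \<open>The product kernel restricted to one period. The cut-off makes it integrable on the
  whole space, so that periodic convolution becomes an ordinary one.\<close>

definition \<Phi> :: "real^'n \<Rightarrow> real" where
  "\<Phi> y = (\<Prod>i\<in>UNIV. indicator win (y $ i) *\<^sub>R kap (y $ i))"

lemma \<Phi>_nonneg: "\<Phi> y \<ge> 0" unfolding \<Phi>_def using kap_nonneg by (intro prod_nonneg) auto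

lemma \<Phi>_integral:
  shows "integrable lborel (\<Phi> :: real^'n \<Rightarrow> real)" and "(\<integral>y. \<Phi> y \<partial>(lborel :: (real^'n) measure)) = 1"
proof -
  have i: "integrable lborel (\<lambda>s. indicator win s *\<^sub>R kap s)" using integrable_kap[of "\<lambda>_. 1"] by simp
  show "integrable lborel (\<Phi> :: real^'n \<Rightarrow> real)" "(\<integral>y. \<Phi> y \<partial>(lborel :: (real^'n) measure)) = 1"
    unfolding \<Phi>_def[abs_def]
    using lborel_integral_prod_cart[of "\<lambda>_::'n. \<lambda>s. indicator win s *\<^sub>R kap s", OF i] integral_kap by simp_all
qed

lemma \<Phi>_cos_integral:
  fixes l :: "'n::finite"
  assumes k: "k \<ge> 1"
  shows "integrable lborel (\<lambda>y::real^'n. \<Phi> y * (1 - cos (y $ l / R)))"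
    and "(\<integral>y. \<Phi> y * (1 - cos (y $ l / R)) \<partial>(lborel :: (real^'n) measure)) = 1 - w (- 1)"
proof -
  define f where "f i s = (if i = l then indicator win s *\<^sub>R (kap s * (1 - cos (s / R))) else indicator win s *\<^sub>R kap s)" for i :: 'n and s
  have c: "continuous_on win (\<lambda>s. 1 - cos (s / R))" using R by (intro continuous_intros) auto
  have i: "integrable lborel (f i)" for i
  proof (cases "i = l")
    case True
    then have "f i = (\<lambda>s. indicator win s *\<^sub>R (kap s * (1 - cos (s / R))))" by (simp add: f_def fun_eq_iff)
    then show ?thesis using integrable_kap[OF c] by (simp only:)
  next
    case False
    then have "f i = (\<lambda>s. indicator win s *\<^sub>R (kap s * 1))" by (simp add: f_def fun_eq_iff)
    then show ?thesis using integrable_kap[of "\<lambda>_. 1"] by (simp only: continuous_on_const)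
  qed
  have eq: "(\<Prod>i\<in>UNIV. f i (y $ i)) = \<Phi> y * (1 - cos (y $ l / R))" for y :: "real^'n"
  proof -
    have "(\<Prod>i\<in>UNIV. f i (y $ i)) = (\<Prod>i\<in>UNIV. (indicator win (y $ i) *\<^sub>R kap (y $ i)) * (if i = l then 1 - cos (y $ i / R) else 1))"
      by (intro prod.cong refl) (simp add: f_def)
    also have "\<dots> = \<Phi> y * (\<Prod>i\<in>UNIV. if i = l then 1 - cos (y $ i / R) else 1)" by (simp only: prod.distrib \<Phi>_def)
    also have "(\<Prod>i\<in>UNIV. if i = l then 1 - cos (y $ i / R) else 1) = 1 - cos (y $ l / R)" by (simp add: prod.delta)
    finally show ?thesis .
  qed
  show "integrable lborel (\<lambda>y::real^'n. \<Phi> y * (1 - cos (y $ l / R)))"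
    using lborel_integral_prod_cart(1)[of f, OF i] unfolding eq .
  have "(\<integral>y. \<Phi> y * (1 - cos (y $ l / R)) \<partial>(lborel :: (real^'n) measure)) = (\<Prod>i\<in>UNIV. \<integral>s. f i s \<partial>lborel)"
    using lborel_integral_prod_cart(2)[of f, OF i] unfolding eq .
  also have "\<dots> = (\<Prod>i\<in>UNIV. if i = l then 1 - w (- 1) else 1)"
  proof (intro prod.cong refl)
    fix i
    show "(\<integral>s. f i s \<partial>lborel) = (if i = l then 1 - w (- 1) else 1)"
    proof (cases "i = l")
      case True
      then have "f i = (\<lambda>s. indicator win s *\<^sub>R (kap s * (1 - cos (s / R))))" by (simp add: f_def fun_eq_iff)
      then show ?thesis using integral_kap_cos[OF k] True by (simp only: if_True simp_thms)
    next
      case False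
      then have "f i = (\<lambda>s. indicator win s *\<^sub>R kap s)" by (simp add: f_def fun_eq_iff)
      then show ?thesis using integral_kap False by (simp only: if_False simp_thms)
    qed
  qed
  also have "\<dots> = 1 - w (- 1)" by (simp add: prod.delta)
  finally show "(\<integral>y. \<Phi> y * (1 - cos (y $ l / R)) \<partial>(lborel :: (real^'n) measure)) = 1 - w (- 1)" .
qed

lemma \<Phi>_expand:
  fixes y :: "real^'n"
  assumes y: "\<And>i. y $ i \<in> win"
  shows "\<Phi> y = (\<Sum>g\<in>freq_grid k. W g / (2 * pi * R) ^ CARD('n) * cos (((1 / R) *\<^sub>R freq_vec g) \<bullet> y))"
proof -
  have "complex_of_real (\<Phi> y) = (\<Prod>i\<in>UNIV. complex_of_real (kap (y $ i)))" using y by (simp add: \<Phi>_def)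
  also have "\<dots> = (\<Prod>i\<in>UNIV. \<Sum>m\<in>{- int k..int k}. (w m / (2 * pi * R)) *\<^sub>R cis (of_int m * y $ i / R))"
    by (simp only: kap_expand)
  also have "\<dots> = (\<Sum>g\<in>freq_grid k. \<Prod>i\<in>UNIV. (w (g i) / (2 * pi * R)) *\<^sub>R cis (of_int (g i) * y $ i / R))"
    unfolding freq_grid_def by (rule prod_sum_PiE) auto
  also have "\<dots> = (\<Sum>g\<in>freq_grid k. (W g / (2 * pi * R) ^ CARD('n)) *\<^sub>R cis (((1 / R) *\<^sub>R freq_vec g) \<bullet> y))"
  proof (intro sum.cong refl)
    fix g :: "'n \<Rightarrow> int"
    have c: "(\<Prod>i\<in>S. cis (t i)) = cis (\<Sum>i\<in>S. t i)" if "finite S" for t and S :: "'n set"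
      using that by (induction S) (simp_all add: cis_mult)
    have "(\<Prod>i\<in>UNIV. (w (g i) / (2 * pi * R)) *\<^sub>R cis (of_int (g i) * y $ i / R)) =
        (\<Prod>i\<in>UNIV. complex_of_real (w (g i) / (2 * pi * R))) * (\<Prod>i\<in>UNIV. cis (of_int (g i) * y $ i / R))"
      by (simp only: scaleR_conv_of_real prod.distrib)
    also have "(\<Prod>i\<in>UNIV. complex_of_real (w (g i) / (2 * pi * R))) = complex_of_real (\<Prod>i\<in>UNIV. w (g i) / (2 * pi * R))" by (simp only: of_real_prod)
    also have "(\<Prod>i\<in>UNIV. w (g i) / (2 * pi * R)) = W g / (2 * pi * R) ^ CARD('n)" by (simp add: prod_dividef W_def)
    also have "(\<Prod>i\<in>UNIV. cis (of_int (g i) * y $ i / R)) = cis (((1 / R) *\<^sub>R freq_vec g) \<bullet> y)"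
      by (subst c) (simp_all add: inner_vec_def freq_vec_def)
    finally show "(\<Prod>i\<in>UNIV. (w (g i) / (2 * pi * R)) *\<^sub>R cis (of_int (g i) * y $ i / R)) = (W g / (2 * pi * R) ^ CARD('n)) *\<^sub>R cis (((1 / R) *\<^sub>R freq_vec g) \<bullet> y)"
      by (simp only: scaleR_conv_of_real)
  qed
  finally have "Re (complex_of_real (\<Phi> y)) = Re (\<Sum>g\<in>freq_grid k. (W g / (2 * pi * R) ^ CARD('n)) *\<^sub>R cis (((1 / R) *\<^sub>R freq_vec g) \<bullet> y))" by (simp only:)
  then show ?thesis by simp
qed

text \<open>The partial sum damped by the kernel coefficients, that is, the convolution of the
  covariogram with \<open>\<Phi>\<close> at points of the sample cube.\<close>

definition \<sigma> :: "(real^'n) set \<Rightarrow> real^'n \<Rightarrow> real" where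
  "\<sigma> K x = (\<Sum>g\<in>freq_grid k. W g * (fourier_coeff K R g * cos (((1 / R) *\<^sub>R freq_vec g) \<bullet> x)))"

text \<open>For \<open>x\<close> and \<open>t\<close> in the cube from -1 to 1 the coordinates of
  \<open>x - t\<close> have modulus at most \<open>2 \<le> pi * R\<close>. So the restricted kernel
  agrees with its trigonometric polynomial wherever the covariogram does not vanish, and there is no
  overlap between periods.\<close>

lemma \<sigma>_integral:
  fixes K :: "(real^'n) set"
  assumes K: "compact K" "K \<subseteq> unit_cube" and R1: "R \<ge> 1" and x: "\<And>i. \<bar>x $ i\<bar> \<le> 1"
  shows "integrable lborel (\<lambda>t. covariogram K t * \<Phi> (x - t))"
    and "\<sigma> K x = (\<integral>t. covariogram K t * \<Phi> (x - t) \<partial>lborel)"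
proof -
  define z where "z g = (1 / R) *\<^sub>R freq_vec g" for g :: "'n \<Rightarrow> int"
  let ?c = "(2 * pi * R) ^ CARD('n)"
  have i: "integrable lborel (\<lambda>t. covariogram K t * f t)" if "continuous_on UNIV f" for f :: "real^'n \<Rightarrow> real"
    using integrable_covariogram_times[OF K(1) that] by simp
  have ic: "integrable lborel (\<lambda>t. covariogram K t * cos (z g \<bullet> (x - t)))" for g by (intro i continuous_intros)
  have eq: "covariogram K t * \<Phi> (x - t) = (\<Sum>g\<in>freq_grid k. W g / ?c * (covariogram K t * cos (z g \<bullet> (x - t))))" for t
  proof (cases "\<forall>i. \<bar>t $ i\<bar> \<le> 1")
    case False
    then show ?thesis using covariogram_outside[OF K(2) False] by simp
  next
    case True
    have "(x - t) $ i \<in> win" for i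
    proof -
      have "2 \<le> pi * R" using mult_mono[of 2 pi 1 R] pi_ge_two R1 by simp
      moreover have "\<bar>x $ i\<bar> \<le> 1" "\<bar>t $ i\<bar> \<le> 1" using x True by auto
      ultimately show ?thesis unfolding win_def by (auto simp: abs_le_iff)
    qed
    then show ?thesis by (subst \<Phi>_expand) (auto simp: z_def sum_distrib_left mult_ac)
  qed
  show "integrable lborel (\<lambda>t. covariogram K t * \<Phi> (x - t))"
    unfolding eq by (intro Bochner_Integration.integrable_sum Bochner_Integration.integrable_mult_right ic)
  have trm: "(\<integral>t. covariogram K t * cos (z g \<bullet> (x - t)) \<partial>lborel) = ?c * fourier_coeff K R g * cos (z g \<bullet> x)" for g
  proof -
    have i1: "integrable lborel (\<lambda>t. covariogram K t * cos (z g \<bullet> t))" and i2: "integrable lborel (\<lambda>t. covariogram K t * sin (z g \<bullet> t))"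
      by (intro i continuous_intros)+
    have "(\<integral>t. covariogram K t * cos (z g \<bullet> (x - t)) \<partial>lborel) =
        (\<integral>t. cos (z g \<bullet> x) * (covariogram K t * cos (z g \<bullet> t)) + sin (z g \<bullet> x) * (covariogram K t * sin (z g \<bullet> t)) \<partial>lborel)"
      by (intro Bochner_Integration.integral_cong refl) (simp add: inner_diff_right cos_diff algebra_simps)
    also have "\<dots> = cos (z g \<bullet> x) * (\<integral>t. covariogram K t * cos (z g \<bullet> t) \<partial>lborel) + sin (z g \<bullet> x) * (\<integral>t. covariogram K t * sin (z g \<bullet> t) \<partial>lborel)"
      using i1 i2 by simp
    also have "\<dots> = cos (z g \<bullet> x) * (cmod (fourier_transform (indicator K) (z g)))\<^sup>2" by (simp add: covariogram_fourier_real[OF K(1)])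
    also have "(cmod (fourier_transform (indicator K) (z g)))\<^sup>2 = ?c * fourier_coeff K R g" using R by (simp add: fourier_coeff_def z_def)
    finally show ?thesis by (simp add: mult_ac)
  qed
  have "(\<integral>t. covariogram K t * \<Phi> (x - t) \<partial>lborel) = (\<Sum>g\<in>freq_grid k. \<integral>t. W g / ?c * (covariogram K t * cos (z g \<bullet> (x - t))) \<partial>lborel)"
    unfolding eq by (intro Bochner_Integration.integral_sum Bochner_Integration.integrable_mult_right ic)
  also have "\<dots> = (\<Sum>g\<in>freq_grid k. W g / ?c * (?c * fourier_coeff K R g * cos (z g \<bullet> x)))"
    by (simp only: Bochner_Integration.integral_mult_right_zero trm)
  also have "\<dots> = \<sigma> K x" unfolding \<sigma>_def z_def using R by (intro sum.cong refl) simp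
  finally show "\<sigma> K x = (\<integral>t. covariogram K t * \<Phi> (x - t) \<partial>lborel)" by simp
qed

lemma \<sigma>_le:
  fixes K :: "(real^'n) set"
  assumes K: "compact K" "K \<subseteq> unit_cube" and R1: "R \<ge> 1"
  shows "\<sigma> K 0 \<le> measure lebesgue K"
proof -
  have mK: "K \<in> lmeasurable" using K(1) by (rule lmeasurable_compact)
  have x0: "\<And>i. \<bar>(0::real^'n) $ i\<bar> \<le> 1" by simp
  have m: "(\<Phi> :: real^'n \<Rightarrow> real) \<in> borel_measurable borel" using borel_measurable_integrable[OF \<Phi>_integral(1)] by simp
  have s: "(\<integral>t. \<Phi> ((0::real^'n) - t) \<partial>lborel) = 1" using lborel_integral_reflect[OF m, of 0] \<Phi>_integral(2) by simp
  \<comment> \<open>A function that is not integrable has integral 0 by convention, so the value 1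
    just found proves integrability.\<close>
  have i\<Phi>: "integrable lborel (\<lambda>t::real^'n. \<Phi> (0 - t))"
  proof (rule ccontr)
    assume "\<not> integrable lborel (\<lambda>t::real^'n. \<Phi> (0 - t))"
    then show False using s not_integrable_integral_eq by (metis zero_neq_one)
  qed
  have "\<sigma> K 0 = (\<integral>t. covariogram K t * \<Phi> (0 - t) \<partial>lborel)" by (rule \<sigma>_integral(2)[OF K R1 x0])
  also have "\<dots> \<le> (\<integral>t. measure lebesgue K * \<Phi> (0 - t) \<partial>(lborel :: (real^'n) measure))"
  proof (rule Bochner_Integration.integral_mono)
    show "integrable lborel (\<lambda>t. covariogram K t * \<Phi> (0 - t))" by (rule \<sigma>_integral(1)[OF K R1 x0])
    show "integrable lborel (\<lambda>t::real^'n. measure lebesgue K * \<Phi> (0 - t))" by (intro Bochner_Integration.integrable_mult_right i\<Phi>)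
    show "covariogram K t * \<Phi> (0 - t) \<le> measure lebesgue K * \<Phi> (0 - t)" for t
      by (intro mult_right_mono covariogram_le mK \<Phi>_nonneg)
  qed
  also have "\<dots> = measure lebesgue K" using s by simp
  finally show ?thesis .
qed

text \<open>The convolution is split at distance \<delta>. Inside, the modulus of continuity gives
  \<open>e\<close>. Outside, some coordinate satisfies
  \<open>1 - cos (y $ l / R) \<ge> 1 - cos (\<delta> / R)\<close>, and Chebyshev's argument with
  this function bounds the mass of the kernel.\<close>

lemma \<sigma>_close:
  fixes K :: "(real^'n) set"
  assumes K: "compact K" "K \<subseteq> unit_cube" and R1: "R \<ge> 1" and x: "\<And>i. \<bar>x $ i\<bar> \<le> 1" and k: "k \<ge> 1"
    and \<delta>: "0 < \<delta>" "\<delta> \<le> pi * R"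
    and mod: "\<And>t. (\<And>i. \<bar>(x - t) $ i\<bar> \<le> \<delta>) \<Longrightarrow> \<bar>covariogram K t - covariogram K x\<bar> \<le> e"
  shows "\<bar>\<sigma> K x - covariogram K x\<bar> \<le> e + measure lebesgue K * real CARD('n) * (1 - w (- 1)) / (1 - cos (\<delta> / R))"
proof -
  let ?g = "covariogram K" and ?V = "measure lebesgue K" and ?q = "1 - cos (\<delta> / R)"
  have mK: "K \<in> lmeasurable" using K(1) by (rule lmeasurable_compact)
  have q: "?q > 0"
  proof -
    have "cos (\<delta> / R) < cos 0"
      using \<delta> R by (intro cos_monotone_0_pi) (auto simp: divide_le_eq mult.commute)
    then show ?thesis by simp
  qed
  have e0: "e \<ge> 0" using mod[of x] \<delta>(1) by simp
  \<comment> \<open>An integrable majorant covering both cases at once; each coordinate contributes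
    one Chebyshev term.\<close>
  define h where "h y = e * \<Phi> y + (\<Sum>l\<in>UNIV. (?V / ?q) * (\<Phi> y * (1 - cos (y $ l / R))))" for y :: "real^'n"
  have hi: "integrable lborel h"
    unfolding h_def[abs_def]
    by (intro Bochner_Integration.integrable_add Bochner_Integration.integrable_sum Bochner_Integration.integrable_mult_right \<Phi>_integral(1) \<Phi>_cos_integral(1)[OF k])
  have hI: "(\<integral>y. h y \<partial>lborel) = e + ?V * real CARD('n) * (1 - w (- 1)) / ?q"
  proof -
    have i1: "integrable lborel (\<lambda>y::real^'n. e * \<Phi> y)" by (intro Bochner_Integration.integrable_mult_right \<Phi>_integral(1))
    have i2: "integrable lborel (\<lambda>y::real^'n. (?V / ?q) * (\<Phi> y * (1 - cos (y $ l / R))))" for l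
      by (intro Bochner_Integration.integrable_mult_right \<Phi>_cos_integral(1)[OF k])
    have "(\<integral>y. h y \<partial>lborel) = (\<integral>y. e * \<Phi> y \<partial>(lborel :: (real^'n) measure)) + (\<integral>y. (\<Sum>l\<in>UNIV. (?V / ?q) * (\<Phi> y * (1 - cos (y $ l / R)))) \<partial>(lborel :: (real^'n) measure))"
      unfolding h_def by (rule Bochner_Integration.integral_add[OF i1 Bochner_Integration.integrable_sum[OF i2]])
    also have "(\<integral>y. (\<Sum>l\<in>UNIV. (?V / ?q) * (\<Phi> y * (1 - cos (y $ l / R)))) \<partial>(lborel :: (real^'n) measure)) =
        (\<Sum>l\<in>UNIV. \<integral>y. (?V / ?q) * (\<Phi> y * (1 - cos (y $ l / R))) \<partial>(lborel :: (real^'n) measure))"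
      by (rule Bochner_Integration.integral_sum[OF i2])
    also have "\<dots> = (\<Sum>l\<in>(UNIV::'n set). (?V / ?q) * (1 - w (- 1)))"
      by (intro sum.cong refl) (simp only: integral_mult_right_zero \<Phi>_cos_integral(2)[OF k])
    also have "(\<integral>y. e * \<Phi> y \<partial>(lborel :: (real^'n) measure)) = e * 1"
      by (simp only: integral_mult_right_zero \<Phi>_integral(2))
    finally show ?thesis by simp
  qed
  have pt: "\<bar>?g (x - y) - ?g x\<bar> * \<Phi> y \<le> h y" for y
  proof (cases "\<Phi> y = 0")
    case True then show ?thesis by (simp add: h_def)
  next
    case False
    have win: "y $ i \<in> win" for i
    proof (rule ccontr)
      assume "y $ i \<notin> win"
      then have "\<Phi> y = 0" unfolding \<Phi>_def by (intro prod_zero bexI[of _ i]) auto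
      then show False using False by simp
    qed
    have s0: "(\<Sum>l\<in>UNIV. (?V / ?q) * (\<Phi> y * (1 - cos (y $ l / R)))) \<ge> 0"
      using q \<Phi>_nonneg by (intro sum_nonneg mult_nonneg_nonneg) auto
    show ?thesis
    proof (cases "\<forall>i. \<bar>y $ i\<bar> \<le> \<delta>")
      case True
      then have "\<bar>?g (x - y) - ?g x\<bar> \<le> e" by (intro mod) simp
      then have "\<bar>?g (x - y) - ?g x\<bar> * \<Phi> y \<le> e * \<Phi> y" using \<Phi>_nonneg by (intro mult_right_mono)
      then show ?thesis using s0 by (simp add: h_def)
    next
      case False
      then obtain l where l: "\<bar>y $ l\<bar> > \<delta>" by (auto simp: not_le)
      have "\<bar>y $ l\<bar> \<le> pi * R" using win[of l] by (auto simp: win_def)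
      then have "cos (\<bar>y $ l\<bar> / R) \<le> cos (\<delta> / R)"
        using l R \<delta>(1) by (intro cos_monotone_0_pi_le) (auto simp: divide_right_mono divide_le_eq mult.commute)
      moreover have "cos (\<bar>y $ l\<bar> / R) = cos (y $ l / R)"
        using cos_abs_real[of "y $ l / R"] R by (simp add: abs_divide)
      ultimately have cl: "?q \<le> 1 - cos (y $ l / R)" by simp
      have "\<bar>?g (x - y) - ?g x\<bar> \<le> ?V"
        using covariogram_nonneg[of K "x - y"] covariogram_nonneg[of K x] covariogram_le[OF mK, of "x - y"] covariogram_le[OF mK, of x]
        by (simp add: abs_le_iff)
      then have "\<bar>?g (x - y) - ?g x\<bar> * \<Phi> y \<le> ?V * \<Phi> y" using \<Phi>_nonneg by (intro mult_right_mono)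
      also have "\<dots> = (?V / ?q) * (\<Phi> y * ?q)" using q by simp
      also have "\<dots> \<le> (?V / ?q) * (\<Phi> y * (1 - cos (y $ l / R)))"
        using q cl \<Phi>_nonneg by (intro mult_left_mono) auto
      also have "\<dots> \<le> (\<Sum>l\<in>UNIV. (?V / ?q) * (\<Phi> y * (1 - cos (y $ l / R))))"
      proof (intro member_le_sum)
        show "(?V / ?q) * (\<Phi> y * (1 - cos (y $ j / R))) \<ge> 0" for j
          using q \<Phi>_nonneg by (intro mult_nonneg_nonneg divide_nonneg_pos) auto
      qed auto
      finally show ?thesis unfolding h_def using e0 \<Phi>_nonneg[of y] by (intro add_increasing mult_nonneg_nonneg)
    qed
  qed
  have m: "(\<Phi> :: real^'n \<Rightarrow> real) \<in> borel_measurable borel" using borel_measurable_integrable[OF \<Phi>_integral(1)] by simp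
  have gm: "?g \<in> borel_measurable borel" by (intro borel_measurable_continuous_onI continuous_covariogram K)
  have pm: "(\<lambda>y. ?g (x - y) * \<Phi> y) \<in> borel_measurable borel"
    using m gm by (intro borel_measurable_times measurable_compose[OF _ gm]) auto
  have ig: "integrable lborel (\<lambda>y. ?g (x - y) * \<Phi> y)"
  proof (rule Bochner_Integration.integrable_bound[where f = "\<lambda>y. ?V * \<Phi> y"])
    show "integrable lborel (\<lambda>y::real^'n. ?V * \<Phi> y)" by (intro Bochner_Integration.integrable_mult_right \<Phi>_integral(1))
    show "(\<lambda>y. ?g (x - y) * \<Phi> y) \<in> borel_measurable lborel" using pm by simp
    show "AE y in lborel. norm (?g (x - y) * \<Phi> y) \<le> norm (?V * \<Phi> y)"
      using covariogram_le[OF mK] covariogram_nonneg[of K] \<Phi>_nonneg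
      by (intro AE_I2) (auto simp: abs_mult intro!: mult_right_mono)
  qed
  have P1: "(\<integral>y. \<Phi> y \<partial>(lborel :: (real^'n) measure)) = 1" by (rule \<Phi>_integral(2))
  have "\<sigma> K x = (\<integral>t. ?g t * \<Phi> (x - t) \<partial>lborel)" by (rule \<sigma>_integral(2)[OF K R1 x])
  also have "\<dots> = (\<integral>t. (\<lambda>y. ?g (x - y) * \<Phi> y) (x - t) \<partial>lborel)" by simp
  also have "\<dots> = (\<integral>y. ?g (x - y) * \<Phi> y \<partial>lborel)" by (rule lborel_integral_reflect[OF pm])
  finally have "\<sigma> K x - ?g x = (\<integral>y. ?g (x - y) * \<Phi> y \<partial>lborel) - (\<integral>y. ?g x * \<Phi> y \<partial>(lborel :: (real^'n) measure))" using P1 by simp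
  also have "\<dots> = (\<integral>y. ?g (x - y) * \<Phi> y - ?g x * \<Phi> y \<partial>lborel)"
    by (rule Bochner_Integration.integral_diff[symmetric, OF ig Bochner_Integration.integrable_mult_right[OF \<Phi>_integral(1)]])
  finally have d: "\<sigma> K x - ?g x = (\<integral>y. ?g (x - y) * \<Phi> y - ?g x * \<Phi> y \<partial>lborel)" .
  have id: "integrable lborel (\<lambda>y. ?g (x - y) * \<Phi> y - ?g x * \<Phi> y)"
    by (intro Bochner_Integration.integrable_diff ig Bochner_Integration.integrable_mult_right \<Phi>_integral(1))
  have "norm (\<sigma> K x - ?g x) \<le> (\<integral>y. norm (?g (x - y) * \<Phi> y - ?g x * \<Phi> y) \<partial>lborel)" unfolding d by (rule integral_norm_bound)
  also have "\<dots> \<le> (\<integral>y. h y \<partial>lborel)"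
  proof (rule Bochner_Integration.integral_mono[OF integrable_norm[OF id] hi])
    fix y
    have "norm (?g (x - y) * \<Phi> y - ?g x * \<Phi> y) = \<bar>?g (x - y) - ?g x\<bar> * \<Phi> y"
      using \<Phi>_nonneg[of y] by (simp add: left_diff_distrib[symmetric] abs_mult)
    then show "norm (?g (x - y) * \<Phi> y - ?g x * \<Phi> y) \<le> h y" using pt by simp
  qed
  finally show ?thesis unfolding hI by simp
qed

end

context trig_kernel
begin

text \<open>The coefficients of the Fejer kernel: among \<open>k + 1\<close> constant weights,
  \<open>k + 1 - |m|\<close> pairs have difference \<open>m\<close>.\<close>

lemma w_lower:
  assumes b: "\<beta> = (\<lambda>_. 1)" and m: "\<bar>m\<bar> \<le> int k"
  shows "w m \<ge> 1 - of_int \<bar>m\<bar> / (real k + 1)"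
proof -
  have n: "nrm = real k + 1" unfolding nrm_def unfolding b by simp
  let ?A = "{p. p \<le> k \<and> m \<le> int p \<and> int p \<le> int k + m}"
  have A: "?A = {nat m..nat (int k + min m 0)}" using m by auto
  have "real k + 1 - of_int \<bar>m\<bar> = real (card ?A)" unfolding A using m by (auto simp: min_def nat_diff_distrib)
  also have "\<dots> = (\<Sum>p\<le>k. if m \<le> int p \<and> int p \<le> int k + m then 1 else 0)"
    by (simp add: sum.If_cases Collect_conj_eq[symmetric] Int_def)
  also have "\<dots> \<le> (\<Sum>p\<le>k. \<Sum>q\<le>k. if int p - int q = m then \<beta> p * \<beta> q else 0)"
  proof (rule sum_mono)
    fix p
    show "(if m \<le> int p \<and> int p \<le> int k + m then 1 else 0) \<le> (\<Sum>q\<le>k. if int p - int q = m then \<beta> p * \<beta> q else 0)"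
    proof (cases "m \<le> int p \<and> int p \<le> int k + m")
      case True
      then have "(\<Sum>q\<le>k. if q = nat (int p - m) then 1 else (0::real)) = 1" by (auto simp: nat_le_iff)
      moreover have "(\<Sum>q\<le>k. if q = nat (int p - m) then 1 else (0::real)) \<le> (\<Sum>q\<le>k. if int p - int q = m then \<beta> p * \<beta> q else 0)"
        using True by (intro sum_mono) (auto simp: b)
      ultimately show ?thesis using True by simp
    next
      case False
      then show ?thesis by (auto simp: b intro!: sum_nonneg)
    qed
  qed
  finally have "(real k + 1 - of_int \<bar>m\<bar>) / (real k + 1) \<le> w m" unfolding w_def n by (intro divide_right_mono) auto
  moreover have "(real k + 1 - of_int \<bar>m\<bar>) / (real k + 1) = 1 - of_int \<bar>m\<bar> / (real k + 1)" by (simp add: diff_divide_distrib)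
  ultimately show ?thesis by simp
qed

end

lemma fourier_coeff_nonneg: "R > 0 \<Longrightarrow> fourier_coeff K R g \<ge> 0"
  by (simp add: fourier_coeff_def)

text \<open>
  The coefficients are nonnegative, so the partial sum at the origin is dominated by the limit of
  the Fejer means of order \<open>N\<close>.
\<close>

lemma fourier_sum_le_measure:
  fixes K :: "(real^'n) set"
  assumes K: "compact K" "K \<subseteq> unit_cube" and R1: "R \<ge> 1"
  shows "fourier_sum K R k 0 \<le> measure lebesgue K"
proof -
  let ?V = "measure lebesgue K" and ?S = "fourier_sum K R k 0"
  have "(1 - real k / (real N + 1)) ^ CARD('n) * ?S \<le> ?V" if N: "N \<ge> k" for N
  proof -
    interpret trig_kernel R N "\<lambda>_. 1" by unfold_locales (use R1 in auto)
    let ?q = "1 - real k / (real N + 1)"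
    have q0: "?q \<ge> 0" using N by (simp add: divide_le_eq)
    have "?q ^ CARD('n) * ?S = (\<Sum>g\<in>freq_grid k. ?q ^ CARD('n) * fourier_coeff K R g)"
      by (simp add: fourier_sum_def sum_distrib_left)
    also have "\<dots> \<le> (\<Sum>g\<in>freq_grid k. W g * fourier_coeff K R g)"
    proof (intro sum_mono mult_right_mono fourier_coeff_nonneg)
      fix g :: "'n \<Rightarrow> int" assume g: "g \<in> freq_grid k"
      have "(\<Prod>i\<in>(UNIV::'n set). ?q) \<le> (\<Prod>i\<in>UNIV. w (g i))"
      proof (intro prod_mono conjI q0)
        fix i
        have "g i \<in> {- int k..int k}" using g by (auto simp: freq_grid_def)
        then have gi: "\<bar>g i\<bar> \<le> int k" by auto
        have "of_int \<bar>g i\<bar> / (real N + 1) \<le> real k / (real N + 1)"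
          using gi by (intro divide_right_mono) linarith+
        moreover have "w (g i) \<ge> 1 - of_int \<bar>g i\<bar> / (real N + 1)" using gi N by (intro w_lower) auto
        ultimately show "?q \<le> w (g i)" by linarith
      qed
      then show "?q ^ CARD('n) \<le> W g" by (simp add: W_def)
    qed (use R1 in simp)
    also have "\<dots> \<le> (\<Sum>g\<in>freq_grid N. W g * fourier_coeff K R g)"
    proof (rule sum_mono2)
      show "finite (freq_grid N :: ('n \<Rightarrow> int) set)" by (rule finite_freq_grid)
      show "(freq_grid k :: ('n \<Rightarrow> int) set) \<subseteq> freq_grid N" unfolding freq_grid_def using N by (intro PiE_mono) auto
      show "W g * fourier_coeff K R g \<ge> 0" for g :: "'n \<Rightarrow> int"
        using R1 by (intro mult_nonneg_nonneg W_nonneg fourier_coeff_nonneg) auto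
    qed
    also have "\<dots> = \<sigma> K 0" by (simp add: \<sigma>_def)
    also have "\<dots> \<le> ?V" by (rule \<sigma>_le[OF K R1])
    finally show ?thesis .
  qed
  then have ev: "\<forall>\<^sub>F N in sequentially. (1 - real k / (real N + 1)) ^ CARD('n) * ?S \<le> ?V"
    using eventually_ge_at_top[of k] by (rule eventually_mono[rotated])
  have "(\<lambda>N. 1 - real k / (real N + 1)) \<longlonglongrightarrow> 1" by real_asymp
  then have "(\<lambda>N. (1 - real k / (real N + 1)) ^ CARD('n) * ?S) \<longlonglongrightarrow> 1 ^ CARD('n) * ?S"
    by (intro tendsto_intros)
  from tendsto_upperbound[OF this ev] show ?thesis by simp
qed

text \<open>
  The weights \<open>sin ((p + 1) \<theta>)\<close> with \<open>\<theta> = pi / (k + 2)\<close> are an eigenvector of the discrete Laplacian, so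
  that the first Fourier coefficient of the kernel is \<open>cos \<theta>\<close> and the kernel concentrates at scale
  \<open>R / k\<close>.
\<close>

lemma fourier_sum_close:
  fixes K :: "(real^'n) set"
  assumes K: "compact K" "K \<subseteq> unit_cube" and R1: "R \<ge> 1" and x: "\<And>i. \<bar>x $ i\<bar> \<le> 1" and k: "k \<ge> 1"
    and \<delta>: "0 < \<delta>" "\<delta> \<le> pi * R"
    and mod: "\<And>s t. (\<And>i. \<bar>(s - t) $ i\<bar> \<le> \<delta>) \<Longrightarrow> \<bar>covariogram K t - covariogram K s\<bar> \<le> e"
  shows "\<bar>fourier_sum K R k x - covariogram K x\<bar>
    \<le> 2 * (e + measure lebesgue K * real CARD('n) * (1 - cos (pi / (real k + 2))) / (1 - cos (\<delta> / R)))"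
proof -
  define \<theta> where "\<theta> = pi / (real k + 2)"
  define s where "s j = sin (real j * \<theta>)" for j :: nat
  have \<theta>: "\<theta> > 0" by (simp add: \<theta>_def)
  have spos: "s (Suc p) > 0" if "p \<le> k" for p
  proof -
    have "real (Suc p) * \<theta> < (real k + 2) * \<theta>" using that \<theta> by (intro mult_strict_right_mono) auto
    then show ?thesis unfolding s_def using \<theta> by (intro sin_gt_zero) (auto simp: \<theta>_def)
  qed
  interpret trig_kernel R k "\<lambda>p. if p \<le> k then s (Suc p) else 0"
    using R1 spos by unfold_locales (auto intro: less_imp_le)
  have w1: "w (- 1) = cos \<theta>"
  proof -
    have s0: "s 0 = 0" by (simp add: s_def)
    have sk: "s (Suc (Suc k)) = 0"
    proof -
      have "real (Suc (Suc k)) * \<theta> = pi" by (simp add: \<theta>_def field_simps)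
      then show ?thesis by (simp only: s_def sin_pi)
    qed
    have "(\<Sum>p\<le>k. \<Sum>q\<le>k. if int p - int q = - 1 then (if p \<le> k then s (Suc p) else 0) * (if q \<le> k then s (Suc q) else 0) else 0)
        = (\<Sum>p\<le>k. s (Suc p) * s (Suc (Suc p)))" (is "?L = ?T")
    proof (intro sum.cong refl)
      fix p assume p: "p \<in> {..k}"
      have "(\<Sum>q\<le>k. if int p - int q = - 1 then (if p \<le> k then s (Suc p) else 0) * (if q \<le> k then s (Suc q) else 0) else 0)
          = (\<Sum>q\<le>k. if q = Suc p then s (Suc p) * s (Suc (Suc p)) else 0)"
        using p by (intro sum.cong refl) auto
      also have "\<dots> = s (Suc p) * s (Suc (Suc p))"
      proof (cases "Suc p \<le> k")
        case False
        then have "p = k" using p by simp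
        then show ?thesis using sk by simp
      qed (simp add: sum.delta)
      finally show "(\<Sum>q\<le>k. if int p - int q = - 1 then (if p \<le> k then s (Suc p) else 0) * (if q \<le> k then s (Suc q) else 0) else 0)
          = s (Suc p) * s (Suc (Suc p))" .
    qed
    \<comment> \<open>Pair the recurrence \<open>s p + s (p + 2) = 2 cos \<theta> s (p + 1)\<close>
      with \<open>s (p + 1)\<close>. The sums with the left and with the right neighbour agree
      because \<open>s\<close> vanishes at 0 and at \<open>k + 2\<close>.\<close>
    moreover have "?T = cos \<theta> * nrm"
    proof -
      have tel: "?T - (\<Sum>p\<le>k. s p * s (Suc p)) = 0"
      proof -
        have "(\<Sum>p\<le>k. s (Suc p) * s (Suc (Suc p)) - s p * s (Suc p)) = s (Suc k) * s (Suc (Suc k)) - s 0 * s (Suc 0)"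
          using sum_telescope[of "\<lambda>p. - (s p * s (Suc p))" k] by (simp add: algebra_simps)
        then show ?thesis by (simp add: sum_subtractf s0 sk)
      qed
      have rec: "s p + s (Suc (Suc p)) = 2 * cos \<theta> * s (Suc p)" for p
      proof -
        have "s p = sin (real (Suc p) * \<theta> - \<theta>)" "s (Suc (Suc p)) = sin (real (Suc p) * \<theta> + \<theta>)"
          by (simp_all add: s_def algebra_simps)
        then show ?thesis by (simp add: sin_add sin_diff s_def)
      qed
      have "2 * ?T = ?T + (\<Sum>p\<le>k. s p * s (Suc p))" using tel by simp
      also have "\<dots> = (\<Sum>p\<le>k. s (Suc p) * (s p + s (Suc (Suc p))))" by (simp add: sum.distrib[symmetric] algebra_simps)
      also have "\<dots> = (\<Sum>p\<le>k. 2 * cos \<theta> * (s (Suc p))\<^sup>2)" unfolding rec by (simp add: power2_eq_square mult_ac)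
      also have "\<dots> = 2 * cos \<theta> * nrm" by (simp add: nrm_def sum_distrib_left)
      finally show ?thesis by simp
    qed
    ultimately show ?thesis using nrm_pos unfolding w_def by simp
  qed
  let ?E = "e + measure lebesgue K * real CARD('n) * (1 - w (- 1)) / (1 - cos (\<delta> / R))"
  have mod': "\<bar>covariogram K t - covariogram K y\<bar> \<le> e" if "\<And>i. \<bar>(y - t) $ i\<bar> \<le> \<delta>" for y t
    using that by (rule mod)
  have cx: "\<bar>\<sigma> K x - covariogram K x\<bar> \<le> ?E"
    using K R1 x k \<delta> mod' by (rule \<sigma>_close)
  have z1: "\<bar>(0::real^'n) $ i\<bar> \<le> 1" for i by simp
  have c0: "\<bar>\<sigma> K 0 - covariogram K 0\<bar> \<le> ?E"
    using K R1 z1 k \<delta> mod' by (rule \<sigma>_close)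
  have g0: "covariogram K 0 = measure lebesgue K" by (simp add: covariogram_def)
  \<comment> \<open>The coefficients \<open>(1 - W g) * fourier_coeff K R g\<close> are nonnegative,
    so removing the damping costs at most what it costs at the origin. There the sum is at most the
    volume, which the damped sum already approximates within \<open>?E\<close>.\<close>
  have "\<bar>fourier_sum K R k x - \<sigma> K x\<bar> = \<bar>\<Sum>g\<in>freq_grid k. (1 - W g) * fourier_coeff K R g * cos (((1 / R) *\<^sub>R freq_vec g) \<bullet> x)\<bar>"
    unfolding fourier_sum_def \<sigma>_def sum_subtractf[symmetric] by (simp add: algebra_simps)
  also have "\<dots> \<le> (\<Sum>g\<in>freq_grid k. (1 - W g) * fourier_coeff K R g)"
  proof (rule order_trans[OF sum_abs], rule sum_mono)
    fix g :: "'n \<Rightarrow> int"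
    have "(1 - W g) * fourier_coeff K R g \<ge> 0" using W_le_1[of g] R1 by (intro mult_nonneg_nonneg fourier_coeff_nonneg) auto
    then show "\<bar>(1 - W g) * fourier_coeff K R g * cos (((1 / R) *\<^sub>R freq_vec g) \<bullet> x)\<bar> \<le> (1 - W g) * fourier_coeff K R g"
      using abs_cos_le_one by (subst abs_mult) (simp add: mult_left_le)
  qed
  also have "\<dots> = fourier_sum K R k 0 - \<sigma> K 0"
    by (simp add: fourier_sum_def \<sigma>_def sum_subtractf[symmetric] algebra_simps)
  finally have "\<bar>fourier_sum K R k x - \<sigma> K x\<bar> \<le> fourier_sum K R k 0 - \<sigma> K 0" .
  note st = this
  have gen: "\<bar>a - c\<bar> \<le> 2 * E" if "\<bar>s - c\<bar> \<le> E" "\<bar>s0 - V\<bar> \<le> E" "f0 \<le> V" "\<bar>a - s\<bar> \<le> f0 - s0"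
    for a c s s0 f0 V E :: real using that by linarith
  have "\<bar>fourier_sum K R k x - covariogram K x\<bar> \<le> 2 * ?E"
    by (rule gen[OF cx c0[unfolded g0] fourier_sum_le_measure[OF K R1] st])
  then show ?thesis by (simp add: w1 \<theta>_def)
qed

text \<open>With \<open>R = k powr \<gamma>\<close> the numerator
  \<open>1 - cos (pi / (k + 2))\<close> is of order \<open>k powr - 2\<close> and the denominator of
  order \<open>k powr (- 2 * \<gamma>)\<close>, so their ratio tends to 0 for \<gamma> < 1.\<close>

theorem fourier_sum_uniform:
  fixes K :: "(real^'n) set"
  assumes K: "compact K" "K \<noteq> {}" "K \<subseteq> unit_cube" and \<gamma>: "0 < \<gamma>" "\<gamma> < 1" and \<epsilon>: "\<epsilon> > 0"
  shows "\<forall>\<^sub>F k in sequentially. \<forall>x. (\<forall>i. \<bar>x $ i\<bar> \<le> 1) \<longrightarrow>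
    \<bar>fourier_sum K (real k powr \<gamma>) k x - covariogram K x\<bar> < \<epsilon>"
proof -
  obtain d where d: "d > 0" "\<And>x y. norm (x - y) \<le> d \<Longrightarrow> \<bar>covariogram K x - covariogram K y\<bar> < \<epsilon> / 4"
    using covariogram_modulus[OF K(1,2), of "\<epsilon> / 4"] \<epsilon> by auto
  define \<delta> where "\<delta> = min 1 (d / real CARD('n))"
  have \<delta>: "0 < \<delta>" "\<delta> \<le> 1" "real CARD('n) * \<delta> \<le> d"
    using d(1) by (auto simp: \<delta>_def min_def field_simps)
  have mod: "\<bar>covariogram K t - covariogram K s\<bar> \<le> \<epsilon> / 4" if st: "\<And>i. \<bar>(s - t) $ i\<bar> \<le> \<delta>" for s t
  proof -
    have "norm (s - t) \<le> (\<Sum>i\<in>UNIV. \<bar>(s - t) $ i\<bar>)" by (rule norm_le_l1_cart)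
    also have "\<dots> \<le> (\<Sum>i\<in>(UNIV::'n set). \<delta>)" by (intro sum_mono st)
    also have "\<dots> \<le> d" using \<delta>(3) by simp
    finally show ?thesis using d(2)[of t s] by (simp add: norm_minus_commute)
  qed
  let ?c = "measure lebesgue K * real CARD('n)"
  let ?r = "\<lambda>k. (1 - cos (pi / (real k + 2))) / (1 - cos (\<delta> / real k powr \<gamma>))"
  have "?r \<longlonglongrightarrow> 0" using \<gamma> \<delta>(1) by real_asymp
  then have "(\<lambda>k. 2 * (?c * ?r k)) \<longlonglongrightarrow> 2 * (?c * 0)" by (intro tendsto_intros)
  then have "\<forall>\<^sub>F k in sequentially. 2 * (?c * ?r k) < \<epsilon> / 2"
    using \<epsilon> by (intro order_tendstoD(2)[of _ "2 * (?c * 0)"]) auto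
  then show ?thesis using eventually_ge_at_top[of 1]
  proof eventually_elim
    case (elim k)
    have R1: "real k powr \<gamma> \<ge> 1" using elim(2) \<gamma>(1) by (intro ge_one_powr_ge_zero) auto
    have "\<delta> \<le> pi * real k powr \<gamma>" using mult_mono[of 1 pi 1 "real k powr \<gamma>"] R1 pi_ge_two \<delta>(2) by simp
    show ?case
    proof (intro allI impI)
      fix x :: "real^'n" assume x: "\<forall>i. \<bar>x $ i\<bar> \<le> 1"
      have x': "\<And>i. \<bar>x $ i\<bar> \<le> 1" using x by blast
      have "\<bar>fourier_sum K (real k powr \<gamma>) k x - covariogram K x\<bar> \<le>
          2 * (\<epsilon> / 4 + measure lebesgue K * real CARD('n) * (1 - cos (pi / (real k + 2))) / (1 - cos (\<delta> / real k powr \<gamma>)))"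
        using K(1,3) R1 x' elim(2) \<delta>(1) \<open>\<delta> \<le> pi * real k powr \<gamma>\<close> mod by (rule fourier_sum_close)
      also have "\<dots> = \<epsilon> / 2 + 2 * (?c * ?r k)" by simp
      also have "\<dots> < \<epsilon>" using elim(1) by simp
      finally show "\<bar>fourier_sum K (real k powr \<gamma>) k x - covariogram K x\<bar> < \<epsilon>" .
    qed
  qed
qed

section \<open>The least squares problem\<close>

lemma card_int_grid: "card (int_grid k :: (real^'n) set) = (2 * k + 1) ^ CARD('n)"
proof -
  have "card (int_grid k :: (real^'n) set) = card (freq_grid k :: ('n \<Rightarrow> int) set)"
    using bij_betw_same_card[OF bij_freq_vec] by metis
  also have "\<dots> = (2 * k + 1) ^ CARD('n)"
  proof -
    have "card {- int k..int k} = 2 * k + 1" by simp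
    then show ?thesis unfolding freq_grid_def by (subst card_PiE) simp_all
  qed
  finally show ?thesis .
qed

lemma real_card_int_grid: "real (card (int_grid k :: (real^'n) set)) = (2 * real k + 1) ^ CARD('n)"
  unfolding card_int_grid by (simp add: add_ac)

lemma grid_mean_mono:
  fixes f h :: "real^'n \<Rightarrow> real"
  assumes "\<And>v. v \<in> int_grid k \<Longrightarrow> f ((1 / real k) *\<^sub>R v) \<le> h ((1 / real k) *\<^sub>R v)"
  shows "grid_mean k f \<le> grid_mean k h"
  unfolding grid_mean_def by (intro divide_right_mono sum_mono assms) auto

lemma grid_mean_add: "grid_mean k (\<lambda>x. f x + h x) = grid_mean k f + grid_mean k h"
  unfolding grid_mean_def by (simp add: sum.distrib add_divide_distrib)

lemma grid_mean_cmult: "grid_mean k (\<lambda>x. c * f x) = c * grid_mean k f"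
  unfolding grid_mean_def by (simp add: sum_distrib_left)

lemma grid_mean_const: "grid_mean k (\<lambda>x::real^'n. c) = c"
  unfolding grid_mean_def using real_card_int_grid[where 'n = 'n, of k] by simp

lemma grid_mean_nonneg: "(\<And>x. f x \<ge> 0) \<Longrightarrow> grid_mean k f \<ge> 0"
  unfolding grid_mean_def by (intro divide_nonneg_nonneg sum_nonneg) auto

lemma square_add_le: "(a + b)\<^sup>2 \<le> 2 * a\<^sup>2 + 2 * b\<^sup>2" for a b :: real
  using zero_le_power2[of "a - b"] by (simp add: power2_eq_square algebra_simps)

lemma grid_mean_sum_square_le:
  "grid_mean k (\<lambda>x. (f x + h x)\<^sup>2) \<le> 2 * grid_mean k (\<lambda>x. (f x)\<^sup>2) + 2 * grid_mean k (\<lambda>x. (h x)\<^sup>2)"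
  unfolding grid_mean_cmult[symmetric] grid_mean_add[symmetric]
  by (intro grid_mean_mono square_add_le)

text \<open>Pass from \<open>g\<close> to the data \<open>m\<close>, from there to \<open>a\<close>,
  use that \<open>a\<close> fits at least as well as \<open>b\<close>, and return from
  \<open>b\<close> to \<open>g\<close>. Two applications of the inequality for squared sums give
  \<open>2 + 2 * 2 = 6\<close> and \<open>2 * 2 = 4\<close>.\<close>

lemma least_squares_error:
  assumes "grid_mean k (\<lambda>x. (m x - a x)\<^sup>2) \<le> grid_mean k (\<lambda>x. (m x - b x)\<^sup>2)"
  shows "grid_mean k (\<lambda>x. (a x - g x)\<^sup>2) \<le> 6 * grid_mean k (\<lambda>x. (m x - g x)\<^sup>2) + 4 * grid_mean k (\<lambda>x. (b x - g x)\<^sup>2)"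
proof -
  have "grid_mean k (\<lambda>x. (a x - g x)\<^sup>2) = grid_mean k (\<lambda>x. ((m x - g x) + (a x - m x))\<^sup>2)" by simp
  also have "\<dots> \<le> 2 * grid_mean k (\<lambda>x. (m x - g x)\<^sup>2) + 2 * grid_mean k (\<lambda>x. (a x - m x)\<^sup>2)"
    by (rule grid_mean_sum_square_le)
  also have "grid_mean k (\<lambda>x. (a x - m x)\<^sup>2) = grid_mean k (\<lambda>x. (m x - a x)\<^sup>2)" by (simp add: power2_commute)
  finally have 1: "grid_mean k (\<lambda>x. (a x - g x)\<^sup>2) \<le> 2 * grid_mean k (\<lambda>x. (m x - g x)\<^sup>2) + 2 * grid_mean k (\<lambda>x. (m x - a x)\<^sup>2)" .
  have "grid_mean k (\<lambda>x. (m x - b x)\<^sup>2) = grid_mean k (\<lambda>x. ((m x - g x) + (g x - b x))\<^sup>2)" by simp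
  also have "\<dots> \<le> 2 * grid_mean k (\<lambda>x. (m x - g x)\<^sup>2) + 2 * grid_mean k (\<lambda>x. (g x - b x)\<^sup>2)"
    by (rule grid_mean_sum_square_le)
  also have "grid_mean k (\<lambda>x. (g x - b x)\<^sup>2) = grid_mean k (\<lambda>x. (b x - g x)\<^sup>2)" by (simp add: power2_commute)
  finally show ?thesis using 1 assms by linarith
qed

lemma two_half_count: "2 * half_count n k + 1 = (2 * int k + 1) ^ n"
  unfolding half_count_def by simp

lemma half_count_nonneg: "half_count n k \<ge> 0"
  unfolding half_count_def by (simp add: one_le_power)

text \<open>Index 0 gives the origin, the positive indices the chosen half, and the negative ones
  its reflection. Hence sums over all indices are sums over the grid, whatever half and order were
  chosen.\<close>

lemma frequency_enumeration_bij:
  fixes z :: "int \<Rightarrow> real^'n"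
  assumes k: "k \<ge> 1" and fe: "frequency_enumeration \<gamma> k z"
  shows "bij_betw z {- half_count CARD('n) k..half_count CARD('n) k}
    ((\<lambda>v. (1 / real k powr \<gamma>) *\<^sub>R v) ` int_grid k)"
proof -
  define I where "I = half_count CARD('n) k"
  define s where "s v = (1 / real k powr \<gamma>) *\<^sub>R v" for v :: "real^'n"
  have I0: "I \<ge> 0" by (simp add: I_def half_count_nonneg)
  have s0: "s v = 0 \<longleftrightarrow> v = 0" for v using k by (simp add: s_def)
  have sinj: "inj s" using k by (auto simp: inj_def s_def)
  have sm: "s (- v) = - s v" for v by (simp add: s_def)
  have fe': "(\<exists>H\<subseteq>int_grid k. H \<inter> uminus ` H = {} \<and> int_grid k = {0} \<union> H \<union> uminus ` H \<and>
      bij_betw z {0..I} (s ` ({0} \<union> H))) \<and> z 0 = 0 \<and> (\<forall>i\<in>{- I..-1}. z i = - z (- i))"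
    using fe unfolding frequency_enumeration_def I_def s_def[abs_def] .
  then have z0: "z 0 = 0" and zm: "\<And>i. i \<in> {- I..-1} \<Longrightarrow> z i = - z (- i)" by auto
  from conjunct1[OF fe'] obtain H where "H \<subseteq> int_grid k \<and> H \<inter> uminus ` H = {} \<and> int_grid k = {0} \<union> H \<union> uminus ` H \<and>
      bij_betw z {0..I} (s ` ({0} \<union> H))" by (rule exE)
  note Hc = this
  note H = conjunct1[OF conjunct2[OF Hc]] conjunct1[OF conjunct2[OF conjunct2[OF Hc]]]
  note b = conjunct2[OF conjunct2[OF conjunct2[OF Hc]]]
  have H0: "0 \<notin> H" using H(1) by (metis IntI empty_iff imageI neg_0_equal_iff_equal)
  have bp: "bij_betw z {1..I} (s ` H)"
  proof -
    have "bij_betw z ({0..I} - {0}) (s ` ({0} \<union> H) - {0})"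
    proof (rule bij_betw_DiffI[OF b])
      show "bij_betw z {0} {0}" using z0 by (simp add: bij_betw_def)
      have "s 0 = 0" using s0 by blast
      then show "{0} \<subseteq> s ` ({0} \<union> H)" by force
      show "{0} \<subseteq> {0..I}" using I0 by simp
    qed
    moreover have "{0..I} - {0} = {1..I}" by auto
    moreover have "s ` ({0} \<union> H) - {0} = s ` H"
    proof -
      have "0 \<notin> s ` H" using H0 s0 by (metis imageE)
      moreover have "s ` ({0} \<union> H) = insert 0 (s ` H)" using s0[of 0] by (simp only: image_Un image_insert image_empty simp_thms insert_is_Un[symmetric])
      ultimately show ?thesis by simp
    qed
    ultimately show ?thesis by simp
  qed
  have bn: "bij_betw z {- I..- 1} (s ` uminus ` H)"
  proof -
    have "bij_betw (uminus \<circ> (z \<circ> uminus)) {- I..- 1} (uminus ` s ` H)"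
    proof (intro bij_betw_trans)
      show "bij_betw uminus {- I..- 1} {1..I}" by (rule bij_betwI[where g = uminus]) auto
      show "bij_betw z {1..I} (s ` H)" by (rule bp)
      show "bij_betw uminus (s ` H) (uminus ` s ` H)" by (simp add: inj_on_def bij_betw_def)
    qed
    moreover have "uminus ` s ` H = s ` uminus ` H" by (simp add: image_image sm)
    moreover have "bij_betw z {- I..- 1} (s ` uminus ` H) = bij_betw (uminus \<circ> (z \<circ> uminus)) {- I..- 1} (s ` uminus ` H)"
      unfolding o_def by (rule bij_betw_cong) (rule zm)
    ultimately show ?thesis by (simp only:)
  qed
  have "bij_betw z ({- I..- 1} \<union> {0..I}) (s ` uminus ` H \<union> s ` ({0} \<union> H))"
  proof (rule bij_betw_combine[OF bn b])
    have "s ` uminus ` H \<inter> s ` ({0} \<union> H) = s ` (uminus ` H \<inter> ({0} \<union> H))"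
      by (rule image_Int[symmetric, OF sinj])
    also have "uminus ` H \<inter> ({0} \<union> H) = {}" using H(1) H0 by auto
    finally show "s ` uminus ` H \<inter> s ` ({0} \<union> H) = {}" by simp
  qed
  moreover have "{- I..- 1} \<union> {0..I} = {- I..I}" using I0 by auto
  moreover have "s ` uminus ` H \<union> s ` ({0} \<union> H) = s ` int_grid k" unfolding H(2) by auto
  ultimately show ?thesis by (simp add: I_def s_def[abs_def])
qed

lemma sum_frequency_enumeration:
  fixes z :: "int \<Rightarrow> real^'n"
  assumes k: "k \<ge> 1" and fe: "frequency_enumeration \<gamma> k z"
  shows "(\<Sum>i\<in>{- half_count CARD('n) k..half_count CARD('n) k}. f (z i)) =
    (\<Sum>v\<in>int_grid k. f ((1 / real k powr \<gamma>) *\<^sub>R v))"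
proof -
  have "(\<Sum>i\<in>{- half_count CARD('n) k..half_count CARD('n) k}. f (z i)) =
      (\<Sum>u\<in>(\<lambda>v. (1 / real k powr \<gamma>) *\<^sub>R v) ` int_grid k. f u)"
    by (rule sum.reindex_bij_betw[OF frequency_enumeration_bij[OF assms]])
  also have "\<dots> = (\<Sum>v\<in>int_grid k. f ((1 / real k powr \<gamma>) *\<^sub>R v))"
    using k by (subst sum.reindex) (auto simp: inj_on_def)
  finally show ?thesis .
qed

lemma sum_symmetric_int:
  fixes f :: "int \<Rightarrow> 'b::comm_monoid_add"
  assumes "h \<ge> 0"
  shows "(\<Sum>j\<in>{- h..h}. f j) = (\<Sum>j\<in>{0..h}. if j = 0 then f 0 else f j + f (- j))"
proof -
  have "(\<Sum>j\<in>{- h..h}. f j) = (\<Sum>j\<in>{- h..- 1}. f j) + (\<Sum>j\<in>{0..h}. f j)"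
    using assms by (subst sum.union_disjoint[symmetric]) (auto intro!: sum.cong)
  also have "(\<Sum>j\<in>{- h..- 1}. f j) = (\<Sum>j\<in>{1..h}. f (- j))"
    by (rule sum.reindex_bij_witness[of _ uminus uminus]) auto
  also have "(\<Sum>j\<in>{0..h}. f j) = f 0 + (\<Sum>j\<in>{1..h}. f j)"
  proof -
    have "{0..h} = insert 0 {1..h}" using assms by auto
    then show ?thesis by simp
  qed
  finally have "(\<Sum>j\<in>{- h..h}. f j) = f 0 + (\<Sum>j\<in>{1..h}. f j + f (- j))" by (simp add: sum.distrib ac_simps)
  also have "\<dots> = (\<Sum>j\<in>{0..h}. if j = 0 then f 0 else f j + f (- j))"
  proof -
    have "{0..h} = insert 0 {1..h}" using assms by auto
    then show ?thesis by simp
  qed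
  finally show ?thesis .
qed

lemma fourier_transform_indicator_even:
  assumes "compact K"
  shows "(cmod (fourier_transform (indicator K) (- z)))\<^sup>2 = (cmod (fourier_transform (indicator K) z))\<^sup>2"
  using covariogram_fourier_real(1)[OF assms, of "- z"] covariogram_fourier_real(1)[OF assms, of z] by simp

text \<open>A negative index reuses the measurement of its absolute value. Folding the sum onto the
  indices \<open>j \<ge> 0\<close>, whose noise terms are independent, doubles every weight except
  that of the origin.\<close>

definition noise_weight :: "real \<Rightarrow> nat \<Rightarrow> (int \<Rightarrow> real^'n) \<Rightarrow> real^'n \<Rightarrow> int \<Rightarrow> real" where
  "noise_weight \<gamma> k z x j = (if j = 0 then 1 else 2 * cos (z j \<bullet> x)) / (2 * pi * real k powr \<gamma>) ^ CARD('n)"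

lemma covariogram_estimate_decomposition:
  fixes z :: "int \<Rightarrow> real^'n"
  assumes K: "compact K" and k: "k \<ge> 1" and fe: "frequency_enumeration \<gamma> k z"
  shows "covariogram_estimate \<gamma> k z (\<lambda>r i. noisy_measurement K z X r i \<omega>) x =
    fourier_sum K (real k powr \<gamma>) k x +
    (\<Sum>j\<in>{0..half_count CARD('n) k}. noise_weight \<gamma> k z x j *
      noise_term (\<lambda>j. cmod (fourier_transform (indicator K) (z j))) X j \<omega>)"
proof -
  define I where "I = half_count CARD('n) k"
  define F where "F j = cmod (fourier_transform (indicator K) (z j))" for j
  define N where "N j = noise_term F X \<bar>j\<bar> \<omega>" for j
  define c where "c = (2 * pi * real k powr \<gamma>) ^ CARD('n)"
  have I0: "I \<ge> 0" by (simp add: I_def half_count_nonneg)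
  have zm: "z j = - z (- j)" if "j \<in> {- I..-1}" for j
    using fe that unfolding frequency_enumeration_def I_def by blast
  have z0: "z 0 = 0" using fe unfolding frequency_enumeration_def by blast
  have pm: "product_measurement (\<lambda>r i. noisy_measurement K z X r i \<omega>) j = (F j)\<^sup>2 + N j" if j: "j \<in> {- I..I}" for j
  proof (cases "j \<ge> 0")
    case True
    then show ?thesis
      by (simp add: product_measurement_def noisy_measurement_def F_def N_def noise_term_def power2_eq_square algebra_simps)
  next
    case False
    then have "j \<in> {- I..-1}" using j by auto
    from zm[OF this] have "(F j)\<^sup>2 = (F (- j))\<^sup>2"
      unfolding F_def by (simp only: fourier_transform_indicator_even[OF K])
    then show ?thesis using False
      by (simp add: product_measurement_def noisy_measurement_def F_def N_def noise_term_def power2_eq_square algebra_simps)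
  qed
  have "(\<Sum>j\<in>{- I..I}. cos (z j \<bullet> x) * product_measurement (\<lambda>r i. noisy_measurement K z X r i \<omega>) j) =
      (\<Sum>j\<in>{- I..I}. cos (z j \<bullet> x) * (F j)\<^sup>2) + (\<Sum>j\<in>{- I..I}. cos (z j \<bullet> x) * N j)"
    unfolding sum.distrib[symmetric] by (intro sum.cong refl) (simp add: pm algebra_simps)
  moreover have "1 / c * (\<Sum>j\<in>{- I..I}. cos (z j \<bullet> x) * (F j)\<^sup>2) = fourier_sum K (real k powr \<gamma>) k x"
  proof -
    have "(\<Sum>j\<in>{- I..I}. cos (z j \<bullet> x) * (F j)\<^sup>2) =
        (\<Sum>v\<in>int_grid k. cos (((1 / real k powr \<gamma>) *\<^sub>R v) \<bullet> x) * (cmod (fourier_transform (indicator K) ((1 / real k powr \<gamma>) *\<^sub>R v)))\<^sup>2)"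
      unfolding F_def I_def by (rule sum_frequency_enumeration[OF k fe])
    also have "\<dots> = (\<Sum>g\<in>freq_grid k. cos (((1 / real k powr \<gamma>) *\<^sub>R freq_vec g) \<bullet> x) * (cmod (fourier_transform (indicator K) ((1 / real k powr \<gamma>) *\<^sub>R freq_vec g)))\<^sup>2)"
      by (rule sum.reindex_bij_betw[symmetric, OF bij_freq_vec])
    finally show ?thesis
      unfolding fourier_sum_def fourier_coeff_def c_def by (simp add: sum_distrib_left mult.commute)
  qed
  moreover have "1 / c * (\<Sum>j\<in>{- I..I}. cos (z j \<bullet> x) * N j) = (\<Sum>j\<in>{0..I}. noise_weight \<gamma> k z x j * noise_term F X j \<omega>)"
  proof -
    have "(\<Sum>j\<in>{- I..I}. cos (z j \<bullet> x) * N j) = (\<Sum>j\<in>{0..I}. c * (noise_weight \<gamma> k z x j * noise_term F X j \<omega>))"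
      unfolding sum_symmetric_int[OF I0]
    proof (intro sum.cong refl)
      fix j assume j: "j \<in> {0..I}"
      have c0: "c \<noteq> 0" using k by (simp add: c_def)
      show "(if j = 0 then cos (z 0 \<bullet> x) * N 0 else cos (z j \<bullet> x) * N j + cos (z (- j) \<bullet> x) * N (- j)) =
          c * (noise_weight \<gamma> k z x j * noise_term F X j \<omega>)"
      proof (cases "j = 0")
        case True
        then show ?thesis using c0 by (simp add: noise_weight_def c_def[symmetric] N_def z0)
      next
        case False
        then have "z (- j) = - z j" using zm[of "- j"] j by simp
        then show ?thesis using False j c0 by (simp add: noise_weight_def c_def[symmetric] N_def)
      qed
    qed
    then show ?thesis using k by (simp add: sum_distrib_left[symmetric] c_def)
  qed
  ultimately show ?thesis
    unfolding covariogram_estimate_def I_def[symmetric] c_def[symmetric] F_def[symmetric, abs_def]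
    by (simp only: distrib_left)
qed

lemma lsq_objective_grid_mean:
  fixes z :: "int \<Rightarrow> real^'n"
  assumes k: "k \<ge> 1" and fe: "frequency_enumeration \<gamma> k z"
  shows "lsq_objective \<gamma> k z g P = (2 * real k + 1) ^ CARD('n) *
    grid_mean k (\<lambda>x. (covariogram_estimate \<gamma> k z g x - covariogram (P \<inter> unit_cube) x)\<^sup>2)"
proof -
  have "real k powr (\<gamma> - 1) * (1 / real k powr \<gamma>) = 1 / real k" using k by (simp add: powr_diff)
  then have s: "(real k powr (\<gamma> - 1)) *\<^sub>R ((1 / real k powr \<gamma>) *\<^sub>R v) = (1 / real k) *\<^sub>R v" for v :: "real^'n"
    by (simp only: scaleR_scaleR)
  have p: "(2 * real k + 1) ^ CARD('n) \<noteq> 0" using k by simp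
  show ?thesis
    unfolding lsq_objective_def sample_point_def
    unfolding sum_frequency_enumeration[OF k fe, of "\<lambda>u. (covariogram_estimate \<gamma> k z g ((real k powr (\<gamma> - 1)) *\<^sub>R u)
      - covariogram (P \<inter> unit_cube) ((real k powr (\<gamma> - 1)) *\<^sub>R u))\<^sup>2"] s grid_mean_def
    using p by simp
qed

lemma fourier_transform_indicator_le:
  fixes K :: "(real^'n) set"
  assumes K: "compact K" "K \<subseteq> unit_cube"
  shows "cmod (fourier_transform (indicator K) x) \<le> 1"
proof -
  have "cmod (fourier_transform (indicator K) x) \<le> (LINT y|lebesgue. norm (indicator K y * exp (- \<i> * complex_of_real (x \<bullet> y))))"
    unfolding fourier_transform_def by (rule integral_norm_bound)
  also have "\<dots> = (LINT y|lebesgue. indicator K y)"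
    by (intro Bochner_Integration.integral_cong refl) (simp add: norm_mult indicator_def)
  also have "\<dots> = measure lebesgue K" by simp
  also have "\<dots> \<le> measure lebesgue (unit_cube :: (real^'n) set)"
    using K by (intro measure_mono_fmeasurable lmeasurable_compact fmeasurableD) (auto simp: unit_cube_cbox)
  also have "\<dots> = 1"
    unfolding unit_cube_cbox by (subst measure_completion, simp, subst content_cbox_cart) (auto simp: interval_ne_empty_cart)
  finally show ?thesis .
qed

text \<open>The squared number of terms grows like \<open>k ^ (2 * n)\<close> and the fourth power
  of the weights decays like \<open>k powr (- 4 * n * \<gamma>)\<close>. The exponent is below -1
  precisely for \<gamma> above \<open>1/2 + 1/(4 n)\<close>.\<close>

lemma noise_weight_summable:
  assumes "1/2 + 1 / (4 * real n) < \<gamma>" "n \<ge> 1"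
  shows "summable (\<lambda>k. (2 / (2 * pi * real k powr \<gamma>) ^ n) ^ 4 * (real (card {0..half_count n k}))\<^sup>2)"
proof (rule summable_comparison_test'[where N = 1])
  let ?e = "2 * real n - 4 * real n * \<gamma>"
  let ?C = "(2 / (2 * pi) ^ n) ^ 4 * (3 ^ n)\<^sup>2 :: real"
  have "?e < - 1"
  proof -
    have "4 * real n * (1/2 + 1 / (4 * real n)) < 4 * real n * \<gamma>" using assms by (intro mult_strict_left_mono) auto
    moreover have "4 * real n * (1/2 + 1 / (4 * real n)) = 2 * real n + 1" using assms(2) by (simp add: field_simps)
    ultimately show ?thesis by linarith
  qed
  then show "summable (\<lambda>k. ?C * real k powr ?e)" by (intro summable_mult) (simp add: summable_real_powr_iff)
  fix k :: nat assume k: "k \<ge> 1"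
  have "real (card {0..half_count n k}) = of_int (half_count n k) + 1" using half_count_nonneg[of n k] by simp
  also have "\<dots> \<le> (2 * real k + 1) ^ n"
  proof -
    have "half_count n k + 1 \<le> (2 * int k + 1) ^ n" using two_half_count[of n k] half_count_nonneg[of n k] by linarith
    then have "real_of_int (half_count n k + 1) \<le> real_of_int ((2 * int k + 1) ^ n)" by (simp only: of_int_le_iff)
    then show ?thesis by simp
  qed
  also have "\<dots> \<le> (3 * real k) ^ n" using k by (intro power_mono) auto
  finally have c: "real (card {0..half_count n k}) \<le> (3 * real k) ^ n" .
  have "(2 / (2 * pi * real k powr \<gamma>) ^ n) ^ 4 * (real (card {0..half_count n k}))\<^sup>2 \<le> (2 / (2 * pi * real k powr \<gamma>) ^ n) ^ 4 * ((3 * real k) ^ n)\<^sup>2"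
    by (intro mult_left_mono power_mono c) auto
  also have "\<dots> = ?C * (real k ^ (2 * n) / (real k powr \<gamma>) ^ (4 * n))"
  proof -
    have r: "(2 / (p * q)) ^ 4 * (s * t)\<^sup>2 = (2 / p) ^ 4 * s\<^sup>2 * (t\<^sup>2 / q ^ 4)" for p q s t :: real
      by (simp add: power_divide power_mult_distrib)
    have e: "(real k ^ n)\<^sup>2 = real k ^ (2 * n)" "((real k powr \<gamma>) ^ n) ^ 4 = (real k powr \<gamma>) ^ (4 * n)"
      by (simp_all only: power_mult[symmetric] mult.commute)
    show ?thesis unfolding power_mult_distrib[of "2 * pi"] power_mult_distrib[of 3 "real k"] r e ..
  qed
  also have "real k ^ (2 * n) / (real k powr \<gamma>) ^ (4 * n) = real k powr ?e"
  proof -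
    have kp: "real k > 0" using k by simp
    have "real k ^ (2 * n) = real k powr (2 * real n)" using powr_realpow[OF kp, of "2 * n"] by simp
    moreover have "(real k powr \<gamma>) ^ (4 * n) = real k powr (4 * real n * \<gamma>)"
      using powr_realpow[of "real k powr \<gamma>" "4 * n"] kp by (simp add: powr_powr mult_ac)
    ultimately show ?thesis by (simp only: powr_diff)
  qed
  finally show "norm ((2 / (2 * pi * real k powr \<gamma>) ^ n) ^ 4 * (real (card {0..half_count n k}))\<^sup>2) \<le> ?C * real k powr ?e" by simp
qed

text \<open>The deterministic part, for one fixed outcome: randomness has been condensed into the
  hypothesis \<open>noise\<close>. Clipping the competitor to the cube does not increase its volume
  distance from \<open>K\<close>, because \<open>K\<close> lies in the cube.\<close>

lemma noisy_mod_lsq_consistent: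
  fixes K :: "(real^'n) set" and z :: "nat \<Rightarrow> int \<Rightarrow> real^'n" and X :: "nat \<Rightarrow> nat \<Rightarrow> int \<Rightarrow> 'w \<Rightarrow> real"
    and Q P :: "nat \<Rightarrow> (real^'n) set"
  assumes dim: "CARD('n) \<ge> 2" and K: "convex_body K" "K \<subseteq> unit_cube" "centroid K = 0"
    and det: "determined_by_covariogram K" and \<gamma>: "0 < \<gamma>" "\<gamma> < 1"
    and z: "\<And>k. k \<ge> 1 \<Longrightarrow> frequency_enumeration \<gamma> k (z k)"
    and Q: "\<And>k. k \<ge> 1 \<Longrightarrow> polytope (Q k) \<and> Q k \<noteq> {}"
    and Q_lim: "(\<exists>N. is_blaschke_body K N \<and> (\<lambda>k. hausdorff_dist (Q k) N) \<longlonglongrightarrow> 0) \<or>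
      (\<lambda>k. hausdorff_dist (Q k) (difference_body K)) \<longlonglongrightarrow> 0"
    and noise: "(\<lambda>k. grid_mean k (\<lambda>x. (\<Sum>j\<in>{0..half_count CARD('n) k}. noise_weight \<gamma> k (z k) x j *
      noise_term (\<lambda>j. cmod (fourier_transform (indicator K) (z k j))) (X k) j \<omega>)\<^sup>2)) \<longlonglongrightarrow> 0"
    and out: "\<And>k. k \<ge> 1 \<Longrightarrow>
      noisy_mod_lsq_output \<gamma> k (z k) (\<lambda>r i. noisy_measurement K (z k) (X k) r i \<omega>) (Q k) (P k)"
  shows "(\<lambda>k. min (hausdorff_dist K (P k)) (hausdorff_dist (uminus ` K) (P k))) \<longlonglongrightarrow> 0"
proof -
  define E where "E k = covariogram_estimate \<gamma> k (z k) (\<lambda>r i. noisy_measurement K (z k) (X k) r i \<omega>)" for k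
  define S where "S k = fourier_sum K (real k powr \<gamma>) k" for k
  define N where "N k x = (\<Sum>j\<in>{0..half_count CARD('n) k}. noise_weight \<gamma> k (z k) x j *
      noise_term (\<lambda>j. cmod (fourier_transform (indicator K) (z k j))) (X k) j \<omega>)" for k x
  have Kc: "compact K" using K(1) by (simp add: convex_body_def)
  have Kne: "K \<noteq> {}" using K(1) by (auto simp: convex_body_def)
  have E: "E k x = S k x + N k x" if "k \<ge> 1" for k x
    unfolding E_def S_def N_def by (rule covariogram_estimate_decomposition[OF Kc that z[OF that]])
  \<comment> \<open>Outputs are given by a relation. This predicate collects the facts about an
    unclipped minimizer, so that one \<open>T k\<close> can be chosen for every
    \<open>k\<close>.\<close>
  define good where "good k T \<longleftrightarrow> (\<exists>a. is_area_polytope (facet_normals (Q k)) a T) \<and>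
      (\<forall>b P'. admissible_areas (facet_normals (Q k)) b \<and> is_area_polytope (facet_normals (Q k)) b P' \<longrightarrow>
        grid_mean k (\<lambda>x. (E k x - covariogram (T \<inter> unit_cube) x)\<^sup>2) \<le> grid_mean k (\<lambda>x. (E k x - covariogram (P' \<inter> unit_cube) x)\<^sup>2)) \<and>
      (\<exists>t. P k = (+) t ` (T \<inter> unit_cube)) \<and> centroid (P k) = 0" for k T
  have "\<exists>T. good k T" if k: "k \<ge> 1" for k
  proof -
    have "(2 * real k + 1) ^ CARD('n) > 0" by simp
    then have obj: "lsq_objective \<gamma> k (z k) (\<lambda>r i. noisy_measurement K (z k) (X k) r i \<omega>) T \<le>
        lsq_objective \<gamma> k (z k) (\<lambda>r i. noisy_measurement K (z k) (X k) r i \<omega>) P' \<longleftrightarrow>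
        grid_mean k (\<lambda>x. (E k x - covariogram (T \<inter> unit_cube) x)\<^sup>2) \<le> grid_mean k (\<lambda>x. (E k x - covariogram (P' \<inter> unit_cube) x)\<^sup>2)" for T P'
      unfolding lsq_objective_grid_mean[OF k z[OF k]] E_def by (rule mult_le_cancel_left_pos)
    show ?thesis using out[OF k] unfolding noisy_mod_lsq_output_def obj good_def by blast
  qed
  then obtain T where good: "\<And>k. k \<ge> 1 \<Longrightarrow> good k (T k)" by metis
  have T: "\<exists>a. is_area_polytope (facet_normals (Q k)) a (T k)"
    and Tmin: "\<And>b P'. admissible_areas (facet_normals (Q k)) b \<Longrightarrow> is_area_polytope (facet_normals (Q k)) b P' \<Longrightarrow>
        grid_mean k (\<lambda>x. (E k x - covariogram (T k \<inter> unit_cube) x)\<^sup>2) \<le> grid_mean k (\<lambda>x. (E k x - covariogram (P' \<inter> unit_cube) x)\<^sup>2)"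
    and TP: "(\<exists>t. P k = (+) t ` (T k \<inter> unit_cube)) \<and> centroid (P k) = 0" if "k \<ge> 1" for k
    using good[OF that] unfolding good_def by (iprover, iprover, iprover)
  have Qev: "\<forall>\<^sub>F k in sequentially. polytope (Q k) \<and> Q k \<noteq> {}"
    using eventually_ge_at_top[of 1] by (rule eventually_mono) (rule Q)
  show ?thesis
  proof (rule covariogram_stability[OF K det])
    show "compact (T k \<inter> unit_cube) \<and> convex (T k \<inter> unit_cube) \<and> T k \<inter> unit_cube \<subseteq> unit_cube" if "k \<ge> 1" for k
    proof -
      have "polytope (T k)" using T[OF that] by (auto simp: is_area_polytope_def)
      then show ?thesis unfolding unit_cube_cbox
        by (intro conjI compact_Int convex_Int polytope_imp_compact polytope_imp_convex compact_cbox convex_box Int_lower2)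
    qed
    show "(\<exists>t. P k = (+) t ` (T k \<inter> unit_cube)) \<and> centroid (P k) = 0" if "k \<ge> 1" for k using TP[OF that] .
    show "(\<lambda>k. grid_mean k (\<lambda>x. (covariogram (T k \<inter> unit_cube) x - covariogram K x)\<^sup>2)) \<longlonglongrightarrow> 0"
    proof (rule tendstoI)
      fix e :: real assume e: "e > 0"
      \<comment> \<open>The final bound is
        \<open>12 \<epsilon>\<^sup>2 + 12 e / 100 + 64 \<epsilon>\<^sup>2\<close>, which is at most
        \<open>e / 2\<close> since
        \<open>\<epsilon>\<^sup>2 \<le> \<epsilon> \<le> e / 200\<close>.\<close>
      define \<epsilon> where "\<epsilon> = min 1 (e / 200)"
      have \<epsilon>: "\<epsilon> > 0" "\<epsilon> \<le> 1" "\<epsilon> \<le> e / 200" using e by (auto simp: \<epsilon>_def)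
      have "\<forall>\<^sub>F k in sequentially. grid_mean k (\<lambda>x. (N k x)\<^sup>2) < e / 100"
        using order_tendstoD(2)[OF noise, of "e / 100"] e by (simp add: N_def)
      moreover have "\<forall>\<^sub>F k in sequentially. \<exists>a P'. admissible_areas (facet_normals (Q k)) a \<and>
          is_area_polytope (facet_normals (Q k)) a P' \<and> measure lebesgue (P' - K) < \<epsilon> \<and> measure lebesgue (K - P') < \<epsilon>"
        by (rule area_polytopes_approximate[OF dim K(1,3) Qev Q_lim \<epsilon>(1)])
      moreover have "\<forall>\<^sub>F k in sequentially. \<forall>x. (\<forall>i. \<bar>x $ i\<bar> \<le> 1) \<longrightarrow> \<bar>S k x - covariogram K x\<bar> < \<epsilon>"
        unfolding S_def by (rule fourier_sum_uniform[OF Kc Kne K(2) \<gamma> \<epsilon>(1)])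
      moreover have "\<forall>\<^sub>F k::nat in sequentially. k \<ge> 1" by (rule eventually_ge_at_top)
      ultimately show "\<forall>\<^sub>F k in sequentially. dist (grid_mean k (\<lambda>x. (covariogram (T k \<inter> unit_cube) x - covariogram K x)\<^sup>2)) 0 < e"
      proof eventually_elim
        case (elim k)
        have k: "k \<ge> 1" by (rule elim(4))
        obtain a P' where P': "admissible_areas (facet_normals (Q k)) a" "is_area_polytope (facet_normals (Q k)) a P'"
            "measure lebesgue (P' - K) < \<epsilon>" "measure lebesgue (K - P') < \<epsilon>"
          using elim(2) by blast
        have "compact P'" using P'(2) by (auto simp: is_area_polytope_def intro: polytope_imp_compact)
        then have P'm: "P' \<in> lmeasurable" and Bm: "P' \<inter> unit_cube \<in> lmeasurable"
          unfolding unit_cube_cbox by (auto intro!: lmeasurable_compact compact_Int)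
        have Km: "K \<in> lmeasurable" using Kc by (rule lmeasurable_compact)
        have b: "\<bar>covariogram (P' \<inter> unit_cube) x - covariogram K x\<bar> \<le> 4 * \<epsilon>" for x
        proof -
          have "measure lebesgue (P' \<inter> unit_cube - K) \<le> measure lebesgue (P' - K)"
            using P'm Bm Km by (intro measure_mono_fmeasurable fmeasurable_Diff) (auto intro: fmeasurableD)
          moreover have "K - P' \<inter> unit_cube = K - P'" using K(2) by blast
          moreover have "\<bar>covariogram (P' \<inter> unit_cube) x - covariogram K x\<bar> \<le>
              2 * (measure lebesgue (P' \<inter> unit_cube - K) + measure lebesgue (K - P' \<inter> unit_cube))"
            by (rule covariogram_diff_le[OF Bm Km])
          ultimately show ?thesis using P'(3,4) by simp
        qed
        have sq: "x\<^sup>2 \<le> c\<^sup>2" if "\<bar>x\<bar> \<le> c" for x c :: real using power_mono[OF that, of 2] by simp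
        have B: "grid_mean k (\<lambda>x. (covariogram (P' \<inter> unit_cube) x - covariogram K x)\<^sup>2) \<le> 16 * \<epsilon>\<^sup>2"
        proof -
          have "grid_mean k (\<lambda>x. (covariogram (P' \<inter> unit_cube) x - covariogram K x)\<^sup>2) \<le> grid_mean k (\<lambda>x::real^'n. (4 * \<epsilon>)\<^sup>2)"
            by (intro grid_mean_mono sq b)
          then show ?thesis by (simp add: grid_mean_const power_mult_distrib)
        qed
        have "grid_mean k (\<lambda>x. (S k x - covariogram K x)\<^sup>2) \<le> grid_mean k (\<lambda>x::real^'n. \<epsilon>\<^sup>2)"
        proof (intro grid_mean_mono sq)
          fix v :: "real^'n" assume v: "v \<in> int_grid k"
          have "\<bar>((1 / real k) *\<^sub>R v) $ i\<bar> \<le> 1" for i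
            using v k by (simp add: int_grid_def abs_mult divide_le_eq)
          then show "\<bar>S k ((1 / real k) *\<^sub>R v) - covariogram K ((1 / real k) *\<^sub>R v)\<bar> \<le> \<epsilon>"
            using elim(3) by (blast intro: less_imp_le)
        qed
        then have "grid_mean k (\<lambda>x. (S k x - covariogram K x)\<^sup>2) \<le> \<epsilon>\<^sup>2" by (simp add: grid_mean_const)
        moreover have "grid_mean k (\<lambda>x. (E k x - covariogram K x)\<^sup>2) \<le>
            2 * grid_mean k (\<lambda>x. (S k x - covariogram K x)\<^sup>2) + 2 * grid_mean k (\<lambda>x. (N k x)\<^sup>2)"
          using grid_mean_sum_square_le[of k "\<lambda>x. S k x - covariogram K x" "N k"] by (simp add: E[OF k] algebra_simps)
        moreover have "grid_mean k (\<lambda>x. (covariogram (T k \<inter> unit_cube) x - covariogram K x)\<^sup>2) \<le>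
            6 * grid_mean k (\<lambda>x. (E k x - covariogram K x)\<^sup>2) + 4 * grid_mean k (\<lambda>x. (covariogram (P' \<inter> unit_cube) x - covariogram K x)\<^sup>2)"
          by (intro least_squares_error Tmin[OF k P'(1,2)])
        moreover have "\<epsilon>\<^sup>2 \<le> \<epsilon>" using \<epsilon> by (simp add: power2_eq_square mult_left_le)
        ultimately have "grid_mean k (\<lambda>x. (covariogram (T k \<inter> unit_cube) x - covariogram K x)\<^sup>2) < e"
          using B elim(1) \<epsilon>(3) e by linarith
        moreover have "grid_mean k (\<lambda>x. (covariogram (T k \<inter> unit_cube) x - covariogram K x)\<^sup>2) \<ge> 0"
          by (rule grid_mean_nonneg) simp
        ultimately show ?case by simp
      qed
    qed
  qed
qed

text \<open>The exceptional null set comes from the convergence of the \<open>Q k\<close> and from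
  the noise; outside it the argument concerns a single outcome and every sequence of outputs for
  it.\<close>

theorem theorem9p1:
  fixes K\<^sub>0 :: "(real^'n) set"
    and \<gamma> :: real
    and z :: "nat \<Rightarrow> int \<Rightarrow> real^'n"
    and M :: "'w measure"
    and X :: "nat \<Rightarrow> nat \<Rightarrow> int \<Rightarrow> 'w \<Rightarrow> real"
    and Q P :: "nat \<Rightarrow> 'w \<Rightarrow> (real^'n) set"
  defines "I \<equiv> \<lambda>k. {1, 2 :: nat} \<times> {0..half_count CARD('n) k}"
  defines "g \<equiv> \<lambda>k \<omega> r i. noisy_measurement K\<^sub>0 (z k) (X k) r i \<omega>"
  assumes dim: "CARD('n) \<ge> 2"
    and K\<^sub>0: "convex_body K\<^sub>0" "K\<^sub>0 \<subseteq> unit_cube" "centroid K\<^sub>0 = 0"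
    and determined: "determined_by_covariogram K\<^sub>0"
    and \<gamma>: "1/2 + 1 / (4 * real CARD('n)) < \<gamma>" "\<gamma> < 1"
    and z: "\<And>k. k \<ge> 1 \<Longrightarrow> frequency_enumeration \<gamma> k (z k)"
    and M: "prob_space M"
    and indep: "\<And>k. k \<ge> 1 \<Longrightarrow>
          prob_space.indep_vars M (\<lambda>_. borel) (\<lambda>(r, i). X k r i) (I k)"
    and zero_mean: "\<And>k r i. k \<ge> 1 \<Longrightarrow> (r, i) \<in> I k \<Longrightarrow>
          integrable M (X k r i) \<and> (LINT \<omega>|M. X k r i \<omega>) = 0"
    and fourth_moments: "\<exists>C. \<forall>k\<ge>1. \<forall>(r, i)\<in>I k.
          integrable M (\<lambda>\<omega>. X k r i \<omega> ^ 4) \<and> (LINT \<omega>|M. X k r i \<omega> ^ 4) \<le> C"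
    and Q: "\<And>k \<omega>. k \<ge> 1 \<Longrightarrow> \<omega> \<in> space M \<Longrightarrow>
          polytope (Q k \<omega>) \<and> Q k \<omega> \<noteq> {} \<and> o_symmetric (Q k \<omega>)"
    and Q_indep: "\<And>k. k \<ge> 1 \<Longrightarrow>
          indep_elements M hausdorff_borel (Q k)
            (\<Pi>\<^sub>M p\<in>I k. borel) (\<lambda>\<omega>. \<lambda>(r, i)\<in>I k. g k \<omega> r i)"
    and Q_lim: "AE \<omega> in M.
          (\<exists>N. is_blaschke_body K\<^sub>0 N \<and> (\<lambda>k. hausdorff_dist (Q k \<omega>) N) \<longlonglongrightarrow> 0) \<or>
          (\<lambda>k. hausdorff_dist (Q k \<omega>) (difference_body K\<^sub>0)) \<longlonglongrightarrow> 0"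
  shows "AE \<omega> in M.
          (\<forall>k\<ge>1. noisy_mod_lsq_output \<gamma> k (z k) (g k \<omega>) (Q k \<omega>) (P k \<omega>)) \<longrightarrow>
          (\<lambda>k. min (hausdorff_dist K\<^sub>0 (P k \<omega>)) (hausdorff_dist (uminus ` K\<^sub>0) (P k \<omega>)))
            \<longlonglongrightarrow> 0"
proof -
  interpret prob_space M by (rule M)
  obtain C where C: "\<And>k r i. k \<ge> 1 \<Longrightarrow> (r, i) \<in> I k \<Longrightarrow>
      integrable M (\<lambda>\<omega>. X k r i \<omega> ^ 4) \<and> (LINT \<omega>|M. X k r i \<omega> ^ 4) \<le> C"
    using fourth_moments by fastforce
  have \<gamma>0: "0 < \<gamma>"
  proof -
    have "0 \<le> 1 / (4 * real CARD('n))" by simp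
    then show ?thesis using \<gamma>(1) by linarith
  qed
  have Kc: "compact K\<^sub>0" using K\<^sub>0(1) by (simp add: convex_body_def)
  define F where "F k j = cmod (fourier_transform (indicator K\<^sub>0) (z k j))" for k j
  have "AE \<omega> in M. (\<lambda>k. (\<Sum>v\<in>int_grid k. (\<Sum>j\<in>{0..half_count CARD('n) k}.
      noise_weight \<gamma> k (z k) ((1 / real k) *\<^sub>R v) j * noise_term (F k) (X k) j \<omega>)\<^sup>2) / real (card (int_grid k :: (real^'n) set))) \<longlonglongrightarrow> 0"
  proof (rule noise_mean_square_tendsto_zero[where \<beta> = "\<lambda>k. 2 / (2 * pi * real k powr \<gamma>) ^ CARD('n)"])
    show "indep_vars (\<lambda>_. borel) (\<lambda>(r, i). X k r i) ({1, 2} \<times> {0..half_count CARD('n) k})" if "k \<ge> 1" for k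
      using indep[OF that] by (simp add: I_def)
    show "integrable M (X k r j) \<and> expectation (X k r j) = 0 \<and>
        integrable M (\<lambda>\<omega>. X k r j \<omega> ^ 4) \<and> expectation (\<lambda>\<omega>. X k r j \<omega> ^ 4) \<le> C"
      if "k \<ge> 1" "r \<in> {1, 2}" "j \<in> {0..half_count CARD('n) k}" for k r j
    proof -
      have "(r, j) \<in> I k" using that by (simp add: I_def)
      then show ?thesis using zero_mean[OF that(1)] C[OF that(1)] by blast
    qed
    show "\<bar>F k j\<bar> \<le> 1" for k j using fourier_transform_indicator_le[OF Kc K\<^sub>0(2)] by (simp add: F_def)
    show "finite (int_grid k :: (real^'n) set) \<and> int_grid k \<noteq> ({} :: (real^'n) set)" for k
      using finite_int_grid by (auto simp: int_grid_def intro!: exI[of _ 0])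
    show "\<bar>noise_weight \<gamma> k (z k) ((1 / real k) *\<^sub>R v) j\<bar> \<le> 2 / (2 * pi * real k powr \<gamma>) ^ CARD('n)" if k: "k \<ge> 1" for k v j
    proof -
      have "\<bar>2 * cos (z k j \<bullet> ((1 / real k) *\<^sub>R v))\<bar> \<le> 2 * 1"
        unfolding abs_mult by (intro mult_mono) auto
      then have "\<bar>if j = 0 then 1 else 2 * cos (z k j \<bullet> ((1 / real k) *\<^sub>R v))\<bar> \<le> 2"
        by (simp only: abs_one mult_1_right split: if_split) simp
      then show ?thesis unfolding noise_weight_def abs_divide using k by (intro frac_le) auto
    qed
    show "2 / (2 * pi * real k powr \<gamma>) ^ CARD('n) > 0" if "k \<ge> 1" for k using that by simp
    show "summable (\<lambda>k. (2 / (2 * pi * real k powr \<gamma>) ^ CARD('n)) ^ 4 * (real (card {0..half_count CARD('n) k}))\<^sup>2)"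
      using \<gamma>(1) dim by (intro noise_weight_summable) auto
  qed
  then have "AE \<omega> in M. (\<lambda>k. grid_mean k (\<lambda>x. (\<Sum>j\<in>{0..half_count CARD('n) k}. noise_weight \<gamma> k (z k) x j *
      noise_term (F k) (X k) j \<omega>)\<^sup>2)) \<longlonglongrightarrow> 0"
    unfolding grid_mean_def real_card_int_grid .
  then show ?thesis using Q_lim AE_space
  proof eventually_elim
    case (elim \<omega>)
    show ?case
    proof
      assume out: "\<forall>k\<ge>1. noisy_mod_lsq_output \<gamma> k (z k) (g k \<omega>) (Q k \<omega>) (P k \<omega>)"
      have Q': "polytope (Q k \<omega>) \<and> Q k \<omega> \<noteq> {}" if "k \<ge> 1" for k using Q[OF that elim(3)] by blast
      have out': "noisy_mod_lsq_output \<gamma> k (z k) (\<lambda>r i. noisy_measurement K\<^sub>0 (z k) (X k) r i \<omega>) (Q k \<omega>) (P k \<omega>)" if "k \<ge> 1" for k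
        using out that by (simp add: g_def)
      show "(\<lambda>k. min (hausdorff_dist K\<^sub>0 (P k \<omega>)) (hausdorff_dist (uminus ` K\<^sub>0) (P k \<omega>))) \<longlonglongrightarrow> 0"
        using dim K\<^sub>0 determined \<gamma>0 \<gamma>(2) z Q' elim(2) elim(1)[unfolded F_def[abs_def]] out'
        by (rule noisy_mod_lsq_consistent)
    qed
  qed
qed

end
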